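(* Let $p\ge2$ be an integer. Zhu's algebra $A(\mathcal{W}(p))$ is spanned by $$\{[\omega]^i:\ 0\le i\le 3p-2\}\cup\{[\omega]^i*[X]:\ 0\le i\le p-1,\ X=E,F\text{ or }H\}.$$ Thus $A(\mathcal{W}(p))$ is at most $(6p-1)$-dimensional.
   Context: Definition of $\mathcal{W}(p)$. Let $L=\mathbb{Z}\alpha$ with $\langle\alpha,\alpha\rangle=2p$, and let $V_L=\mathcal{U}(\hat{\mathfrak h}_{<0})\otimes\mathbb{C}[L]$ be the lattice vertex algebra with vacuum $\mathbf 1$ and conformal vector $\omega=\frac{\alpha(-1)^2}{4p}\mathbf 1+\frac{p-1}{2p}\alpha(-2)\mathbf 1$ (central charge $1-\frac{6(p-1)^2}{p}$). Let $L^\circ=\mathbb{Z}\frac{\alpha}{2p}$ and let $V_{L^\circ}$ be the associated generalized vertex algebra. With $u_n$ the coefficient of $x^{-n-1}$ in $Y(u,x)$, put $Q=e^\alpha_0$ and $\tilde Q=e^{-\alpha/p}_0:V_L\to V_{L^\circ}$. Then $\mathcal{W}(p)=\operatorname{Ker}(\tilde Q|_{V_L})$, a vertex operator algebra with conformal vector $\omega$. Put $F=e^{-\alpha}$, $H=Qe^{-\alpha}$, $E=Q^2e^{-\alpha}$, which lie in $\mathcal{W}(p)$. Zhu's algebra. For a vertex operator algebra $V$ and homogeneous $a\in V$, $b\in V$, set $a*b=\operatorname{Res}_x Y(a,x)\frac{(1+x)^{\mathrm{wt}(a)}}{x}b$ and $a\circ b=\operatorname{Res}_xY(a,x)\frac{(1+x)^{\mathrm{wt}(a)}}{x^2}b$,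 extended bilinearly. $O(V)$ is the span of all $a\circ b$, $A(V)=V/O(V)$ is a unital associative algebra under $*$, and $[v]$ is the image of $v\in V$. Powers $[\omega]^i$ are taken with respect to $*$. *)

theory Defs
  imports
    Complex_Main
    "HOL-Library.Poly_Mapping"
    "HOL-Library.Product_Plus"
    "HOL-Computational_Algebra.Formal_Laurent_Series"
    "HOL-Algebra.QuotRing"
    "HOL-Algebra.Embedded_Algebras"
begin

section \<open>The space of the generalized lattice vertex algebra\<close>

text \<open>
  The space \<open>U(h\<^sub><\<^sub>0) \<otimes> C[L\<degree>]\<close> has the basis
  \<open>(\<Prod>n. \<alpha>(-n-1) ^ \<mu> n) \<otimes> e ^ (k\<alpha>/2p)\<close>, indexed by pairs \<open>(\<mu>, k)\<close>. Variable number \<open>n\<close> is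
  \<open>\<alpha>(-n-1)\<close>, so that numbering starts at 0, and the integer \<open>k\<close> stands for \<open>k\<alpha>/2p\<close>. The type
  does not depend on \<open>p\<close>; the operators on it do. Since the rank is one and
  \<open>\<langle>\<alpha>,\<alpha>\<rangle> = 2p\<close> is even, the cocycle of the lattice \<open>L\<close> can be taken trivial, and
  \<open>e ^ \<beta> \<cdot> e ^ \<gamma> = e ^ (\<beta> + \<gamma>)\<close> throughout. The product of the type \<open>fock\<close> is that of the commutative
  algebra \<open>S(h\<^sub><\<^sub>0) \<otimes> C[L\<degree>]\<close>.
\<close>

type_synonym fock = "((nat \<Rightarrow>\<^sub>0 nat) \<times> int) \<Rightarrow>\<^sub>0 complex"

definition cst :: "complex \<Rightarrow> fock" where
  "cst c = Poly_Mapping.single 0 c"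

definition fscale :: "complex \<Rightarrow> fock \<Rightarrow> fock" where
  "fscale c v = cst c * v"

global_interpretation fock: vector_space fscale
proof
  show "fscale a (x + y) = fscale a x + fscale a y" for a x y
    by (simp add: fscale_def distrib_left)
  show "fscale (a + b) x = fscale a x + fscale b x" for a b x
    by (simp add: fscale_def cst_def single_add distrib_right)
  show "fscale a (fscale b x) = fscale (a * b) x" for a b x
    by (simp add: fscale_def cst_def mult_single flip: mult.assoc)
  show "fscale 1 x = x" for x
    by (simp add: fscale_def cst_def)
qed

text \<open>The vector \<open>\<alpha>(-n-1) \<one>\<close>.\<close>

definition osc :: "nat \<Rightarrow> fock" where
  "osc n = Poly_Mapping.single (Poly_Mapping.single n 1, 0) 1"

text \<open>The vector \<open>e ^ (k\<alpha>/2p)\<close>.\<close>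

definition expo :: "int \<Rightarrow> fock" where
  "expo k = Poly_Mapping.single (0, k) 1"

definition lattice_space :: "nat \<Rightarrow> fock set" where
  "lattice_space p = {v. \<forall>(\<mu>, k) \<in> Poly_Mapping.keys v. 2 * int p dvd k}"


section \<open>Vertex operators\<close>

text \<open>
  The operator \<open>\<alpha>(m)\<close>: for \<open>m < 0\<close> multiplication, on \<open>e ^ (k\<alpha>/2p)\<close> the scalar
  \<open>\<langle>\<alpha>, k\<alpha>/2p\<rangle> = k\<close> for \<open>m = 0\<close>, and \<open>2pm \<partial>/\<partial>\<alpha>(-m)\<close> for \<open>m > 0\<close>.
\<close>

definition heis :: "nat \<Rightarrow> int \<Rightarrow> fock \<Rightarrow> fock" where
  "heis p m v =
    (if m < 0 then osc (nat (- m - 1)) * v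
     else if m = 0 then
       (\<Sum>(\<mu>, k) \<in> Poly_Mapping.keys v.
          Poly_Mapping.single (\<mu>, k) (of_int k * Poly_Mapping.lookup v (\<mu>, k)))
     else
       (\<Sum>(\<mu>, k) \<in> Poly_Mapping.keys v.
          Poly_Mapping.single (\<mu> - Poly_Mapping.single (nat (m - 1)) 1, k)
            (2 * of_nat p * of_int m * of_nat (Poly_Mapping.lookup \<mu> (nat (m - 1)))
              * Poly_Mapping.lookup v (\<mu>, k))))"

text \<open>
  \<open>op_pow A j N\<close> and \<open>op_exp A N\<close> are the coefficients of \<open>z ^ N\<close> in
  \<open>(\<Sum>n\<ge>1. A n z ^ n) ^ j\<close> and in \<open>exp (\<Sum>n\<ge>1. A n z ^ n)\<close>, for commuting operators \<open>A n\<close>. Only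
  \<open>j \<le> N\<close> contributes to the latter.
\<close>

primrec op_pow :: "(nat \<Rightarrow> fock \<Rightarrow> fock) \<Rightarrow> nat \<Rightarrow> nat \<Rightarrow> fock \<Rightarrow> fock" where
  "op_pow A 0 N v = (if N = 0 then v else 0)"
| "op_pow A (Suc j) N v = (\<Sum>n = 1..N. A n (op_pow A j (N - n) v))"

definition op_exp :: "(nat \<Rightarrow> fock \<Rightarrow> fock) \<Rightarrow> nat \<Rightarrow> fock \<Rightarrow> fock" where
  "op_exp A N v = (\<Sum>j\<le>N. fscale (1 / fact j) (op_pow A j N v))"

text \<open>
  With \<open>\<beta> = k\<alpha>/2p\<close>, these are the coefficient of \<open>x ^ i\<close> in \<open>exp (\<Sum>n\<ge>1. \<beta>(-n) x ^ n / n)\<close> and the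
  coefficient of \<open>x ^ (-j)\<close> in \<open>exp (- (\<Sum>n\<ge>1. \<beta>(n) x ^ (-n) / n))\<close>.
\<close>

definition exp_creation :: "nat \<Rightarrow> int \<Rightarrow> nat \<Rightarrow> fock \<Rightarrow> fock" where
  "exp_creation p k =
    op_exp (\<lambda>n v. fscale (of_int k / (2 * of_nat p) / of_nat n) (heis p (- int n) v))"

definition exp_annihilation :: "nat \<Rightarrow> int \<Rightarrow> nat \<Rightarrow> fock \<Rightarrow> fock" where
  "exp_annihilation p k =
    op_exp (\<lambda>n v. fscale (- (of_int k / (2 * of_nat p) / of_nat n)) (heis p (int n) v))"

text \<open>
  \<open>Y(e ^ \<beta>, x) v = exp (\<Sum>n\<ge>1. \<beta>(-n) x ^ n / n) exp (- (\<Sum>n\<ge>1. \<beta>(n) x ^ (-n) / n)) e ^ \<beta> x ^ \<beta>(0) v\<close> for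
  \<open>\<beta> = k\<alpha>/2p\<close> and \<open>v\<close> in the lattice vertex algebra. On a basis vector of charge \<open>l\<alpha>/2p\<close>, \<open>x ^ \<beta>(0)\<close> is
  the power with exponent \<open>\<langle>\<beta>, l\<alpha>/2p\<rangle> = k l/2p\<close>. This is an integer if \<open>2p\<close> divides \<open>l\<close>. The
  fractional powers of \<open>x\<close> that occur on the rest of the generalized vertex algebra are not modelled:
  for other \<open>l\<close> the value has no meaning. The sum over \<open>j\<close> has only finitely many nonzero terms.
\<close>

definition vop_exp :: "nat \<Rightarrow> int \<Rightarrow> fock \<Rightarrow> fock fls" where
  "vop_exp p k v =
    (\<Sum>(\<mu>, l) \<in> Poly_Mapping.keys v.
       fls_const (cst (Poly_Mapping.lookup v (\<mu>, l))) *
       Sum_any (\<lambda>j. fls_X_intpow (k * l div (2 * int p) - int j) *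
          fps_to_fls (Abs_fps (\<lambda>i.
            exp_creation p k i (exp_annihilation p k j (Poly_Mapping.single (\<mu>, k + l) 1))))))"

text \<open>
  \<open>vop_list p k [n\<^sub>1,\<dots>,n\<^sub>r] v\<close> is \<open>Y(\<alpha>(-n\<^sub>1-1) \<dots> \<alpha>(-n\<^sub>r-1) e ^ \<beta>, x) v\<close> for \<open>\<beta> = k\<alpha>/2p\<close>, that is, the
  iterated normally ordered product of the fields
  \<open>(1/n!) \<partial> ^ n \<alpha>(x) = (\<Sum>m. (-m-1 choose n) \<alpha>(m) x ^ (-m-1-n))\<close> with \<open>Y(e ^ \<beta>, x)\<close>: the terms with
  \<open>m < 0\<close> go to the left, those with \<open>m \<ge> 0\<close> to the right. In the first summand \<open>m = -(i+n)-1\<close>;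
  the terms with \<open>-n \<le> m < 0\<close> have coefficient zero. In the second one only finitely many terms are
  nonzero, as \<open>\<alpha>(m) v = 0\<close> for large \<open>m\<close>.
\<close>

primrec vop_list :: "nat \<Rightarrow> int \<Rightarrow> nat list \<Rightarrow> fock \<Rightarrow> fock fls" where
  "vop_list p k [] v = vop_exp p k v"
| "vop_list p k (n # ns) v =
    fps_to_fls (Abs_fps (\<lambda>i. of_nat ((i + n) choose n) * osc (i + n))) * vop_list p k ns v
    + Sum_any (\<lambda>m. fls_const (cst ((- of_nat m - 1) gchoose n)) * fls_X_intpow (- int m - 1 - int n)
         * vop_list p k ns (heis p (int m) v))"

definition mono_list :: "(nat \<Rightarrow>\<^sub>0 nat) \<Rightarrow> nat list" where
  "mono_list \<mu> = concat (map (\<lambda>n. replicate (Poly_Mapping.lookup \<mu> n) n)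
                              (sorted_list_of_set (Poly_Mapping.keys \<mu>)))"

text \<open>
  \<open>Y(u, x) v\<close> for \<open>u\<close> in the generalized vertex algebra and \<open>v\<close> in the lattice vertex algebra.
\<close>

definition vop :: "nat \<Rightarrow> fock \<Rightarrow> fock \<Rightarrow> fock fls" where
  "vop p u v =
    (\<Sum>(\<mu>, k) \<in> Poly_Mapping.keys u.
       fls_const (cst (Poly_Mapping.lookup u (\<mu>, k))) * vop_list p k (mono_list \<mu>) v)"

definition nmode :: "nat \<Rightarrow> fock \<Rightarrow> int \<Rightarrow> fock \<Rightarrow> fock" where
  "nmode p u n v = fls_nth (vop p u v) (- n - 1)"


section \<open>The triplet vertex algebra\<close>

definition conformal :: "nat \<Rightarrow> fock" where
  "conformal p = fscale (1 / (4 * of_nat p)) (osc 0 ^ 2)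
                 + fscale ((of_nat p - 1) / (2 * of_nat p)) (osc 1)"

definition screening :: "nat \<Rightarrow> fock \<Rightarrow> fock" where
  "screening p = nmode p (expo (2 * int p)) 0"

text \<open>The charge \<open>-\<alpha>/p\<close> is \<open>(-2)\<alpha>/2p\<close>.\<close>

definition dual_screening :: "nat \<Rightarrow> fock \<Rightarrow> fock" where
  "dual_screening p = nmode p (expo (- 2)) 0"

definition triplet_space :: "nat \<Rightarrow> fock set" where
  "triplet_space p = {v \<in> lattice_space p. dual_screening p v = 0}"

definition triplet_F :: "nat \<Rightarrow> fock" where
  "triplet_F p = expo (- 2 * int p)"

definition triplet_H :: "nat \<Rightarrow> fock" where
  "triplet_H p = screening p (expo (- 2 * int p))"

definition triplet_E :: "nat \<Rightarrow> fock" where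
  "triplet_E p = screening p (screening p (expo (- 2 * int p)))"

record voa =
  voa_space :: "fock set"
  voa_op :: "fock \<Rightarrow> fock \<Rightarrow> fock fls"
  voa_vac :: fock
  voa_conf :: fock

definition triplet :: "nat \<Rightarrow> voa" where
  "triplet p = \<lparr>voa_space = triplet_space p, voa_op = vop p, voa_vac = 1, voa_conf = conformal p\<rparr>"


section \<open>Zhu's algebra\<close>

text \<open>
  The eigenspaces of \<open>L(0) = \<omega>\<^sub>1\<close>. Weights are natural numbers here, which suffices for the triplet
  algebra: the vectors of charge \<open>m\<alpha>\<close> have weights at least \<open>p m ^ 2 - (p - 1) m \<ge> 0\<close>.
\<close>

definition wt_space :: "voa \<Rightarrow> nat \<Rightarrow> fock set" where
  "wt_space V n = {a \<in> voa_space V. fls_nth (voa_op V (voa_conf V) a) (- 2) = fscale (of_nat n) a}"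

definition wt_decomp :: "voa \<Rightarrow> fock \<Rightarrow> nat \<Rightarrow>\<^sub>0 fock" where
  "wt_decomp V a = (THE f. (\<forall>n. Poly_Mapping.lookup f n \<in> wt_space V n) \<and>
                           a = (\<Sum>n \<in> Poly_Mapping.keys f. Poly_Mapping.lookup f n))"

text \<open>
  The residue of \<open>Y(a, x) (1 + x) ^ wt(a) / x ^ r b\<close>, extended linearly in \<open>a\<close> from homogeneous vectors.
\<close>

definition zhu_prod :: "voa \<Rightarrow> nat \<Rightarrow> fock \<Rightarrow> fock \<Rightarrow> fock" where
  "zhu_prod V r a b =
    (\<Sum>n \<in> Poly_Mapping.keys (wt_decomp V a).
       fls_nth (voa_op V (Poly_Mapping.lookup (wt_decomp V a) n) b
                * (1 + fls_X) ^ n * fls_X_intpow (- int r)) (- 1))"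

definition zhu_star :: "voa \<Rightarrow> fock \<Rightarrow> fock \<Rightarrow> fock" where
  "zhu_star V = zhu_prod V 1"

definition zhu_circ :: "voa \<Rightarrow> fock \<Rightarrow> fock \<Rightarrow> fock" where
  "zhu_circ V = zhu_prod V 2"

definition zhu_O :: "voa \<Rightarrow> fock set" where
  "zhu_O V = fock.span {zhu_circ V a b | a b. a \<in> voa_space V \<and> b \<in> voa_space V}"

text \<open>
  \<open>V\<close> with the product \<open>*\<close>. It is not a ring (\<open>*\<close> is associative only modulo \<open>O(V)\<close>); the record
  serves to form the quotient.
\<close>

definition zhu_pre :: "voa \<Rightarrow> fock ring" where
  "zhu_pre V = \<lparr>carrier = voa_space V, mult = zhu_star V, one = voa_vac V, zero = 0, add = (+)\<rparr>"

definition zhu_alg :: "voa \<Rightarrow> fock set ring" where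
  "zhu_alg V = zhu_pre V Quot zhu_O V"

definition zhu_class :: "voa \<Rightarrow> fock \<Rightarrow> fock set" where
  "zhu_class V v = zhu_O V +>\<^bsub>zhu_pre V\<^esub> v"

text \<open>
  The copy \<open>C \<cdot> [\<one>]\<close> of the complex numbers in \<open>A(V)\<close>, over which spans and dimensions are taken:
  \<open>[c \<one>] * [v] = [c v]\<close>.
\<close>

definition zhu_scalars :: "voa \<Rightarrow> fock set set" where
  "zhu_scalars V = range (\<lambda>c. zhu_class V (fscale c (voa_vac V)))"

end

theory Submission imports Defs "HOL-Library.Multiset" "HOL-Computational_Algebra.Polynomial" begin

text \<open>The vector \<open>F\<close> satisfies a third order equation in the Virasoro operators. As in the work of
  Belavin, Polyakov and Zamolodchikov, this equation becomes a recursion on the modes \<open>F\<^sub>j H\<close>, so they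
  lie in the Virasoro span of \<open>F\<close>; applying \<open>Q\<close>, all modes between \<open>E, F, H\<close> lie in the Virasoro span
  of \<open>1, E, F, H\<close>. Hence Zhu's algebra of the subalgebra generated by \<open>\<omega>, E, F, H\<close> is spanned by the
  classes of \<open>\<omega> ^ i\<close> and \<open>\<omega> ^ i * X\<close>. The zero mode of a twisted
  product of \<open>F\<close> and \<open>H\<close> is \<open>g(L(0))\<close> times that of \<open>F\<close>, with \<open>g\<close> of degree at most \<open>p\<close>, and
  \<open>H * H\<close> is \<open>f(\<omega>)\<close> with \<open>f\<close> of degree at most \<open>2p - 1\<close>. On Fock modules both sides can be
  computed, which shows that \<open>g\<close> and \<open>f\<close> do not vanish. So \<open>g(\<omega>) * X = 0\<close> for \<open>X = E, F, H\<close>,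
  and \<open>(g f)(\<omega>) = g(\<omega>) * H * H = 0\<close>. The subalgebra is all of \<open>W(p)\<close>: if \<open>v\<close> has weight
  \<open>N > 0\<close>, then modulo contributions of lower weight \<open>f(N) v\<close> is the square of the zero mode of
  \<open>H\<close> applied to \<open>v\<close>, and this zero mode is controlled by \<open>Q\<close>, the zero mode of \<open>F\<close> and \<open>g(N)\<close>.\<close>

section \<open>Linear operators on the Fock space\<close>

text \<open>\<open>vop\<close> is given by explicit series, so the axioms of a vertex algebra are
  theorems here. The Borcherds identity is reduced, one oscillator at a time, to three exponentials,
  and there to the residue theorem for z^m (z - 1)^n. It is proved for all charges with integral
  pairings, even between the two fields, and not only for the lattice: thus the fields of V_L act on
  every Fock module, and e^(-\<alpha>/p) and e^(\<alpha>/2p) are available as well. A kernel shows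
  no generators, whereas a spanning set of the algebra requires them; below weight 2p - 1 the kernel
  condition enters through a separate bound on the weights of charge \<alpha>. The polynomials f and
  g come from one recursion, \<open>Rep\<close>, that is used twice: passing from u to L(-n) u
  multiplies the polynomial by (-1)^n (wt u + (n - 1) h), where h is a weight on Fock modules and
  becomes \<omega> in Zhu's algebra. As p roots of g are explicit weights smaller than 2p - 1, g(N)
  can be inverted for every integer N from 2p - 1 on. The bound 6p - 1 is (3p - 1) + 3p: the degree
  bound of g f once and that of g three times.\<close>

abbreviation "lookup \<equiv> Poly_Mapping.lookup"
abbreviation "single \<equiv> Poly_Mapping.single"
abbreviation "keys \<equiv> Poly_Mapping.keys"

definition lin :: "(fock \<Rightarrow> fock) \<Rightarrow> bool" where
  "lin f \<longleftrightarrow> (\<forall>x y. f (x + y) = f x + f y) \<and> (\<forall>c x. f (fscale c x) = fscale c (f x))"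

lemma linI: "(\<And>x y. f (x + y) = f x + f y) \<Longrightarrow> (\<And>c x. f (fscale c x) = fscale c (f x)) \<Longrightarrow> lin f"
  by (simp add: lin_def)

lemma lin_add: "lin f \<Longrightarrow> f (x + y) = f x + f y"
  and lin_scale: "lin f \<Longrightarrow> f (fscale c x) = fscale c (f x)"
  by (auto simp: lin_def)

lemma lin_0: "lin f \<Longrightarrow> f 0 = 0"
  using lin_scale[of f 0 0] by simp

lemma lin_minus: "lin f \<Longrightarrow> f (- x) = - f x"
  using lin_scale[of f "-1" x] by simp

lemma lin_diff: "lin f \<Longrightarrow> f (x - y) = f x - f y"
  using lin_add[of f x "- y"] by (simp add: lin_minus)

lemma lin_sum: "lin f \<Longrightarrow> f (sum g A) = (\<Sum>i\<in>A. f (g i))"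
  by (induction A rule: infinite_finite_induct) (auto simp: lin_0 lin_add)

lemmas lin_simps = lin_add lin_scale lin_0 lin_minus lin_diff lin_sum

lemma lin_comp: "lin f \<Longrightarrow> lin g \<Longrightarrow> lin (\<lambda>x. f (g x))"
  by (auto simp: lin_def)

lemma lin_id: "lin (\<lambda>x. x)" by (simp add: lin_def)

lemma lin_zero: "lin (\<lambda>x. 0)" by (simp add: lin_def)

lemma lin_plus: "lin f \<Longrightarrow> lin g \<Longrightarrow> lin (\<lambda>x. f x + g x)"
  by (auto simp: lin_def fock.scale_right_distrib)

lemma lin_smult: "lin f \<Longrightarrow> lin (\<lambda>x. fscale c (f x))"
  by (auto simp: lin_def fock.scale_right_distrib fock.scale_left_commute)

lemma lin_sum_fun: "(\<And>i. i \<in> A \<Longrightarrow> lin (f i)) \<Longrightarrow> lin (\<lambda>x. \<Sum>i\<in>A. f i x)"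
  by (induction A rule: infinite_finite_induct) (auto intro: lin_plus lin_zero)

lemma fscale_mult_left: "fscale c x * y = fscale c (x * y)"
  and fscale_mult_right: "x * fscale c y = fscale c (x * y)"
  by (simp_all add: fscale_def mult_ac)

lemma lin_mult: "lin f \<Longrightarrow> lin (\<lambda>x. a * f x)"
  by (auto simp: lin_def distrib_left fscale_mult_right)

lemma fscale_single: "fscale c (single x d) = single x (c * d)"
  by (cases x) (simp add: fscale_def cst_def mult_single zero_prod_def)

lemma lookup_fscale: "lookup (fscale c v) x = c * lookup v x"
  unfolding fscale_def cst_def mult_map_scale_conv_mult[symmetric]
  by (simp add: map.rep_eq when_def)

lemma keys_fscale: "keys (fscale c v) \<subseteq> keys v"
  by (auto simp: in_keys_iff lookup_fscale)

lemma fock_expand: "v = (\<Sum>x\<in>keys v. fscale (lookup v x) (single x 1))"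
  by (rule poly_mapping_eqI)
     (simp add: lookup_sum fscale_single lookup_single when_def in_keys_iff)

section \<open>Charges, and induction over oscillator monomials\<close>

definition chg :: "int set \<Rightarrow> fock set" where
  "chg S = {v. \<forall>x\<in>keys v. snd x \<in> S}"

lemma chg_add: "u \<in> chg S \<Longrightarrow> v \<in> chg S \<Longrightarrow> u + v \<in> chg S"
  using keys_add[of u v] by (auto simp: chg_def)

lemma chg_0: "0 \<in> chg S" by (simp add: chg_def)

lemma chg_scale: "v \<in> chg S \<Longrightarrow> fscale c v \<in> chg S"
  using keys_fscale[of c v] by (auto simp: chg_def)

lemma chg_empty: "v \<in> chg {} \<Longrightarrow> v = 0"
proof -
  assume "v \<in> chg {}"
  then have "x \<notin> keys v" for x by (cases x) (auto simp: chg_def)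
  then show "v = 0" by (intro poly_mapping_eqI) (simp add: in_keys_iff)
qed

lemma chg_UNIV: "v \<in> chg UNIV" by (simp add: chg_def)

lemma chg_mono: "v \<in> chg S \<Longrightarrow> S \<subseteq> T \<Longrightarrow> v \<in> chg T"
  by (auto simp: chg_def)

lemma single_chg: "l \<in> S \<Longrightarrow> single (m, l) c \<in> chg S"
  by (auto simp: chg_def split: if_splits)

lemma expo_chg: "k \<in> S \<Longrightarrow> expo k \<in> chg S"
  by (simp add: expo_def single_chg)

lemma fock_basis_induct [consumes 1, case_names single add scale]:
  assumes "v \<in> chg S"
    and "\<And>\<mu> l. l \<in> S \<Longrightarrow> P (single (\<mu>, l) 1)"
    and "\<And>u w. u \<in> chg S \<Longrightarrow> w \<in> chg S \<Longrightarrow> P u \<Longrightarrow> P w \<Longrightarrow> P (u + w)"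
    and "\<And>c u. u \<in> chg S \<Longrightarrow> P u \<Longrightarrow> P (fscale c u)"
    and "S \<noteq> {}"
  shows "P v"
proof -
  from \<open>S \<noteq> {}\<close> obtain k where "k \<in> S" by blast
  then have zero: "P 0"
    using assms(4)[of "single (0, k) 1" 0] assms(2)[of k 0] by (simp add: single_chg)
  have *: "P (\<Sum>x\<in>A. fscale (lookup v x) (single x 1)) \<and>
     (\<Sum>x\<in>A. fscale (lookup v x) (single x 1)) \<in> chg S"
    if "finite A" "A \<subseteq> keys v" for A
    using that
  proof (induction A rule: finite_induct)
    case empty
    then show ?case by (simp add: zero chg_0)
  next
    case (insert x A)
    obtain m l where x: "x = (m, l)" by (cases x)
    have "l \<in> S" using insert.prems assms(1) by (auto simp: x chg_def)
    then show ?case using insert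
      by (auto simp: x intro!: assms chg_add chg_scale single_chg)
  qed
  show ?thesis by (subst fock_expand) (use * in auto)
qed

lemma osc_single: "osc n * single (\<mu>, l) c = single (\<mu> + single n 1, l) c"
  by (simp add: osc_def mult_single add.commute)

lemma expo_single: "expo k * single (\<mu>, l) c = single (\<mu>, k + l) c"
  by (simp add: expo_def mult_single)

lemma expo_mult: "expo k * expo l = expo (k + l)"
  by (simp add: expo_def mult_single)

lemma mindex_induct [case_names zero add]:
  fixes \<mu> :: "nat \<Rightarrow>\<^sub>0 nat"
  assumes "P 0" "\<And>\<mu> n. P \<mu> \<Longrightarrow> P (\<mu> + single n 1)"
  shows "P \<mu>"
proof -
  have step: "P (\<nu> + single n k)" if "P \<nu>" for \<nu> n k
    by (induction k) (use that assms(2)[of "\<nu> + single n _" n] in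
        \<open>auto simp: add.assoc simp flip: single_add\<close>)
  have "P (\<Sum>n\<in>A. single n (lookup \<mu> n))" if "finite A" for A
    using that
  proof (induction A rule: finite_induct)
    case (insert x F)
    from step[OF insert.IH, of x "lookup \<mu> x"] show ?case
      using insert.hyps by (simp add: add.commute)
  qed (simp add: assms(1))
  from this[of "keys \<mu>"]
  have "P (\<Sum>n\<in>keys \<mu>. single n (lookup \<mu> n))"
    by simp
  also have "(\<Sum>n\<in>keys \<mu>. single n (lookup \<mu> n)) = \<mu>"
    by (rule poly_mapping_eqI) (simp add: lookup_sum lookup_single when_def in_keys_iff)
  finally show ?thesis .
qed

text \<open>Every vector with charges in \<open>S\<close> arises from exponentials by creation
  operators, so fields can be treated by adding one oscillator at a time. For empty \<open>S\<close>
  the space is 0 and the rules would not yield \<open>P 0\<close>.\<close>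

lemma fock_induct [consumes 2, case_names expo osc add scale]:
  assumes "v \<in> chg S" and "S \<noteq> {}"
    and "\<And>k. k \<in> S \<Longrightarrow> P (expo k)"
    and "\<And>n u. u \<in> chg S \<Longrightarrow> P u \<Longrightarrow> P (osc n * u)"
    and "\<And>u w. u \<in> chg S \<Longrightarrow> w \<in> chg S \<Longrightarrow> P u \<Longrightarrow> P w \<Longrightarrow> P (u + w)"
    and "\<And>c u. u \<in> chg S \<Longrightarrow> P u \<Longrightarrow> P (fscale c u)"
  shows "P v"
  using assms(1)
proof (induction v rule: fock_basis_induct)
  case (single \<mu> l)
  show ?case
  proof (induction \<mu> rule: mindex_induct)
    case zero
    then show ?case using assms(3)[OF single] by (simp add: expo_def)
  next
    case (add \<mu> n)
    then show ?case using assms(4)[OF single_chg[OF single] add, of n] by (simp add: osc_single)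
  qed
qed (use assms in auto)

text \<open>The operators are defined by sums over \<open>keys v\<close>, an index set that varies
  with \<open>v\<close>. As \<open>h x 0 = 0\<close>, each sum may be extended to a larger finite
  set, and over a common set additivity is visible.\<close>

lemma lin_keys_sum:
  assumes "\<And>x a b. h x (a + b) = h x a + h x b" "\<And>x c a. h x (c * a) = fscale c (h x a)"
  shows "lin (\<lambda>v. \<Sum>x\<in>keys v. h x (lookup v x))"
proof -
  have h0: "h x 0 = 0" for x using assms(2)[of x 0 0] by simp
  have ex: "(\<Sum>x\<in>keys v. h x (lookup v x)) = (\<Sum>x\<in>A. h x (lookup v x))"
    if "finite A" "keys v \<subseteq> A" for v A
    by (rule sum.mono_neutral_left) (use that in \<open>auto simp: in_keys_iff h0\<close>)
  show ?thesis
  proof (rule linI)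
    fix u v :: fock
    let ?A = "keys u \<union> keys v"
    show "(\<Sum>x\<in>keys (u + v). h x (lookup (u + v) x)) =
      (\<Sum>x\<in>keys u. h x (lookup u x)) + (\<Sum>x\<in>keys v. h x (lookup v x))"
      using keys_add[of u v] ex[of ?A u] ex[of ?A v] ex[of ?A "u + v"]
      by (simp add: lookup_add assms(1) sum.distrib)
  next
    fix c :: complex and v :: fock
    show "(\<Sum>x\<in>keys (fscale c v). h x (lookup (fscale c v) x)) =
      fscale c (\<Sum>x\<in>keys v. h x (lookup v x))"
      using keys_fscale[of c v]
        ex[of "keys v" "fscale c v"]
      by (simp add: lookup_fscale assms(2) fock.scale_sum_right)
  qed
qed

lemma lin_eq_basis:
  assumes "lin f" "lin g" "v \<in> chg S" "\<And>\<mu> k. k \<in> S \<Longrightarrow> f (single (\<mu>, k) 1) = g (single (\<mu>, k) 1)"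
  shows "f v = g v"
proof (cases "S = {}")
  case True
  then have "v = 0" using assms(3) by (intro chg_empty) simp
  then show ?thesis using assms by (simp add: lin_0)
next
  case False
  with assms(3) show ?thesis
    by (induction v rule: fock_basis_induct) (use assms False in \<open>auto simp: lin_add lin_scale\<close>)
qed

lemma lin_fscale: "lin (fscale c)"
  by (rule linI) (simp_all add: fock.scale_right_distrib fock.scale_left_commute)

lemma lin_times: "lin ((*) a)"
  by (rule linI) (simp_all add: distrib_left fscale_mult_right)

section \<open>The Heisenberg commutation relations\<close>

lemma heis_lin: "lin (heis p m)"
proof -
  consider "m < 0" | "m = 0" | "m > 0" by linarith
  then show ?thesis
  proof cases
    case 1
    then have "heis p m = (*) (osc (nat (- m - 1)))" by (auto simp: heis_def fun_eq_iff)
    then show ?thesis by (simp add: lin_times)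
  next
    case 2
    have "lin (\<lambda>v. \<Sum>x\<in>keys v. (\<lambda>x a. single x (of_int (snd x) * a)) x (lookup v x))"
      by (rule lin_keys_sum) (auto simp: algebra_simps single_add fscale_single)
    also have "(\<lambda>v. \<Sum>x\<in>keys v. (\<lambda>x a. single x (of_int (snd x) * a)) x (lookup v x)) = heis p m"
      using 2 by (auto simp: heis_def fun_eq_iff case_prod_unfold)
    finally show ?thesis .
  next
    case 3
    let ?g = "\<lambda>x a. single (fst x - single (nat (m - 1)) 1, snd x)
            (2 * of_nat p * of_int m * of_nat (lookup (fst x) (nat (m - 1))) * a) :: fock"
    have "lin (\<lambda>v. \<Sum>x\<in>keys v. ?g x (lookup v x))"
      by (rule lin_keys_sum) (auto simp: algebra_simps single_add fscale_single simp flip: single_add)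
    also have "(\<lambda>v. \<Sum>x\<in>keys v. ?g x (lookup v x)) = heis p m"
      using 3 by (auto simp: heis_def fun_eq_iff case_prod_unfold)
    finally show ?thesis .
  qed
qed

lemmas heis_add = lin_add[OF heis_lin] and heis_scale = lin_scale[OF heis_lin] and heis_0 [simp] = lin_0[OF heis_lin]
  and heis_sum = lin_sum[OF heis_lin] and heis_diff = lin_diff[OF heis_lin] and heis_minus = lin_minus[OF heis_lin]

lemma heis_neg: "m < 0 \<Longrightarrow> heis p m v = osc (nat (- m - 1)) * v"
  by (simp add: heis_def)

lemma osc_heis: "osc n * v = heis p (- 1 - int n) v"
  by (simp add: heis_def)

lemma heis_zero_single: "heis p 0 (single (\<mu>, k) c) = single (\<mu>, k) (of_int k * c)"
  by (simp add: heis_def)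

lemma heis_pos_single: "heis p (1 + int n) (single (\<mu>, k) c) =
   single (\<mu> - single n 1, k) (2 * of_nat p * (1 + of_nat n) * of_nat (lookup \<mu> n) * c)"
  by (simp add: heis_def)

lemma heis_zero_chg: "v \<in> chg {k} \<Longrightarrow> heis p 0 v = fscale (of_int k) v"
  by (rule lin_eq_basis[OF heis_lin lin_fscale]) (auto simp: heis_zero_single fscale_single)

lemma int_trichotomy [case_names neg zero pos]:
  obtains n where "m = - 1 - int n" | "m = 0" | n where "m = 1 + int n"
proof -
  have "m = - 1 - int (nat (- m - 1))" if "m < 0" using that by simp
  moreover have "m = 1 + int (nat (m - 1))" if "m > 0" using that by simp
  ultimately show ?thesis using that by (meson linorder_neqE_linordered_idom)
qed

lemma lin_chg:
  assumes "lin f" "v \<in> chg S" "\<And>\<mu> k. k \<in> S \<Longrightarrow> f (single (\<mu>, k) 1) \<in> chg T"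
  shows "f v \<in> chg T"
proof (cases "S = {}")
  case True
  then have "v = 0" using assms(2) by (intro chg_empty) simp
  then show ?thesis using assms by (simp add: lin_0 chg_0)
next
  case False
  with assms(2) show ?thesis
    by (induction v rule: fock_basis_induct)
       (use assms False in \<open>auto simp: lin_add lin_scale intro: chg_add chg_scale\<close>)
qed

lemma heis_chg:
  assumes "v \<in> chg S"
  shows "heis p m v \<in> chg S"
  by (rule lin_chg[OF heis_lin assms], cases m rule: int_trichotomy)
     (auto simp: osc_heis[of _ _ p, symmetric] osc_single heis_zero_single heis_pos_single intro!: single_chg)

lemma osc_chg: "v \<in> chg S \<Longrightarrow> osc n * v \<in> chg S"
  by (simp add: osc_heis[of _ _ 0] heis_chg)

text \<open>Multiplication by an exponential shifts the charge and touches no oscillator; only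
  \<open>\<alpha>(0)\<close>, which measures the charge, notices it.\<close>

lemma heis_expo_mult:
  "heis p m (expo k * v) = expo k * heis p m v + (if m = 0 then fscale (of_int k) (expo k * v) else 0)"
proof (rule lin_eq_basis[where v = v and S = UNIV and f = "\<lambda>v. heis p m (expo k * v)" and
      g = "\<lambda>v. expo k * heis p m v + (if m = 0 then fscale (of_int k) (expo k * v) else 0)"])
  show "lin (\<lambda>v. heis p m (expo k * v))" by (rule lin_comp[OF heis_lin lin_times])
  show "lin (\<lambda>v. expo k * heis p m v + (if m = 0 then fscale (of_int k) (expo k * v) else 0))"
    by (cases "m = 0") (auto intro!: lin_plus lin_mult heis_lin lin_smult lin_times lin_zero)
  show "v \<in> chg UNIV" by (rule chg_UNIV)
  fix \<mu> l
  show "heis p m (expo k * single (\<mu>, l) 1) = expo k * heis p m (single (\<mu>, l) 1)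
     + (if m = 0 then fscale (of_int k) (expo k * single (\<mu>, l) 1) else 0)"
    by (cases m rule: int_trichotomy)
       (auto simp: osc_heis[of _ _ p, symmetric] osc_single expo_single heis_zero_single heis_pos_single fscale_single add.commute
          simp flip: single_add)
qed

lemma heis_expo: "heis p m (expo k) = (if m < 0 then osc (nat (- m - 1)) * expo k else if m = 0 then fscale (of_int k) (expo k) else 0)"
  by (auto simp: heis_def expo_def fscale_single)

text \<open>Subtraction of exponents is truncated and may be exchanged with addition only where the
  exponent is positive. Elsewhere the factor \<open>lookup \<mu> n\<close> of the derivative is
  zero.\<close>

lemma mindex_diff_add:
  fixes \<mu> \<nu> :: "'a \<Rightarrow>\<^sub>0 nat"
  shows "lookup \<mu> n \<noteq> 0 \<Longrightarrow> \<mu> + \<nu> - single n (1::nat) = (\<mu> - single n 1) + \<nu>"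
  by (rule poly_mapping_eqI) (auto simp: lookup_add lookup_minus lookup_single when_def)

lemma heis_pos_osc:
  "heis p (1 + int n) (osc k * v) = osc k * heis p (1 + int n) v
     + (if n = k then fscale (2 * of_nat p * (1 + of_nat n)) v else 0)"
proof (rule lin_eq_basis[where v = v and S = UNIV and f = "\<lambda>v. heis p (1 + int n) (osc k * v)" and
      g = "\<lambda>v. osc k * heis p (1 + int n) v + (if n = k then fscale (2 * of_nat p * (1 + of_nat n)) v else 0)"])
  show "lin (\<lambda>v. heis p (1 + int n) (osc k * v))" by (rule lin_comp[OF heis_lin lin_times])
  show "lin (\<lambda>v. osc k * heis p (1 + int n) v + (if n = k then fscale (2 * of_nat p * (1 + of_nat n)) v else 0))"
    by (cases "n = k") (auto intro!: lin_plus lin_mult heis_lin lin_fscale lin_zero)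
  show "v \<in> chg UNIV" by (rule chg_UNIV)
  fix \<mu> :: "nat \<Rightarrow>\<^sub>0 nat" and l
  have "\<mu> + single k 1 - single n 1 = \<mu> - single n 1 + single k 1"
    if "lookup \<mu> n \<noteq> 0" using mindex_diff_add[OF that] by simp
  moreover have "\<mu> + single n 1 - single n (1::nat) = \<mu>" by simp
  ultimately show "heis p (1 + int n) (osc k * single (\<mu>, l) 1) = osc k * heis p (1 + int n) (single (\<mu>, l) 1)
     + (if n = k then fscale (2 * of_nat p * (1 + of_nat n)) (single (\<mu>, l) 1) else 0)"
    unfolding osc_single heis_pos_single fscale_single
    by (cases "lookup \<mu> n = 0"; cases "n = k")
       (auto simp: lookup_add lookup_single single_add[symmetric] algebra_simps)
qed

lemma heis_comm_neg:
  "heis p i (osc n * v) = osc n * heis p i v + (if i = 1 + int n then fscale (2 * of_nat p * of_int i) v else 0)"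
proof (cases i rule: int_trichotomy)
  case (pos k)
  then show ?thesis using heis_pos_osc[of p k n v] by auto
next
  case zero
  have "heis p 0 (osc n * v) = osc n * heis p 0 v"
    by (rule lin_eq_basis[OF lin_comp[OF heis_lin lin_times] lin_mult[OF heis_lin] chg_UNIV])
       (simp add: heis_zero_single osc_single)
  then show ?thesis by (simp add: zero)
qed (auto simp: heis_neg mult_ac)

lemma heis_comm:
  "heis p i (heis p j v) = heis p j (heis p i v) + (if i + j = 0 then fscale (2 * of_nat p * of_int i) v else 0)"
proof (cases j rule: int_trichotomy)
  case (neg n)
  have "(i = 1 + int n) = (i + j = 0)" using neg by linarith
  then show ?thesis using heis_comm_neg[of p i n v] unfolding osc_heis[of _ _ p] neg[symmetric] by simp
next
  case zero
  show ?thesis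
  proof (cases i rule: int_trichotomy)
    case (neg n)
    then show ?thesis using zero heis_comm_neg[of p 0 n v] unfolding osc_heis[of _ _ p] neg[symmetric] by simp
  next
    case (pos n)
    have "heis p 0 (heis p i v) = heis p i (heis p 0 v)"
      by (rule lin_eq_basis[OF lin_comp[OF heis_lin heis_lin] lin_comp[OF heis_lin heis_lin] chg_UNIV])
         (simp add: pos heis_zero_single heis_pos_single mult_ac)
    then show ?thesis by (simp add: zero)
  qed (simp add: zero)
next
  case (pos n)
  show ?thesis
  proof (cases i rule: int_trichotomy)
    case (neg k)
    have "heis p j (heis p i v) = heis p i (heis p j v) + (if j = 1 + int k then fscale (2 * of_nat p * of_int j) v else 0)"
      using heis_comm_neg[of p j k v] unfolding osc_heis[of _ _ p] neg[symmetric] .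
    moreover have "(j = 1 + int k) = (i + j = 0)" using neg by linarith
    moreover have "of_int i = - (of_int j :: complex)" if "i + j = 0"
      using that by (metis add.inverse_inverse minus_add_cancel neg_eq_iff_add_eq_0 of_int_minus)
    ultimately show ?thesis by simp
  next
    case zero
    have "heis p 0 (heis p j v) = heis p j (heis p 0 v)"
      by (rule lin_eq_basis[OF lin_comp[OF heis_lin heis_lin] lin_comp[OF heis_lin heis_lin] chg_UNIV])
         (simp add: pos heis_zero_single heis_pos_single mult_ac)
    then show ?thesis by (simp add: zero pos)
  next
    case (pos k)
    note j = \<open>j = 1 + int n\<close>
    have [simp]: "\<mu> - single n (Suc 0) - single k (Suc 0) =
       \<mu> - single k (Suc 0) - single n (Suc 0)" for \<mu>
      by (rule poly_mapping_eqI) (simp add: lookup_minus)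
    have "heis p i (heis p j v) = heis p j (heis p i v)"
      by (rule lin_eq_basis[OF lin_comp[OF heis_lin heis_lin] lin_comp[OF heis_lin heis_lin] chg_UNIV],
          cases "k = n")
         (simp_all add: pos j heis_pos_single lookup_minus lookup_single diff_right_commute mult_ac)
    then show ?thesis by (simp add: pos j)
  qed
qed

text \<open>The annihilation half of a normally ordered product is a sum over all
  \<open>m \<ge> 0\<close>; this makes it finite on each vector.\<close>

lemma heis_vanish: "\<exists>N. \<forall>m\<ge>N. heis p (int m) v = 0"
proof -
  have "v \<in> chg UNIV" "(UNIV :: int set) \<noteq> {}" by (auto intro: chg_UNIV)
  then show ?thesis
  proof (induction v rule: fock_induct)
    case (expo k)
    show ?case by (rule exI[of _ 1]) (simp add: heis_expo)
  next
    case (osc n u)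
    then obtain N where "\<forall>m\<ge>N. heis p (int m) u = 0" by blast
    then show ?case by (intro exI[of _ "max N (n + 2)"]) (simp add: heis_comm_neg)
  next
    case (add u w)
    then obtain M N where "\<forall>m\<ge>M. heis p (int m) u = 0" "\<forall>m\<ge>N. heis p (int m) w = 0" by blast
    then show ?case by (intro exI[of _ "max M N"]) (simp add: heis_add)
  next
    case (scale c u)
    then show ?case by (auto simp: heis_scale)
  qed
qed

text \<open>Reading off the coefficient of \<open>e ^ (K\<alpha>/2p)\<close> after annihilating separates vectors.\<close>

lemma heis_separating:
  assumes "p > 0"
    and "\<And>is K. \<forall>i\<in>set is. i > 0 \<Longrightarrow> lookup (foldr (heis p) is v) (0, K) = 0"
  shows "v = 0"
proof -
  have "\<exists>is c. (\<forall>i\<in>set is. i > 0) \<and> c \<noteq> 0 \<and>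
     (\<forall>v. lookup (foldr (heis p) is v) (0, K) = c * lookup v (\<mu>, K))" for \<mu> K
  proof (induction \<mu> rule: mindex_induct)
    case zero
    show ?case by (rule exI[of _ "[]"], rule exI[of _ 1]) simp
  next
    case (add \<mu> n)
    then obtain "is" c where IH: "\<forall>i\<in>set is. i > 0" "c \<noteq> 0"
      "\<And>v. lookup (foldr (heis p) is v) (0, K) = c * lookup v (\<mu>, K)" by blast
    \<comment> \<open>The factor produced by \<open>\<alpha>(n+1)\<close> when it lowers the
      exponent of variable \<open>n\<close> from \<open>lookup \<mu> n + 1\<close>. It is nonzero,
      so a monomial can be removed one variable at a time.\<close>
    let ?d = "2 * of_nat p * (1 + of_nat n) * of_nat (lookup \<mu> n + 1) :: complex"
    have l: "lookup (heis p (1 + int n) v) (\<mu>, K) = ?d * lookup v (\<mu> + single n 1, K)" for v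
    proof (rule fock_basis_induct[OF chg_UNIV[of v]])
      fix \<nu> l
      have "\<nu> - single n 1 = \<mu> \<and> lookup \<nu> n \<noteq> 0 \<longleftrightarrow> \<nu> = \<mu> + single n 1"
        by (auto simp: poly_mapping_eq_iff fun_eq_iff lookup_minus lookup_add lookup_single when_def)
      then show "lookup (heis p (1 + int n) (single (\<nu>, l) 1)) (\<mu>, K) =
         ?d * lookup (single (\<nu>, l) 1) (\<mu> + single n 1, K)"
        by (cases "lookup \<nu> n = 0")
           (auto simp: heis_pos_single lookup_single when_def lookup_add)
    qed (auto simp: heis_add heis_scale lookup_add lookup_fscale algebra_simps)
    have "1 + of_nat n \<noteq> (0::complex)" "1 + of_nat (lookup \<mu> n) \<noteq> (0::complex)"
      by (metis of_nat_Suc of_nat_eq_0_iff nat.simps(3))+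
    then have "?d \<noteq> 0" using assms(1) by simp
    then show ?case using IH
      by (intro exI[of _ "is @ [1 + int n]"] exI[of _ "c * ?d"]) (auto simp: l)
  qed
  then show ?thesis using assms(2)
    by (intro poly_mapping_eqI) (metis lookup_zero mult_eq_0_iff old.prod.exhaust)
qed

section \<open>Locally finite sums\<close>

text \<open>\<open>Sum_any\<close> returns 0 when infinitely many terms are nonzero, so each
  manipulation of such a sum has to be accompanied by this finiteness condition.\<close>

definition fs :: "(nat \<Rightarrow> 'a::zero) \<Rightarrow> bool" where
  "fs f \<longleftrightarrow> (\<exists>N. \<forall>i\<ge>N. f i = 0)"

lemma fsI: "(\<And>i. i \<ge> N \<Longrightarrow> f i = 0) \<Longrightarrow> fs f"
  by (auto simp: fs_def)

lemma fs_iff_finite: "fs f \<longleftrightarrow> finite {i. f i \<noteq> 0}"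
proof
  assume "fs f"
  then obtain N where "\<forall>i\<ge>N. f i = 0" by (auto simp: fs_def)
  then have "{i. f i \<noteq> 0} \<subseteq> {..<N}" using not_le by blast
  then show "finite {i. f i \<noteq> 0}" by (rule finite_subset) simp
next
  assume "finite {i. f i \<noteq> 0}"
  then obtain N where "\<forall>i\<in>{i. f i \<noteq> 0}. i < N" by (auto simp: finite_nat_set_iff_bounded)
  then show "fs f" using not_le by (intro fsI[of N]) blast
qed

lemma fs_finite: "fs f \<Longrightarrow> finite {i. f i \<noteq> 0}"
  by (simp add: fs_iff_finite)

lemma Sum_any_lt: "Sum_any f = sum f {..<N}" if "\<And>i. i \<ge> N \<Longrightarrow> f i = 0" for f :: "nat \<Rightarrow> 'a::comm_monoid_add"
proof (rule Sum_any.expand_superset)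
  show "{i. f i \<noteq> 0} \<subseteq> {..<N}" using that not_le by blast
qed simp

lemma Sum_any_le: "Sum_any f = sum f {..N}" if "\<And>i. i > N \<Longrightarrow> f i = 0" for f :: "nat \<Rightarrow> 'a::comm_monoid_add"
proof (rule Sum_any.expand_superset)
  show "{i. f i \<noteq> 0} \<subseteq> {..N}" using that not_le by blast
qed simp

lemma fs_add: "fs f \<Longrightarrow> fs g \<Longrightarrow> fs (\<lambda>i. f i + g i :: 'a::monoid_add)"
proof -
  assume "fs f" "fs g"
  then obtain M N where "\<forall>i\<ge>M. f i = 0" "\<forall>i\<ge>N. g i = 0" by (auto simp: fs_def)
  then show ?thesis by (intro fsI[of "max M N"]) simp
qed

lemma Sum_any_add: "fs f \<Longrightarrow> fs g \<Longrightarrow> Sum_any (\<lambda>i. f i + g i) = Sum_any f + Sum_any g"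
  by (rule Sum_any.distrib) (auto simp: fs_finite)

lemma Sum_any_lin: "lin T \<Longrightarrow> fs f \<Longrightarrow> T (Sum_any f) = Sum_any (\<lambda>i. T (f i))"
proof -
  assume T: "lin T" and "fs f"
  then obtain N where N: "\<And>i. i \<ge> N \<Longrightarrow> f i = 0" by (auto simp: fs_def)
  show ?thesis using N by (simp add: Sum_any_lt[of N] lin_sum[OF T] lin_0[OF T])
qed

lemma fs_lin: "lin T \<Longrightarrow> fs f \<Longrightarrow> fs (\<lambda>i. T (f i))"
  unfolding fs_def by (metis lin_0)

lemmas Sum_any_fscale = Sum_any_lin[OF lin_fscale]
lemmas Sum_any_heis = Sum_any_lin[OF heis_lin]

lemma Sum_any_diff: "fs f \<Longrightarrow> fs g \<Longrightarrow> Sum_any (\<lambda>i. f i - g i) = Sum_any f - (Sum_any g :: fock)"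
  using Sum_any_add[of f "\<lambda>i. fscale (-1) (g i)"] Sum_any_fscale[of g "-1"] fs_lin[OF lin_fscale, of g "-1"]
  by simp

text \<open>The supports of the two families are both finite or both infinite; in the second case
  both sides take the default value 0.\<close>

lemma Sum_any_shift:
  fixes f :: "nat \<Rightarrow> 'a::comm_monoid_add"
  assumes "\<And>i. i < s \<Longrightarrow> f i = 0"
  shows "Sum_any f = Sum_any (\<lambda>i. f (i + s))"
proof (cases "fs f")
  case True
  then obtain N where N: "\<And>i. i \<ge> N \<Longrightarrow> f i = 0" by (auto simp: fs_def)
  have "Sum_any f = sum f {..<N + s}" by (rule Sum_any_lt) (simp add: N)
  also have "\<dots> = sum f {s..<N + s}"
    by (rule sum.mono_neutral_right) (auto simp: assms)
  also have "\<dots> = (\<Sum>i<N. f (i + s))"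
    by (simp add: sum.shift_bounds_nat_ivl[of f 0 s N, simplified] atLeast0LessThan)
  also have "\<dots> = Sum_any (\<lambda>i. f (i + s))" by (rule Sum_any_lt[symmetric]) (simp add: N)
  finally show ?thesis .
next
  case False
  moreover have "\<not> fs (\<lambda>i. f (i + s))"
  proof
    assume "fs (\<lambda>i. f (i + s))"
    then obtain N where "\<And>i. i \<ge> N \<Longrightarrow> f (i + s) = 0" by (auto simp: fs_def)
    then have "f i = 0" if "i \<ge> N + s" for i using that
      \<open>\<And>i. i \<ge> N \<Longrightarrow> f (i + s) = 0\<close>[of "i - s"] by simp
    with False fsI show False by blast
  qed
  ultimately show ?thesis by (simp add: fs_iff_finite)
qed

lemma Sum_any_Suc: "fs f \<Longrightarrow> Sum_any f = f 0 + Sum_any (\<lambda>i. f (Suc i))" for f :: "nat \<Rightarrow> 'a::comm_monoid_add"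
proof -
  assume "fs f"
  then obtain N where N: "\<And>i. i \<ge> N \<Longrightarrow> f i = 0" by (auto simp: fs_def)
  then have "Sum_any f = sum f {..<Suc N}" by (intro Sum_any_lt) simp
  moreover have "Sum_any (\<lambda>i. f (Suc i)) = (\<Sum>i<N. f (Suc i))" using N by (intro Sum_any_lt) simp
  ultimately show ?thesis by (simp only: sum.lessThan_Suc_shift)
qed

text \<open>Finiteness in both indices jointly. Finite rows with a finite family of row sums would
  not justify interchanging the two summations.\<close>

definition fs2 :: "(nat \<Rightarrow> nat \<Rightarrow> 'a::zero) \<Rightarrow> bool" where
  "fs2 g \<longleftrightarrow> (\<exists>N. \<forall>i j. i \<ge> N \<or> j \<ge> N \<longrightarrow> g i j = 0)"

lemma fs2_rows:
  assumes "\<And>i j. i \<ge> M \<Longrightarrow> g i j = 0" "\<And>i. fs (g i)"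
  shows "fs2 g"
proof -
  from assms(2) obtain N where N: "\<And>i j. j \<ge> N i \<Longrightarrow> g i j = 0" unfolding fs_def by metis
  show ?thesis unfolding fs2_def
  proof (intro exI allI impI)
    fix i j assume "i \<ge> max M (Max (N ` {..<M})) \<or> j \<ge> max M (Max (N ` {..<M}))"
    moreover have "N i \<le> Max (N ` {..<M})" if "i < M" using that by simp
    ultimately show "g i j = 0" using assms(1)[of i j] N[of i j]
      by (metis max.boundedE not_le order.trans)
  qed
qed

lemma fs2_cols:
  assumes "\<And>i j. j \<ge> M \<Longrightarrow> g i j = 0" "\<And>j. fs (\<lambda>i. g i j)"
  shows "fs2 g"
  using fs2_rows[of M "\<lambda>i j. g j i"] assms unfolding fs2_def by blast

lemma fs2_fs:
  fixes g :: "nat \<Rightarrow> nat \<Rightarrow> 'a::comm_monoid_add"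
  assumes "fs2 g"
  shows "fs (g i)" "fs (\<lambda>i. Sum_any (g i))"
proof -
  from assms obtain N where N: "\<And>i j. i \<ge> N \<or> j \<ge> N \<Longrightarrow> g i j = 0" unfolding fs2_def by blast
  show "fs (g i)" by (rule fsI[of N]) (simp add: N)
  show "fs (\<lambda>i. Sum_any (g i))" by (rule fsI[of N]) (simp add: N)
qed

lemma fs2_swap_iff: "fs2 (\<lambda>i j. g j i) \<longleftrightarrow> fs2 g"
  unfolding fs2_def by blast

lemma Sum_any_swap: "fs2 g \<Longrightarrow> Sum_any (\<lambda>i. Sum_any (g i)) = Sum_any (\<lambda>j. Sum_any (\<lambda>i. g i j))"
  for g :: "nat \<Rightarrow> nat \<Rightarrow> 'a::comm_monoid_add"
proof -
  assume "fs2 g"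
  then obtain N where "\<And>i j. i \<ge> N \<or> j \<ge> N \<Longrightarrow> g i j = 0" unfolding fs2_def by blast
  then have "{a. \<exists>b. g a b \<noteq> 0} \<times> {b. \<exists>a. g a b \<noteq> 0} \<subseteq> {..<N} \<times> {..<N}"
    using not_le by blast
  then show ?thesis by (intro Sum_any.swap) auto
qed

text \<open>Collects a double sum along the diagonals \<open>i + j = s\<close>, where convolutions
  of binomial coefficients appear.\<close>

lemma Sum_any_triangle: "fs2 g \<Longrightarrow> Sum_any (\<lambda>i. Sum_any (g i)) = Sum_any (\<lambda>s. \<Sum>i\<le>s. g i (s - i))"
  for g :: "nat \<Rightarrow> nat \<Rightarrow> 'a::comm_monoid_add"
proof -
  assume "fs2 g"
  then obtain N where N: "\<And>i j. i \<ge> N \<or> j \<ge> N \<Longrightarrow> g i j = 0" unfolding fs2_def by blast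
  have "Sum_any (\<lambda>i. Sum_any (g i)) = (\<Sum>i<N. \<Sum>j<N. g i j)"
    using N by (simp add: Sum_any_lt[of N])
  also have "\<dots> = (\<Sum>(i,j)\<in>{..<N} \<times> {..<N}. g i j)" by (simp add: sum.cartesian_product)
  also have "\<dots> = (\<Sum>(i,j)\<in>{(i,j). i + j < N + N}. g i j)"
  proof (rule sum.mono_neutral_left)
    show "finite {(i, j). i + j < N + N}"
      by (rule finite_subset[of _ "{..<N+N} \<times> {..<N+N}"]) auto
    show "\<forall>x\<in>{(i, j). i + j < N + N} - {..<N} \<times> {..<N}. (case x of (i, j) \<Rightarrow> g i j) = 0"
    proof
      fix x assume "x \<in> {(i, j). i + j < N + N} - {..<N} \<times> {..<N}"
      then obtain i j where "x = (i, j)" "i \<ge> N \<or> j \<ge> N" by (cases x) (auto simp: not_less)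
      then show "(case x of (i, j) \<Rightarrow> g i j) = 0" by (simp add: N)
    qed
  qed auto
  also have "\<dots> = (\<Sum>s<N+N. \<Sum>i\<le>s. g i (s - i))" by (rule sum.triangle_reindex)
  also have "\<dots> = Sum_any (\<lambda>s. \<Sum>i\<le>s. g i (s - i))"
  proof (rule Sum_any_lt[symmetric])
    fix s assume "s \<ge> N + N"
    then have "i \<ge> N \<or> s - i \<ge> N" for i by linarith
    then show "(\<Sum>i\<le>s. g i (s - i)) = 0" by (simp add: N)
  qed
  finally show ?thesis .
qed

lemma fls_nth_Sum_any: "fs f \<Longrightarrow> fls_nth (Sum_any f) n = Sum_any (\<lambda>j. fls_nth (f j) n)"
  for f :: "nat \<Rightarrow> 'a::comm_monoid_add fls"
proof -
  assume "fs f"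
  then obtain N where N: "\<And>i. i \<ge> N \<Longrightarrow> f i = 0" by (auto simp: fs_def)
  then show ?thesis by (simp add: Sum_any_lt[of N] fls_nth_sum)
qed

section \<open>Exponentials of oscillators\<close>

lemma op_pow_lin: "(\<And>n. lin (A n)) \<Longrightarrow> lin (op_pow A j N)"
proof (induction j arbitrary: N)
  case 0
  have "op_pow A 0 N = (if N = 0 then (\<lambda>v. v) else (\<lambda>v. 0))" by (simp add: fun_eq_iff)
  then show ?case by (simp add: lin_id lin_zero)
next
  case (Suc j)
  have "lin (\<lambda>v. \<Sum>n = 1..N. A n (op_pow A j (N - n) v))"
    by (rule lin_sum_fun, rule lin_comp[OF Suc.prems Suc.IH[OF Suc.prems]])
  then show ?case by (simp only: op_pow.simps[abs_def])
qed

lemma op_exp_lin: "(\<And>n. lin (A n)) \<Longrightarrow> lin (op_exp A N)"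
  unfolding op_exp_def[abs_def] by (rule lin_sum_fun, rule lin_smult, rule op_pow_lin)

lemma op_pow_0: "(\<And>n. lin (A n)) \<Longrightarrow> N < j \<Longrightarrow> op_pow A j N v = 0"
proof (induction j arbitrary: N)
  case (Suc j)
  have "A n (op_pow A j (N - n) v) = 0" if "n \<in> {1..N}" for n
    using Suc.IH[OF Suc.prems(1), of "N - n"] Suc.prems that lin_0[OF Suc.prems(1)] by auto
  then show ?case by simp
qed simp

lemma sum_triangle_swap: "(\<Sum>n = 1..N. \<Sum>m = 1..N - n. f n m) = (\<Sum>m = 1..N. \<Sum>n = 1..N - m. f n m)"
  for f :: "nat \<Rightarrow> nat \<Rightarrow> 'a::comm_monoid_add"
  unfolding sum.Sigma[OF finite_atLeastAtMost ballI[OF finite_atLeastAtMost]]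
  by (rule sum.reindex_bij_witness[of _ "\<lambda>(a, b). (b, a)" "\<lambda>(a, b). (b, a)"]) auto

text \<open>All commutators of \<open>D\<close> with the \<open>A n\<close> are scalars, so
  \<open>D\<close> acts on the j-th power of the series as a derivation.\<close>

lemma op_pow_comm:
  assumes A: "\<And>n. lin (A n)" and D: "lin D"
    and comm: "\<And>n v. D (A n v) = A n (D v) + fscale (c n) v"
  shows "D (op_pow A j N v) = op_pow A j N (D v) + fscale (of_nat j) (\<Sum>n = 1..N. fscale (c n) (op_pow A (j - 1) (N - n) v))"
proof (induction j arbitrary: N)
  case 0
  then show ?case using lin_0[OF D] by simp
next
  case (Suc j)
  have "D (op_pow A (Suc j) N v) = (\<Sum>n = 1..N. A n (D (op_pow A j (N - n) v)) + fscale (c n) (op_pow A j (N - n) v))"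
    by (simp add: lin_sum[OF D] comm)
  also have "\<dots> = op_pow A (Suc j) N (D v)
     + (\<Sum>n = 1..N. \<Sum>m = 1..N - n. fscale (of_nat j) (fscale (c m) (A n (op_pow A (j - 1) (N - n - m) v))))
     + (\<Sum>n = 1..N. fscale (c n) (op_pow A j (N - n) v))"
    by (simp add: Suc lin_simps[OF A] sum.distrib fock.scale_sum_right)
  also have "(\<Sum>n = 1..N. \<Sum>m = 1..N - n. fscale (of_nat j) (fscale (c m) (A n (op_pow A (j - 1) (N - n - m) v))))
      = (\<Sum>m = 1..N. \<Sum>n = 1..N - m. fscale (of_nat j) (fscale (c m) (A n (op_pow A (j - 1) (N - n - m) v))))"
    by (rule sum_triangle_swap)
  also have "\<dots> = (\<Sum>m = 1..N. fscale (of_nat j) (fscale (c m) (op_pow A j (N - m) v)))"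
  proof (rule sum.cong[OF refl])
    fix m assume "m \<in> {1..N}"
    show "(\<Sum>n = 1..N - m. fscale (of_nat j) (fscale (c m) (A n (op_pow A (j - 1) (N - n - m) v)))) =
       fscale (of_nat j) (fscale (c m) (op_pow A j (N - m) v))"
      by (cases j) (simp_all add: fock.scale_sum_right add.commute)
  qed
  finally show ?case by (simp add: fock.scale_sum_right fock.scale_left_distrib sum.distrib algebra_simps)
qed

text \<open>If [D, A(z)] = c z^s is central, then [D, exp A(z)] = c z^s exp A(z): the factor
  \<open>j\<close> of the derivation turns 1/j! into 1/(j-1)!.\<close>

lemma op_exp_comm:
  assumes A: "\<And>n. lin (A n)" and D: "lin D"
    and comm: "\<And>n v. n > 0 \<Longrightarrow> D (A n v) = A n (D v) + (if n = s then fscale c v else 0)" and "s > 0"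
  shows "D (op_exp A N v) = op_exp A N (D v) + (if s \<le> N then fscale c (op_exp A (N - s) v) else 0)"
proof -
  \<comment> \<open>\<open>op_pow\<close> never uses index 0, so \<open>A 0\<close>, whose
    commutator with \<open>D\<close> is not controlled, may be replaced by 0.\<close>
  define B where "B n = (if n = 0 then (\<lambda>v. 0) else A n)" for n
  have B: "lin (B n)" for n by (auto simp: B_def A lin_zero)
  have pow: "op_pow A j N v = op_pow B j N v" for j N v
    by (induction j arbitrary: N) (auto simp: B_def)
  have comm': "D (B n v) = B n (D v) + fscale (if n = s then c else 0) v" for n v
    using comm[of n v] \<open>s > 0\<close> by (auto simp: B_def lin_0[OF D])
  have pc: "D (op_pow B j N v) = op_pow B j N (D v) + fscale (of_nat j) (if s \<le> N then fscale c (op_pow B (j - 1) (N - s) v) else 0)" for j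
  proof -
    have "(\<Sum>n = 1..N. fscale (if n = s then c else 0) (op_pow B (j - 1) (N - n) v)) =
       (\<Sum>n = 1..N. if n = s then fscale c (op_pow B (j - 1) (N - n) v) else 0)" by (rule sum.cong) auto
    then show ?thesis using op_pow_comm[OF B D comm', where j = j and N = N and v = v] \<open>s > 0\<close>
      by (auto simp: sum.delta)
  qed
  have "D (op_exp A N v) = (\<Sum>j\<le>N. fscale (1 / fact j) (D (op_pow B j N v)))"
    by (simp add: op_exp_def lin_simps[OF D] pow)
  also have "\<dots> = op_exp A N (D v) + (\<Sum>j\<le>N. if s \<le> N then fscale (of_nat j / fact j) (fscale c (op_pow B (j - 1) (N - s) v)) else 0)"
    by (cases "s \<le> N") (simp_all add: pc op_exp_def pow fock.scale_right_distrib sum.distrib)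
  also have "(\<Sum>j\<le>N. if s \<le> N then fscale (of_nat j / fact j) (fscale c (op_pow B (j - 1) (N - s) v)) else 0) =
     (if s \<le> N then fscale c (op_exp A (N - s) v) else 0)"
  proof (cases "s \<le> N")
    case True
    then obtain M where N: "N = Suc M" and "N - s \<le> M" using \<open>s > 0\<close> by (cases N) auto
    have "(\<Sum>j\<le>N. fscale (of_nat j / fact j) (fscale c (op_pow B (j - 1) (N - s) v))) =
       (\<Sum>j\<le>M. fscale (1 / fact j) (fscale c (op_pow B j (N - s) v)))"
      unfolding N sum.atMost_Suc_shift by (simp add: field_simps del: of_nat_Suc)
    also have "\<dots> = (\<Sum>j\<le>N - s. fscale (1 / fact j) (fscale c (op_pow B j (N - s) v)))"
      using \<open>N - s \<le> M\<close> by (intro sum.mono_neutral_right) (auto simp: op_pow_0[OF B])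
    finally show ?thesis using True
      by (simp add: op_exp_def pow fock.scale_sum_right fock.scale_left_commute)
  qed simp
  finally show ?thesis .
qed

lemma op_exp_0 [simp]: "op_exp A 0 v = v"
  by (simp add: op_exp_def)

text \<open>Apply z d/dz to exp A(z): the result is z A'(z) exp A(z). The recursion in
  \<open>N\<close> obtained this way replaces the explicit sum over powers in the later
  computations.\<close>

lemma op_exp_Euler:
  assumes A: "\<And>n. lin (A n)" and comm: "\<And>m n v. A m (A n v) = A n (A m v)"
  shows "fscale (of_nat N) (op_exp A N v) = (\<Sum>n = 1..N. fscale (of_nat n) (A n (op_exp A (N - n) v)))"
proof -
  have pw: "fscale (of_nat N) (op_pow A j N v) = fscale (of_nat j) (\<Sum>n = 1..N. fscale (of_nat n) (A n (op_pow A (j - 1) (N - n) v)))" for j N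
  proof (induction j arbitrary: N)
    case (Suc j)
    have "fscale (of_nat N) (op_pow A (Suc j) N v) =
      (\<Sum>n = 1..N. fscale (of_nat n) (A n (op_pow A j (N - n) v)) + A n (fscale (of_nat (N - n)) (op_pow A j (N - n) v)))"
      unfolding op_pow.simps fock.scale_sum_right
      by (rule sum.cong) (auto simp: lin_scale[OF A] of_nat_diff simp flip: fock.scale_left_distrib)
    also have "\<dots> = (\<Sum>n = 1..N. fscale (of_nat n) (A n (op_pow A j (N - n) v)))
       + (\<Sum>n = 1..N. \<Sum>m = 1..N - n. fscale (of_nat j) (fscale (of_nat m) (A m (A n (op_pow A (j - 1) (N - n - m) v)))))"
      unfolding Suc by (simp add: sum.distrib lin_simps[OF A] fock.scale_sum_right comm[of _ _ "op_pow A _ _ _"])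
    also have "(\<Sum>n = 1..N. \<Sum>m = 1..N - n. fscale (of_nat j) (fscale (of_nat m) (A m (A n (op_pow A (j - 1) (N - n - m) v)))))
       = (\<Sum>m = 1..N. \<Sum>n = 1..N - m. fscale (of_nat j) (fscale (of_nat m) (A m (A n (op_pow A (j - 1) (N - n - m) v)))))"
      by (rule sum_triangle_swap)
    also have "\<dots> = (\<Sum>m = 1..N. fscale (of_nat j) (fscale (of_nat m) (A m (op_pow A j (N - m) v))))"
    proof (rule sum.cong[OF refl])
      fix m assume "m \<in> {1..N}"
      show "(\<Sum>n = 1..N - m. fscale (of_nat j) (fscale (of_nat m) (A m (A n (op_pow A (j - 1) (N - n - m) v))))) =
         fscale (of_nat j) (fscale (of_nat m) (A m (op_pow A j (N - m) v)))"
        by (cases j) (simp_all add: fock.scale_sum_right lin_simps[OF A] add.commute)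
    qed
    finally show ?case by (simp add: fock.scale_sum_right fock.scale_left_distrib sum.distrib algebra_simps)
  qed (cases N; simp)
  show ?thesis
  proof (cases N)
    case (Suc M)
    have "fscale (of_nat N) (op_exp A N v) = (\<Sum>j\<le>N. fscale (of_nat j / fact j) (\<Sum>n = 1..N. fscale (of_nat n) (A n (op_pow A (j - 1) (N - n) v))))"
      unfolding op_exp_def fock.scale_sum_right
    proof (rule sum.cong[OF refl])
      fix j
      have "fscale (of_nat N) (fscale (1 / fact j) (op_pow A j N v)) = fscale (1 / fact j) (fscale (of_nat N) (op_pow A j N v))"
        by (rule fock.scale_left_commute)
      then show "fscale (of_nat N) (fscale (1 / fact j) (op_pow A j N v)) =
        (\<Sum>n = 1..N. fscale (of_nat j / fact j) (fscale (of_nat n) (A n (op_pow A (j - 1) (N - n) v))))"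
        by (simp add: pw fock.scale_sum_right)
    qed
    also have "\<dots> = (\<Sum>j\<le>M. fscale (1 / fact j) (\<Sum>n = 1..N. fscale (of_nat n) (A n (op_pow A j (N - n) v))))"
      unfolding Suc sum.atMost_Suc_shift by (simp add: field_simps del: of_nat_Suc)
    also have "\<dots> = (\<Sum>n = 1..N. \<Sum>j\<le>M. fscale (1 / fact j) (fscale (of_nat n) (A n (op_pow A j (N - n) v))))"
      by (simp add: fock.scale_sum_right) (rule sum.swap)
    also have "\<dots> = (\<Sum>n = 1..N. \<Sum>j\<le>N - n. fscale (1 / fact j) (fscale (of_nat n) (A n (op_pow A j (N - n) v))))"
      using Suc by (intro sum.cong[OF refl] sum.mono_neutral_right) (auto simp: op_pow_0[OF A] lin_0[OF A])
    finally show ?thesis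
      by (simp add: op_exp_def lin_simps[OF A] fock.scale_sum_right fock.scale_left_commute)
  qed simp
qed

abbreviation crA :: "nat \<Rightarrow> int \<Rightarrow> nat \<Rightarrow> fock \<Rightarrow> fock" where
  "crA p k n v \<equiv> fscale (of_int k / (2 * of_nat p) / of_nat n) (heis p (- int n) v)"

abbreviation anA :: "nat \<Rightarrow> int \<Rightarrow> nat \<Rightarrow> fock \<Rightarrow> fock" where
  "anA p k n v \<equiv> fscale (- (of_int k / (2 * of_nat p) / of_nat n)) (heis p (int n) v)"

lemma crA_lin: "lin (crA p k n)" and anA_lin: "lin (anA p k n)"
  by (rule lin_smult, rule heis_lin)+

lemma exp_creation_lin: "lin (exp_creation p k N)"
  unfolding exp_creation_def by (rule op_exp_lin, rule crA_lin)

lemma exp_annihilation_lin: "lin (exp_annihilation p k N)"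
  unfolding exp_annihilation_def by (rule op_exp_lin, rule anA_lin)

lemma exp_creation_0 [simp]: "exp_creation p k 0 v = v"
  and exp_annihilation_0 [simp]: "exp_annihilation p k 0 v = v"
  by (simp_all add: exp_creation_def exp_annihilation_def)

lemma heis_exp_creation_pos:
  assumes "p > 0" "s > 0"
  shows "heis p (int s) (exp_creation p k N v) = exp_creation p k N (heis p (int s) v)
     + (if s \<le> N then fscale (of_int k) (exp_creation p k (N - s) v) else 0)"
  unfolding exp_creation_def
proof (rule op_exp_comm)
  fix n :: nat and v assume "n > 0"
  then show "heis p (int s) (crA p k n v) = crA p k n (heis p (int s) v) + (if n = s then fscale (of_int k) v else 0)"
    using assms by (simp add: heis_scale heis_comm[of p "int s" "- int n" v] fock.scale_right_distrib)
qed (rule crA_lin heis_lin assms)+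

lemma heis_exp_creation_le:
  assumes "m \<le> 0"
  shows "heis p m (exp_creation p k N v) = exp_creation p k N (heis p m v)"
proof -
  have "heis p m (op_exp (crA p k) N v) = op_exp (crA p k) N (heis p m v)
     + (if N + 1 \<le> N then fscale 0 (op_exp (crA p k) (N - (N + 1)) v) else 0)"
  proof (rule op_exp_comm)
    fix n :: nat and v assume "n > 0"
    then show "heis p m (crA p k n v) = crA p k n (heis p m v) + (if n = N + 1 then fscale 0 v else 0)"
      using assms by (simp add: heis_scale heis_comm[of p m "- int n" v])
  qed (rule crA_lin heis_lin | simp)+
  then show ?thesis by (simp add: exp_creation_def)
qed

lemma heis_exp_annihilation_neg:
  assumes "p > 0" "s > 0"
  shows "heis p (- int s) (exp_annihilation p k N v) = exp_annihilation p k N (heis p (- int s) v)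
     + (if s \<le> N then fscale (of_int k) (exp_annihilation p k (N - s) v) else 0)"
  unfolding exp_annihilation_def
proof (rule op_exp_comm)
  fix n :: nat and v assume "n > 0"
  then show "heis p (- int s) (anA p k n v) = anA p k n (heis p (- int s) v) + (if n = s then fscale (of_int k) v else 0)"
    using assms by (simp add: heis_scale heis_comm[of p "- int s" "int n" v] fock.scale_right_distrib heis_minus)
qed (rule anA_lin heis_lin assms)+

lemma heis_exp_annihilation_ge:
  assumes "m \<ge> 0"
  shows "heis p m (exp_annihilation p k N v) = exp_annihilation p k N (heis p m v)"
proof -
  have "heis p m (op_exp (anA p k) N v) = op_exp (anA p k) N (heis p m v)
     + (if N + 1 \<le> N then fscale 0 (op_exp (anA p k) (N - (N + 1)) v) else 0)"
  proof (rule op_exp_comm)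
    fix n :: nat and v assume "n > 0"
    then show "heis p m (anA p k n v) = anA p k n (heis p m v) + (if n = N + 1 then fscale 0 v else 0)"
      using assms by (simp add: heis_scale heis_comm[of p m "int n" v] heis_minus)
  qed (rule anA_lin heis_lin | simp)+
  then show ?thesis by (simp add: exp_annihilation_def)
qed

lemma exp_creation_Euler:
  "fscale (of_nat N) (exp_creation p k N v) =
   (\<Sum>n = 1..N. fscale (of_int k / (2 * of_nat p)) (heis p (- int n) (exp_creation p k (N - n) v)))"
proof -
  have "fscale (of_nat N) (exp_creation p k N v) =
    (\<Sum>n = 1..N. fscale (of_nat n) (crA p k n (exp_creation p k (N - n) v)))"
    unfolding exp_creation_def
  proof (rule op_exp_Euler)
    fix m n v show "crA p k m (crA p k n v) = crA p k n (crA p k m v)"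
      by (simp add: heis_scale heis_comm[of p "- int m" "- int n" v] fock.scale_left_commute mult.commute)
  qed (rule crA_lin)
  also have "\<dots> = (\<Sum>n = 1..N. fscale (of_int k / (2 * of_nat p)) (heis p (- int n) (exp_creation p k (N - n) v)))"
    by (rule sum.cong) auto
  finally show ?thesis .
qed

lemma exp_annihilation_expo: "exp_annihilation p k j (expo l) = (if j = 0 then expo l else 0)"
proof -
  have pw: "op_pow (anA p k) i N (expo l) = (if i = 0 \<and> N = 0 then expo l else 0)" for i N
  proof (induction i arbitrary: N)
    case (Suc i)
    have "anA p k n (if i = 0 \<and> N - n = 0 then expo l else 0) = 0" if "n \<in> {1..N}" for n
      using that by (auto simp: heis_expo)
    then have "(\<Sum>n = 1..N. anA p k n (if i = 0 \<and> N - n = 0 then expo l else 0)) = 0"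
      by (intro sum.neutral) blast
    then show ?case unfolding op_pow.simps Suc by simp
  qed simp
  show ?thesis unfolding exp_annihilation_def op_exp_def pw by auto
qed

text \<open>Moving the exponential past \<open>\<alpha>(-n-1)\<close> yields one extra term with the
  index lowered by \<open>n + 1\<close>, so the bound grows by \<open>n + 1\<close> with each
  oscillator.\<close>

lemma exp_annihilation_vanish:
  assumes "p > 0"
  shows "fs (\<lambda>j. exp_annihilation p k j v)"
proof -
  have "v \<in> chg UNIV" "(UNIV :: int set) \<noteq> {}" by (auto intro: chg_UNIV)
  then show ?thesis
  proof (induction v rule: fock_induct)
    case (expo l)
    show ?case by (rule fsI[of 1]) (simp add: exp_annihilation_expo)
  next
    case (osc n u)
    then obtain N where N: "\<And>j. j \<ge> N \<Longrightarrow> exp_annihilation p k j u = 0" by (auto simp: fs_def)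
    have "exp_annihilation p k j (osc n * u) = 0" if "j \<ge> N + n + 1" for j
      using heis_exp_annihilation_neg[of p "Suc n" k j u] assms that N[of j] N[of "j - Suc n"]
      by (simp add: osc_heis[of _ _ p])
    then show ?case by (intro fsI[of "N + n + 1"])
  next
    case (add u w)
    then show ?case using fs_add by (simp add: lin_add[OF exp_annihilation_lin])
  next
    case (scale c u)
    then show ?case using fs_lin[OF lin_fscale] by (simp add: lin_scale[OF exp_annihilation_lin])
  qed
qed

text \<open>The modes of \<open>Y(e ^ (k\<alpha>/2p), x)\<close> on a charge where \<open>x ^ \<beta>(0)\<close> is \<open>x ^ e\<close>.\<close>

definition ex :: "nat \<Rightarrow> int \<Rightarrow> int \<Rightarrow> int \<Rightarrow> fock \<Rightarrow> fock" where
  "ex p k e m v = Sum_any (\<lambda>j. if int j \<ge> m + 1 + e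
     then exp_creation p k (nat (int j - m - 1 - e)) (exp_annihilation p k j (expo k * v)) else 0)"

lemma ex_fs:
  assumes "p > 0"
  shows "fs (\<lambda>j. if int j \<ge> m + 1 + e
     then exp_creation p k (nat (int j - m - 1 - e)) (exp_annihilation p k j (expo k * v)) else 0)"
proof -
  obtain N where "\<And>j. j \<ge> N \<Longrightarrow> exp_annihilation p k j (expo k * v) = 0"
    using exp_annihilation_vanish[OF assms] unfolding fs_def by blast
  then show ?thesis by (intro fsI[of N]) (simp add: lin_0[OF exp_creation_lin])
qed

lemma ex_lin:
  assumes "p > 0"
  shows "lin (ex p k e m)"
proof (rule linI)
  fix u v
  show "ex p k e m (u + v) = ex p k e m u + ex p k e m v"
    unfolding ex_def Sum_any_add[OF ex_fs[OF assms] ex_fs[OF assms], symmetric]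
    by (rule Sum_any.cong) (auto simp: distrib_left lin_add[OF exp_creation_lin] lin_add[OF exp_annihilation_lin])
next
  fix c v
  show "ex p k e m (fscale c v) = fscale c (ex p k e m v)"
    unfolding ex_def Sum_any_fscale[OF ex_fs[OF assms]]
    by (rule Sum_any.cong) (auto simp: fscale_mult_right lin_scale[OF exp_creation_lin] lin_scale[OF exp_annihilation_lin])
qed

text \<open>\<open>\<alpha>(i)\<close> meets exactly one of the three factors: the charge shift for
  \<open>i = 0\<close>, the creation exponential for \<open>i > 0\<close>, the annihilation
  exponential for \<open>i < 0\<close>. Each of them contributes \<open>k\<close> times the mode
  shifted by \<open>i\<close>.\<close>

lemma heis_ex:
  assumes p: "p > 0"
  shows "heis p i (ex p k e m v) = ex p k e m (heis p i v) + fscale (of_int k) (ex p k e (m + i) v)"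
proof -
  consider "i = 0" | s where "i = int s" "s > 0" | s where "i = - int s" "s > 0"
    by (metis int_cases2 of_nat_0 of_nat_0_less_iff neg_equal_0_iff_equal not_gr_zero)
  then show ?thesis
  proof cases
    case 1
    show ?thesis
      unfolding ex_def Sum_any_heis[OF ex_fs[OF p]] Sum_any_fscale[OF ex_fs[OF p]] Sum_any_add[OF ex_fs[OF p] fs_lin[OF lin_fscale ex_fs[OF p]], symmetric]
      by (rule Sum_any.cong)
         (auto simp: 1 heis_exp_creation_le heis_exp_annihilation_ge heis_expo_mult
            lin_simps[OF exp_creation_lin] lin_simps[OF exp_annihilation_lin])
  next
    case (2 s)
    show ?thesis
      unfolding ex_def Sum_any_heis[OF ex_fs[OF p]] Sum_any_fscale[OF ex_fs[OF p]] Sum_any_add[OF ex_fs[OF p] fs_lin[OF lin_fscale ex_fs[OF p]], symmetric]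
    proof (rule Sum_any.cong)
      fix j
      let ?w = "exp_annihilation p k j (expo k * v)"
      have w: "heis p i ?w = exp_annihilation p k j (expo k * heis p i v)"
        using 2 by (simp add: heis_exp_annihilation_ge heis_expo_mult)
      show "heis p i (if int j \<ge> m + 1 + e then exp_creation p k (nat (int j - m - 1 - e)) ?w else 0) =
        (if int j \<ge> m + 1 + e then exp_creation p k (nat (int j - m - 1 - e)) (exp_annihilation p k j (expo k * heis p i v)) else 0)
        + fscale (of_int k) (if int j \<ge> m + i + 1 + e then exp_creation p k (nat (int j - (m + i) - 1 - e)) ?w else 0)"
      proof (cases "int j \<ge> m + 1 + e")
        case True
        define N where "N = nat (int j - m - 1 - e)"
        have "s \<le> N \<longleftrightarrow> int j \<ge> m + i + 1 + e" "N - s = nat (int j - (m + i) - 1 - e)"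
          using True 2 by (auto simp: N_def)
        then show ?thesis using True heis_exp_creation_pos[OF p 2(2), of k N ?w]
          unfolding N_def[symmetric] w[symmetric] using 2(1) by auto
      next
        case False
        then show ?thesis using 2 by simp
      qed
    qed
  next
    case (3 s)
    let ?f = "\<lambda>m v j. if int j \<ge> m + 1 + e then exp_creation p k (nat (int j - m - 1 - e)) (exp_annihilation p k j (expo k * v)) else 0"
    \<comment> \<open>The correction lowers the annihilation index by \<open>s\<close>; reindexed by
      \<open>s\<close>, it is the sum that defines the mode \<open>m + i\<close>.\<close>
    let ?g = "\<lambda>j. if s \<le> j then fscale (of_int k) (if int j \<ge> m + 1 + e then exp_creation p k (nat (int j - m - 1 - e)) (exp_annihilation p k (j - s) (expo k * v)) else 0) else 0"
    have gs: "?g (j + s) = fscale (of_int k) (?f (m + i) v j)" for j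
      using 3 by (auto simp: algebra_simps)
    have fg: "fs ?g"
    proof -
      obtain N where N: "\<And>j. j \<ge> N \<Longrightarrow> exp_annihilation p k j (expo k * v) = 0"
        using exp_annihilation_vanish[OF p] unfolding fs_def by blast
      show ?thesis by (rule fsI[of "N + s"]) (simp add: N lin_0[OF exp_creation_lin])
    qed
    have "heis p i (ex p k e m v) = Sum_any (\<lambda>j. ?f m (heis p i v) j + ?g j)"
      unfolding ex_def Sum_any_heis[OF ex_fs[OF p]]
    proof (rule Sum_any.cong)
      fix j
      show "heis p i (?f m v j) = ?f m (heis p i v) j + ?g j"
        using heis_exp_annihilation_neg[OF p 3(2), of k j "expo k * v"] 3
        by (auto simp: heis_exp_creation_le heis_expo_mult lin_simps[OF exp_creation_lin])
    qed
    also have "\<dots> = ex p k e m (heis p i v) + Sum_any ?g"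
      unfolding ex_def by (rule Sum_any_add[OF ex_fs[OF p] fg])
    also have "Sum_any ?g = Sum_any (\<lambda>j. ?g (j + s))" by (rule Sum_any_shift) simp
    also have "\<dots> = fscale (of_int k) (ex p k e (m + i) v)"
      unfolding gs ex_def by (rule Sum_any_fscale[OF ex_fs[OF p], symmetric])
    finally show ?thesis .
  qed
qed

lemma ex_expo: "p > 0 \<Longrightarrow> ex p k e m (expo l) = (if m + 1 + e \<le> 0 then exp_creation p k (nat (- m - 1 - e)) (expo (k + l)) else 0)"
proof -
  have "ex p k e m (expo l) = (\<Sum>j<1. if int j \<ge> m + 1 + e
     then exp_creation p k (nat (int j - m - 1 - e)) (exp_annihilation p k j (expo k * expo l)) else 0)"
    unfolding ex_def by (rule Sum_any_lt) (simp add: expo_mult exp_annihilation_expo lin_0[OF exp_creation_lin])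
  then show ?thesis by (simp add: expo_mult)
qed

lemma fls_nth_vop_exp:
  assumes p: "p > 0" and v: "v \<in> chg {l}"
  shows "fls_nth (vop_exp p k v) (- m - 1) = ex p k (k * l div (2 * int p)) m v"
proof -
  define G where "G x = Sum_any (\<lambda>j. fls_X_intpow (k * snd x div (2 * int p) - int j) *
          fps_to_fls (Abs_fps (\<lambda>i.
            exp_creation p k i (exp_annihilation p k j (single (fst x, k + snd x) 1)))))" for x :: "(nat \<Rightarrow>\<^sub>0 nat) \<times> int"
  have eq: "fls_nth (vop_exp p k v) n = (\<Sum>x\<in>keys v. fscale (lookup v x) (fls_nth (G x) n))" for v n
    unfolding vop_exp_def G_def fls_nth_sum
    by (rule sum.cong[OF refl]) (simp add: case_prod_unfold fscale_def)
  have lin: "lin (\<lambda>v. fls_nth (vop_exp p k v) n)" for n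
    unfolding eq by (rule lin_keys_sum) (simp_all add: fock.scale_left_distrib)
  show ?thesis
  proof (rule lin_eq_basis[OF lin ex_lin[OF p] v])
    fix \<mu> :: "nat \<Rightarrow>\<^sub>0 nat" and k' assume "k' \<in> {l}"
    then have k': "k' = l" by simp
    let ?s = "single (\<mu>, l) (1::complex)"
    let ?e = "k * l div (2 * int p)"
    let ?F = "\<lambda>j. fls_X_intpow (?e - int j) *
          fps_to_fls (Abs_fps (\<lambda>i. exp_creation p k i (exp_annihilation p k j (expo k * ?s)))) :: fock fls"
    obtain N where N: "\<And>j. j \<ge> N \<Longrightarrow> exp_annihilation p k j (expo k * ?s) = 0"
      using exp_annihilation_vanish[OF p] unfolding fs_def by blast
    have fsF: "fs ?F"
    proof (rule fsI[of N])
      fix j assume "j \<ge> N"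
      then have "Abs_fps (\<lambda>i. exp_creation p k i (exp_annihilation p k j (expo k * ?s))) = 0"
        by (intro fps_ext) (simp add: N lin_0[OF exp_creation_lin])
      then show "?F j = 0" by simp
    qed
    have "fls_nth (vop_exp p k ?s) (- m - 1) = fls_nth (Sum_any ?F) (- m - 1)"
      by (simp add: eq G_def expo_single)
    also have "\<dots> = ex p k ?e m ?s"
      unfolding fls_nth_Sum_any[OF fsF] ex_def
      by (rule Sum_any.cong, simp only: fls_X_intpow_times_conv_shift) (auto simp: algebra_simps)
    finally show "fls_nth (vop_exp p k (single (\<mu>, k') 1)) (- m - 1) = ex p k (k * l div (2 * int p)) m (single (\<mu>, k') 1)"
      by (simp add: k')
  qed
qed

lemma vop_exp_lin: "lin (\<lambda>v. fls_nth (vop_exp p k v) n)"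
proof -
  define G where "G x = Sum_any (\<lambda>j. fls_X_intpow (k * snd x div (2 * int p) - int j) *
          fps_to_fls (Abs_fps (\<lambda>i.
            exp_creation p k i (exp_annihilation p k j (single (fst x, k + snd x) 1)))))" for x :: "(nat \<Rightarrow>\<^sub>0 nat) \<times> int"
  have eq: "fls_nth (vop_exp p k v) n = (\<Sum>x\<in>keys v. fscale (lookup v x) (fls_nth (G x) n))" for v n
    unfolding vop_exp_def G_def fls_nth_sum
    by (rule sum.cong[OF refl]) (simp add: case_prod_unfold fscale_def)
  show ?thesis
    unfolding eq by (rule lin_keys_sum) (simp_all add: fock.scale_left_distrib)
qed

section \<open>Normally ordered products are independent of the order of their factors\<close>

definition flin :: "(fock \<Rightarrow> fock fls) \<Rightarrow> bool" where
  "flin G \<longleftrightarrow> (\<forall>n. lin (\<lambda>v. fls_nth (G v) n))"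

lemma flin_0: "flin G \<Longrightarrow> G 0 = 0"
  unfolding flin_def by (intro fls_eqI) (simp add: lin_0[of "\<lambda>v. fls_nth (G v) _"])

definition cre :: "nat \<Rightarrow> fock fls" where
  "cre n = fps_to_fls (Abs_fps (\<lambda>i. of_nat ((i + n) choose n) * osc (i + n)))"

definition ann_coeff :: "nat \<Rightarrow> nat \<Rightarrow> fock fls" where
  "ann_coeff n m = fls_const (cst ((- of_nat m - 1) gchoose n)) * fls_X_intpow (- int m - 1 - int n)"

text \<open>One step of \<open>vop_list\<close> with the remaining field \<open>G\<close> as a
  parameter, so that two steps can be compared.\<close>

definition nop :: "nat \<Rightarrow> nat \<Rightarrow> (fock \<Rightarrow> fock fls) \<Rightarrow> fock \<Rightarrow> fock fls" where
  "nop p n G v = cre n * G v + Sum_any (\<lambda>m. ann_coeff n m * G (heis p (int m) v))"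

lemma vop_list_Cons: "vop_list p k (n # ns) = nop p n (vop_list p k ns)"
  by (simp add: nop_def cre_def ann_coeff_def fun_eq_iff)

lemma fs_heis: "G 0 = 0 \<Longrightarrow> fs (\<lambda>m. t m * G (heis p (int m) v) :: 'a::mult_zero)"
proof -
  assume "G 0 = 0"
  obtain N where "\<forall>m\<ge>N. heis p (int m) v = 0" using heis_vanish by blast
  with \<open>G 0 = 0\<close> show ?thesis by (intro fsI[of N]) simp
qed

lemma heis_fsI: "(\<And>i. heis p (int i) v = 0 \<Longrightarrow> f i = 0) \<Longrightarrow> fs f"
  using heis_vanish[of p v] unfolding fs_def by metis

lemma fls_fps_mult_nth:
  "fls_nth (fps_to_fls F * g) n = Sum_any (\<lambda>i. fps_nth F i * fls_nth g (n - int i))"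
  for F :: "'a::comm_ring_1 fps"
proof -
  let ?d = "fls_subdegree g" and ?df = "fls_subdegree (fps_to_fls F)"
  have df: "?df \<ge> 0" by (rule fls_subdegree_fls_to_fps_gt0)
  have z: "fps_nth F (nat i) = 0" if "\<not> ?df \<le> i" "0 \<le> i" for i
    using fls_eq0_below_subdegree[of i "fps_to_fls F"] that by simp
  have "fls_nth (fps_to_fls F * g) n = (\<Sum>i=?df..n - ?d. fls_nth (fps_to_fls F) i * fls_nth g (n - i))"
    by (rule fls_times_nth(2))
  also have "\<dots> = (\<Sum>i=0..n - ?d. fls_nth (fps_to_fls F) i * fls_nth g (n - i))"
    using df z by (intro sum.mono_neutral_left) auto
  also have "\<dots> = (\<Sum>i<nat (n - ?d + 1). fps_nth F i * fls_nth g (n - int i))"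
    by (rule sum.reindex_bij_witness[of _ int nat]) auto
  also have "\<dots> = Sum_any (\<lambda>i. fps_nth F i * fls_nth g (n - int i))"
    by (rule Sum_any_lt[symmetric]) auto
  finally show ?thesis .
qed

lemma fls_nth_cre: "fls_nth (cre n * g) N = Sum_any (\<lambda>i. fscale (of_nat ((i + n) choose n)) (osc (i + n) * fls_nth g (N - int i)))"
  unfolding cre_def fls_fps_mult_nth
  by (rule Sum_any.cong) (simp add: fscale_def cst_def mult.assoc)

lemma fls_nth_ann: "fls_nth (ann_coeff n m * g) N = fscale ((- of_nat m - 1) gchoose n) (fls_nth g (N + int m + 1 + int n))"
proof -
  have "ann_coeff n m * g = fls_const (cst ((- of_nat m - 1) gchoose n)) * fls_shift (- (- int m - 1 - int n)) g"
    by (simp only: ann_coeff_def mult.assoc fls_X_intpow_times_conv_shift(1))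
  then show ?thesis by (simp add: fscale_def algebra_simps)
qed

lemma fls_trunc: "\<exists>N. \<forall>i\<ge>N. fls_nth g (n - int i) = 0"
  by (rule exI[of _ "nat (n - fls_subdegree g + 1)"]) auto

lemma fs_trunc: "(\<And>i. fls_nth g (n - int i) = 0 \<Longrightarrow> f i = 0) \<Longrightarrow> fs f"
  using fls_trunc[of g n] unfolding fs_def by metis

lemma fs_cre: "fs (\<lambda>i. fscale (of_nat ((i + n) choose n)) (osc (i + n) * fls_nth g (N - int i)))"
  by (rule fs_trunc[of g N]) simp

lemma flin_nop:
  assumes "flin G"
  shows "flin (nop p n G)"
  unfolding flin_def
proof (intro allI linI)
  note lin = assms[unfolded flin_def, rule_format]
  have nth: "fls_nth (nop p n G v) N =
     Sum_any (\<lambda>i. fscale (of_nat ((i + n) choose n)) (osc (i + n) * fls_nth (G v) (N - int i)))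
     + Sum_any (\<lambda>m. fscale ((- of_nat m - 1) gchoose n) (fls_nth (G (heis p (int m) v)) (N + int m + 1 + int n)))" for v N
    unfolding nop_def fls_plus_nth fls_nth_cre fls_nth_Sum_any[OF fs_heis[of G, OF flin_0[OF assms]]] fls_nth_ann ..
  have fs2: "fs (\<lambda>m. fscale ((- of_nat m - 1) gchoose n) (fls_nth (G (heis p (int m) v)) (N + int m + 1 + int n)))" for v N
  proof -
    obtain M where "\<forall>m\<ge>M. heis p (int m) v = 0" using heis_vanish by blast
    then show ?thesis by (intro fsI[of M]) (simp add: flin_0[OF assms])
  qed
  fix N u v and c :: complex
  show "fls_nth (nop p n G (u + v)) N = fls_nth (nop p n G u) N + fls_nth (nop p n G v) N"
    unfolding nth by (simp add: lin_add[OF lin] heis_add distrib_left fock.scale_right_distrib Sum_any_add[OF fs_cre fs_cre] Sum_any_add[OF fs2 fs2])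
  show "fls_nth (nop p n G (fscale c v)) N = fscale c (fls_nth (nop p n G v) N)"
    unfolding nth fock.scale_right_distrib Sum_any_fscale[OF fs_cre] Sum_any_fscale[OF fs2]
    by (intro arg_cong2[of _ _ _ _ "(+)"] Sum_any.cong)
       (simp_all add: lin_scale[OF lin] heis_scale fscale_mult_right mult.commute)
qed

lemma flin_vop_list: "flin (vop_list p k ns)"
proof (induction ns)
  case Nil
  then show ?case unfolding flin_def by (simp add: vop_exp_lin)
next
  case (Cons n ns)
  then show ?case unfolding vop_list_Cons by (rule flin_nop)
qed

text \<open>Creation parts commute, annihilation parts commute, and creation always stands to the
  left of annihilation; hence no contraction arises. Consequently the order chosen by
  \<open>mono_list\<close> is immaterial and any oscillator may be split off in front.\<close>

lemma nop_commute:
  assumes G: "flin G"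
  shows "nop p n (nop p m G) = nop p m (nop p n G)"
proof
  fix v
  note G0 = flin_0[OF G]
  have exp: "nop p n (nop p m G) v = cre n * cre m * G v
     + (Sum_any (\<lambda>j. cre n * ann_coeff m j * G (heis p (int j) v)) + Sum_any (\<lambda>i. cre m * ann_coeff n i * G (heis p (int i) v)))
     + Sum_any (\<lambda>i. Sum_any (\<lambda>j. ann_coeff n i * ann_coeff m j * G (heis p (int j) (heis p (int i) v))))" for n m
  proof -
    have "Sum_any (\<lambda>i. ann_coeff n i * nop p m G (heis p (int i) v)) =
      Sum_any (\<lambda>i. cre m * ann_coeff n i * G (heis p (int i) v) + Sum_any (\<lambda>j. ann_coeff n i * ann_coeff m j * G (heis p (int j) (heis p (int i) v))))"
      by (rule Sum_any.cong)
         (simp add: nop_def distrib_left Sum_any_right_distrib[OF fs_finite[OF fs_heis[of G, OF G0]]] mult_ac)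
    also have "\<dots> = Sum_any (\<lambda>i. cre m * ann_coeff n i * G (heis p (int i) v)) + Sum_any (\<lambda>i. Sum_any (\<lambda>j. ann_coeff n i * ann_coeff m j * G (heis p (int j) (heis p (int i) v))))"
      by (rule Sum_any_add[OF fs_heis[of G, OF G0] heis_fsI[of p v]]) (simp add: G0)
    finally show ?thesis
      by (simp add: nop_def[of p n] nop_def[of p m G v] distrib_left Sum_any_right_distrib[OF fs_finite[OF fs_heis[of G, OF G0]]] mult_ac)
  qed
  have "Sum_any (\<lambda>i. Sum_any (\<lambda>j. ann_coeff n i * ann_coeff m j * G (heis p (int j) (heis p (int i) v)))) =
     Sum_any (\<lambda>j. Sum_any (\<lambda>i. ann_coeff n i * ann_coeff m j * G (heis p (int j) (heis p (int i) v))))"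
  proof (rule Sum_any_swap)
    obtain N where N: "\<forall>m\<ge>N. heis p (int m) v = 0" using heis_vanish by blast
    show "fs2 (\<lambda>i j. ann_coeff n i * ann_coeff m j * G (heis p (int j) (heis p (int i) v)))"
      by (rule fs2_rows[of N]) (use N in \<open>auto simp: G0 intro: fs_heis[of G, OF G0]\<close>)
  qed
  also have "\<dots> = Sum_any (\<lambda>j. Sum_any (\<lambda>i. ann_coeff m j * ann_coeff n i * G (heis p (int i) (heis p (int j) v))))"
  proof (intro Sum_any.cong)
    fix i j
    have "heis p (int j) (heis p (int i) v) = heis p (int i) (heis p (int j) v)"
      using heis_comm[of p "int j" "int i" v] by (cases "i = 0 \<and> j = 0") auto
    then show "ann_coeff n i * ann_coeff m j * G (heis p (int j) (heis p (int i) v)) =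
        ann_coeff m j * ann_coeff n i * G (heis p (int i) (heis p (int j) v))"
      by (simp add: mult_ac)
  qed
  finally show "nop p n (nop p m G) v = nop p m (nop p n G) v"
    unfolding exp by (simp add: mult_ac add_ac)
qed

lemma vop_list_swap: "vop_list p k (xs @ n # ys) = vop_list p k (n # xs @ ys)"
  by (induction xs) (simp_all only: append_Nil append_Cons vop_list_Cons nop_commute[OF flin_vop_list])

lemma vop_list_mset: "mset xs = mset ys \<Longrightarrow> vop_list p k xs = vop_list p k ys"
proof (induction xs arbitrary: ys)
  case (Cons x xs)
  then have "x \<in> set ys" by (metis list.set_intros(1) set_mset_mset)
  then obtain ys1 ys2 where ys: "ys = ys1 @ x # ys2" by (meson split_list)
  with Cons have "vop_list p k xs = vop_list p k (ys1 @ ys2)" by simp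
  then show ?case unfolding ys vop_list_swap vop_list_Cons by simp
qed simp

lemma count_mono_list: "count (mset (mono_list \<mu>)) m = lookup \<mu> m"
proof -
  have c: "count (mset (concat (map (\<lambda>n. replicate (f n) n) xs))) m = (if m \<in> set xs then f m else 0)"
    if "distinct xs" for f :: "nat \<Rightarrow> nat" and xs
    using that by (induction xs) auto
  show ?thesis unfolding mono_list_def by (subst c) (auto simp: in_keys_iff)
qed

lemma mset_mono_list: "mset (mono_list (\<mu> + single n 1)) = mset (n # mono_list \<mu>)"
  by (rule multiset_eqI) (auto simp: count_mono_list lookup_add lookup_single)

lemma vop_lin_left: "lin (\<lambda>u. nmode p u n v)"
proof -
  have "nmode p u n v = (\<Sum>x\<in>keys u. fscale (lookup u x) (fls_nth (vop_list p (snd x) (mono_list (fst x)) v) (- n - 1)))" for u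
    unfolding nmode_def vop_def fls_nth_sum by (rule sum.cong) (auto simp: fscale_def)
  then show ?thesis by (simp only:) (rule lin_keys_sum, simp_all add: fock.scale_left_distrib)
qed

lemma nmode_single: "nmode p (single (\<mu>, k) 1) n v = fls_nth (vop_list p k (mono_list \<mu>) v) (- n - 1)"
  by (simp add: nmode_def vop_def cst_def)

lemma nmode_lin: "lin (nmode p u n)"
proof (rule fock_basis_induct[OF chg_UNIV[of u]])
  fix \<mu> :: "nat \<Rightarrow>\<^sub>0 nat" and l show "lin (nmode p (single (\<mu>, l) 1) n)"
    using flin_vop_list[unfolded flin_def] by (simp add: nmode_single[abs_def])
qed (auto simp: lin_add[OF vop_lin_left, abs_def] lin_scale[OF vop_lin_left, abs_def] intro: lin_plus lin_smult)

lemmas nmode_simps = lin_simps[OF nmode_lin] lin_simps[OF vop_lin_left]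

lemma nmode_trunc: "\<exists>N. \<forall>m\<ge>N. nmode p u m v = 0"
  by (rule exI[of _ "- fls_subdegree (vop p u v)"]) (simp add: nmode_def)

lemma nmode_fs: "fs (\<lambda>i. nmode p u (m + int i) v)"
proof -
  obtain N where "\<forall>m\<ge>N. nmode p u m v = 0" using nmode_trunc by blast
  then show ?thesis by (intro fsI[of "nat (N - m)"]) auto
qed

lemma nmode_fsI: "(\<And>i. nmode p u (m + int i) v = 0 \<Longrightarrow> f i = 0) \<Longrightarrow> fs f"
  using nmode_fs[of p u m v] unfolding fs_def by metis

lemma nmode_expo:
  assumes "p > 0" "v \<in> chg {l}"
  shows "nmode p (expo k) m v = ex p k (k * l div (2 * int p)) m v"
  using fls_nth_vop_exp[OF assms, of k m] nmode_single[of p 0 k m v]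
  by (simp add: expo_def mono_list_def)

section \<open>Modes of descendants\<close>

definition bn :: "nat \<Rightarrow> nat \<Rightarrow> complex" where
  "bn n i = of_nat ((i + n) choose n)"

lemma gchoose_neg: "(- of_nat i - 1 :: complex) gchoose n = (- 1) ^ n * bn n i"
  unfolding gbinomial_negated_upper[of "- of_nat i - 1"] bn_def
  by (simp add: binomial_gbinomial add.commute)

text \<open>The recursion behind all inductions on the left argument of \<open>nmode\<close>. By
  \<open>vop_list_mset\<close> the new oscillator may be taken as the first factor, whatever its
  place in the sorted list.\<close>

lemma nmode_osc:
  "nmode p (osc n * u) m v =
    Sum_any (\<lambda>i. fscale (bn n i) (heis p (- 1 - int n - int i) (nmode p u (m + int i) v)))
  + fscale ((- 1) ^ n) (Sum_any (\<lambda>i. fscale (bn n i) (nmode p u (m - 1 - int n - int i) (heis p (int i) v))))"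
proof -
  have fs1: "fs (\<lambda>i. fscale (bn n i) (heis p (- 1 - int n - int i) (nmode p u (m + int i) v)))" for u
    by (rule nmode_fsI[of p u m v]) simp
  have fs2: "fs (\<lambda>i. fscale (bn n i) (nmode p u (m - 1 - int n - int i) (heis p (int i) v)))" for u
    by (rule heis_fsI[of p v]) (simp add: nmode_simps)
  show ?thesis
  proof (rule fock_basis_induct[OF chg_UNIV[of u]])
    fix \<mu> :: "nat \<Rightarrow>\<^sub>0 nat" and l :: int
    let ?u = "single (\<mu>, l) (1::complex)"
    have "nmode p (osc n * ?u) m v = fls_nth (nop p n (vop_list p l (mono_list \<mu>)) v) (- m - 1)"
      unfolding osc_single nmode_single vop_list_mset[OF mset_mono_list] vop_list_Cons ..
    also have "\<dots> = Sum_any (\<lambda>i. fscale (of_nat ((i + n) choose n)) (osc (i + n) * fls_nth (vop_list p l (mono_list \<mu>) v) (- m - 1 - int i)))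
       + Sum_any (\<lambda>i. fscale ((- of_nat i - 1) gchoose n) (fls_nth (vop_list p l (mono_list \<mu>) (heis p (int i) v)) (- m - 1 + int i + 1 + int n)))"
      unfolding nop_def fls_plus_nth fls_nth_cre fls_nth_Sum_any[OF fs_heis[of "vop_list p l (mono_list \<mu>)", OF flin_0[OF flin_vop_list]]] fls_nth_ann ..
    also have "Sum_any (\<lambda>i. fscale (of_nat ((i + n) choose n)) (osc (i + n) * fls_nth (vop_list p l (mono_list \<mu>) v) (- m - 1 - int i)))
        = Sum_any (\<lambda>i. fscale (bn n i) (heis p (- 1 - int n - int i) (nmode p ?u (m + int i) v)))"
      by (rule Sum_any.cong) (simp add: bn_def nmode_single osc_heis[of _ _ p] algebra_simps)
    also have "Sum_any (\<lambda>i. fscale ((- of_nat i - 1) gchoose n) (fls_nth (vop_list p l (mono_list \<mu>) (heis p (int i) v)) (- m - 1 + int i + 1 + int n)))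
      = fscale ((- 1) ^ n) (Sum_any (\<lambda>i. fscale (bn n i) (nmode p ?u (m - 1 - int n - int i) (heis p (int i) v))))"
      unfolding Sum_any_fscale[OF fs2]
      by (rule Sum_any.cong) (simp add: gchoose_neg nmode_single algebra_simps)
    finally show "nmode p (osc n * ?u) m v =
    Sum_any (\<lambda>i. fscale (bn n i) (heis p (- 1 - int n - int i) (nmode p ?u (m + int i) v)))
  + fscale ((- 1) ^ n) (Sum_any (\<lambda>i. fscale (bn n i) (nmode p ?u (m - 1 - int n - int i) (heis p (int i) v))))" .
  next
    fix u w
    assume 1: "nmode p (osc n * u) m v =
    Sum_any (\<lambda>i. fscale (bn n i) (heis p (- 1 - int n - int i) (nmode p u (m + int i) v)))
  + fscale ((- 1) ^ n) (Sum_any (\<lambda>i. fscale (bn n i) (nmode p u (m - 1 - int n - int i) (heis p (int i) v))))"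
     and 2: "nmode p (osc n * w) m v =
    Sum_any (\<lambda>i. fscale (bn n i) (heis p (- 1 - int n - int i) (nmode p w (m + int i) v)))
  + fscale ((- 1) ^ n) (Sum_any (\<lambda>i. fscale (bn n i) (nmode p w (m - 1 - int n - int i) (heis p (int i) v))))"
    show "nmode p (osc n * (u + w)) m v =
    Sum_any (\<lambda>i. fscale (bn n i) (heis p (- 1 - int n - int i) (nmode p (u + w) (m + int i) v)))
  + fscale ((- 1) ^ n) (Sum_any (\<lambda>i. fscale (bn n i) (nmode p (u + w) (m - 1 - int n - int i) (heis p (int i) v))))"
      by (simp add: distrib_left nmode_simps 1 2 heis_add fock.scale_right_distrib Sum_any_add[OF fs1 fs1] Sum_any_add[OF fs2 fs2])
  next
    fix c u
    assume 1: "nmode p (osc n * u) m v =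
    Sum_any (\<lambda>i. fscale (bn n i) (heis p (- 1 - int n - int i) (nmode p u (m + int i) v)))
  + fscale ((- 1) ^ n) (Sum_any (\<lambda>i. fscale (bn n i) (nmode p u (m - 1 - int n - int i) (heis p (int i) v))))"
    have s: "fscale x (fscale c w) = fscale c (fscale x w)" for x w by (rule fock.scale_left_commute)
    show "nmode p (osc n * fscale c u) m v =
    Sum_any (\<lambda>i. fscale (bn n i) (heis p (- 1 - int n - int i) (nmode p (fscale c u) (m + int i) v)))
  + fscale ((- 1) ^ n) (Sum_any (\<lambda>i. fscale (bn n i) (nmode p (fscale c u) (m - 1 - int n - int i) (heis p (int i) v))))"
      unfolding fscale_mult_right lin_scale[OF vop_lin_left] heis_scale s[of "bn _ _"]
        Sum_any_fscale[OF fs1, symmetric] Sum_any_fscale[OF fs2, symmetric] 1 fock.scale_right_distrib s[of "(-1) ^ n"] ..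
  qed simp
qed

abbreviation ch :: "int \<Rightarrow> nat \<Rightarrow> complex" where
  "ch m j \<equiv> of_int m gchoose j"

lemma fs_fscale: "fs f \<Longrightarrow> fs (\<lambda>i. fscale (c i) (f i))"
  unfolding fs_def by (metis fock.scale_zero_right)

lemma fs_zero: "fs (\<lambda>_. 0)" by (simp add: fs_def)

lemma fs_if: "fs f \<Longrightarrow> fs (\<lambda>i. if P i then f i else 0)"
  unfolding fs_def by metis

lemma Sum_any_if_int:
  "Sum_any (\<lambda>r. if i = c + int r then f r else 0) = (if i \<ge> c then f (nat (i - c)) else (0::fock))"
proof (cases "i \<ge> c")
  case True
  then have "Sum_any (\<lambda>r. if i = c + int r then f r else 0) = Sum_any (\<lambda>r. if r = nat (i - c) then f r else 0)"
    by (intro Sum_any.cong) auto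
  with True show ?thesis by simp
qed simp

lemma heis_heis_fs: "fs (\<lambda>j. nmode p (heis p (int j) u) (s j) v)"
  by (rule heis_fsI[of p u]) (simp add: nmode_simps)

text \<open>The commutator formula for the current and an arbitrary field, available before the
  Borcherds identity and needed for it. When an oscillator is added to \<open>u\<close>, both halves
  of \<open>nmode_osc\<close> reproduce the induction hypothesis, and the remaining central terms
  have to add up to one binomial coefficient.\<close>

theorem heis_nmode:
  assumes p: "p > 0"
  shows "heis p i (nmode p u m v) = nmode p u m (heis p i v)
     + Sum_any (\<lambda>j. fscale (ch i j) (nmode p (heis p (int j) u) (m + i - int j) v))"
proof -
  have fsS: "fs (\<lambda>j. fscale (ch i j) (nmode p (heis p (int j) u) (m + i - int j) v))" for i u m v
    by (rule fs_fscale, rule heis_heis_fs)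
  have "u \<in> chg UNIV" "(UNIV :: int set) \<noteq> {}" by (auto intro: chg_UNIV)
  then show ?thesis
  proof (induction u arbitrary: i m v rule: fock_induct)
    case (expo k)
    have "Sum_any (\<lambda>j. fscale (ch i j) (nmode p (heis p (int j) (expo k)) (m + i - int j) v))
        = (\<Sum>j<1. fscale (ch i j) (nmode p (heis p (int j) (expo k)) (m + i - int j) v))"
      by (rule Sum_any_lt) (simp add: heis_expo nmode_simps)
    then have s: "Sum_any (\<lambda>j. fscale (ch i j) (nmode p (heis p (int j) (expo k)) (m + i - int j) v))
        = fscale (of_int k) (nmode p (expo k) (m + i) v)"
      by (simp add: heis_expo nmode_simps)
    have "heis p i (nmode p (expo k) m v) = nmode p (expo k) m (heis p i v) + fscale (of_int k) (nmode p (expo k) (m + i) v)"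
    proof (rule lin_eq_basis[where f = "\<lambda>v. heis p i (nmode p (expo k) m v)" and S = UNIV
          and g = "\<lambda>v. nmode p (expo k) m (heis p i v) + fscale (of_int k) (nmode p (expo k) (m + i) v)"])
      show "lin (\<lambda>v. heis p i (nmode p (expo k) m v))"
        by (rule lin_comp[OF heis_lin nmode_lin])
      show "lin (\<lambda>v. nmode p (expo k) m (heis p i v) + fscale (of_int k) (nmode p (expo k) (m + i) v))"
        by (rule lin_plus[OF lin_comp[OF nmode_lin heis_lin] lin_smult[OF nmode_lin]])
      fix \<mu> :: "nat \<Rightarrow>\<^sub>0 nat" and l :: int
      have s: "single (\<mu>, l) 1 \<in> chg {l}" by (simp add: single_chg)
      show "heis p i (nmode p (expo k) m (single (\<mu>, l) 1)) =
        nmode p (expo k) m (heis p i (single (\<mu>, l) 1))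
        + fscale (of_int k) (nmode p (expo k) (m + i) (single (\<mu>, l) 1))"
        unfolding nmode_expo[OF p s] nmode_expo[OF p heis_chg[OF s]] by (rule heis_ex[OF p])
    qed (rule chg_UNIV)
    then show ?case unfolding s .
  next
    case (osc n u)
    note IH = osc.IH
    \<comment> \<open>The correction term of the induction hypothesis as an operator.
      \<open>L1\<close> and \<open>L2\<close> commute \<open>\<alpha>(i)\<close> with the creation
      and the annihilation half of \<open>nmode_osc\<close>; \<open>R\<close> expands the claimed
      right-hand side.\<close>
    define S where "S i s x = Sum_any (\<lambda>j. fscale (ch i j) (nmode p (heis p (int j) u) (s + i - int j) x))" for i s x
    obtain J where J: "\<And>j. j \<ge> J \<Longrightarrow> heis p (int j) u = 0" using heis_vanish by blast
    have Slin: "lin (S i s)" for i s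
    proof -
      have "S i s x = (\<Sum>j<J. fscale (ch i j) (nmode p (heis p (int j) u) (s + i - int j) x))" for x
        unfolding S_def by (rule Sum_any_lt) (simp add: J nmode_simps)
      then have "S i s = (\<lambda>x. \<Sum>j<J. fscale (ch i j) (nmode p (heis p (int j) u) (s + i - int j) x))" by (rule ext)
      then show ?thesis by (simp only:) (rule lin_sum_fun, rule lin_smult, rule nmode_lin)
    qed
    have Sfs: "fs (\<lambda>r. S i (s + int r) x)" for i s x
    proof -
      have "fs (\<lambda>r. Sum_any (\<lambda>j. fscale (ch i j) (nmode p (heis p (int j) u) (s + int r + i - int j) x)))"
      proof (rule fs2_fs(2), rule fs2_cols[of J])
        fix j show "fs (\<lambda>r. fscale (ch i j) (nmode p (heis p (int j) u) (s + int r + i - int j) x))"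
          by (rule nmode_fsI[of p "heis p (int j) u" "s + i - int j" x]) (simp add: algebra_simps)
      qed (simp add: J nmode_simps)
      then show ?thesis by (simp add: S_def)
    qed
    let ?U = "nmode p u"
    have fsc: "fs (\<lambda>r. fscale (bn n r) (heis p (- 1 - int n - int r) (nmode p w (m + int r) x)))" for w m x
      by (rule nmode_fsI[of p w m x]) simp
    have fsa: "fs (\<lambda>r. fscale (bn n r) (nmode p w (m - 1 - int n - int r) (heis p (int r) x)))" for w m x
      by (rule heis_fsI[of p x]) (simp add: nmode_simps)
    have L1: "heis p i (Sum_any (\<lambda>r. fscale (bn n r) (heis p (- 1 - int n - int r) (?U (m + int r) v)))) =
        Sum_any (\<lambda>r. fscale (bn n r) (heis p (- 1 - int n - int r) (?U (m + int r) (heis p i v))))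
      + Sum_any (\<lambda>r. fscale (bn n r) (heis p (- 1 - int n - int r) (S i (m + int r) v)))
      + (if i \<ge> 1 + int n then fscale (bn n (nat (i - (1 + int n))) * (2 * of_nat p * of_int i)) (?U (m + i - 1 - int n) v) else 0)"
    proof -
      have "heis p i (Sum_any (\<lambda>r. fscale (bn n r) (heis p (- 1 - int n - int r) (?U (m + int r) v)))) =
        Sum_any (\<lambda>r. (fscale (bn n r) (heis p (- 1 - int n - int r) (?U (m + int r) (heis p i v)))
      + fscale (bn n r) (heis p (- 1 - int n - int r) (S i (m + int r) v)))
      + (if i = 1 + int n + int r then fscale (bn n r * (2 * of_nat p * of_int i)) (?U (m + int r) v) else 0))"
        unfolding Sum_any_heis[OF fsc]
      proof (rule Sum_any.cong)
        fix r
        have "(i + (- 1 - int n - int r) = 0) = (i = 1 + int n + int r)" by linarith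
        then show "heis p i (fscale (bn n r) (heis p (- 1 - int n - int r) (?U (m + int r) v))) =
          fscale (bn n r) (heis p (- 1 - int n - int r) (?U (m + int r) (heis p i v)))
      + fscale (bn n r) (heis p (- 1 - int n - int r) (S i (m + int r) v))
      + (if i = 1 + int n + int r then fscale (bn n r * (2 * of_nat p * of_int i)) (?U (m + int r) v) else 0)"
          unfolding heis_scale heis_comm[of p i "- 1 - int n - int r"] IH[of i "m + int r" v] S_def[symmetric]
          by (auto simp: heis_add fock.scale_right_distrib)
      qed
      also have "\<dots> = Sum_any (\<lambda>r. fscale (bn n r) (heis p (- 1 - int n - int r) (?U (m + int r) (heis p i v))))
      + Sum_any (\<lambda>r. fscale (bn n r) (heis p (- 1 - int n - int r) (S i (m + int r) v)))
      + Sum_any (\<lambda>r. if i = (1 + int n) + int r then fscale (bn n r * (2 * of_nat p * of_int i)) (?U (m + int r) v) else 0)"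
      proof -
        have "fs (\<lambda>r. fscale (bn n r) (heis p (- 1 - int n - int r) (S i (m + int r) v)))"
          using Sfs[of i m v] unfolding fs_def by (metis heis_0 fock.scale_zero_right)
        moreover have "fs (\<lambda>r. if i = (1 + int n) + int r then fscale (bn n r * (2 * of_nat p * of_int i)) (?U (m + int r) v) else 0)"
          by (intro fs_if fs_fscale nmode_fs)
        ultimately show ?thesis by (simp add: Sum_any_add fsc fs_add)
      qed
      finally show ?thesis unfolding Sum_any_if_int by (auto simp: algebra_simps)
    qed
    have L2: "heis p i (Sum_any (\<lambda>r. fscale (bn n r) (?U (m - 1 - int n - int r) (heis p (int r) v)))) =
        Sum_any (\<lambda>r. fscale (bn n r) (?U (m - 1 - int n - int r) (heis p (int r) (heis p i v))))
      + Sum_any (\<lambda>r. fscale (bn n r) (S i (m - 1 - int n - int r) (heis p (int r) v)))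
      + (if i \<le> 0 then fscale (bn n (nat (- i)) * (2 * of_nat p * of_int i)) (?U (m + i - 1 - int n) v) else 0)"
    proof -
      have "heis p i (Sum_any (\<lambda>r. fscale (bn n r) (?U (m - 1 - int n - int r) (heis p (int r) v)))) =
        Sum_any (\<lambda>r. (fscale (bn n r) (?U (m - 1 - int n - int r) (heis p (int r) (heis p i v)))
      + fscale (bn n r) (S i (m - 1 - int n - int r) (heis p (int r) v)))
      + (if - i = 0 + int r then fscale (bn n r * (2 * of_nat p * of_int i)) (?U (m - 1 - int n - int r) v) else 0))"
        unfolding Sum_any_heis[OF fsa]
      proof (rule Sum_any.cong)
        fix r
        have "(i + int r = 0) = (- i = 0 + int r)" by linarith
        then show "heis p i (fscale (bn n r) (?U (m - 1 - int n - int r) (heis p (int r) v))) =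
          fscale (bn n r) (?U (m - 1 - int n - int r) (heis p (int r) (heis p i v)))
      + fscale (bn n r) (S i (m - 1 - int n - int r) (heis p (int r) v))
      + (if - i = 0 + int r then fscale (bn n r * (2 * of_nat p * of_int i)) (?U (m - 1 - int n - int r) v) else 0)"
          unfolding heis_scale IH[of i "m - 1 - int n - int r" "heis p (int r) v"] S_def[symmetric] heis_comm[of p i "int r" v]
          by (auto simp: nmode_simps fock.scale_right_distrib)
      qed
      also have "\<dots> = Sum_any (\<lambda>r. fscale (bn n r) (?U (m - 1 - int n - int r) (heis p (int r) (heis p i v))))
      + Sum_any (\<lambda>r. fscale (bn n r) (S i (m - 1 - int n - int r) (heis p (int r) v)))
      + Sum_any (\<lambda>r. if - i = 0 + int r then fscale (bn n r * (2 * of_nat p * of_int i)) (?U (m - 1 - int n - int r) v) else 0)"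
      proof -
        have "fs (\<lambda>r. fscale (bn n r) (S i (m - 1 - int n - int r) (heis p (int r) v)))"
          by (rule heis_fsI[of p v]) (simp add: lin_0[OF Slin])
        moreover have "fs (\<lambda>r. if - i = 0 + int r then fscale (bn n r * (2 * of_nat p * of_int i)) (?U (m - 1 - int n - int r) v) else 0)"
          by (rule fsI[of "nat (1 - i)"]) auto
        ultimately show ?thesis by (simp add: Sum_any_add fsa fs_add)
      qed
      finally show ?thesis unfolding Sum_any_if_int by (auto simp: algebra_simps)
    qed
    have R: "Sum_any (\<lambda>j. fscale (ch i j) (nmode p (heis p (int j) (osc n * u)) (m + i - int j) v)) =
        Sum_any (\<lambda>r. fscale (bn n r) (heis p (- 1 - int n - int r) (S i (m + int r) v)))
      + fscale ((- 1) ^ n) (Sum_any (\<lambda>r. fscale (bn n r) (S i (m - 1 - int n - int r) (heis p (int r) v))))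
      + fscale (ch i (n + 1) * (2 * of_nat p * of_nat (n + 1))) (?U (m + i - 1 - int n) v)"
    proof -
      have "Sum_any (\<lambda>j. fscale (ch i j) (nmode p (heis p (int j) (osc n * u)) (m + i - int j) v)) =
        Sum_any (\<lambda>j. fscale (ch i j) (nmode p (osc n * heis p (int j) u) (m + i - int j) v)
           + (if j = n + 1 then fscale (ch i (n + 1) * (2 * of_nat p * of_nat (n + 1))) (?U (m + i - 1 - int n) v) else 0))"
      proof (rule Sum_any.cong)
        fix j
        have "(int j = 1 + int n) = (j = n + 1)" by linarith
        then show "fscale (ch i j) (nmode p (heis p (int j) (osc n * u)) (m + i - int j) v) =
          fscale (ch i j) (nmode p (osc n * heis p (int j) u) (m + i - int j) v)
           + (if j = n + 1 then fscale (ch i (n + 1) * (2 * of_nat p * of_nat (n + 1))) (?U (m + i - 1 - int n) v) else 0)"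
          unfolding heis_comm_neg by (auto simp: nmode_simps fock.scale_right_distrib algebra_simps)
      qed
      also have "\<dots> = Sum_any (\<lambda>j. fscale (ch i j) (nmode p (osc n * heis p (int j) u) (m + i - int j) v))
          + fscale (ch i (n + 1) * (2 * of_nat p * of_nat (n + 1))) (?U (m + i - 1 - int n) v)"
      proof -
        have "fs (\<lambda>j. fscale (ch i j) (nmode p (osc n * heis p (int j) u) (m + i - int j) v))"
          by (rule fsI[of J]) (simp add: J nmode_simps)
        moreover have "fs (\<lambda>j. if j = n + 1 then fscale (ch i (n + 1) * (2 * of_nat p * of_nat (n + 1))) (?U (m + i - 1 - int n) v) else 0)"
          by (rule fsI[of "n + 2"]) simp
        ultimately show ?thesis by (simp only: Sum_any_add Sum_any.delta)
      qed
      also have "Sum_any (\<lambda>j. fscale (ch i j) (nmode p (osc n * heis p (int j) u) (m + i - int j) v)) =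
         Sum_any (\<lambda>j. Sum_any (\<lambda>r. fscale (ch i j) (fscale (bn n r) (heis p (- 1 - int n - int r) (nmode p (heis p (int j) u) (m + i - int j + int r) v))))
          + Sum_any (\<lambda>r. fscale ((- 1) ^ n) (fscale (ch i j) (fscale (bn n r) (nmode p (heis p (int j) u) (m + i - int j - 1 - int n - int r) (heis p (int r) v))))))"
        unfolding nmode_osc fock.scale_right_distrib fock.scale_left_commute[of "(- 1) ^ n" "ch i _"]
          Sum_any_fscale[OF fsc] Sum_any_fscale[OF fsa] Sum_any_fscale[OF fs_lin[OF lin_fscale fsa]] ..
      also have "\<dots> = Sum_any (\<lambda>j. Sum_any (\<lambda>r. fscale (ch i j) (fscale (bn n r) (heis p (- 1 - int n - int r) (nmode p (heis p (int j) u) (m + i - int j + int r) v)))))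
          + Sum_any (\<lambda>j. Sum_any (\<lambda>r. fscale ((- 1) ^ n) (fscale (ch i j) (fscale (bn n r) (nmode p (heis p (int j) u) (m + i - int j - 1 - int n - int r) (heis p (int r) v))))))"
        by (rule Sum_any_add; rule fsI[of J]) (simp_all add: J nmode_simps)
      also have "Sum_any (\<lambda>j. Sum_any (\<lambda>r. fscale (ch i j) (fscale (bn n r) (heis p (- 1 - int n - int r) (nmode p (heis p (int j) u) (m + i - int j + int r) v)))))
        = Sum_any (\<lambda>r. Sum_any (\<lambda>j. fscale (ch i j) (fscale (bn n r) (heis p (- 1 - int n - int r) (nmode p (heis p (int j) u) (m + i - int j + int r) v)))))"
        by (rule Sum_any_swap, rule fs2_rows[of J]) (simp add: J nmode_simps, rule fs_lin[OF lin_fscale fsc])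
      also have "\<dots> = Sum_any (\<lambda>r. fscale (bn n r) (heis p (- 1 - int n - int r) (S i (m + int r) v)))"
        unfolding S_def Sum_any_heis[OF fsS] Sum_any_fscale[OF fs_lin[OF heis_lin fsS]]
        by (intro Sum_any.cong) (simp add: heis_scale algebra_simps)
      also have "Sum_any (\<lambda>j. Sum_any (\<lambda>r. fscale ((- 1) ^ n) (fscale (ch i j) (fscale (bn n r) (nmode p (heis p (int j) u) (m + i - int j - 1 - int n - int r) (heis p (int r) v))))))
        = Sum_any (\<lambda>r. Sum_any (\<lambda>j. fscale ((- 1) ^ n) (fscale (ch i j) (fscale (bn n r) (nmode p (heis p (int j) u) (m + i - int j - 1 - int n - int r) (heis p (int r) v))))))"
        by (rule Sum_any_swap, rule fs2_rows[of J]) (simp add: J nmode_simps, rule fs_lin[OF lin_fscale fs_lin[OF lin_fscale fsa]])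
      also have "\<dots> = fscale ((- 1) ^ n) (Sum_any (\<lambda>r. fscale (bn n r) (S i (m - 1 - int n - int r) (heis p (int r) v))))"
      proof -
        have "fs (\<lambda>r. fscale (bn n r) (S i (m - 1 - int n - int r) (heis p (int r) v)))"
          by (rule heis_fsI[of p v]) (simp add: lin_0[OF Slin])
        then have "fscale ((- 1) ^ n) (Sum_any (\<lambda>r. fscale (bn n r) (S i (m - 1 - int n - int r) (heis p (int r) v)))) =
          Sum_any (\<lambda>r. fscale ((- 1) ^ n) (fscale (bn n r) (S i (m - 1 - int n - int r) (heis p (int r) v))))"
          by (rule Sum_any_fscale)
        also have "\<dots> = Sum_any (\<lambda>r. Sum_any (\<lambda>j. fscale ((- 1) ^ n) (fscale (ch i j) (fscale (bn n r) (nmode p (heis p (int j) u) (m + i - int j - 1 - int n - int r) (heis p (int r) v))))))"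
          unfolding S_def Sum_any_fscale[OF fsS] Sum_any_fscale[OF fs_lin[OF lin_fscale fsS]]
            Sum_any_fscale[OF fs_lin[OF lin_fscale fs_lin[OF lin_fscale fsS]]]
          by (intro Sum_any.cong) (simp add: algebra_simps)
        finally show ?thesis ..
      qed
      finally show ?thesis .
    qed
    \<comment> \<open>For \<open>i > n\<close> only the creation half contributes, for
      \<open>i \<le> 0\<close> only the annihilation half, and for \<open>0 < i \<le> n\<close>
      neither, where \<open>(i - 1) gchoose n\<close> vanishes as well. By absorption all cases give
      \<open>ch i (n + 1)\<close>.\<close>
    have key: "(if i \<ge> 1 + int n then bn n (nat (i - (1 + int n))) * (2 * of_nat p * of_int i) else 0)
       + (- 1) ^ n * (if i \<le> 0 then bn n (nat (- i)) * (2 * of_nat p * of_int i) else 0)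
       = ch i (n + 1) * (2 * of_nat p * of_nat (n + 1))"
    proof -
      have ab: "ch i (n + 1) * of_nat (n + 1) = of_int i * ((of_int i - 1) gchoose n)"
        using gbinomial_absorption[of n "of_int i :: complex"] by (simp add: mult.commute)
      consider "i \<ge> 1 + int n" | "i \<le> 0" | "0 < i" "i < 1 + int n" by linarith
      then have "(if i \<ge> 1 + int n then bn n (nat (i - (1 + int n))) else 0)
       + (- 1) ^ n * (if i \<le> 0 then bn n (nat (- i)) else 0) = ((of_int i - 1) gchoose n) \<or> i = 0"
      proof cases
        case 1
        then have "of_int i - 1 = (of_nat (nat (i - (1 + int n)) + n) :: complex)" by (simp add: of_nat_nat)
        then show ?thesis using 1 by (simp only: bn_def binomial_gbinomial) simp
      next
        case 2
        then have "of_int i - 1 = - (of_nat (nat (- i)) :: complex) - 1" by (simp add: of_nat_nat)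
        then show ?thesis using 2 by (simp only: gchoose_neg) simp
      next
        case 3
        then have e: "of_int i - 1 = (of_nat (nat (i - 1)) :: complex)" by (simp add: of_nat_nat)
        have "nat (i - 1) choose n = 0" using 3 by (simp add: nat_less_iff)
        then have "(of_int i - 1 :: complex) gchoose n = 0" unfolding e binomial_gbinomial[symmetric] by simp
        then show ?thesis using 3 by simp
      qed
      then have "((if i \<ge> 1 + int n then bn n (nat (i - (1 + int n))) else 0)
       + (- 1) ^ n * (if i \<le> 0 then bn n (nat (- i)) else 0)) * of_int i = ((of_int i - 1) gchoose n) * of_int i" by auto
      moreover have "ch i (n + 1) * (2 * of_nat p * of_nat (n + 1)) = 2 * of_nat p * (ch i (n + 1) * of_nat (n + 1))"
        by (simp only: mult_ac)
      ultimately show ?thesis unfolding ab by (auto split: if_splits simp: algebra_simps)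
    qed
    have cases: "fscale x w + fscale y (fscale z w) = fscale c w" if "x + y * z = c" for x y z c w
      using that by (simp flip: fock.scale_left_distrib)
    have fi: "(if P then fscale c w else 0) = fscale (if P then c else 0) w" for P c w by simp
    show ?case
      unfolding nmode_osc[of p n u m] heis_add heis_scale L1 L2 R fi
      using cases[OF key, of "?U (m + i - 1 - int n) v"]
      by (simp add: fock.scale_right_distrib algebra_simps del: of_nat_Suc of_nat_add)
  next
    case (add u w)
    have "fscale (ch i j) (nmode p (heis p (int j) (u + w)) (m + i - int j) v) =
      fscale (ch i j) (nmode p (heis p (int j) u) (m + i - int j) v) + fscale (ch i j) (nmode p (heis p (int j) w) (m + i - int j) v)" for j
      by (simp add: heis_add nmode_simps fock.scale_right_distrib)
    then show ?case using add by (simp add: heis_add nmode_simps Sum_any_add fsS)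
  next
    case (scale c u)
    have "fscale (ch i j) (nmode p (heis p (int j) (fscale c u)) (m + i - int j) v) =
      fscale c (fscale (ch i j) (nmode p (heis p (int j) u) (m + i - int j) v))" for j
      by (simp add: heis_scale nmode_simps mult.commute)
    then show ?case using scale
      by (simp add: heis_scale nmode_simps fock.scale_right_distrib Sum_any_fscale[OF fsS, symmetric] del: fock.scale_scale)
  qed
qed

section \<open>The Borcherds identity\<close>

text \<open>Multiplication of a doubly infinite series, truncated in its second variable, by \<open>(x + \<epsilon> y) ^ n\<close>.\<close>

definition PW :: "complex \<Rightarrow> int \<Rightarrow> (int \<Rightarrow> int \<Rightarrow> fock) \<Rightarrow> int \<Rightarrow> int \<Rightarrow> fock" where
  "PW e n G a b = Sum_any (\<lambda>j. fscale (e ^ j * ch n j) (G (a + n - int j) (b + int j)))"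

definition tr :: "(int \<Rightarrow> int \<Rightarrow> fock) \<Rightarrow> bool" where
  "tr G \<longleftrightarrow> (\<exists>K. \<forall>a b. b \<ge> K \<longrightarrow> G a b = 0)"

lemma trI: "(\<And>a b. b \<ge> K \<Longrightarrow> G a b = 0) \<Longrightarrow> tr G"
  by (auto simp: tr_def)

lemma PW_fs:
  assumes "tr G"
  shows "fs (\<lambda>j. fscale (c j) (G (a j) (b + int j)))"
proof -
  from assms obtain K where "\<forall>a b. b \<ge> K \<longrightarrow> G a b = 0" by (auto simp: tr_def)
  then show ?thesis by (intro fsI[of "nat (K - b)"]) auto
qed

lemma PW_bound: "(\<And>a b. b \<ge> K \<Longrightarrow> G a b = 0) \<Longrightarrow> b \<ge> K \<Longrightarrow> PW e n G a b = 0"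
  by (simp add: PW_def)

lemma tr_PW: "tr G \<Longrightarrow> tr (PW e n G)"
proof -
  assume "tr G"
  then obtain K where "\<And>a b. b \<ge> K \<Longrightarrow> G a b = 0" by (auto simp: tr_def)
  then show ?thesis by (intro trI[of K] PW_bound)
qed

text \<open>Powers of (x + e y) multiply by adding exponents, which is Vandermonde's convolution.
  Negative exponents are included; they occur when an oscillator is contracted.\<close>

lemma PW_PW:
  assumes "tr G"
  shows "PW e n (PW e n' G) = PW e (n + n') G"
proof (intro ext)
  fix a b
  from assms obtain K where K: "\<And>a b. b \<ge> K \<Longrightarrow> G a b = 0" by (auto simp: tr_def)
  let ?g = "\<lambda>i j. fscale (e ^ i * ch n i) (fscale (e ^ j * ch n' j) (G (a + n - int i + n' - int j) (b + int i + int j)))"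
  have "PW e n (PW e n' G) a b = Sum_any (\<lambda>i. Sum_any (?g i))"
    unfolding PW_def by (simp only: Sum_any_fscale[OF PW_fs[OF assms]])
  also have "\<dots> = Sum_any (\<lambda>s. \<Sum>i\<le>s. ?g i (s - i))"
  proof (rule Sum_any_triangle)
    show "fs2 ?g" unfolding fs2_def
      by (rule exI[of _ "nat (K - b)"]) (auto intro!: K)
  qed
  also have "\<dots> = PW e (n + n') G a b"
    unfolding PW_def
  proof (rule Sum_any.cong)
    fix s
    have "(\<Sum>i\<le>s. ?g i (s - i)) = (\<Sum>i\<le>s. fscale (e ^ s * (ch n i * ch n' (s - i))) (G (a + n + n' - int s) (b + int s)))"
    proof (rule sum.cong[OF refl])
      fix i assume "i \<in> {..s}"
      then show "?g i (s - i) = fscale (e ^ s * (ch n i * ch n' (s - i))) (G (a + n + n' - int s) (b + int s))"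
      proof -
        have "e ^ i * ch n i * (e ^ (s - i) * ch n' (s - i)) = (e ^ i * e ^ (s - i)) * (ch n i * ch n' (s - i))"
          by (simp only: mult_ac)
        also have "e ^ i * e ^ (s - i) = e ^ s" using \<open>i \<in> {..s}\<close> by (simp flip: power_add)
        finally have "e ^ i * ch n i * (e ^ (s - i) * ch n' (s - i)) = e ^ s * (ch n i * ch n' (s - i))" .
        moreover have "a + n - int i + n' - int (s - i) = a + n + n' - int s" "b + int i + int (s - i) = b + int s"
          using \<open>i \<in> {..s}\<close> by (auto simp: of_nat_diff)
        ultimately show ?thesis by (simp only: fock.scale_scale)
      qed
    qed
    also have "\<dots> = fscale (e ^ s * (\<Sum>i\<le>s. ch n i * ch n' (s - i))) (G (a + n + n' - int s) (b + int s))"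
      by (simp add: sum_distrib_left fock.scale_sum_left)
    also have "(\<Sum>i\<le>s. ch n i * ch n' (s - i)) = ch (n + n') s"
      using gbinomial_Vandermonde[of "of_int n :: complex" "of_int n'" s] by (simp add: atLeast0AtMost)
    finally show "(\<Sum>i\<le>s. ?g i (s - i)) = fscale (e ^ s * ch (n + n') s) (G (a + (n + n') - int s) (b + int s))"
      by (simp add: algebra_simps)
  qed
  finally show "PW e n (PW e n' G) a b = PW e (n + n') G a b" .
qed

lemma PW_Sum_any:
  assumes "\<And>i a b. b \<ge> K \<Longrightarrow> F i a b = 0" "\<And>a b. fs (\<lambda>i. F i a b)"
  shows "PW e n (\<lambda>a b. Sum_any (\<lambda>i. F i a b)) a b = Sum_any (\<lambda>i. PW e n (F i) a b)"
    and "fs (\<lambda>i. PW e n (F i) a b)"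
proof -
  have f2: "fs2 (\<lambda>j i. fscale (e ^ j * ch n j) (F i (a + n - int j) (b + int j)))"
  proof (rule fs2_rows[of "nat (K - b)"])
    fix i j assume "j \<ge> nat (K - b)"
    then have "F i (a + n - int j) (b + int j) = 0" by (intro assms(1)) simp
    then show "fscale (e ^ j * ch n j) (F i (a + n - int j) (b + int j)) = 0" by simp
  qed (rule fs_fscale, rule assms(2))
  show "PW e n (\<lambda>a b. Sum_any (\<lambda>i. F i a b)) a b = Sum_any (\<lambda>i. PW e n (F i) a b)"
    unfolding PW_def Sum_any_fscale[OF assms(2)] by (rule Sum_any_swap[OF f2])
  show "fs (\<lambda>i. PW e n (F i) a b)"
    unfolding PW_def by (rule fs2_fs(2), rule fs2_swap_iff[THEN iffD2, OF f2])
qed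

lemma PW_add:
  assumes "tr F" "tr G"
  shows "PW e n (\<lambda>a b. F a b + G a b) a b = PW e n F a b + PW e n G a b"
  unfolding PW_def fock.scale_right_distrib by (rule Sum_any_add[OF PW_fs[OF assms(1)] PW_fs[OF assms(2)]])

lemma PW_lin:
  assumes "tr G" "lin T"
  shows "PW e n (\<lambda>a b. T (G a b)) a b = T (PW e n G a b)"
  unfolding PW_def Sum_any_lin[OF assms(2) PW_fs[OF assms(1)]] lin_scale[OF assms(2)] ..

lemma PW_shift:
  "PW e n (\<lambda>a b. G (a + c) (b + d)) a b = PW e n G (a + c) (b + d)"
  unfolding PW_def by (rule Sum_any.cong) (simp add: algebra_simps)

definition sg :: "int \<Rightarrow> complex" where "sg n = (if even n then 1 else - 1)"

lemma sg_add: "sg (m + n) = sg m * sg n" by (auto simp: sg_def)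
lemma sg_diff: "sg (m - n) = sg m * sg n" by (auto simp: sg_def)
lemma sg_nat: "sg (int n) = (- 1) ^ n" by (auto simp: sg_def)
lemma sg_minus: "sg (- n) = sg n" by (auto simp: sg_def)
lemma sg_1: "sg 1 = - 1" by (auto simp: sg_def)

lemma bn_choose: "of_nat ((n + i + j) choose i) = (- 1) ^ i * ch (- int n - 1 - int j) i"
proof -
  have "(of_int (- int n - 1 - int j) :: complex) gchoose i = (- 1) ^ i * (of_nat (n + i + j) gchoose i)"
    unfolding gbinomial_negated_upper[of "of_int (- int n - 1 - int j)"] by (simp add: algebra_simps)
  moreover have "(- 1) ^ i * (- 1) ^ i = (1 :: complex)" by (simp flip: power_mult_distrib)
  ultimately show ?thesis unfolding binomial_gbinomial by (simp add: mult.assoc[symmetric])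
qed

lemma choose_add_fact: "of_nat ((a + b) choose b) = (fact (a + b) / (fact a * fact b) :: complex)"
  by (simp add: binomial_fact mult.commute)

lemma bn_fact: "bn n i = fact (n + i) / (fact n * fact i)"
  unfolding bn_def choose_add_fact by (simp add: add.commute mult.commute)

lemma ch_nat: "ch (int m) j = of_nat (m choose j)"
  by (simp add: binomial_gbinomial)

lemma choose3_fact: "of_nat ((n + i + j) choose i) = (fact (n + i + j) / (fact (n + j) * fact i) :: complex)"
  using choose_add_fact[of "n + j" i] by (simp add: add_ac)

text \<open>Both sides are, up to sign, the multinomial coefficient (n + i + j)! / (n! i! j!); so
  are those of \<open>bn_ch\<close>, \<open>bn_bn\<close> and \<open>bn_bn'\<close>, with their own
  indices. These identities match the coefficients that an added oscillator produces in the three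
  terms of the Borcherds identity.\<close>

lemma bn_swap: "bn n i * ch (- 1 - int n - int i) j = (- 1) ^ j * bn n j * ((- 1) ^ i * ch (- int n - 1 - int j) i)"
proof -
  have "bn n i * of_nat ((n + i + j) choose j) = bn n j * of_nat ((n + i + j) choose i)"
    unfolding bn_fact choose3_fact choose_add_fact by (simp add: field_simps)
  moreover have "of_nat ((n + i + j) choose i) = (- 1) ^ i * ch (- int n - 1 - int j) i" by (rule bn_choose)
  moreover have "of_nat ((n + i + j) choose j) = (- 1) ^ j * ch (- 1 - int n - int i) j"
  proof -
    have "- 1 - int n - int i = - int n - 1 - int i" "n + i + j = n + j + i" by simp_all
    then show ?thesis using bn_choose[of n j i] by (simp only:)
  qed
  ultimately have "bn n i * ((- 1) ^ j * ch (- 1 - int n - int i) j) = bn n j * ((- 1) ^ i * ch (- int n - 1 - int j) i)" by simp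
  then have "(- 1) ^ j * (bn n i * ((- 1) ^ j * ch (- 1 - int n - int i) j)) = (- 1) ^ j * (bn n j * ((- 1) ^ i * ch (- int n - 1 - int j) i))" by simp
  moreover have "(- 1) ^ j * (bn n i * ((- 1) ^ j * ch (- 1 - int n - int i) j)) = ((- 1) ^ j * (- 1) ^ j) * (bn n i * ch (- 1 - int n - int i) j)"
    by (simp only: mult_ac)
  moreover have "(- 1) ^ j * (- 1) ^ j = (1 :: complex)" by (simp flip: power_mult_distrib)
  ultimately show ?thesis by (simp only: mult_1 mult.assoc)
qed

lemma bn_eq: "bn n i = (- 1) ^ i * ch (- int n - 1) i"
  using bn_choose[of n i 0] choose_add_fact[of n i] by (simp add: bn_fact)

lemma bn_ch: "bn n (r + j) * ch (int (r + j)) j = bn n j * ((- 1) ^ r * ch (- int n - 1 - int j) r)"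
  unfolding bn_choose[symmetric] ch_nat bn_fact choose3_fact choose_add_fact by (simp add: field_simps)

lemma bn_bn: "bn n i * bn (n + i) i' = bn n (i + i') * ch (int (i + i')) i"
proof -
  have "of_nat ((i + i') choose i) = (fact (i + i') / (fact i' * fact i) :: complex)"
    using choose_add_fact[of i' i] by (simp add: add.commute)
  then show ?thesis unfolding ch_nat bn_fact by (simp add: field_simps)
qed

lemma bn_bn': "bn n i * bn (n + i) i' * (- 1) ^ (n + i) = (- 1) ^ n * bn n i' * ch (- int n - 1 - int i') i"
proof -
  have "bn n i * bn (n + i) i' = bn n i' * ((- 1) ^ i * ch (- int n - 1 - int i') i)"
    unfolding bn_choose[symmetric] bn_fact choose3_fact by (simp add: field_simps)
  moreover have "(- 1) ^ i * (- 1) ^ i = (1 :: complex)" by (simp flip: power_mult_distrib)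
  ultimately show ?thesis by (simp add: power_add algebra_simps)
qed

text \<open>The truncation bound is uniform in the summation index; this lets \<open>PW\<close> be
  applied term by term to a locally finite sum.\<close>

definition ufs :: "(nat \<Rightarrow> int \<Rightarrow> int \<Rightarrow> fock) \<Rightarrow> bool" where
  "ufs F \<longleftrightarrow> (\<exists>K. \<forall>i a b. b \<ge> K \<longrightarrow> F i a b = 0) \<and> (\<forall>a b. fs (\<lambda>i. F i a b))"

lemma ufsI: "(\<And>i a b. b \<ge> K \<Longrightarrow> F i a b = 0) \<Longrightarrow> (\<And>a b. fs (\<lambda>i. F i a b)) \<Longrightarrow> ufs F"
  unfolding ufs_def by blast

lemma ufs_finite:
  assumes "\<And>i a b. i \<ge> N \<Longrightarrow> F i a b = 0" "\<And>i. tr (F i)"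
  shows "ufs F"
proof -
  from assms(2) have "\<forall>i. \<exists>K. \<forall>a b. b \<ge> K \<longrightarrow> F i a b = 0" unfolding tr_def by blast
  then obtain K where K: "\<And>i a b. b \<ge> K i \<Longrightarrow> F i a b = 0" by metis
  show ?thesis
  proof (rule ufsI)
    fix i a b assume b: "b \<ge> Max (insert 0 (K ` {..<N}))"
    show "F i a b = 0"
    proof (cases "i < N")
      case True
      then have "K i \<le> Max (insert 0 (K ` {..<N}))" by simp
      from order.trans[OF this b] show ?thesis by (rule K)
    qed (simp add: assms)
  next
    fix a b show "fs (\<lambda>i. F i a b)" by (rule fsI[of N]) (rule assms(1))
  qed
qed

lemma ufs_tr: "ufs F \<Longrightarrow> tr (\<lambda>a b. Sum_any (\<lambda>i. F i a b))"
proof -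
  assume "ufs F"
  then obtain K where "\<And>i a b. b \<ge> K \<Longrightarrow> F i a b = 0" unfolding ufs_def by blast
  then show ?thesis by (intro trI[of K]) simp
qed

lemma ufs_PW:
  assumes "ufs F"
  shows "PW e n (\<lambda>a b. Sum_any (\<lambda>i. F i a b)) a b = Sum_any (\<lambda>i. PW e n (F i) a b)"
    and "fs (\<lambda>i. PW e n (F i) a b)"
proof -
  from assms obtain K where K: "\<And>i a b. b \<ge> K \<Longrightarrow> F i a b = 0" and f: "\<And>a b. fs (\<lambda>i. F i a b)"
    unfolding ufs_def by blast
  show "PW e n (\<lambda>a b. Sum_any (\<lambda>i. F i a b)) a b = Sum_any (\<lambda>i. PW e n (F i) a b)"
    by (rule PW_Sum_any(1)[OF K f])
  show "fs (\<lambda>i. PW e n (F i) a b)" by (rule PW_Sum_any(2)[OF K f])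
qed

lemma tr_lin: "tr G \<Longrightarrow> lin T \<Longrightarrow> tr (\<lambda>a b. T (G a b))"
  unfolding tr_def by (metis lin_0)

lemma tr_shift: "tr G \<Longrightarrow> tr (\<lambda>a b. G (a + c) (b + d))"
proof -
  assume "tr G"
  then obtain K where "\<And>a b. b \<ge> K \<Longrightarrow> G a b = 0" by (auto simp: tr_def)
  then show ?thesis by (intro trI[of "K - d"]) simp
qed

lemma PW_lin_shift:
  assumes "tr G" "lin T"
  shows "PW e n (\<lambda>a b. T (G (a + c) (b + d))) a b = T (PW e n G (a + c) (b + d))"
  using PW_lin[OF tr_shift[OF assms(1)] assms(2)] PW_shift by metis

lemma lin_fscale_heis: "lin (\<lambda>x. fscale c (heis p i x))"
  by (rule lin_smult, rule heis_lin)

lemma PW_three: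
  assumes "ufs F1" "ufs F2" "ufs F3"
  shows "PW e n (\<lambda>a b. Sum_any (\<lambda>i. F1 i a b) + fscale s (Sum_any (\<lambda>i. F2 i a b)) + fscale s (Sum_any (\<lambda>i. F3 i a b))) a b =
    Sum_any (\<lambda>i. PW e n (F1 i) a b) + fscale s (Sum_any (\<lambda>i. PW e n (F2 i) a b)) + fscale s (Sum_any (\<lambda>i. PW e n (F3 i) a b))"
proof -
  note t = ufs_tr[OF assms(1)] ufs_tr[OF assms(2)] ufs_tr[OF assms(3)]
  note t2 = tr_lin[OF t(2) lin_fscale, of s] and t3 = tr_lin[OF t(3) lin_fscale, of s]
  have t12: "tr (\<lambda>a b. Sum_any (\<lambda>i. F1 i a b) + fscale s (Sum_any (\<lambda>i. F2 i a b)))"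
  proof -
    obtain K1 K2 where "\<And>a b. b \<ge> K1 \<Longrightarrow> Sum_any (\<lambda>i. F1 i a b) = 0" "\<And>a b. b \<ge> K2 \<Longrightarrow> fscale s (Sum_any (\<lambda>i. F2 i a b)) = 0"
      using t(1) t2 unfolding tr_def by blast
    then show ?thesis by (intro trI[of "max K1 K2"]) simp
  qed
  show ?thesis
    unfolding PW_add[OF t12 t3] PW_add[OF t(1) t2] PW_lin[OF t(2) lin_fscale] PW_lin[OF t(3) lin_fscale]
      ufs_PW(1)[OF assms(1)] ufs_PW(1)[OF assms(2)] ufs_PW(1)[OF assms(3)] ..
qed

section \<open>The three terms of the Borcherds identity\<close>

definition fA where "fA p u v w m k = nmode p u m (nmode p v k w)"
definition fB where "fB p u v w k m = nmode p v k (nmode p u m w)"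
definition fC where "fC p u v w k l = nmode p (nmode p u l v) k w"

text \<open>In generating series, \<open>TA\<close> and \<open>TB\<close> multiply the two products
  of fields by (x - y)^l, expanded for large x and for large y respectively, and \<open>TC\<close>
  multiplies Y(Y(u, z) v, y) by (y + z)^m. So \<open>borch\<close> is the full Jacobi identity in
  modes.\<close>

definition TA where "TA p u v w m l k = PW (- 1) l (fA p u v w) m k"
definition TB where "TB p u v w m l k = fscale (sg l) (PW (- 1) l (fB p u v w) k m)"
definition TC where "TC p u v w m l k = PW 1 m (fC p u v w) k l"

definition borch where
  "borch p u v w \<longleftrightarrow> (\<forall>m l k. TC p u v w m l k = TA p u v w m l k - TB p u v w m l k)"

lemma tr_fA: "tr (fA p u v w)"
proof -
  obtain K where "\<forall>k\<ge>K. nmode p v k w = 0" using nmode_trunc by blast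
  then show ?thesis by (intro trI[of K]) (simp add: fA_def nmode_simps)
qed

lemma tr_fB: "tr (fB p u v w)"
proof -
  obtain K where "\<forall>k\<ge>K. nmode p u k w = 0" using nmode_trunc by blast
  then show ?thesis by (intro trI[of K]) (simp add: fB_def nmode_simps)
qed

lemma tr_fC: "tr (fC p u v w)"
proof -
  obtain K where "\<forall>k\<ge>K. nmode p u k v = 0" using nmode_trunc by blast
  then show ?thesis by (intro trI[of K]) (simp add: fC_def nmode_simps)
qed

lemma f_0: "fA p u v 0 = (\<lambda>_ _. 0)" "fA p u 0 w = (\<lambda>_ _. 0)" "fB p u v 0 = (\<lambda>_ _. 0)" "fB p u 0 w = (\<lambda>_ _. 0)"
  "fC p u v 0 = (\<lambda>_ _. 0)" "fC p u 0 w = (\<lambda>_ _. 0)"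
  by (auto simp: fun_eq_iff fA_def fB_def fC_def nmode_simps)

lemma PW_0: "PW e n (\<lambda>_ _. 0) a b = 0" by (simp add: PW_def)

lemma T_0: "TA p u v 0 m l k = 0" "TA p u 0 w m l k = 0" "TB p u v 0 m l k = 0" "TB p u 0 w m l k = 0"
  "TC p u v 0 m l k = 0" "TC p u 0 w m l k = 0"
  by (simp_all add: TA_def TB_def TC_def f_0 PW_0)

text \<open>An oscillator in front of \<open>u\<close> ends up in one of three places: outermost on
  the left, on \<open>w\<close>, or contracted with \<open>v\<close>. The contraction contributes (x
  - y)^(-n-1-j). The other order of the fields and the iterate have the same three kinds of terms,
  so that the identity can be inherited.\<close>

lemma fA_osc:
  assumes p: "p > 0"
  shows "fA p (osc n * u) v w m k =
     Sum_any (\<lambda>i. fscale (bn n i) (heis p (- 1 - int n - int i) (fA p u v w (m + int i) k)))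
   + fscale ((- 1) ^ n) (Sum_any (\<lambda>i. fscale (bn n i) (fA p u v (heis p (int i) w) (m - 1 - int n - int i) k)))
   + fscale ((- 1) ^ n) (Sum_any (\<lambda>j. fscale (bn n j) (PW (- 1) (- int n - 1 - int j) (fA p u (heis p (int j) v) w) m k)))"
proof -
  obtain J where J: "\<And>j. j \<ge> J \<Longrightarrow> heis p (int j) v = 0" using heis_vanish by blast
  define g where "g i j = fscale (bn n i) (fscale (ch (int i) j) (nmode p u (m - 1 - int n - int i) (nmode p (heis p (int j) v) (k + int i - int j) w)))" for i j
  have g2: "fs2 g"
  proof (rule fs2_cols[of J])
    fix j show "fs (\<lambda>i. g i j)"
      by (rule nmode_fsI[of p "heis p (int j) v" "k - int j" w]) (simp add: g_def nmode_simps algebra_simps)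
  qed (simp add: g_def J nmode_simps)
  have inner: "fs (\<lambda>j. fscale (ch (int i) j) (nmode p (heis p (int j) v) (k + int i - int j) w))" for i
    by (rule fs_fscale, rule heis_heis_fs)
  have f1: "fs (\<lambda>i. fscale (bn n i) (nmode p u (m - 1 - int n - int i) (nmode p v k (heis p (int i) w))))"
    by (rule heis_fsI[of p w]) (simp add: nmode_simps)
  have "Sum_any (\<lambda>i. fscale (bn n i) (nmode p u (m - 1 - int n - int i) (heis p (int i) (nmode p v k w)))) =
    Sum_any (\<lambda>i. fscale (bn n i) (nmode p u (m - 1 - int n - int i) (nmode p v k (heis p (int i) w))) + Sum_any (g i))"
    unfolding heis_nmode[OF p, of "int _" v] lin_add[OF nmode_lin] Sum_any_lin[OF nmode_lin inner] fock.scale_right_distrib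
      Sum_any_fscale[OF fs_lin[OF nmode_lin inner, unfolded lin_scale[OF nmode_lin]]] g_def lin_scale[OF nmode_lin] ..
  also have "\<dots> = Sum_any (\<lambda>i. fscale (bn n i) (nmode p u (m - 1 - int n - int i) (nmode p v k (heis p (int i) w)))) + Sum_any (\<lambda>i. Sum_any (g i))"
    by (rule Sum_any_add[OF f1 fs2_fs(2)[OF g2]])
  also have "Sum_any (\<lambda>i. Sum_any (g i)) = Sum_any (\<lambda>j. Sum_any (\<lambda>i. g i j))" by (rule Sum_any_swap[OF g2])
  also have "\<dots> = Sum_any (\<lambda>j. fscale (bn n j) (PW (- 1) (- int n - 1 - int j) (fA p u (heis p (int j) v) w) m k))"
  proof (rule Sum_any.cong)
    fix j
    have "Sum_any (\<lambda>i. g i j) = Sum_any (\<lambda>r. g (r + j) j)"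
      by (rule Sum_any_shift) (simp add: g_def binomial_gbinomial[symmetric])
    also have "\<dots> = Sum_any (\<lambda>r. fscale (bn n j) (fscale ((- 1) ^ r * ch (- int n - 1 - int j) r) (fA p u (heis p (int j) v) w (m + (- int n - 1 - int j) - int r) (k + int r))))"
    proof (rule Sum_any.cong)
      fix r
      have "m - 1 - int n - int (r + j) = m + (- int n - 1 - int j) - int r" "k + int (r + j) - int j = k + int r" by simp_all
      then show "g (r + j) j = fscale (bn n j) (fscale ((- 1) ^ r * ch (- int n - 1 - int j) r) (fA p u (heis p (int j) v) w (m + (- int n - 1 - int j) - int r) (k + int r)))"
        unfolding g_def fA_def fock.scale_scale bn_ch by (simp only:)
    qed
    also have "\<dots> = fscale (bn n j) (PW (- 1) (- int n - 1 - int j) (fA p u (heis p (int j) v) w) m k)"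
      unfolding PW_def by (rule Sum_any_fscale[symmetric], rule PW_fs[OF tr_fA])
    finally show "Sum_any (\<lambda>i. g i j) = fscale (bn n j) (PW (- 1) (- int n - 1 - int j) (fA p u (heis p (int j) v) w) m k)" .
  qed
  finally show ?thesis
    unfolding fA_def[of _ "osc n * u"] nmode_osc[of p n u m] by (simp add: fA_def fock.scale_right_distrib add.assoc)
qed

lemma fB_osc:
  assumes p: "p > 0"
  shows "fB p (osc n * u) v w k m =
     Sum_any (\<lambda>i. fscale (bn n i) (heis p (- 1 - int n - int i) (fB p u v w k (m + int i))))
   + fscale ((- 1) ^ n) (Sum_any (\<lambda>i. fscale (bn n i) (fB p u v (heis p (int i) w) k (m - 1 - int n - int i))))
   + fscale ((- 1) ^ n) (Sum_any (\<lambda>j. fscale (bn n j) (fscale (sg (- int n - 1 - int j)) (PW (- 1) (- int n - 1 - int j) (fB p u (heis p (int j) v) w) k m))))"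
proof -
  obtain J where J: "\<And>j. j \<ge> J \<Longrightarrow> heis p (int j) v = 0" using heis_vanish by blast
  define g where "g i j = fscale (bn n i) (fscale (ch (- 1 - int n - int i) j) (nmode p (heis p (int j) v) (k + (- 1 - int n - int i) - int j) (nmode p u (m + int i) w)))" for i j
  have g2: "fs2 g"
  proof (rule fs2_cols[of J])
    fix j show "fs (\<lambda>i. g i j)"
      by (rule nmode_fsI[of p u m w]) (simp add: g_def nmode_simps)
  qed (simp add: g_def J nmode_simps)
  have inner: "fs (\<lambda>j. fscale (ch (- 1 - int n - int i) j) (nmode p (heis p (int j) v) (k + (- 1 - int n - int i) - int j) (nmode p u (m + int i) w)))" for i
    by (rule fs_fscale, rule heis_heis_fs)
  have f1: "fs (\<lambda>i. fscale (bn n i) (heis p (- 1 - int n - int i) (nmode p u (m + int i) w)))"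
    by (rule nmode_fsI[of p u m w]) simp
  have f2: "fs (\<lambda>i. fscale (bn n i) (nmode p u (m - 1 - int n - int i) (heis p (int i) w)))"
    by (rule heis_fsI[of p w]) (simp add: nmode_simps)
  have f3: "fs (\<lambda>i. fscale (bn n i) (heis p (- 1 - int n - int i) (fB p u v w k (m + int i))))"
    by (rule nmode_fsI[of p u m w]) (simp add: fB_def nmode_simps)
  have "nmode p v k (Sum_any (\<lambda>i. fscale (bn n i) (heis p (- 1 - int n - int i) (nmode p u (m + int i) w))))
     = Sum_any (\<lambda>i. fscale (bn n i) (heis p (- 1 - int n - int i) (fB p u v w k (m + int i))) - Sum_any (g i))"
    unfolding Sum_any_lin[OF nmode_lin f1]
  proof (rule Sum_any.cong)
    fix i
    show "nmode p v k (fscale (bn n i) (heis p (- 1 - int n - int i) (nmode p u (m + int i) w))) =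
      fscale (bn n i) (heis p (- 1 - int n - int i) (fB p u v w k (m + int i))) - Sum_any (g i)"
      using heis_nmode[OF p, of "- 1 - int n - int i" v k "nmode p u (m + int i) w"]
      unfolding fB_def g_def Sum_any_fscale[OF inner, symmetric] lin_scale[OF nmode_lin] by (simp add: fock.scale_right_distrib)
  qed
  also have "\<dots> = Sum_any (\<lambda>i. fscale (bn n i) (heis p (- 1 - int n - int i) (fB p u v w k (m + int i)))) - Sum_any (\<lambda>i. Sum_any (g i))"
    by (rule Sum_any_diff[OF f3 fs2_fs(2)[OF g2]])
  also have "Sum_any (\<lambda>i. Sum_any (g i)) = Sum_any (\<lambda>j. Sum_any (\<lambda>i. g i j))" by (rule Sum_any_swap[OF g2])
  also have "\<dots> = Sum_any (\<lambda>j. fscale (- ((- 1) ^ n)) (fscale (bn n j) (fscale (sg (- int n - 1 - int j)) (PW (- 1) (- int n - 1 - int j) (fB p u (heis p (int j) v) w) k m))))"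
  proof (rule Sum_any.cong)
    fix j
    have "Sum_any (\<lambda>i. g i j) = Sum_any (\<lambda>r. fscale ((- 1) ^ j * bn n j) (fscale ((- 1) ^ r * ch (- int n - 1 - int j) r) (fB p u (heis p (int j) v) w (k + (- int n - 1 - int j) - int r) (m + int r))))"
    proof (rule Sum_any.cong)
      fix r
      have "k + (- 1 - int n - int r) - int j = k + (- int n - 1 - int j) - int r" by simp
      then show "g r j = fscale ((- 1) ^ j * bn n j) (fscale ((- 1) ^ r * ch (- int n - 1 - int j) r) (fB p u (heis p (int j) v) w (k + (- int n - 1 - int j) - int r) (m + int r)))"
        unfolding g_def fB_def fock.scale_scale bn_swap by (simp only:)
    qed
    also have "\<dots> = fscale ((- 1) ^ j * bn n j) (PW (- 1) (- int n - 1 - int j) (fB p u (heis p (int j) v) w) k m)"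
      unfolding PW_def by (rule Sum_any_fscale[symmetric], rule PW_fs[OF tr_fB])
    also have "(- 1) ^ j * bn n j = - ((- 1) ^ n) * (bn n j * sg (- int n - 1 - int j))"
    proof -
      have "sg (- int n - 1 - int j) = - ((- 1) ^ n * (- 1) ^ j)" by (simp add: sg_diff sg_minus sg_nat sg_1)
      moreover have "(- 1) ^ n * (- 1) ^ n = (1 :: complex)" by (simp flip: power_mult_distrib)
      ultimately show ?thesis by (simp add: algebra_simps)
    qed
    finally show "Sum_any (\<lambda>i. g i j) = fscale (- ((- 1) ^ n)) (fscale (bn n j) (fscale (sg (- int n - 1 - int j)) (PW (- 1) (- int n - 1 - int j) (fB p u (heis p (int j) v) w) k m)))"
      by (simp only: fock.scale_scale)
  qed
  also have "\<dots> = fscale (- ((- 1) ^ n)) (Sum_any (\<lambda>j. fscale (bn n j) (fscale (sg (- int n - 1 - int j)) (PW (- 1) (- int n - 1 - int j) (fB p u (heis p (int j) v) w) k m))))"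
    by (rule Sum_any_fscale[symmetric], rule fsI[of J]) (simp add: J f_0 PW_0)
  finally have 1: "nmode p v k (Sum_any (\<lambda>i. fscale (bn n i) (heis p (- 1 - int n - int i) (nmode p u (m + int i) w)))) =
    Sum_any (\<lambda>i. fscale (bn n i) (heis p (- 1 - int n - int i) (fB p u v w k (m + int i))))
    + fscale ((- 1) ^ n) (Sum_any (\<lambda>j. fscale (bn n j) (fscale (sg (- int n - 1 - int j)) (PW (- 1) (- int n - 1 - int j) (fB p u (heis p (int j) v) w) k m))))"
    by simp
  have 2: "nmode p v k (Sum_any (\<lambda>i. fscale (bn n i) (nmode p u (m - 1 - int n - int i) (heis p (int i) w)))) =
    Sum_any (\<lambda>i. fscale (bn n i) (fB p u v (heis p (int i) w) k (m - 1 - int n - int i)))"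
    unfolding Sum_any_lin[OF nmode_lin f2] lin_scale[OF nmode_lin] fB_def ..
  show ?thesis
    unfolding fB_def[of _ "osc n * u"] nmode_osc[of p n u m] lin_add[OF nmode_lin] lin_scale[OF nmode_lin] 1 2
    by (simp only: add_ac)
qed

text \<open>The exponent grows with \<open>r\<close>, and with it the first index. Finiteness in
  \<open>r\<close> therefore comes from truncation in the first index at each fixed second index,
  while \<open>tr\<close> limits the second one.\<close>

lemma fs_PW_nat: "tr G \<Longrightarrow> (\<And>b. \<exists>A. \<forall>a\<ge>A. G a b = 0) \<Longrightarrow> fs (\<lambda>r. PW e (int r + c) G a b)"
proof -
  assume "tr G" and "\<And>b. \<exists>A. \<forall>a\<ge>A. G a b = 0"
  then obtain A where A: "\<And>a b. a \<ge> A b \<Longrightarrow> G a b = 0" by metis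
  from \<open>tr G\<close> obtain K where K: "\<And>a b. b \<ge> K \<Longrightarrow> G a b = 0" by (auto simp: tr_def)
  have "fs (\<lambda>r. Sum_any (\<lambda>j. fscale (e ^ j * ch (int r + c) j) (G (a + (int r + c) - int j) (b + int j))))"
  proof (rule fs2_fs(2), rule fs2_cols[of "nat (K - b)"])
    fix i j assume "j \<ge> nat (K - b)"
    then show "fscale (e ^ j * ch (int i + c) j) (G (a + (int i + c) - int j) (b + int j)) = 0"
      using K[of "b + int j"] by simp
  next
    fix j show "fs (\<lambda>i. fscale (e ^ j * ch (int i + c) j) (G (a + (int i + c) - int j) (b + int j)))"
      by (rule fsI[of "nat (A (b + int j) - a - c + int j)"]) (simp add: A)
  qed
  then show ?thesis by (simp add: PW_def)
qed

lemma fC_osc: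
  assumes p: "p > 0"
  shows "fC p (osc n * u) v w k l =
     Sum_any (\<lambda>i. fscale (bn n i) (heis p (- 1 - int n - int i) (PW 1 (int i) (fC p u v w) k l)))
   + fscale ((- 1) ^ n) (Sum_any (\<lambda>i. fscale (bn n i) (PW 1 (- 1 - int n - int i) (fC p u v (heis p (int i) w)) k l)))
   + fscale ((- 1) ^ n) (Sum_any (\<lambda>j. fscale (bn n j) (fC p u (heis p (int j) v) w k (l - 1 - int n - int j))))"
proof -
  obtain I where I: "\<And>i. i \<ge> I \<Longrightarrow> nmode p u (l + int i) v = 0" using nmode_fs[of p u l v] unfolding fs_def by blast
  have f1: "fs (\<lambda>i. fscale (bn n i) (heis p (- 1 - int n - int i) (nmode p u (l + int i) v)))"
    by (rule nmode_fsI[of p u l v]) simp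
  have f2: "fs (\<lambda>i. fscale (bn n i) (nmode p u (l - 1 - int n - int i) (heis p (int i) v)))"
    by (rule heis_fsI[of p v]) (simp add: nmode_simps)
  define g where "g i i' = fscale (bn n i) (fscale (bn (n + i) i') (heis p (- 1 - int (n + i) - int i') (fC p u v w (k + int i') (l + int i))))" for i i'
  define h where "h i i' = fscale (bn n i) (fscale ((- 1) ^ (n + i)) (fscale (bn (n + i) i') (fC p u v (heis p (int i') w) (k - 1 - int (n + i) - int i') (l + int i))))" for i i'
  have g2: "fs2 g"
  proof (rule fs2_rows[of I])
    fix i show "fs (g i)"
      unfolding g_def fC_def by (rule nmode_fsI[of p "nmode p u (l + int i) v" k w]) simp
  qed (simp add: g_def fC_def I nmode_simps)
  have h2: "fs2 h"
  proof (rule fs2_rows[of I])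
    fix i show "fs (h i)"
      unfolding h_def fC_def by (rule heis_fsI[of p w]) (simp add: nmode_simps)
  qed (simp add: h_def fC_def I nmode_simps)
  have "nmode p (Sum_any (\<lambda>i. fscale (bn n i) (heis p (- 1 - int n - int i) (nmode p u (l + int i) v)))) k w =
    Sum_any (\<lambda>i. Sum_any (g i) + Sum_any (h i))"
    unfolding Sum_any_lin[OF vop_lin_left f1]
  proof (rule Sum_any.cong)
    fix i
    have "- 1 - int n - int i = - 1 - int (n + i)" by simp
    then have e: "heis p (- 1 - int n - int i) (nmode p u (l + int i) v) = osc (n + i) * nmode p u (l + int i) v"
      by (simp only: osc_heis[of _ _ p])
    have s1: "fs (\<lambda>i'. fscale (bn (n + i) i') (heis p (- 1 - int (n + i) - int i') (nmode p (nmode p u (l + int i) v) (k + int i') w)))"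
      by (rule nmode_fsI[of p "nmode p u (l + int i) v" k w]) simp
    have s2: "fs (\<lambda>i'. fscale (bn (n + i) i') (nmode p (nmode p u (l + int i) v) (k - 1 - int (n + i) - int i') (heis p (int i') w)))"
      by (rule heis_fsI[of p w]) (simp add: nmode_simps)
    show "nmode p (fscale (bn n i) (heis p (- 1 - int n - int i) (nmode p u (l + int i) v))) k w = Sum_any (g i) + Sum_any (h i)"
      unfolding e lin_scale[OF vop_lin_left] nmode_osc[of p "n + i"] fock.scale_right_distrib g_def h_def fC_def
        Sum_any_fscale[OF s1] Sum_any_fscale[OF s2] Sum_any_fscale[OF fs_lin[OF lin_fscale s2]] ..
  qed
  also have "\<dots> = Sum_any (\<lambda>i. Sum_any (g i)) + Sum_any (\<lambda>i. Sum_any (h i))"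
    by (rule Sum_any_add[OF fs2_fs(2)[OF g2] fs2_fs(2)[OF h2]])
  also have "Sum_any (\<lambda>i. Sum_any (g i)) = Sum_any (\<lambda>r. \<Sum>i\<le>r. g i (r - i))" by (rule Sum_any_triangle[OF g2])
  also have "\<dots> = Sum_any (\<lambda>i. fscale (bn n i) (heis p (- 1 - int n - int i) (PW 1 (int i) (fC p u v w) k l)))"
  proof (rule Sum_any.cong)
    fix r
    have "PW 1 (int r) (fC p u v w) k l = (\<Sum>i\<le>r. fscale (1 ^ i * ch (int r) i) (fC p u v w (k + int r - int i) (l + int i)))"
      unfolding PW_def by (rule Sum_any_le) (simp add: binomial_gbinomial[symmetric])
    moreover have "(\<Sum>i\<le>r. g i (r - i)) = (\<Sum>i\<le>r. fscale (bn n r) (heis p (- 1 - int n - int r) (fscale (1 ^ i * ch (int r) i) (fC p u v w (k + int r - int i) (l + int i)))))"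
    proof (rule sum.cong[OF refl])
      fix i assume "i \<in> {..r}"
      then have i: "- 1 - int (n + i) - int (r - i) = - 1 - int n - int r" "k + int (r - i) = k + int r - int i" "i + (r - i) = r"
        by (auto simp: of_nat_diff)
      show "g i (r - i) = fscale (bn n r) (heis p (- 1 - int n - int r) (fscale (1 ^ i * ch (int r) i) (fC p u v w (k + int r - int i) (l + int i))))"
        unfolding g_def fock.scale_scale bn_bn i heis_scale by simp
    qed
    ultimately show "(\<Sum>i\<le>r. g i (r - i)) = fscale (bn n r) (heis p (- 1 - int n - int r) (PW 1 (int r) (fC p u v w) k l))"
      by (simp only: heis_sum fock.scale_sum_right)
  qed
  also have "Sum_any (\<lambda>i. Sum_any (h i)) = Sum_any (\<lambda>i'. Sum_any (\<lambda>i. h i i'))" by (rule Sum_any_swap[OF h2])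
  also have "\<dots> = Sum_any (\<lambda>i. fscale ((- 1) ^ n) (fscale (bn n i) (PW 1 (- 1 - int n - int i) (fC p u v (heis p (int i) w)) k l)))"
  proof (rule Sum_any.cong)
    fix i'
    have "Sum_any (\<lambda>i. h i i') = Sum_any (\<lambda>i. fscale ((- 1) ^ n * bn n i') (fscale (1 ^ i * ch (- 1 - int n - int i') i) (fC p u v (heis p (int i') w) (k + (- 1 - int n - int i') - int i) (l + int i))))"
    proof (rule Sum_any.cong)
      fix i
      have e: "k - 1 - int (n + i) - int i' = k + (- 1 - int n - int i') - int i" "- int n - 1 - int i' = - 1 - int n - int i'" by simp_all
      have "bn n i * ((- 1) ^ (n + i) * bn (n + i) i') = (- 1) ^ n * bn n i' * (1 ^ i * ch (- 1 - int n - int i') i)"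
        using bn_bn'[of n i i'] unfolding e by (simp add: mult_ac)
      then show "h i i' = fscale ((- 1) ^ n * bn n i') (fscale (1 ^ i * ch (- 1 - int n - int i') i) (fC p u v (heis p (int i') w) (k + (- 1 - int n - int i') - int i) (l + int i)))"
        unfolding h_def e(1) fock.scale_scale by (simp only: mult.assoc)
    qed
    also have "\<dots> = fscale ((- 1) ^ n * bn n i') (PW 1 (- 1 - int n - int i') (fC p u v (heis p (int i') w)) k l)"
      unfolding PW_def by (rule Sum_any_fscale[symmetric], rule PW_fs[OF tr_fC])
    finally show "Sum_any (\<lambda>i. h i i') = fscale ((- 1) ^ n) (fscale (bn n i') (PW 1 (- 1 - int n - int i') (fC p u v (heis p (int i') w)) k l))"
      by (simp only: fock.scale_scale)
  qed
  also have "\<dots> = fscale ((- 1) ^ n) (Sum_any (\<lambda>i. fscale (bn n i) (PW 1 (- 1 - int n - int i) (fC p u v (heis p (int i) w)) k l)))"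
    by (rule Sum_any_fscale[symmetric], rule heis_fsI[of p w]) (simp add: f_0 PW_0)
  finally have 1: "nmode p (Sum_any (\<lambda>i. fscale (bn n i) (heis p (- 1 - int n - int i) (nmode p u (l + int i) v)))) k w =
    Sum_any (\<lambda>i. fscale (bn n i) (heis p (- 1 - int n - int i) (PW 1 (int i) (fC p u v w) k l)))
    + fscale ((- 1) ^ n) (Sum_any (\<lambda>i. fscale (bn n i) (PW 1 (- 1 - int n - int i) (fC p u v (heis p (int i) w)) k l)))" .
  have 2: "nmode p (Sum_any (\<lambda>i. fscale (bn n i) (nmode p u (l - 1 - int n - int i) (heis p (int i) v)))) k w =
    Sum_any (\<lambda>j. fscale (bn n j) (fC p u (heis p (int j) v) w k (l - 1 - int n - int j)))"
    unfolding Sum_any_lin[OF vop_lin_left f2] lin_scale[OF vop_lin_left] fC_def ..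
  show ?thesis
    unfolding fC_def[of _ "osc n * u"] nmode_osc[of p n u l] lin_add[OF vop_lin_left] lin_scale[OF vop_lin_left] 1 2 ..
qed

lemma PW_lin_sh1: "tr G \<Longrightarrow> lin T \<Longrightarrow> PW e n (\<lambda>a b. T (G (a + c) b)) a b = T (PW e n G (a + c) b)"
  using PW_lin_shift[of G T e n c 0 a b] by simp

lemma PW_lin_sh2: "tr G \<Longrightarrow> lin T \<Longrightarrow> PW e n (\<lambda>a b. T (G a (b + d))) a b = T (PW e n G a (b + d))"
  using PW_lin_shift[of G T e n 0 d a b] by simp

lemma PW_lin_sh1': "tr G \<Longrightarrow> lin T \<Longrightarrow> PW e n (\<lambda>a b. T (G (a - x - y - z) b)) a b = T (PW e n G (a - x - y - z) b)"
  using PW_lin_shift[of G T e n "- x - y - z" 0 a b] by (simp add: algebra_simps)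

lemma PW_lin_sh2': "tr G \<Longrightarrow> lin T \<Longrightarrow> PW e n (\<lambda>a b. T (G a (b - x - y - z))) a b = T (PW e n G a (b - x - y - z))"
  using PW_lin_shift[of G T e n 0 "- x - y - z" a b] by (simp add: algebra_simps)

lemma tr_sh1: "tr G \<Longrightarrow> tr (\<lambda>a b. G (a + c) b)"
  using tr_shift[of G c 0] by simp

lemma tr_sh2: "tr G \<Longrightarrow> tr (\<lambda>a b. G a (b + d))"
  using tr_shift[of G 0 d] by simp

lemma tr_sh1': "tr G \<Longrightarrow> tr (\<lambda>a b. G (a - x - y - z) b)"
  using tr_shift[of G "- x - y - z" 0] by (simp add: algebra_simps)

lemma tr_sh2': "tr G \<Longrightarrow> tr (\<lambda>a b. G a (b - x - y - z))"
  using tr_shift[of G 0 "- x - y - z"] by (simp add: algebra_simps)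

text \<open>The contraction lowers \<open>l\<close>, because powers of (x - y) add up by
  \<open>PW_PW\<close>. Finiteness of the first sum is recorded too, since
  \<open>borch_osc_left\<close> subtracts such sums term by term.\<close>

lemma TA_osc:
  assumes p: "p > 0"
  shows "TA p (osc n * u) v w m l k =
     Sum_any (\<lambda>i. fscale (bn n i) (heis p (- 1 - int n - int i) (TA p u v w (m + int i) l k)))
   + fscale ((- 1) ^ n) (Sum_any (\<lambda>i. fscale (bn n i) (TA p u v (heis p (int i) w) (m - 1 - int n - int i) l k)))
   + fscale ((- 1) ^ n) (Sum_any (\<lambda>j. fscale (bn n j) (TA p u (heis p (int j) v) w m (l - 1 - int n - int j) k)))" (is ?eq)
   and "fs (\<lambda>i. fscale (bn n i) (heis p (- 1 - int n - int i) (TA p u v w (m + int i) l k)))" (is ?fs)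
proof -
  obtain K where K: "\<And>k. k \<ge> K \<Longrightarrow> nmode p v k w = 0" using nmode_trunc by blast
  obtain I where I: "\<And>i. i \<ge> I \<Longrightarrow> heis p (int i) w = 0" using heis_vanish by blast
  obtain J where J: "\<And>i. i \<ge> J \<Longrightarrow> heis p (int i) v = 0" using heis_vanish by blast
  let ?F1 = "\<lambda>i m k. fscale (bn n i) (heis p (- 1 - int n - int i) (fA p u v w (m + int i) k))"
  let ?F2 = "\<lambda>i m k. fscale (bn n i) (fA p u v (heis p (int i) w) (m - 1 - int n - int i) k)"
  let ?F3 = "\<lambda>j m k. fscale (bn n j) (PW (- 1) (- int n - 1 - int j) (fA p u (heis p (int j) v) w) m k)"
  have u1: "ufs ?F1"
  proof (rule ufsI[of K])
    fix a b show "fs (\<lambda>i. ?F1 i a b)" by (rule nmode_fsI[of p u a "nmode p v b w"]) (simp add: fA_def)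
  qed (simp add: K fA_def nmode_simps)
  have u2: "ufs ?F2"
    by (rule ufs_finite[of I]) (simp add: I f_0, rule tr_lin[OF tr_sh1'[OF tr_fA] lin_fscale])
  have u3: "ufs ?F3"
    by (rule ufs_finite[of J]) (simp add: J f_0 PW_0, rule tr_lin[OF tr_PW[OF tr_fA] lin_fscale])
  have e: "l + (- int n - 1 - int j) = l - 1 - int n - int j" for j by simp
  show ?eq
    unfolding TA_def fA_osc[OF p, abs_def] PW_three[OF u1 u2 u3] PW_lin_sh1[OF tr_fA lin_fscale_heis] PW_lin_sh1'[OF tr_fA lin_fscale]
      PW_lin[OF tr_PW[OF tr_fA] lin_fscale] PW_PW[OF tr_fA] e ..
  show ?fs
    using ufs_PW(2)[OF u1, of "-1" l m k] unfolding TA_def PW_lin_sh1[OF tr_fA lin_fscale_heis] .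
qed

lemma TB_osc:
  assumes p: "p > 0"
  shows "TB p (osc n * u) v w m l k =
     Sum_any (\<lambda>i. fscale (bn n i) (heis p (- 1 - int n - int i) (TB p u v w (m + int i) l k)))
   + fscale ((- 1) ^ n) (Sum_any (\<lambda>i. fscale (bn n i) (TB p u v (heis p (int i) w) (m - 1 - int n - int i) l k)))
   + fscale ((- 1) ^ n) (Sum_any (\<lambda>j. fscale (bn n j) (TB p u (heis p (int j) v) w m (l - 1 - int n - int j) k)))" (is ?eq)
   and "fs (\<lambda>i. fscale (bn n i) (heis p (- 1 - int n - int i) (TB p u v w (m + int i) l k)))" (is ?fs)
proof -
  obtain K where K: "\<And>k. k \<ge> K \<Longrightarrow> nmode p u k w = 0" using nmode_trunc by blast
  obtain I where I: "\<And>i. i \<ge> I \<Longrightarrow> heis p (int i) w = 0" using heis_vanish by blast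
  obtain J where J: "\<And>i. i \<ge> J \<Longrightarrow> heis p (int i) v = 0" using heis_vanish by blast
  let ?F1 = "\<lambda>i k m. fscale (bn n i) (heis p (- 1 - int n - int i) (fB p u v w k (m + int i)))"
  let ?F2 = "\<lambda>i k m. fscale (bn n i) (fB p u v (heis p (int i) w) k (m - 1 - int n - int i))"
  let ?F3 = "\<lambda>j k m. fscale (bn n j) (fscale (sg (- int n - 1 - int j)) (PW (- 1) (- int n - 1 - int j) (fB p u (heis p (int j) v) w) k m))"
  have u1: "ufs ?F1"
  proof (rule ufsI[of K])
    fix a b show "fs (\<lambda>i. ?F1 i a b)" by (rule nmode_fsI[of p u b w]) (simp add: fB_def nmode_simps)
  qed (simp add: K fB_def nmode_simps)
  have u2: "ufs ?F2"
    by (rule ufs_finite[of I]) (simp add: I f_0, rule tr_lin[OF tr_sh2'[OF tr_fB] lin_fscale])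
  have u3: "ufs ?F3"
    by (rule ufs_finite[of J]) (simp add: J f_0 PW_0, rule tr_lin[OF tr_lin[OF tr_PW[OF tr_fB] lin_fscale] lin_fscale])
  have e: "l + (- int n - 1 - int j) = l - 1 - int n - int j" for j by simp
  have eq: "PW (- 1) l (fB p (osc n * u) v w) k m =
     Sum_any (\<lambda>i. fscale (bn n i) (heis p (- 1 - int n - int i) (PW (- 1) l (fB p u v w) k (m + int i))))
   + fscale ((- 1) ^ n) (Sum_any (\<lambda>i. fscale (bn n i) (PW (- 1) l (fB p u v (heis p (int i) w)) k (m - 1 - int n - int i))))
   + fscale ((- 1) ^ n) (Sum_any (\<lambda>j. fscale (bn n j) (fscale (sg (- int n - 1 - int j)) (PW (- 1) (l - 1 - int n - int j) (fB p u (heis p (int j) v) w) k m))))"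
    unfolding fB_osc[OF p, abs_def] PW_three[OF u1 u2 u3] PW_lin_sh2[OF tr_fB lin_fscale_heis] PW_lin_sh2'[OF tr_fB lin_fscale]
      PW_lin[OF tr_PW[OF tr_fB] lin_comp[OF lin_fscale lin_fscale]] PW_PW[OF tr_fB] e ..
  have f1: "fs (\<lambda>i. fscale (bn n i) (heis p (- 1 - int n - int i) (PW (- 1) l (fB p u v w) k (m + int i))))"
    using ufs_PW(2)[OF u1, of "-1" l k m] unfolding PW_lin_sh2[OF tr_fB lin_fscale_heis] .
  have f2: "fs (\<lambda>i. fscale (bn n i) (PW (- 1) l (fB p u v (heis p (int i) w)) k (m - 1 - int n - int i)))"
    by (rule fsI[of I]) (simp add: I f_0 PW_0)
  have f3: "fs (\<lambda>j. fscale (bn n j) (fscale (sg (- int n - 1 - int j)) (PW (- 1) (l - 1 - int n - int j) (fB p u (heis p (int j) v) w) k m)))"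
    by (rule fsI[of J]) (simp add: J f_0 PW_0)
  have s: "sg l * sg (- int n - 1 - int j) = sg (l - 1 - int n - int j)" for j
    unfolding sg_add[symmetric] by (rule arg_cong[of _ _ sg]) simp
  have c: "fscale x (fscale y z) = fscale y (fscale x z)" for x y z by (rule fock.scale_left_commute)
  show ?eq
    unfolding TB_def eq fock.scale_right_distrib c[of "sg l" "(- 1) ^ n"] Sum_any_fscale[OF f1, of "sg l"] Sum_any_fscale[OF f2, of "sg l"] Sum_any_fscale[OF f3, of "sg l"]
    by (simp add: heis_scale s[symmetric] mult_ac)
  show ?fs
    using fs_fscale[OF f1, of "\<lambda>_. sg l"] unfolding TB_def heis_scale c[of "sg l" "bn n _"] .
qed

lemma TC_osc:
  assumes p: "p > 0"
  shows "TC p (osc n * u) v w m l k =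
     Sum_any (\<lambda>i. fscale (bn n i) (heis p (- 1 - int n - int i) (TC p u v w (m + int i) l k)))
   + fscale ((- 1) ^ n) (Sum_any (\<lambda>i. fscale (bn n i) (TC p u v (heis p (int i) w) (m - 1 - int n - int i) l k)))
   + fscale ((- 1) ^ n) (Sum_any (\<lambda>j. fscale (bn n j) (TC p u (heis p (int j) v) w m (l - 1 - int n - int j) k)))"
proof -
  obtain K where K: "\<And>k. k \<ge> K \<Longrightarrow> nmode p u k v = 0" using nmode_trunc by blast
  obtain I where I: "\<And>i. i \<ge> I \<Longrightarrow> heis p (int i) w = 0" using heis_vanish by blast
  obtain J where J: "\<And>i. i \<ge> J \<Longrightarrow> heis p (int i) v = 0" using heis_vanish by blast
  let ?F1 = "\<lambda>i k l. fscale (bn n i) (heis p (- 1 - int n - int i) (PW 1 (int i) (fC p u v w) k l))"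
  let ?F2 = "\<lambda>i k l. fscale (bn n i) (PW 1 (- 1 - int n - int i) (fC p u v (heis p (int i) w)) k l)"
  let ?F3 = "\<lambda>j k l. fscale (bn n j) (fC p u (heis p (int j) v) w k (l - 1 - int n - int j))"
  have KC: "fC p u v w a b = 0" if "b \<ge> K" for a b using K[OF that] by (simp add: fC_def nmode_simps)
  have u1: "ufs ?F1"
  proof (rule ufsI[of K])
    fix i a b assume "b \<ge> K"
    then show "?F1 i a b = 0" using PW_bound[of K "fC p u v w" b] KC by simp
  next
    fix a b
    have "fs (\<lambda>i. PW 1 (int i + 0) (fC p u v w) a b)"
      by (rule fs_PW_nat[OF tr_fC]) (unfold fC_def, rule nmode_trunc)
    then show "fs (\<lambda>i. ?F1 i a b)" unfolding fs_def by (metis add.right_neutral heis_0 fock.scale_zero_right)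
  qed
  have u2: "ufs ?F2"
    by (rule ufs_finite[of I]) (simp add: I f_0 PW_0, rule tr_lin[OF tr_PW[OF tr_fC] lin_fscale])
  have u3: "ufs ?F3"
    by (rule ufs_finite[of J]) (simp add: J f_0, rule tr_lin[OF tr_sh2'[OF tr_fC] lin_fscale])
  have e: "m + (- 1 - int n - int j) = m - 1 - int n - int j" for j by simp
  show ?thesis
    unfolding TC_def fC_osc[OF p, abs_def] PW_three[OF u1 u2 u3] PW_lin[OF tr_PW[OF tr_fC] lin_fscale_heis]
      PW_lin[OF tr_PW[OF tr_fC] lin_fscale] PW_lin_sh2'[OF tr_fC lin_fscale] PW_PW[OF tr_fC] e ..
qed

text \<open>\<open>TA_osc\<close>, \<open>TB_osc\<close> and \<open>TC_osc\<close> are the same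
  linear combination of terms with one oscillator less in the first argument, at the price of
  modified \<open>v\<close> and \<open>w\<close>.\<close>

lemma borch_osc_left:
  assumes p: "p > 0" and b: "borch p u v w" "\<And>j. borch p u (heis p j v) w" "\<And>i. borch p u v (heis p i w)"
  shows "borch p (osc n * u) v w"
  unfolding borch_def
proof (intro allI)
  fix m l k
  have e: "TC p u v w m l k = TA p u v w m l k - TB p u v w m l k"
    "TC p u (heis p j v) w m l k = TA p u (heis p j v) w m l k - TB p u (heis p j v) w m l k"
    "TC p u v (heis p j w) m l k = TA p u v (heis p j w) m l k - TB p u v (heis p j w) m l k" for j m l k
    using b unfolding borch_def by auto
  have fw: "fs (\<lambda>i. fscale (bn n i) (T p u v (heis p (int i) w) (m - 1 - int n - int i) l k))" if "\<And>m l k. T p u v 0 m l k = 0"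
    for T :: "nat \<Rightarrow> fock \<Rightarrow> fock \<Rightarrow> fock \<Rightarrow> int \<Rightarrow> int \<Rightarrow> int \<Rightarrow> fock"
    by (rule heis_fsI[of p w]) (simp add: that)
  have fv: "fs (\<lambda>i. fscale (bn n i) (T p u (heis p (int i) v) w m (l - 1 - int n - int i) k))" if "\<And>m l k. T p u 0 w m l k = 0"
    for T :: "nat \<Rightarrow> fock \<Rightarrow> fock \<Rightarrow> fock \<Rightarrow> int \<Rightarrow> int \<Rightarrow> int \<Rightarrow> fock"
    by (rule heis_fsI[of p v]) (simp add: that)
  show "TC p (osc n * u) v w m l k = TA p (osc n * u) v w m l k - TB p (osc n * u) v w m l k"
    unfolding TA_osc(1)[OF p] TB_osc(1)[OF p] TC_osc[OF p] e heis_diff fock.scale_right_diff_distrib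
      Sum_any_diff[OF TA_osc(2)[OF p] TB_osc(2)[OF p]] Sum_any_diff[OF fw[of TA, OF T_0(1)] fw[of TB, OF T_0(3)]]
      Sum_any_diff[OF fv[of TA, OF T_0(2)] fv[of TB, OF T_0(4)]]
    by (simp add: algebra_simps)
qed

lemma heis_nmode_expo:
  assumes "p > 0"
  shows "heis p i (nmode p (expo k) m v) = nmode p (expo k) m (heis p i v) + fscale (of_int k) (nmode p (expo k) (m + i) v)"
proof -
  have "Sum_any (\<lambda>j. fscale (ch i j) (nmode p (heis p (int j) (expo k)) (m + i - int j) v))
      = (\<Sum>j<1. fscale (ch i j) (nmode p (heis p (int j) (expo k)) (m + i - int j) v))"
    by (rule Sum_any_lt) (simp add: heis_expo nmode_simps)
  then show ?thesis unfolding heis_nmode[OF assms, of i "expo k"] by (simp add: heis_expo nmode_simps)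
qed

text \<open>With an exponential as first argument, the current meets it only through its charge
  \<open>c\<close>, so the contraction is a single term instead of a sum.\<close>

lemma fA_osc2:
  assumes p: "p > 0"
  shows "fA p (expo c) (osc n * v) w m k =
     Sum_any (\<lambda>i. fscale (bn n i) (heis p (- 1 - int n - int i) (fA p (expo c) v w m (k + int i))))
   + fscale ((- 1) ^ n) (Sum_any (\<lambda>i. fscale (bn n i) (fA p (expo c) v (heis p (int i) w) m (k - 1 - int n - int i))))
   + fscale (- of_int c) (PW (- 1) (- 1 - int n) (fA p (expo c) v w) m k)"
proof -
  let ?e = "nmode p (expo c)"
  have f1: "fs (\<lambda>i. fscale (bn n i) (heis p (- 1 - int n - int i) (nmode p v (k + int i) w)))"
    by (rule nmode_fsI[of p v k w]) simp
  have f2: "fs (\<lambda>i. fscale (bn n i) (nmode p v (k - 1 - int n - int i) (heis p (int i) w)))"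
    by (rule heis_fsI[of p w]) (simp add: nmode_simps)
  have f3: "fs (\<lambda>i. fscale (bn n i) (heis p (- 1 - int n - int i) (fA p (expo c) v w m (k + int i))))"
    by (rule nmode_fsI[of p v k w]) (simp add: fA_def nmode_simps)
  have f4: "fs (\<lambda>i. fscale ((- 1) ^ i * ch (- 1 - int n) i) (fA p (expo c) v w (m + (- 1 - int n) - int i) (k + int i)))"
    by (rule PW_fs[OF tr_fA])
  have "?e m (Sum_any (\<lambda>i. fscale (bn n i) (heis p (- 1 - int n - int i) (nmode p v (k + int i) w)))) =
    Sum_any (\<lambda>i. fscale (bn n i) (heis p (- 1 - int n - int i) (fA p (expo c) v w m (k + int i)))
      + fscale (- of_int c) (fscale ((- 1) ^ i * ch (- 1 - int n) i) (fA p (expo c) v w (m + (- 1 - int n) - int i) (k + int i))))"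
    unfolding Sum_any_lin[OF nmode_lin f1]
  proof (rule Sum_any.cong)
    fix i
    have "- int n - 1 = - 1 - int n" by simp
    then have b: "bn n i = (- 1) ^ i * ch (- 1 - int n) i" using bn_eq[of n i] by (simp only:)
    have "m + (- 1 - int n - int i) = m + (- 1 - int n) - int i" by simp
    then have h: "heis p (- 1 - int n - int i) (?e m (nmode p v (k + int i) w)) =
      ?e m (heis p (- 1 - int n - int i) (nmode p v (k + int i) w)) + fscale (of_int c) (?e (m + (- 1 - int n) - int i) (nmode p v (k + int i) w))"
      using heis_nmode_expo[OF p, of "- 1 - int n - int i" c m] by (simp only:)
    show "?e m (fscale (bn n i) (heis p (- 1 - int n - int i) (nmode p v (k + int i) w))) =
      fscale (bn n i) (heis p (- 1 - int n - int i) (fA p (expo c) v w m (k + int i)))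
      + fscale (- of_int c) (fscale ((- 1) ^ i * ch (- 1 - int n) i) (fA p (expo c) v w (m + (- 1 - int n) - int i) (k + int i)))"
      unfolding b[symmetric] fA_def h lin_scale[OF nmode_lin] by (simp add: fock.scale_right_distrib mult.commute)
  qed
  also have "\<dots> = Sum_any (\<lambda>i. fscale (bn n i) (heis p (- 1 - int n - int i) (fA p (expo c) v w m (k + int i))))
    + fscale (- of_int c) (PW (- 1) (- 1 - int n) (fA p (expo c) v w) m k)"
    unfolding PW_def Sum_any_fscale[OF f4] by (rule Sum_any_add[OF f3 fs_lin[OF lin_fscale f4]])
  finally have 1: "?e m (Sum_any (\<lambda>i. fscale (bn n i) (heis p (- 1 - int n - int i) (nmode p v (k + int i) w)))) = \<dots>" .
  have 2: "?e m (Sum_any (\<lambda>i. fscale (bn n i) (nmode p v (k - 1 - int n - int i) (heis p (int i) w)))) =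
     Sum_any (\<lambda>i. fscale (bn n i) (fA p (expo c) v (heis p (int i) w) m (k - 1 - int n - int i)))"
    unfolding Sum_any_lin[OF nmode_lin f2] lin_scale[OF nmode_lin] fA_def ..
  show ?thesis
    unfolding fA_def[of _ _ "osc n * v"] nmode_osc[of p n v k] lin_add[OF nmode_lin] lin_scale[OF nmode_lin] 1 2
    by (simp only: add_ac)
qed

lemma fB_osc2:
  assumes p: "p > 0"
  shows "fB p (expo c) (osc n * v) w k m =
     Sum_any (\<lambda>i. fscale (bn n i) (heis p (- 1 - int n - int i) (fB p (expo c) v w (k + int i) m)))
   + fscale ((- 1) ^ n) (Sum_any (\<lambda>i. fscale (bn n i) (fB p (expo c) v (heis p (int i) w) (k - 1 - int n - int i) m)))
   + fscale (- of_int c) (fscale (sg (- 1 - int n)) (PW (- 1) (- 1 - int n) (fB p (expo c) v w) k m))"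
proof -
  let ?e = "nmode p (expo c)"
  have f2: "fs (\<lambda>i. fscale (bn n i) (fB p (expo c) v (heis p (int i) w) (k - 1 - int n - int i) m))"
    by (rule heis_fsI[of p w]) (simp add: fB_def nmode_simps)
  have f4: "fs (\<lambda>i. fscale ((- 1) ^ i * ch (- 1 - int n) i) (fB p (expo c) v w (k + (- 1 - int n) - int i) (m + int i)))"
    by (rule PW_fs[OF tr_fB])
  have "Sum_any (\<lambda>i. fscale (bn n i) (nmode p v (k - 1 - int n - int i) (heis p (int i) (?e m w)))) =
     Sum_any (\<lambda>i. fscale (bn n i) (fB p (expo c) v (heis p (int i) w) (k - 1 - int n - int i) m)
       + fscale (of_int c) (fscale ((- 1) ^ i * ch (- 1 - int n) i) (fB p (expo c) v w (k + (- 1 - int n) - int i) (m + int i))))"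
  proof (rule Sum_any.cong)
    fix i
    have "- int n - 1 = - 1 - int n" by simp
    then have b: "bn n i = (- 1) ^ i * ch (- 1 - int n) i" using bn_eq[of n i] by (simp only:)
    have e: "k - 1 - int n - int i = k + (- 1 - int n) - int i" by simp
    show "fscale (bn n i) (nmode p v (k - 1 - int n - int i) (heis p (int i) (?e m w))) =
      fscale (bn n i) (fB p (expo c) v (heis p (int i) w) (k - 1 - int n - int i) m)
       + fscale (of_int c) (fscale ((- 1) ^ i * ch (- 1 - int n) i) (fB p (expo c) v w (k + (- 1 - int n) - int i) (m + int i)))"
      unfolding b[symmetric] heis_nmode_expo[OF p] e fB_def by (simp add: nmode_simps fock.scale_right_distrib mult.commute)
  qed
  also have "\<dots> = Sum_any (\<lambda>i. fscale (bn n i) (fB p (expo c) v (heis p (int i) w) (k - 1 - int n - int i) m))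
    + fscale (of_int c) (PW (- 1) (- 1 - int n) (fB p (expo c) v w) k m)"
    unfolding PW_def Sum_any_fscale[OF f4] by (rule Sum_any_add[OF f2 fs_lin[OF lin_fscale f4]])
  finally have 1: "Sum_any (\<lambda>i. fscale (bn n i) (nmode p v (k - 1 - int n - int i) (heis p (int i) (?e m w)))) = \<dots>" .
  have "sg (- 1 - int n) = - ((- 1) ^ n)" by (simp add: sg_diff sg_minus sg_nat sg_1)
  then show ?thesis
    unfolding fB_def[of _ _ "osc n * v"] nmode_osc[of p n v k] 1 by (simp add: fB_def fock.scale_right_distrib mult.commute)
qed

lemma fC_osc2:
  assumes p: "p > 0"
  shows "fC p (expo c) (osc n * v) w k l =
     Sum_any (\<lambda>i. fscale (bn n i) (heis p (- 1 - int n - int i) (fC p (expo c) v w (k + int i) l)))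
   + fscale ((- 1) ^ n) (Sum_any (\<lambda>i. fscale (bn n i) (fC p (expo c) v (heis p (int i) w) (k - 1 - int n - int i) l)))
   + fscale (- of_int c) (fC p (expo c) v w k (l - 1 - int n))"
proof -
  have "nmode p (expo c) l (osc n * v) = osc n * nmode p (expo c) l v - fscale (of_int c) (nmode p (expo c) (l - 1 - int n) v)"
  proof -
    have e: "l + (- 1 - int n) = l - 1 - int n" by simp
    show ?thesis using heis_nmode_expo[OF p, of "- 1 - int n" c l v]
      unfolding osc_heis[of n _ p] e by simp
  qed
  then show ?thesis by (simp add: fC_def nmode_simps nmode_osc)
qed

lemma PW_three':
  assumes "ufs F1" "ufs F2" "tr G"
  shows "PW e n (\<lambda>a b. Sum_any (\<lambda>i. F1 i a b) + fscale s (Sum_any (\<lambda>i. F2 i a b)) + fscale t (G a b)) a b =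
    Sum_any (\<lambda>i. PW e n (F1 i) a b) + fscale s (Sum_any (\<lambda>i. PW e n (F2 i) a b)) + fscale t (PW e n G a b)"
proof -
  note t = ufs_tr[OF assms(1)] ufs_tr[OF assms(2)]
  note t2 = tr_lin[OF t(2) lin_fscale, of s] and t3 = tr_lin[OF assms(3) lin_fscale, of t]
  have t12: "tr (\<lambda>a b. Sum_any (\<lambda>i. F1 i a b) + fscale s (Sum_any (\<lambda>i. F2 i a b)))"
  proof -
    obtain K1 K2 where "\<And>a b. b \<ge> K1 \<Longrightarrow> Sum_any (\<lambda>i. F1 i a b) = 0" "\<And>a b. b \<ge> K2 \<Longrightarrow> fscale s (Sum_any (\<lambda>i. F2 i a b)) = 0"
      using t(1) t2 unfolding tr_def by blast
    then show ?thesis by (intro trI[of "max K1 K2"]) simp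
  qed
  show ?thesis
    unfolding PW_add[OF t12 t3] PW_add[OF t(1) t2] PW_lin[OF t(2) lin_fscale] PW_lin[OF assms(3) lin_fscale]
      ufs_PW(1)[OF assms(1)] ufs_PW(1)[OF assms(2)] ..
qed

lemma TA_osc2:
  assumes p: "p > 0"
  shows "TA p (expo c) (osc n * v) w m l k =
     Sum_any (\<lambda>i. fscale (bn n i) (heis p (- 1 - int n - int i) (TA p (expo c) v w m l (k + int i))))
   + fscale ((- 1) ^ n) (Sum_any (\<lambda>i. fscale (bn n i) (TA p (expo c) v (heis p (int i) w) m l (k - 1 - int n - int i))))
   + fscale (- of_int c) (TA p (expo c) v w m (l - 1 - int n) k)" (is ?eq)
   and "fs (\<lambda>i. fscale (bn n i) (heis p (- 1 - int n - int i) (TA p (expo c) v w m l (k + int i))))" (is ?fs)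
proof -
  obtain K where K: "\<And>k. k \<ge> K \<Longrightarrow> nmode p v k w = 0" using nmode_trunc by blast
  obtain I where I: "\<And>i. i \<ge> I \<Longrightarrow> heis p (int i) w = 0" using heis_vanish by blast
  let ?F1 = "\<lambda>i m k. fscale (bn n i) (heis p (- 1 - int n - int i) (fA p (expo c) v w m (k + int i)))"
  let ?F2 = "\<lambda>i m k. fscale (bn n i) (fA p (expo c) v (heis p (int i) w) m (k - 1 - int n - int i))"
  have u1: "ufs ?F1"
  proof (rule ufsI[of K])
    fix a b show "fs (\<lambda>i. ?F1 i a b)" by (rule nmode_fsI[of p v b w]) (simp add: fA_def nmode_simps)
  qed (simp add: K fA_def nmode_simps)
  have u2: "ufs ?F2"
    by (rule ufs_finite[of I]) (simp add: I f_0, rule tr_lin[OF tr_sh2'[OF tr_fA] lin_fscale])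
  have e: "l + (- 1 - int n) = l - 1 - int n" by simp
  show ?eq
    unfolding TA_def fA_osc2[OF p, abs_def] PW_three'[OF u1 u2 tr_PW[OF tr_fA]] PW_lin_sh2[OF tr_fA lin_fscale_heis] PW_lin_sh2'[OF tr_fA lin_fscale]
      PW_PW[OF tr_fA] e ..
  show ?fs
    using ufs_PW(2)[OF u1, of "-1" l m k] unfolding TA_def PW_lin_sh2[OF tr_fA lin_fscale_heis] .
qed

lemma TB_osc2:
  assumes p: "p > 0"
  shows "TB p (expo c) (osc n * v) w m l k =
     Sum_any (\<lambda>i. fscale (bn n i) (heis p (- 1 - int n - int i) (TB p (expo c) v w m l (k + int i))))
   + fscale ((- 1) ^ n) (Sum_any (\<lambda>i. fscale (bn n i) (TB p (expo c) v (heis p (int i) w) m l (k - 1 - int n - int i))))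
   + fscale (- of_int c) (TB p (expo c) v w m (l - 1 - int n) k)" (is ?eq)
   and "fs (\<lambda>i. fscale (bn n i) (heis p (- 1 - int n - int i) (TB p (expo c) v w m l (k + int i))))" (is ?fs)
proof -
  obtain K where K: "\<And>k. k \<ge> K \<Longrightarrow> nmode p (expo c) k w = 0" using nmode_trunc by blast
  obtain I where I: "\<And>i. i \<ge> I \<Longrightarrow> heis p (int i) w = 0" using heis_vanish by blast
  let ?F1 = "\<lambda>i k m. fscale (bn n i) (heis p (- 1 - int n - int i) (fB p (expo c) v w (k + int i) m))"
  let ?F2 = "\<lambda>i k m. fscale (bn n i) (fB p (expo c) v (heis p (int i) w) (k - 1 - int n - int i) m)"
  have u1: "ufs ?F1"
  proof (rule ufsI[of K])
    fix a b show "fs (\<lambda>i. ?F1 i a b)" by (rule nmode_fsI[of p v a "nmode p (expo c) b w"]) (simp add: fB_def)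
  qed (simp add: K fB_def nmode_simps)
  have u2: "ufs ?F2"
    by (rule ufs_finite[of I]) (simp add: I f_0, rule tr_lin[OF tr_sh1'[OF tr_fB] lin_fscale])
  have e: "l + (- 1 - int n) = l - 1 - int n" by simp
  have eq: "PW (- 1) l (fB p (expo c) (osc n * v) w) k m =
     Sum_any (\<lambda>i. fscale (bn n i) (heis p (- 1 - int n - int i) (PW (- 1) l (fB p (expo c) v w) (k + int i) m)))
   + fscale ((- 1) ^ n) (Sum_any (\<lambda>i. fscale (bn n i) (PW (- 1) l (fB p (expo c) v (heis p (int i) w)) (k - 1 - int n - int i) m)))
   + fscale (- of_int c) (fscale (sg (- 1 - int n)) (PW (- 1) (l - 1 - int n) (fB p (expo c) v w) k m))"
    unfolding fB_osc2[OF p, abs_def] PW_three'[OF u1 u2 tr_lin[OF tr_PW[OF tr_fB] lin_fscale]] PW_lin_sh1[OF tr_fB lin_fscale_heis] PW_lin_sh1'[OF tr_fB lin_fscale]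
      PW_lin[OF tr_PW[OF tr_fB] lin_fscale] PW_PW[OF tr_fB] e ..
  have f1: "fs (\<lambda>i. fscale (bn n i) (heis p (- 1 - int n - int i) (PW (- 1) l (fB p (expo c) v w) (k + int i) m)))"
    using ufs_PW(2)[OF u1, of "-1" l k m] unfolding PW_lin_sh1[OF tr_fB lin_fscale_heis] .
  have f2: "fs (\<lambda>i. fscale (bn n i) (PW (- 1) l (fB p (expo c) v (heis p (int i) w)) (k - 1 - int n - int i) m))"
    by (rule fsI[of I]) (simp add: I f_0 PW_0)
  have s: "sg l * sg (- 1 - int n) = sg (l - 1 - int n)"
    unfolding sg_add[symmetric] by (rule arg_cong[of _ _ sg]) simp
  have cc: "fscale x (fscale y z) = fscale y (fscale x z)" for x y z by (rule fock.scale_left_commute)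
  show ?eq
    unfolding TB_def eq fock.scale_right_distrib cc[of "sg l" "(- 1) ^ n"] Sum_any_fscale[OF f1, of "sg l"] Sum_any_fscale[OF f2, of "sg l"]
    by (simp add: heis_scale s[symmetric] mult_ac)
  show ?fs
    using fs_fscale[OF f1, of "\<lambda>_. sg l"] unfolding TB_def heis_scale cc[of "sg l" "bn n _"] .
qed

lemma TC_osc2:
  assumes p: "p > 0"
  shows "TC p (expo c) (osc n * v) w m l k =
     Sum_any (\<lambda>i. fscale (bn n i) (heis p (- 1 - int n - int i) (TC p (expo c) v w m l (k + int i))))
   + fscale ((- 1) ^ n) (Sum_any (\<lambda>i. fscale (bn n i) (TC p (expo c) v (heis p (int i) w) m l (k - 1 - int n - int i))))
   + fscale (- of_int c) (TC p (expo c) v w m (l - 1 - int n) k)"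
proof -
  obtain K where K: "\<And>k. k \<ge> K \<Longrightarrow> nmode p (expo c) k v = 0" using nmode_trunc by blast
  obtain I where I: "\<And>i. i \<ge> I \<Longrightarrow> heis p (int i) w = 0" using heis_vanish by blast
  let ?F1 = "\<lambda>i k l. fscale (bn n i) (heis p (- 1 - int n - int i) (fC p (expo c) v w (k + int i) l))"
  let ?F2 = "\<lambda>i k l. fscale (bn n i) (fC p (expo c) v (heis p (int i) w) (k - 1 - int n - int i) l)"
  have u1: "ufs ?F1"
  proof (rule ufsI[of K])
    fix a b show "fs (\<lambda>i. ?F1 i a b)" by (rule nmode_fsI[of p "nmode p (expo c) b v" a w]) (simp add: fC_def)
  qed (simp add: K fC_def nmode_simps)
  have u2: "ufs ?F2"
    by (rule ufs_finite[of I]) (simp add: I f_0, rule tr_lin[OF tr_sh1'[OF tr_fC] lin_fscale])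
  have t3: "tr (\<lambda>k l. fC p (expo c) v w k (l - 1 - int n))"
    using tr_sh2[OF tr_fC, of p "expo c" v w "- 1 - int n"] by (simp add: algebra_simps)
  have s3: "PW 1 m (\<lambda>k l. fC p (expo c) v w k (l - 1 - int n)) k l = PW 1 m (fC p (expo c) v w) k (l - 1 - int n)"
    using PW_shift[of 1 m "fC p (expo c) v w" 0 "- 1 - int n" k l] by (simp add: algebra_simps)
  show ?thesis
    unfolding TC_def fC_osc2[OF p, abs_def] PW_three'[OF u1 u2 t3] PW_lin_sh1[OF tr_fC lin_fscale_heis]
      PW_lin_sh1'[OF tr_fC lin_fscale] s3 ..
qed

lemma borch_osc_mid:
  assumes p: "p > 0" and b: "borch p (expo c) v w" "\<And>i. borch p (expo c) v (heis p i w)"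
  shows "borch p (expo c) (osc n * v) w"
  unfolding borch_def
proof (intro allI)
  fix m l k
  let ?u = "expo c"
  have e: "TC p ?u v w m l k = TA p ?u v w m l k - TB p ?u v w m l k"
    "TC p ?u v (heis p j w) m l k = TA p ?u v (heis p j w) m l k - TB p ?u v (heis p j w) m l k" for j m l k
    using b unfolding borch_def by auto
  have fw: "fs (\<lambda>i. fscale (bn n i) (T p ?u v (heis p (int i) w) m l (k - 1 - int n - int i)))" if "\<And>m l k. T p ?u v 0 m l k = 0"
    for T :: "nat \<Rightarrow> fock \<Rightarrow> fock \<Rightarrow> fock \<Rightarrow> int \<Rightarrow> int \<Rightarrow> int \<Rightarrow> fock"
    by (rule heis_fsI[of p w]) (simp add: that)
  show "TC p ?u (osc n * v) w m l k = TA p ?u (osc n * v) w m l k - TB p ?u (osc n * v) w m l k"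
    unfolding TA_osc2(1)[OF p] TB_osc2(1)[OF p] TC_osc2[OF p] e heis_diff fock.scale_right_diff_distrib
      Sum_any_diff[OF TA_osc2(2)[OF p] TB_osc2(2)[OF p]] Sum_any_diff[OF fw[of TA, OF T_0(1)] fw[of TB, OF T_0(3)]]
    by (simp add: algebra_simps)
qed

section \<open>The Borcherds identity for three exponentials\<close>

lemma PW_heis_comm:
  assumes "tr G" "tr G'" "\<And>a b. heis p i (G a b) = G' a b + fscale x (G (a + i) b) + fscale y (G a (b + i))"
  shows "heis p i (PW e n G a b) = PW e n G' a b + fscale x (PW e n G (a + i) b) + fscale y (PW e n G a (b + i))"
proof -
  have t1: "tr (\<lambda>a b. fscale x (G (a + i) b))" by (rule tr_lin[OF tr_sh1[OF assms(1)] lin_fscale])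
  have t2: "tr (\<lambda>a b. fscale y (G a (b + i)))" by (rule tr_lin[OF tr_sh2[OF assms(1)] lin_fscale])
  have t3: "tr (\<lambda>a b. G' a b + fscale x (G (a + i) b))"
  proof -
    obtain K1 K2 where "\<And>a b. b \<ge> K1 \<Longrightarrow> G' a b = 0" "\<And>a b. b \<ge> K2 \<Longrightarrow> fscale x (G (a + i) b) = 0"
      using assms(2) t1 unfolding tr_def by blast
    then show ?thesis by (intro trI[of "max K1 K2"]) simp
  qed
  show ?thesis
    unfolding PW_lin[OF assms(1) heis_lin, symmetric] assms(3) PW_add[OF t3 t2] PW_add[OF assms(2) t1]
      PW_lin_sh1[OF assms(1) lin_fscale] PW_lin_sh2[OF assms(1) lin_fscale] ..
qed

text \<open>All three terms transform alike under every \<open>\<alpha>(i)\<close>. So does the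
  defect of the identity, and annihilation operators then reduce its vanishing to coefficients of
  pure exponentials.\<close>

lemma TA_heis:
  assumes p: "p > 0"
  shows "heis p i (TA p (expo b) (expo c) w m l k) = TA p (expo b) (expo c) (heis p i w) m l k
    + fscale (of_int b) (TA p (expo b) (expo c) w (m + i) l k) + fscale (of_int c) (TA p (expo b) (expo c) w m l (k + i))"
  unfolding TA_def
  by (rule PW_heis_comm[OF tr_fA tr_fA])
     (simp add: fA_def heis_nmode_expo[OF p] nmode_simps add_ac)

lemma TB_heis:
  assumes p: "p > 0"
  shows "heis p i (TB p (expo b) (expo c) w m l k) = TB p (expo b) (expo c) (heis p i w) m l k
    + fscale (of_int b) (TB p (expo b) (expo c) w (m + i) l k) + fscale (of_int c) (TB p (expo b) (expo c) w m l (k + i))"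
proof -
  have "heis p i (PW (- 1) l (fB p (expo b) (expo c) w) k m) = PW (- 1) l (fB p (expo b) (expo c) (heis p i w)) k m
    + fscale (of_int c) (PW (- 1) l (fB p (expo b) (expo c) w) (k + i) m)
    + fscale (of_int b) (PW (- 1) l (fB p (expo b) (expo c) w) k (m + i))"
    by (rule PW_heis_comm[OF tr_fB tr_fB]) (simp add: fB_def heis_nmode_expo[OF p] nmode_simps add_ac)
  then show ?thesis
    unfolding TB_def heis_scale by (simp add: fock.scale_right_distrib add_ac mult.commute)
qed

lemma fC_heis:
  assumes p: "p > 0"
  shows "heis p i (fC p (expo b) (expo c) w k l) = fC p (expo b) (expo c) (heis p i w) k l
    + fscale (of_int b) (PW 1 i (fC p (expo b) (expo c) w) k l) + fscale (of_int c) (fC p (expo b) (expo c) w (k + i) l)"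
proof -
  let ?F = "fC p (expo b) (expo c) w"
  have f: "fs (\<lambda>j. fscale (1 ^ j * ch i j) (?F (k + i - int j) (l + int j)))" by (rule PW_fs[OF tr_fC])
  have "Sum_any (\<lambda>j. fscale (ch i j) (nmode p (heis p (int j) (nmode p (expo b) l (expo c))) (k + i - int j) w)) =
    Sum_any (\<lambda>j. fscale (of_int b) (fscale (1 ^ j * ch i j) (?F (k + i - int j) (l + int j))) + (if j = 0 then fscale (of_int c) (?F (k + i) l) else 0))"
    by (rule Sum_any.cong)
       (simp add: heis_nmode_expo[OF p] heis_expo nmode_simps fC_def fock.scale_right_distrib mult.commute)
  also have "\<dots> = fscale (of_int b) (PW 1 i ?F k l) + fscale (of_int c) (?F (k + i) l)"
  proof -
    have "fs (\<lambda>j. if j = 0 then fscale (of_int c) (?F (k + i) l) else 0)" by (rule fsI[of 1]) simp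
    then show ?thesis
      unfolding PW_def Sum_any_fscale[OF f] by (simp only: Sum_any_add[OF fs_lin[OF lin_fscale f]] Sum_any.delta)
  qed
  finally show ?thesis unfolding fC_def[of _ _ _ w k l] heis_nmode[OF p, of i "nmode p (expo b) l (expo c)"]
    by (simp add: fC_def add_ac)
qed

lemma TC_heis:
  assumes p: "p > 0"
  shows "heis p i (TC p (expo b) (expo c) w m l k) = TC p (expo b) (expo c) (heis p i w) m l k
    + fscale (of_int b) (TC p (expo b) (expo c) w (m + i) l k) + fscale (of_int c) (TC p (expo b) (expo c) w m l (k + i))"
proof -
  let ?F = "fC p (expo b) (expo c) w"
  have t1: "tr (\<lambda>k l. fscale (of_int b) (PW 1 i ?F k l))" by (rule tr_lin[OF tr_PW[OF tr_fC] lin_fscale])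
  have t2: "tr (\<lambda>k l. fscale (of_int c) (?F (k + i) l))" by (rule tr_lin[OF tr_sh1[OF tr_fC] lin_fscale])
  have t3: "tr (\<lambda>k l. fC p (expo b) (expo c) (heis p i w) k l + fscale (of_int b) (PW 1 i ?F k l))"
  proof -
    obtain K1 K2 where "\<And>a k. k \<ge> K1 \<Longrightarrow> fC p (expo b) (expo c) (heis p i w) a k = 0" "\<And>a k. k \<ge> K2 \<Longrightarrow> fscale (of_int b) (PW 1 i ?F a k) = 0"
      using tr_fC[of p "expo b" "expo c" "heis p i w"] t1 unfolding tr_def by blast
    then show ?thesis by (intro trI[of "max K1 K2"]) simp
  qed
  show ?thesis
    unfolding TC_def PW_lin[OF tr_fC heis_lin, symmetric] fC_heis[OF p] PW_add[OF t3 t2] PW_add[OF tr_fC t1]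
      PW_lin_sh1[OF tr_fC lin_fscale] PW_lin[OF tr_PW[OF tr_fC] lin_fscale] PW_PW[OF tr_fC] ..
qed

lemma lookup_Sum_any: "fs f \<Longrightarrow> lookup (Sum_any f) x = Sum_any (\<lambda>i. lookup (f i) x)"
proof -
  assume "fs f"
  then obtain N where "\<And>i. i \<ge> N \<Longrightarrow> f i = 0" by (auto simp: fs_def)
  then show ?thesis by (simp add: Sum_any_lt[of N] lookup_sum)
qed

lemma lookup_osc_mult: "lookup (osc n * v) (0, K) = 0"
proof (rule fock_basis_induct[OF chg_UNIV[of v]])
  fix \<mu> :: "nat \<Rightarrow>\<^sub>0 nat" and l :: int
  have "\<mu> + single n 1 \<noteq> 0"
    using lookup_add[of \<mu> "single n 1" n] by (metis add_is_0 lookup_single_eq lookup_zero one_neq_zero)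
  then show "lookup (osc n * single (\<mu>, l) 1) (0, K) = 0"
    unfolding osc_single by (simp add: lookup_single when_def)
qed (auto simp: distrib_left lookup_add fscale_mult_right lookup_fscale)

lemma lookup_heis_neg: "i < 0 \<Longrightarrow> lookup (heis p i v) (0, K) = 0"
  by (simp add: heis_neg lookup_osc_mult)

lemma lookup_expo: "lookup (expo k) (0, K) = (if K = k then 1 else 0)"
  by (auto simp: expo_def lookup_single when_def)

lemma lookup_exp_creation:
  "lookup (exp_creation p k N (expo g)) (0, K) = (if N = 0 \<and> K = g then 1 else 0)"
proof (cases "N = 0")
  case False
  have "of_nat N * lookup (exp_creation p k N (expo g)) (0, K) = 0"
    unfolding lookup_fscale[symmetric] exp_creation_Euler lookup_sum
    by (rule sum.neutral) (auto simp: lookup_fscale lookup_heis_neg)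
  then show ?thesis using False by simp
qed (simp add: lookup_expo)

text \<open>For the generating series the recursion says z x'(z) = - a z/(1 - z) x(z), whose
  solutions are the multiples of (1 - z)^a.\<close>

lemma binom_rec:
  fixes x :: "nat \<Rightarrow> complex"
  assumes "\<And>N. N > 0 \<Longrightarrow> of_nat N * x N = - a * (\<Sum>n = 1..N. x (N - n))"
  shows "x N = (- 1) ^ N * (a gchoose N) * x 0"
proof (induction N)
  case (Suc N)
  have "(\<Sum>n = 1..Suc N. x (Suc N - n)) = x N + (\<Sum>n = 1..N. x (N - n))"
  proof -
    have "(\<Sum>n = 1..Suc N. x (Suc N - n)) = (\<Sum>n = 0..N. x (N - n))"
      using sum.shift_bounds_cl_Suc_ivl[of "\<lambda>n. x (Suc N - n)" 0 N] by simp
    also have "\<dots> = x N + (\<Sum>n = 1..N. x (N - n))" by (simp add: sum.atLeast_Suc_atMost)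
    finally show ?thesis .
  qed
  then have "of_nat (Suc N) * x (Suc N) = - a * x N + (- a * (\<Sum>n = 1..N. x (N - n)))"
    using assms[of "Suc N"] by (simp add: algebra_simps)
  also have "- a * (\<Sum>n = 1..N. x (N - n)) = of_nat N * x N" using assms[of N] by (cases "N = 0") auto
  also have "- a * x N + of_nat N * x N = (of_nat N - a) * ((- 1) ^ N * (a gchoose N) * x 0)"
    unfolding Suc by (simp add: algebra_simps)
  also have "\<dots> = (- 1) ^ Suc N * ((a - of_nat N) * (a gchoose N)) * x 0" by (simp add: algebra_simps)
  also have "(a - of_nat N) * (a gchoose N) = of_nat (Suc N) * (a gchoose Suc N)"
    using gbinomial_mult_1[of a N] by (simp add: algebra_simps)
  finally have "of_nat (Suc N) * x (Suc N) = of_nat (Suc N) * ((- 1) ^ Suc N * (a gchoose Suc N) * x 0)"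
    by (simp add: algebra_simps del: of_nat_Suc)
  then show ?case by (rule mult_left_cancel[THEN iffD1, OF of_nat_neq_0])
qed simp

lemma lookup_nmode_expo:
  assumes "p > 0"
  shows "lookup (nmode p (expo b) m (expo l)) (0, K) = (if m + 1 + b * l div (2 * int p) = 0 \<and> K = b + l then 1 else 0)"
  unfolding nmode_expo[OF assms expo_chg[OF singletonI]] ex_expo[OF assms] by (auto simp: lookup_exp_creation lookup_expo)

text \<open>In the coefficient of a pure exponential only the contraction of the two exponentials
  survives. It is (1 - z)^a with \<open>a\<close> the pairing of the charges, and
  \<open>binom_rec\<close> reads it off from Euler's recursion.\<close>

lemma lookup_expo_creation:
  assumes p: "p > 0"
  shows "lookup (nmode p (expo b) m (exp_creation p c N (expo l))) (0, K) =
    (if m + 1 + b * l div (2 * int p) = int N \<and> K = b + l then (- 1) ^ N * ((of_int (b * c) / (2 * of_nat p)) gchoose N) else 0)"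
proof -
  let ?a = "of_int (b * c) / (2 * of_nat p) :: complex"
  define y where "y m0 N = lookup (nmode p (expo b) (m0 + int N) (exp_creation p c N (expo l))) (0, K)" for m0 N
  have "of_nat N * y m0 N = - ?a * (\<Sum>n = 1..N. y m0 (N - n))" if "N > 0" for m0 N
  proof -
    have "of_nat N * y m0 N = (\<Sum>n = 1..N. of_int c / (2 * of_nat p) *
       lookup (nmode p (expo b) (m0 + int N) (heis p (- int n) (exp_creation p c (N - n) (expo l)))) (0, K))"
      unfolding y_def lookup_fscale[symmetric] nmode_simps(2)[symmetric] exp_creation_Euler by (simp add: nmode_simps lookup_sum lookup_fscale)
    also have "\<dots> = (\<Sum>n = 1..N. - ?a * y m0 (N - n))"
    proof (rule sum.cong[OF refl])
      fix n assume n: "n \<in> {1..N}"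
      then have e: "m0 + int N + - int n = m0 + int (N - n)" by auto
      have "nmode p (expo b) (m0 + int N) (heis p (- int n) (exp_creation p c (N - n) (expo l))) =
        heis p (- int n) (nmode p (expo b) (m0 + int N) (exp_creation p c (N - n) (expo l)))
        - fscale (of_int b) (nmode p (expo b) (m0 + int (N - n)) (exp_creation p c (N - n) (expo l)))"
        using heis_nmode_expo[OF p, of "- int n" b "m0 + int N" "exp_creation p c (N - n) (expo l)"] unfolding e by simp
      then show "of_int c / (2 * of_nat p) *
       lookup (nmode p (expo b) (m0 + int N) (heis p (- int n) (exp_creation p c (N - n) (expo l)))) (0, K) = - ?a * y m0 (N - n)"
        using n by (simp add: lookup_minus lookup_heis_neg lookup_fscale y_def)
    qed
    finally show ?thesis by (simp add: sum_distrib_left)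
  qed
  from binom_rec[of "y (m - int N)", OF this]
  have "y (m - int N) N = (- 1) ^ N * (?a gchoose N) * y (m - int N) 0" by blast
  then show ?thesis unfolding y_def by (auto simp: lookup_nmode_expo[OF p])
qed

text \<open>The analogue for a descendant in the left argument. An oscillator of the field acquires
  a sign when it is moved onto \<open>expo d\<close>, so (1 + z)^a takes the place of (1 -
  z)^a.\<close>

lemma lookup_creation_expo:
  assumes p: "p > 0"
  shows "lookup (nmode p (exp_creation p b N (expo g)) k (expo d)) (0, K) =
    (if k + 1 + g * d div (2 * int p) = int N \<and> K = g + d then (of_int (b * d) / (2 * of_nat p)) gchoose N else 0)"
proof -
  let ?a = "of_int (b * d) / (2 * of_nat p) :: complex"
  define y where "y k0 N = (- 1) ^ N * lookup (nmode p (exp_creation p b N (expo g)) (k0 + int N) (expo d)) (0, K)" for k0 N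
  have h: "lookup (nmode p (heis p (- int n) u) k (expo d)) (0, K) = - ((- 1) ^ n) * of_int d * lookup (nmode p u (k - int n) (expo d)) (0, K)"
    if "n > 0" for n u k
  proof -
    obtain n' where n': "n = Suc n'" using \<open>n > 0\<close> by (cases n) auto
    have "- int n = - 1 - int n'" by (simp add: n')
    then have 1: "heis p (- int n) u = osc n' * u" by (simp only: osc_heis[of _ _ p])
    have f: "fs (\<lambda>i. fscale (bn n' i) (heis p (- 1 - int n' - int i) (nmode p u (k + int i) (expo d))))"
      by (rule nmode_fsI[of p u k "expo d"]) simp
    have 2: "Sum_any (\<lambda>i. fscale (bn n' i) (nmode p u (k - 1 - int n' - int i) (heis p (int i) (expo d)))) =
      (\<Sum>i<1. fscale (bn n' i) (nmode p u (k - 1 - int n' - int i) (heis p (int i) (expo d))))"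
      by (rule Sum_any_lt) (simp add: heis_expo nmode_simps)
    have 3: "k - 1 - int n' - int 0 = k - int n" "- ((- 1) ^ n) = (- 1 :: complex) ^ n'" by (simp_all add: n')
    have "Sum_any (\<lambda>i. lookup (fscale (bn n' i) (heis p (- 1 - int n' - int i) (nmode p u (k + int i) (expo d)))) (0, K)) = 0"
      by (simp add: lookup_fscale lookup_heis_neg)
    moreover have "(\<Sum>i<1. fscale (bn n' i) (nmode p u (k - 1 - int n' - int i) (heis p (int i) (expo d)))) = fscale (of_int d) (nmode p u (k - int n) (expo d))"
      unfolding lessThan_Suc One_nat_def lessThan_0 3(1)[symmetric] by (simp add: heis_expo nmode_simps bn_def)
    ultimately show ?thesis unfolding 1 nmode_osc 2 lookup_add lookup_Sum_any[OF f] 3(2)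
      by (simp add: lookup_fscale)
  qed
  have "of_nat N * y k0 N = - ?a * (\<Sum>n = 1..N. y k0 (N - n))" if "N > 0" for k0 N
  proof -
    have "of_nat N * y k0 N = (- 1) ^ N * (\<Sum>n = 1..N. of_int b / (2 * of_nat p) *
       lookup (nmode p (heis p (- int n) (exp_creation p b (N - n) (expo g))) (k0 + int N) (expo d)) (0, K))"
    proof -
      have "of_nat N * lookup (nmode p (exp_creation p b N (expo g)) (k0 + int N) (expo d)) (0, K) =
        (\<Sum>n = 1..N. of_int b / (2 * of_nat p) * lookup (nmode p (heis p (- int n) (exp_creation p b (N - n) (expo g))) (k0 + int N) (expo d)) (0, K))"
        unfolding lookup_fscale[symmetric] lin_scale[OF vop_lin_left, symmetric] exp_creation_Euler by (simp add: nmode_simps lookup_sum lookup_fscale)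
      then show ?thesis by (simp add: y_def mult.left_commute[of "of_nat N"])
    qed
    also have "\<dots> = (\<Sum>n = 1..N. - ?a * y k0 (N - n))"
      unfolding sum_distrib_left
    proof (rule sum.cong[OF refl])
      fix n assume n: "n \<in> {1..N}"
      then have e: "k0 + int N - int n = k0 + int (N - n)" by auto
      have "(- 1) ^ N = (- 1 :: complex) ^ (N - n) * (- 1) ^ n" using n by (simp flip: power_add)
      moreover have "(- 1) ^ n * (- 1) ^ n = (1 :: complex)" by (simp flip: power_mult_distrib)
      ultimately have s: "(- 1) ^ N * (- 1) ^ n = (- 1 :: complex) ^ (N - n)" by (simp add: mult.assoc)
      have "(- 1) ^ N * (of_int b / (2 * of_nat p) *
         lookup (nmode p (heis p (- int n) (exp_creation p b (N - n) (expo g))) (k0 + int N) (expo d)) (0, K)) =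
         - ?a * (((- 1) ^ N * (- 1) ^ n) * lookup (nmode p (exp_creation p b (N - n) (expo g)) (k0 + int (N - n)) (expo d)) (0, K))"
      proof -
        have "n > 0" using n by simp
        show ?thesis unfolding h[OF \<open>n > 0\<close>] e by simp
      qed
      then show "(- 1) ^ N * (of_int b / (2 * of_nat p) *
         lookup (nmode p (heis p (- int n) (exp_creation p b (N - n) (expo g))) (k0 + int N) (expo d)) (0, K)) = - ?a * y k0 (N - n)"
        unfolding s y_def .
    qed
    finally show ?thesis by (simp add: sum_distrib_left)
  qed
  from binom_rec[of "y (k - int N)", OF this]
  have "y (k - int N) N = (- 1) ^ N * (?a gchoose N) * y (k - int N) 0" by blast
  then show ?thesis unfolding y_def by (auto simp: lookup_nmode_expo[OF p])
qed

lemma Vandermonde_any: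
  fixes e :: complex
  shows "Sum_any (\<lambda>j. if int j \<le> R then e ^ j * ch l j * (e ^ nat (R - int j) * ch a (nat (R - int j))) else 0) =
    (if R \<ge> 0 then e ^ nat R * ch (l + a) (nat R) else 0)"
proof (cases "R \<ge> 0")
  case True
  then have R: "R = int (nat R)" by simp
  have "Sum_any (\<lambda>j. if int j \<le> R then e ^ j * ch l j * (e ^ nat (R - int j) * ch a (nat (R - int j))) else 0) =
    (\<Sum>j\<le>nat R. if int j \<le> R then e ^ j * ch l j * (e ^ nat (R - int j) * ch a (nat (R - int j))) else 0)"
    by (rule Sum_any_le) auto
  also have "\<dots> = (\<Sum>j\<le>nat R. e ^ nat R * (ch l j * ch a (nat R - j)))"
  proof (rule sum.cong[OF refl])
    fix j assume j: "j \<in> {..nat R}"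
    then have "nat (R - int j) = nat R - j" "int j \<le> R" using True by auto
    moreover have "e ^ j * ch l j * (e ^ (nat R - j) * ch a (nat R - j)) = (e ^ j * e ^ (nat R - j)) * (ch l j * ch a (nat R - j))"
      by (simp only: mult_ac)
    moreover have "e ^ j * e ^ (nat R - j) = e ^ nat R" using j by (simp flip: power_add)
    ultimately show "(if int j \<le> R then e ^ j * ch l j * (e ^ nat (R - int j) * ch a (nat (R - int j))) else 0) = e ^ nat R * (ch l j * ch a (nat R - j))"
      by simp
  qed
  also have "\<dots> = e ^ nat R * ch (l + a) (nat R)"
    using gbinomial_Vandermonde[of "of_int l :: complex" "of_int a" "nat R"] by (simp add: atLeast0AtMost flip: sum_distrib_left)
  finally show ?thesis using True by simp
qed simp

text \<open>The residue theorem for z^m (z - 1)^n: the residue at z = 1 is the difference of the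
  coefficients of z^(-1) in the expansions for |z| > 1 and for |z| < 1. The proof runs through the
  signs of \<open>m\<close> and \<open>n\<close>, where everything becomes symmetry of ordinary
  binomial coefficients.\<close>

lemma scalar_Borcherds:
  "(if - n - 1 \<ge> 0 then ch m (nat (- n - 1)) else 0) =
   (if m + n + 1 \<ge> 0 then (- 1) ^ nat (m + n + 1) * ch n (nat (m + n + 1)) else 0)
   - sg n * (if - m - 1 \<ge> 0 then (- 1) ^ nat (- m - 1) * ch n (nat (- m - 1)) else 0)"
proof -
  have neg: "(- 1) ^ i * ch (- 1 - int a) i = of_nat ((a + i) choose i)" for a i
  proof -
    have "- int a - 1 - int 0 = - 1 - int a" by simp
    then show ?thesis using bn_choose[of a i 0] by (simp only: add_0_right)
  qed
  have neg': "ch (- 1 - int a) i = (- 1) ^ i * of_nat ((a + i) choose i)" for a i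
    unfolding neg[symmetric] mult.assoc[symmetric] by (simp flip: power_mult_distrib)
  have c: "\<exists>a. x = int a \<or> x = - 1 - int a" for x
  proof (cases "x \<ge> 0")
    case True
    then show ?thesis by (intro exI[of _ "nat x"]) simp
  next
    case False
    then show ?thesis by (intro exI[of _ "nat (- 1 - x)"]) simp
  qed
  consider a b where "n = int a" "m = int b" | a b where "n = int a" "m = - 1 - int b"
    | a b where "n = - 1 - int a" "m = int b" | a b where "n = - 1 - int a" "m = - 1 - int b"
    using c[of n] c[of m] by blast
  then show ?thesis
  proof cases
    case (1 a b)
    have e: "m + n + 1 = int (a + b + 1)" "\<not> - n - 1 \<ge> 0" "\<not> - m - 1 \<ge> 0" "a choose (a + b + 1) = 0" using 1 by auto
    show ?thesis unfolding e(1) nat_int 1(1) ch_nat e(4) using e(2,3) 1 by simp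
  next
    case (2 a b)
    show ?thesis
    proof (cases "b \<le> a")
      case True
      then have e: "m + n + 1 = int (a - b)" "- m - 1 = int b" using 2 by auto
      have "a choose (a - b) = a choose b" using True by (simp add: binomial_symmetric[symmetric])
      moreover have "(- 1) ^ a * (- 1) ^ b = (- 1 :: complex) ^ (a - b)"
      proof -
        have "(- 1) ^ a = (- 1 :: complex) ^ (a - b) * (- 1) ^ b" using True by (simp flip: power_add)
        moreover have "(- 1) ^ b * (- 1) ^ b = (1 :: complex)" by (simp flip: power_mult_distrib)
        ultimately show ?thesis by (simp add: mult.assoc)
      qed
      moreover have "\<not> - n - 1 \<ge> 0" using 2 by simp
      ultimately show ?thesis unfolding e nat_int unfolding 2(1) sg_nat ch_nat by (simp add: mult.assoc[symmetric])
    next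
      case False
      then have "\<not> m + n + 1 \<ge> 0" "- m - 1 = int b" "a choose b = 0" using 2 by auto
      then show ?thesis unfolding 2(1) sg_nat ch_nat by simp
    qed
  next
    case (3 a b)
    have e: "- n - 1 = int a" "\<not> - m - 1 \<ge> 0" using 3 by auto
    show ?thesis
    proof (cases "a \<le> b")
      case True
      then have f: "m + n + 1 = int (b - a)" using 3 by auto
      have "b choose (b - a) = b choose a" using True by (simp add: binomial_symmetric[symmetric])
      then show ?thesis unfolding f e(1) nat_int unfolding 3 neg ch_nat using True by simp
    next
      case False
      then have "\<not> m + n + 1 \<ge> 0" "b choose a = 0" using 3 by auto
      then show ?thesis unfolding e(1) nat_int 3(2) ch_nat using e(2) 3 by simp
    qed
  next
    case (4 a b)
    have e: "- n - 1 = int a" "- m - 1 = int b" "\<not> m + n + 1 \<ge> 0" using 4 by auto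
    have "sg n = - ((- 1) ^ a)" unfolding 4 by (simp add: sg_diff sg_nat sg_1 sg_minus)
    moreover have "(a + b) choose b = (b + a) choose a"
      using binomial_symmetric[of b "a + b"] by (simp add: add.commute)
    ultimately show ?thesis unfolding e(1,2) nat_int neg'[of b a, folded 4(2)] neg[of _ a, folded 4(1)] using e(3) by (simp add: 4)
  qed
qed

lemma borch_expo:
  assumes p: "p > 0" and bc: "4 * int p dvd b * c" and bd: "2 * int p dvd b * d" and cd: "2 * int p dvd c * d"
  shows "borch p (expo b) (expo c) (expo d)"
  unfolding borch_def
proof (intro allI)
  fix m l k
  let ?q = "2 * int p"
  define A B C where "A = b * c div ?q" and "B = b * d div ?q" and "C = c * d div ?q"
  \<comment> \<open>The defect of the identity. By \<open>heisD\<close> annihilation operators only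
    shift its indices, so by \<open>heis_separating\<close> it suffices that its coefficients at
    pure exponentials vanish.\<close>
  define D where "D m l k = TC p (expo b) (expo c) (expo d) m l k - (TA p (expo b) (expo c) (expo d) m l k - TB p (expo b) (expo c) (expo d) m l k)" for m l k
  obtain r where r: "b * c = 4 * int p * r" using bc by (auto simp: dvd_def)
  have bc': "?q dvd b * c" unfolding r by simp
  \<comment> \<open>The pairing of \<open>b\<close> and \<open>c\<close> is even; an odd one would
    make the two orders of the fields differ by a sign.\<close>
  have A2: "A = 2 * r" using p unfolding A_def r by simp
  have div: "b * (c + d) div ?q = A + B" "c * (b + d) div ?q = A + C" "(b + c) * d div ?q = B + C"
    unfolding A_def B_def C_def using bc' bd cd by (simp_all add: distrib_left distrib_right div_add mult.commute[of c b])
  have q: "of_int (x div ?q) = (of_int x / (2 * of_nat p) :: complex)" if "?q dvd x" for x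
    using that p by (auto simp: dvd_def)
  note fr = q[OF bc', folded A_def] q[OF bd, folded B_def]
  have heisD: "heis p i (D m l k) = fscale (of_int b) (D (m + i) l k) + fscale (of_int c) (D m l (k + i))" if "i > 0" for i m l k
    using that unfolding D_def heis_diff TA_heis[OF p] TB_heis[OF p] TC_heis[OF p]
    by (simp add: heis_expo T_0 fock.scale_right_diff_distrib algebra_simps)
  have sc: "lookup (D m l k) (0, K) = 0" for m l k K
  proof -
    \<comment> \<open>Conservation of degree and charge. Outside of \<open>?cond\<close> each of the
      three coefficients is zero.\<close>
    let ?cond = "m + l + k + 2 + A + B + C = 0 \<and> K = b + c + d"
    define L R M where "L = - l - 1 - A" and "R = - k - 1 - C" and "M = - m - 1 - B"
    have exA: "nmode p (expo c) k' (expo d) = (if k' + 1 + C \<le> 0 then exp_creation p c (nat (- k' - 1 - C)) (expo (c + d)) else 0)" for k'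
      unfolding nmode_expo[OF p expo_chg[OF singletonI]] ex_expo[OF p] C_def ..
    have exB: "nmode p (expo b) k' (expo d) = (if k' + 1 + B \<le> 0 then exp_creation p b (nat (- k' - 1 - B)) (expo (b + d)) else 0)" for k'
      unfolding nmode_expo[OF p expo_chg[OF singletonI]] ex_expo[OF p] B_def ..
    have exC: "nmode p (expo b) k' (expo c) = (if k' + 1 + A \<le> 0 then exp_creation p b (nat (- k' - 1 - A)) (expo (b + c)) else 0)" for k'
      unfolding nmode_expo[OF p expo_chg[OF singletonI]] ex_expo[OF p] A_def ..
    have TA: "lookup (TA p (expo b) (expo c) (expo d) m l k) (0, K) =
      (if ?cond then (if R \<ge> 0 then (- 1) ^ nat R * ch (l + A) (nat R) else 0) else 0)"
    proof -
      have "lookup (TA p (expo b) (expo c) (expo d) m l k) (0, K) =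
        Sum_any (\<lambda>j. if ?cond then (if int j \<le> R then (- 1) ^ j * ch l j * ((- 1) ^ nat (R - int j) * ch A (nat (R - int j))) else 0) else 0)"
        unfolding TA_def PW_def lookup_Sum_any[OF PW_fs[OF tr_fA]] lookup_fscale
      proof (rule Sum_any.cong)
        fix j
        have e: "- (k + int j) - 1 - C = R - int j" by (simp add: R_def)
        have "lookup (fA p (expo b) (expo c) (expo d) (m + l - int j) (k + int j)) (0, K) =
          (if ?cond \<and> int j \<le> R then (- 1) ^ nat (R - int j) * ch A (nat (R - int j)) else 0)"
        proof (cases "int j \<le> R")
          case True
          then have 1: "nmode p (expo c) (k + int j) (expo d) = exp_creation p c (nat (R - int j)) (expo (c + d))"
            unfolding exA e by (simp add: R_def)
          have 2: "(m + l - int j + 1 + (A + B) = int (nat (R - int j)) \<and> K = b + (c + d)) = ?cond"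
            using True by (auto simp: R_def)
          show ?thesis unfolding fA_def 1 lookup_expo_creation[OF p] div 2 fr(1)[symmetric] using True by simp
        next
          case False
          then have "\<not> k + int j + 1 + C \<le> 0" by (simp add: R_def)
          then show ?thesis using False unfolding fA_def exA by (simp add: nmode_simps)
        qed
        then show "(- 1) ^ j * ch l j * lookup (fA p (expo b) (expo c) (expo d) (m + l - int j) (k + int j)) (0, K) =
          (if ?cond then (if int j \<le> R then (- 1) ^ j * ch l j * ((- 1) ^ nat (R - int j) * ch A (nat (R - int j))) else 0) else 0)"
          by simp
      qed
      then show ?thesis using Vandermonde_any[of R "-1" l A] by (cases ?cond) auto
    qed
    have TB: "lookup (TB p (expo b) (expo c) (expo d) m l k) (0, K) =
      (if ?cond then sg l * (if M \<ge> 0 then (- 1) ^ nat M * ch (l + A) (nat M) else 0) else 0)"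
    proof -
      have "lookup (TB p (expo b) (expo c) (expo d) m l k) (0, K) =
        sg l * Sum_any (\<lambda>j. if ?cond then (if int j \<le> M then (- 1) ^ j * ch l j * ((- 1) ^ nat (M - int j) * ch A (nat (M - int j))) else 0) else 0)"
        unfolding TB_def PW_def lookup_fscale[of "sg l"] lookup_Sum_any[OF PW_fs[OF tr_fB]] lookup_fscale
      proof (rule arg_cong[of _ _ "(*) (sg l)"], rule Sum_any.cong)
        fix j
        have e: "- (m + int j) - 1 - B = M - int j" by (simp add: M_def)
        have "lookup (fB p (expo b) (expo c) (expo d) (k + l - int j) (m + int j)) (0, K) =
          (if ?cond \<and> int j \<le> M then (- 1) ^ nat (M - int j) * ch A (nat (M - int j)) else 0)"
        proof (cases "int j \<le> M")
          case True
          then have 1: "nmode p (expo b) (m + int j) (expo d) = exp_creation p b (nat (M - int j)) (expo (b + d))"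
            unfolding exB e by (simp add: M_def)
          have 2: "(k + l - int j + 1 + (A + C) = int (nat (M - int j)) \<and> K = c + (b + d)) = ?cond"
            using True by (auto simp: M_def)
          show ?thesis unfolding fB_def 1 lookup_expo_creation[OF p] div 2 mult.commute[of c b] fr(1)[symmetric] using True by simp
        next
          case False
          then have "\<not> m + int j + 1 + B \<le> 0" by (simp add: M_def)
          then show ?thesis using False unfolding fB_def exB by (simp add: nmode_simps)
        qed
        then show "(- 1) ^ j * ch l j * lookup (fB p (expo b) (expo c) (expo d) (k + l - int j) (m + int j)) (0, K) =
          (if ?cond then (if int j \<le> M then (- 1) ^ j * ch l j * ((- 1) ^ nat (M - int j) * ch A (nat (M - int j))) else 0) else 0)"
          by simp
      qed
      then show ?thesis using Vandermonde_any[of M "-1" l A] by (cases ?cond) auto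
    qed
    have TC: "lookup (TC p (expo b) (expo c) (expo d) m l k) (0, K) =
      (if ?cond then (if L \<ge> 0 then ch (m + B) (nat L) else 0) else 0)"
    proof -
      have "lookup (TC p (expo b) (expo c) (expo d) m l k) (0, K) =
        Sum_any (\<lambda>j. if ?cond then (if int j \<le> L then 1 ^ j * ch m j * (1 ^ nat (L - int j) * ch B (nat (L - int j))) else 0) else 0)"
        unfolding TC_def PW_def lookup_Sum_any[OF PW_fs[OF tr_fC]] lookup_fscale
      proof (rule Sum_any.cong)
        fix j
        have e: "- (l + int j) - 1 - A = L - int j" by (simp add: L_def)
        have "lookup (fC p (expo b) (expo c) (expo d) (k + m - int j) (l + int j)) (0, K) =
          (if ?cond \<and> int j \<le> L then 1 ^ nat (L - int j) * ch B (nat (L - int j)) else 0)"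
        proof (cases "int j \<le> L")
          case True
          then have 1: "nmode p (expo b) (l + int j) (expo c) = exp_creation p b (nat (L - int j)) (expo (b + c))"
            unfolding exC e by (simp add: L_def)
          have 2: "(k + m - int j + 1 + (B + C) = int (nat (L - int j)) \<and> K = b + c + d) = ?cond"
            using True by (auto simp: L_def)
          show ?thesis unfolding fC_def 1 lookup_creation_expo[OF p] div 2 fr(2)[symmetric] using True by simp
        next
          case False
          then have "\<not> l + int j + 1 + A \<le> 0" by (simp add: L_def)
          then show ?thesis using False unfolding fC_def exC by (simp add: nmode_simps)
        qed
        then show "1 ^ j * ch m j * lookup (fC p (expo b) (expo c) (expo d) (k + m - int j) (l + int j)) (0, K) =
          (if ?cond then (if int j \<le> L then 1 ^ j * ch m j * (1 ^ nat (L - int j) * ch B (nat (L - int j))) else 0) else 0)"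
          by simp
      qed
      then show ?thesis using Vandermonde_any[of L 1 m B] by (cases ?cond) auto
    qed
    have sgA: "sg (l + A) = sg l" unfolding A2 by (simp add: sg_def)
    show ?thesis
    proof (cases ?cond)
      case True
      then have e: "- (l + A) - 1 = L" "- (m + B) - 1 = M" "(m + B) + (l + A) + 1 = R"
        by (auto simp: L_def M_def R_def)
      show ?thesis
        using scalar_Borcherds[of "l + A" "m + B", unfolded e sgA]
        unfolding D_def lookup_minus TA TB TC if_P[OF True] by (simp only: diff_self)
    next
      case False
      show ?thesis unfolding D_def lookup_minus TA TB TC if_not_P[OF False] by simp
    qed
  qed
  have lf: "lin (foldr (heis p) xs)" for xs
  proof (induction xs)
    case (Cons x xs)
    have "foldr (heis p) (x # xs) = (\<lambda>v. heis p x (foldr (heis p) xs v))" by auto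
    then show ?case using lin_comp[OF heis_lin Cons] by simp
  qed (simp add: lin_id id_def)
  have "D m l k = 0"
  proof (rule heis_separating[OF p])
    fix xs :: "int list" and K assume "\<forall>i\<in>set xs. i > 0"
    then show "lookup (foldr (heis p) xs (D m l k)) (0, K) = 0"
    proof (induction xs arbitrary: m l k rule: rev_induct)
      case (snoc i xs)
      then show ?case by (simp add: heisD lin_add[OF lf] lin_scale[OF lf] lookup_add lookup_fscale)
    qed (simp add: sc)
  qed
  then show "TC p (expo b) (expo c) (expo d) m l k = TA p (expo b) (expo c) (expo d) m l k - TB p (expo b) (expo c) (expo d) m l k"
    by (simp add: D_def)
qed

lemma T_lin:
  "lin (\<lambda>w. TA p u v w m l k)" "lin (\<lambda>v. TA p u v w m l k)" "lin (\<lambda>u. TA p u v w m l k)"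
  "lin (\<lambda>w. TB p u v w m l k)" "lin (\<lambda>v. TB p u v w m l k)" "lin (\<lambda>u. TB p u v w m l k)"
  "lin (\<lambda>w. TC p u v w m l k)" "lin (\<lambda>v. TC p u v w m l k)" "lin (\<lambda>u. TC p u v w m l k)"
proof -
  have PWlin: "lin (\<lambda>x. PW e n (F x) a b)" if "\<And>x. tr (F x)" "\<And>a b. lin (\<lambda>x. F x a b)" for F e n a b
  proof (rule linI)
    fix x y c
    have "F (x + y) = (\<lambda>a b. F x a b + F y a b)" using lin_add[OF that(2)] by (simp add: fun_eq_iff)
    then show "PW e n (F (x + y)) a b = PW e n (F x) a b + PW e n (F y) a b"
      by (simp only: PW_add[OF that(1) that(1)])
    have "F (fscale c x) = (\<lambda>a b. fscale c (F x a b))" using lin_scale[OF that(2)] by (simp add: fun_eq_iff)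
    then show "PW e n (F (fscale c x)) a b = fscale c (PW e n (F x) a b)"
      by (simp only: PW_lin[OF that(1) lin_fscale])
  qed
  show "lin (\<lambda>w. TA p u v w m l k)" "lin (\<lambda>v. TA p u v w m l k)" "lin (\<lambda>u. TA p u v w m l k)"
    unfolding TA_def
    by (rule PWlin[OF tr_fA], rule linI, simp add: fA_def nmode_simps, simp add: fA_def nmode_simps)+
  show "lin (\<lambda>w. TB p u v w m l k)" "lin (\<lambda>v. TB p u v w m l k)" "lin (\<lambda>u. TB p u v w m l k)"
    unfolding TB_def
    by (rule lin_smult, rule PWlin[OF tr_fB], rule linI, simp add: fB_def nmode_simps, simp add: fB_def nmode_simps)+
  show "lin (\<lambda>w. TC p u v w m l k)" "lin (\<lambda>v. TC p u v w m l k)" "lin (\<lambda>u. TC p u v w m l k)"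
    unfolding TC_def
    by (rule PWlin[OF tr_fC], rule linI, simp add: fC_def nmode_simps, simp add: fC_def nmode_simps)+
qed

lemma borch_lin:
  "borch p u v w \<Longrightarrow> borch p u v w' \<Longrightarrow> borch p u v (w + w')" "borch p u v w \<Longrightarrow> borch p u v (fscale c w)"
  "borch p u v w \<Longrightarrow> borch p u v' w \<Longrightarrow> borch p u (v + v') w" "borch p u v w \<Longrightarrow> borch p u (fscale c v) w"
  "borch p u v w \<Longrightarrow> borch p u' v w \<Longrightarrow> borch p (u + u') v w" "borch p u v w \<Longrightarrow> borch p (fscale c u) v w"
  unfolding borch_def by (simp_all add: T_lin[THEN lin_add] T_lin[THEN lin_scale] fock.scale_right_diff_distrib)

text \<open>Integral pairings make all powers of x integral, and the even pairing between
  \<open>S1\<close> and \<open>S2\<close> makes the fields local without a sign. \<open>S3\<close>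
  is any set of charges pairing integrally with both, so the identity also holds on Fock modules
  outside the lattice. The induction on \<open>u\<close> is outermost, since contraction with an
  exponential is simpler afterwards.\<close>

theorem Borcherds:
  assumes p: "p > 0" and u: "u \<in> chg S1" and v: "v \<in> chg S2" and w: "w \<in> chg S3"
    and dvd: "\<And>a b. a \<in> S1 \<Longrightarrow> b \<in> S2 \<Longrightarrow> 4 * int p dvd a * b" "\<And>a b. a \<in> S1 \<Longrightarrow> b \<in> S3 \<Longrightarrow> 2 * int p dvd a * b"
      "\<And>a b. a \<in> S2 \<Longrightarrow> b \<in> S3 \<Longrightarrow> 2 * int p dvd a * b"
  shows "borch p u v w"
proof -
  have 0: "borch p 0 v w" "borch p u 0 w" "borch p u v 0" for u v w
    by (auto simp: borch_def T_lin[THEN lin_0])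
  show ?thesis
  proof (cases "S1 = {} \<or> S2 = {} \<or> S3 = {}")
    case True
    then have "u = 0 \<or> v = 0 \<or> w = 0" using u v w chg_empty by metis
    then show ?thesis using 0 by auto
  next
    case False
    then have ne: "S1 \<noteq> {}" "S2 \<noteq> {}" "S3 \<noteq> {}" by auto
    have e3: "borch p (expo a) (expo b) w" if "a \<in> S1" "b \<in> S2" "w \<in> chg S3" for a b w
      using that(3) ne(3)
    proof (induction w rule: fock_induct)
      case (expo d)
      then show ?case using that by (intro borch_expo p dvd)
    next
      case (osc n u)
      show ?case unfolding borch_def
      proof (intro allI)
        fix m l k
        have u: "TC p (expo a) (expo b) u m l k = TA p (expo a) (expo b) u m l k - TB p (expo a) (expo b) u m l k" for m l k
          using osc unfolding borch_def by auto
        show "TC p (expo a) (expo b) (osc n * u) m l k = TA p (expo a) (expo b) (osc n * u) m l k - TB p (expo a) (expo b) (osc n * u) m l k"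
          using TA_heis[OF p, of "- 1 - int n" a b u m l k] TB_heis[OF p, of "- 1 - int n" a b u m l k] TC_heis[OF p, of "- 1 - int n" a b u m l k]
          unfolding u heis_diff osc_heis[of n _ p] by (simp add: fock.scale_right_diff_distrib algebra_simps)
      qed
    qed (auto intro: borch_lin)
    have e2: "borch p (expo a) v w" if "a \<in> S1" "v \<in> chg S2" "w \<in> chg S3" for a v w
      using that(2) ne(2) that(3)
    proof (induction v arbitrary: w rule: fock_induct)
      case (expo d)
      then show ?case using that e3 by blast
    next
      case (osc n u)
      then show ?case by (intro borch_osc_mid p heis_chg) (auto intro: heis_chg)
    qed (auto intro: borch_lin)
    show ?thesis using u ne(1) v w
    proof (induction u arbitrary: v w rule: fock_induct)
      case (expo d)
      then show ?case using e2 by blast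
    next
      case (osc n u)
      then show ?case by (intro borch_osc_left p) (auto intro: heis_chg)
    qed (auto intro: borch_lin)
  qed
qed

section \<open>Commutator formula, associator formula, vacuum and translation\<close>

lemma borch_sum:
  assumes "borch p u v w"
  shows "Sum_any (\<lambda>j. fscale (ch m j) (nmode p (nmode p u (l + int j) v) (m + k - int j) w)) =
    Sum_any (\<lambda>j. fscale ((- 1) ^ j * ch l j) (nmode p u (m + l - int j) (nmode p v (k + int j) w)))
    - fscale (sg l) (Sum_any (\<lambda>j. fscale ((- 1) ^ j * ch l j) (nmode p v (l + k - int j) (nmode p u (m + int j) w))))"
  using assms[unfolded borch_def, rule_format, of m l k]
  unfolding TA_def TB_def TC_def PW_def fA_def fB_def fC_def by (simp add: add.commute)

lemma Sum_any_0: "Sum_any (\<lambda>j::nat. fscale (c j * ch 0 j) (f j)) = fscale (c 0) (f 0)"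
proof -
  have "Sum_any (\<lambda>j::nat. fscale (c j * ch 0 j) (f j)) = (\<Sum>j<1. fscale (c j * ch 0 j) (f j))"
    by (rule Sum_any_lt) (simp add: gbinomial_0_left)
  then show ?thesis by simp
qed

lemma borch_comm:
  assumes "borch p u v w"
  shows "nmode p u m (nmode p v k w) = nmode p v k (nmode p u m w)
    + Sum_any (\<lambda>j. fscale (ch m j) (nmode p (nmode p u (int j) v) (m + k - int j) w))"
  using borch_sum[OF assms, of m 0 k] unfolding Sum_any_0 by (simp add: sg_def)

lemma borch_assoc:
  assumes "borch p u v w"
  shows "nmode p (nmode p u l v) k w =
    Sum_any (\<lambda>j. fscale ((- 1) ^ j * ch l j) (nmode p u (l - int j) (nmode p v (k + int j) w)))
    - fscale (sg l) (Sum_any (\<lambda>j. fscale ((- 1) ^ j * ch l j) (nmode p v (l + k - int j) (nmode p u (int j) w))))"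
  using borch_sum[OF assms, of 0 l k] Sum_any_0[of "\<lambda>_. 1" "\<lambda>j. nmode p (nmode p u (l + int j) v) (0 + k - int j) w"] by simp

lemma Sum_any_zero: "(\<And>i. f i = 0) \<Longrightarrow> Sum_any f = 0"
  by simp

lemma op_exp_trivial: "(\<And>n v. A n v = 0) \<Longrightarrow> op_exp A N v = (if N = 0 then v else 0)"
proof -
  assume A: "\<And>n v. A n v = 0"
  have "op_pow A j N v = (if j = 0 \<and> N = 0 then v else 0)" for j by (cases j) (simp_all add: A)
  then show ?thesis by (simp add: op_exp_def)
qed

lemma expo_0: "expo 0 = 1"
  by (simp add: expo_def flip: single_one zero_prod_def)

lemma one_chg: "0 \<in> S \<Longrightarrow> 1 \<in> chg S"
  using expo_chg[of 0 S] by (simp add: expo_0)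

lemma nmode_one:
  assumes p: "p > 0"
  shows "nmode p 1 m v = (if m = - 1 then v else 0)"
proof (rule fock_basis_induct[OF chg_UNIV[of v]])
  fix \<mu> :: "nat \<Rightarrow>\<^sub>0 nat" and l :: int
  let ?v = "single (\<mu>, l) 1 :: fock"
  have v: "?v \<in> chg {l}" by (simp add: single_chg)
  have c: "exp_creation p 0 N w = (if N = 0 then w else 0)" "exp_annihilation p 0 N w = (if N = 0 then w else 0)" for N w
    unfolding exp_creation_def exp_annihilation_def by (rule op_exp_trivial, simp)+
  have "ex p 0 0 m ?v = (\<Sum>j<1. if int j \<ge> m + 1 + 0
     then exp_creation p 0 (nat (int j - m - 1 - 0)) (exp_annihilation p 0 j (expo 0 * ?v)) else 0)"
    unfolding ex_def by (rule Sum_any_lt) (simp add: c)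
  also have "\<dots> = (if m = - 1 then ?v else 0)"
    unfolding One_nat_def lessThan_Suc lessThan_0 by (auto simp: c expo_0)
  finally show "nmode p 1 m ?v = (if m = - 1 then ?v else 0)"
    using nmode_expo[OF p v, of 0 m] by (simp add: expo_0)
qed (auto simp: nmode_simps)

lemma heis_one: "heis p i 1 = (if i < 0 then osc (nat (- i - 1)) else 0)"
  using heis_expo[of p i 0] by (simp add: expo_0)

lemma nmode_creation:
  assumes p: "p > 0"
  shows "n \<ge> 0 \<Longrightarrow> nmode p u n 1 = 0" "nmode p u (- 1) 1 = u"
proof -
  have s: "Sum_any (\<lambda>i. fscale (bn n i) (nmode p u (m - 1 - int n - int i) (heis p (int i) 1))) = 0" for n m u
    by (simp add: heis_one nmode_simps)
  have "u \<in> chg UNIV" "(UNIV :: int set) \<noteq> {}" by (auto intro: chg_UNIV)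
  then have "(\<forall>n\<ge>0. nmode p u n 1 = 0) \<and> nmode p u (- 1) 1 = u"
  proof (induction u rule: fock_induct)
    case (expo k)
    have "nmode p (expo k) n 1 = (if n + 1 \<le> 0 then exp_creation p k (nat (- n - 1)) (expo k) else 0)" for n
      using nmode_expo[OF p expo_chg[OF singletonI], of k n 0] ex_expo[OF p, of k 0 n 0] by (simp add: expo_0)
    then show ?case by simp
  next
    case (osc m u)
    have eq: "nmode p (osc m * u) n 1 = Sum_any (\<lambda>i. fscale (bn m i) (heis p (- 1 - int m - int i) (nmode p u (n + int i) 1)))" for n
      by (simp add: nmode_osc s)
    have "nmode p (osc m * u) n 1 = 0" if "n \<ge> 0" for n
      unfolding eq by (rule Sum_any_zero) (use osc that in simp)
    moreover have "nmode p (osc m * u) (- 1) 1 = osc m * u"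
      unfolding eq by (subst Sum_any_lt[of 1]) (use osc in \<open>auto simp: bn_def osc_heis[of _ u p]\<close>)
    ultimately show ?case by blast
  qed (simp_all add: nmode_simps)
  then show "n \<ge> 0 \<Longrightarrow> nmode p u n 1 = 0" "nmode p u (- 1) 1 = u" by blast+
qed

lemma ch_m2: "(- 1) ^ j * ch (- 2) j = of_nat (j + 1)"
  using bn_eq[of 1 j] by (simp add: bn_def)

lemma Sum_any_single: "(\<And>j. j \<noteq> i \<Longrightarrow> f j = 0) \<Longrightarrow> Sum_any f = f i" for f :: "nat \<Rightarrow> fock"
  by (subst Sum_any.expand_superset[of "{i}"]) auto

text \<open>The translation operator. \<open>vir_m1\<close> identifies it with L(-1); the present
  form is the one to which the associator formula applies directly.\<close>

definition tran :: "nat \<Rightarrow> fock \<Rightarrow> fock" where "tran p u = nmode p u (- 2) 1"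

lemma tran_lin: "lin (tran p)"
  unfolding tran_def[abs_def] by (rule vop_lin_left)

text \<open>The associator formula with \<open>v = 1\<close> and \<open>l = -2\<close>. Only one
  term survives, in the first sum for \<open>k < 0\<close> and in the second for
  \<open>k > 0\<close>.\<close>

lemma tran_nmode:
  assumes p: "p > 0" and b: "borch p u 1 w"
  shows "nmode p (tran p u) k w = fscale (- of_int k) (nmode p u (k - 1) w)"
proof -
  have 1: "Sum_any (\<lambda>j. fscale ((- 1) ^ j * ch (- 2) j) (nmode p u (- 2 - int j) (nmode p 1 (k + int j) w))) =
    (if k < 0 then fscale (- of_int k) (nmode p u (k - 1) w) else 0)"
  proof (cases "k < 0")
    case True
    then have e: "int (nat (- 1 - k)) = - 1 - k" by simp
    have "Sum_any (\<lambda>j. fscale ((- 1) ^ j * ch (- 2) j) (nmode p u (- 2 - int j) (nmode p 1 (k + int j) w))) =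
      fscale ((- 1) ^ nat (- 1 - k) * ch (- 2) (nat (- 1 - k))) (nmode p u (- 2 - int (nat (- 1 - k))) (nmode p 1 (k + int (nat (- 1 - k))) w))"
      by (rule Sum_any_single) (auto simp: nmode_one[OF p] nmode_simps)
    also have "\<dots> = fscale (of_int (int (nat (- 1 - k)) + 1)) (nmode p u (k - 1) w)"
    proof -
      have e2: "of_nat (nat (- 1 - k) + 1) = (of_int (int (nat (- 1 - k)) + 1) :: complex)" by simp
      have e3: "- 2 - (- 1 - k) = k - 1" "k + (- 1 - k) = - 1" by simp_all
      show ?thesis unfolding ch_m2 e2 e e3 nmode_one[OF p] by simp
    qed
    finally have X: "Sum_any (\<lambda>j. fscale ((- 1) ^ j * ch (- 2) j) (nmode p u (- 2 - int j) (nmode p 1 (k + int j) w))) =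
      fscale (of_int (int (nat (- 1 - k)) + 1)) (nmode p u (k - 1) w)" .
    have "int (nat (- 1 - k)) + 1 = - k" using True by simp
    then show ?thesis unfolding X by (simp only: True if_True of_int_minus)
  next
    case False
    then show ?thesis by (subst Sum_any_zero) (auto simp: nmode_one[OF p] nmode_simps)
  qed
  have 2: "Sum_any (\<lambda>j. fscale ((- 1) ^ j * ch (- 2) j) (nmode p 1 (- 2 + k - int j) (nmode p u (int j) w))) =
    (if k > 0 then fscale (of_int k) (nmode p u (k - 1) w) else 0)"
  proof (cases "k > 0")
    case True
    then have e: "int (nat (k - 1)) = k - 1" by simp
    have f: "1 + complex_of_nat (nat (k - 1)) = of_int k" using True of_nat_nat[of "k - 1", where ?'a = complex] by simp
    have "Sum_any (\<lambda>j. fscale ((- 1) ^ j * ch (- 2) j) (nmode p 1 (- 2 + k - int j) (nmode p u (int j) w))) =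
      fscale ((- 1) ^ nat (k - 1) * ch (- 2) (nat (k - 1))) (nmode p 1 (- 2 + k - int (nat (k - 1))) (nmode p u (int (nat (k - 1))) w))"
      by (rule Sum_any_single) (auto simp: nmode_one[OF p])
    also have "\<dots> = fscale (of_int (int (nat (k - 1)) + 1)) (nmode p u (k - 1) w)"
      unfolding ch_m2 e using f by (simp add: nmode_one[OF p] e)
    also have "int (nat (k - 1)) + 1 = k" using True by simp
    finally show ?thesis using True by simp
  next
    case False
    then show ?thesis by (subst Sum_any_zero) (auto simp: nmode_one[OF p])
  qed
  show ?thesis unfolding tran_def borch_assoc[OF b] 1 2 by (cases "k = 0") (auto simp: sg_def)
qed

section \<open>The Virasoro operators and gradings\<close>

abbreviation vir :: "nat \<Rightarrow> int \<Rightarrow> fock \<Rightarrow> fock" where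
  "vir p n \<equiv> nmode p (conformal p) (n + 1)"

lemma osc_chg0: "osc n \<in> chg {0}"
  unfolding osc_def by (rule single_chg) simp

lemma conformal_chg: "conformal p \<in> chg {0}"
  unfolding conformal_def power2_eq_square by (intro chg_add chg_scale osc_chg osc_chg0)

lemma borch_0:
  assumes "p > 0" "u \<in> chg {0}" "v \<in> chg S" "w \<in> chg T" "\<And>a b. a \<in> S \<Longrightarrow> b \<in> T \<Longrightarrow> 2 * int p dvd a * b"
  shows "borch p u v w"
  by (rule Borcherds[OF assms(1-4)]) (auto intro: assms(5))

lemma borch_1:
  assumes "p > 0" "u \<in> chg S" "w \<in> chg T" "\<And>a b. a \<in> S \<Longrightarrow> b \<in> T \<Longrightarrow> 2 * int p dvd a * b"
  shows "borch p u 1 w"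
  by (rule Borcherds[OF assms(1,2) one_chg[OF singletonI] assms(3)]) (auto intro: assms(4))

lemma nmode_osc0: "p > 0 \<Longrightarrow> nmode p (osc 0) m v = heis p m v"
proof -
  assume p: "p > 0"
  have 1: "Sum_any (\<lambda>i. fscale (bn 0 i) (heis p (- 1 - int 0 - int i) (nmode p 1 (m + int i) v))) = (if m < 0 then heis p m v else 0)"
  proof (cases "m < 0")
    case True
    then have "Sum_any (\<lambda>i. fscale (bn 0 i) (heis p (- 1 - int 0 - int i) (nmode p 1 (m + int i) v))) =
      fscale (bn 0 (nat (- 1 - m))) (heis p (- 1 - int 0 - int (nat (- 1 - m))) (nmode p 1 (m + int (nat (- 1 - m))) v))"
      by (intro Sum_any_single) (auto simp: nmode_one[OF p])
    then show ?thesis using True by (simp add: bn_def nmode_one[OF p])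
  next
    case False
    then show ?thesis by (subst Sum_any_zero) (auto simp: nmode_one[OF p])
  qed
  have 2: "Sum_any (\<lambda>i. fscale (bn 0 i) (nmode p 1 (m - 1 - int 0 - int i) (heis p (int i) v))) = (if m < 0 then 0 else heis p m v)"
  proof (cases "m < 0")
    case True
    then show ?thesis by (subst Sum_any_zero) (auto simp: nmode_one[OF p])
  next
    case False
    then have "Sum_any (\<lambda>i. fscale (bn 0 i) (nmode p 1 (m - 1 - int 0 - int i) (heis p (int i) v))) =
      fscale (bn 0 (nat m)) (nmode p 1 (m - 1 - int 0 - int (nat m)) (heis p (int (nat m)) v))"
      by (intro Sum_any_single) (auto simp: nmode_one[OF p])
    then show ?thesis using False by (simp add: bn_def nmode_one[OF p])
  qed
  show ?thesis using nmode_osc[of p 0 1 m v] unfolding 1 2 by simp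
qed

lemma tran_osc: "p > 0 \<Longrightarrow> tran p (osc n * u) = osc n * tran p u + fscale (of_nat (n + 1)) (osc (n + 1) * u)"
proof -
  assume p: "p > 0"
  have "Sum_any (\<lambda>i. fscale (bn n i) (heis p (- 1 - int n - int i) (nmode p u (- 2 + int i) 1))) =
    (\<Sum>i<2. fscale (bn n i) (heis p (- 1 - int n - int i) (nmode p u (- 2 + int i) 1)))"
    by (rule Sum_any_lt) (simp add: nmode_creation(1)[OF p])
  also have "\<dots> = osc n * tran p u + fscale (of_nat (n + 1)) (osc (n + 1) * u)"
  proof -
    have e: "- 1 - int n - 1 = - 1 - int (n + 1)" by simp
    show ?thesis unfolding numeral_2_eq_2 lessThan_Suc lessThan_0
      using nmode_creation(2)[OF p, of u] by (simp add: bn_def tran_def osc_heis[of _ _ p] e[simplified])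
  qed
  finally show ?thesis unfolding tran_def nmode_osc by (simp add: heis_one nmode_simps)
qed

lemma tran_expo: "p > 0 \<Longrightarrow> tran p (expo k) = fscale (of_int k / (2 * of_nat p)) (osc 0 * expo k)"
proof -
  assume p: "p > 0"
  have "tran p (expo k) = exp_creation p k 1 (expo k)"
    using nmode_expo[OF p expo_chg[OF singletonI], of k "- 2" 0] ex_expo[OF p, of k 0 "- 2" 0] by (simp add: expo_0 tran_def)
  also have "\<dots> = fscale (of_int k / (2 * of_nat p)) (heis p (- 1) (expo k))"
    using exp_creation_Euler[of 1 p k "expo k"] by simp
  finally show ?thesis by (simp add: heis_expo)
qed

lemma nmode_osc1: "p > 0 \<Longrightarrow> nmode p (osc 1) m v = fscale (- of_int m) (heis p (m - 1) v)"
proof -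
  assume p: "p > 0"
  have "tran p (osc 0) = osc 1" using tran_osc[OF p, of 0 1] tran_expo[OF p, of 0] by (simp add: expo_0)
  moreover have "borch p (osc 0) 1 v" by (rule borch_1[OF p osc_chg0 chg_UNIV]) simp
  ultimately show ?thesis using tran_nmode[OF p, of "osc 0" v m] by (simp add: nmode_osc0[OF p])
qed

lemma heis_conformal:
  assumes "p > 0" "j \<ge> 0"
  shows "heis p j (conformal p) = (if j = 1 then osc 0 else if j = 2 then fscale (2 * (of_nat p - 1)) 1 else 0)"
  using assms unfolding conformal_def heis_add heis_scale power2_eq_square heis_comm_neg
  by (cases "j = 1"; cases "j = 2")
     (auto simp: heis_one heis_comm_neg[of p _ _ 1, simplified] fscale_mult_right field_simps fock.scale_right_distrib simp flip: fock.scale_left_distrib)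

text \<open>The summand with \<open>osc 1\<close> in the conformal vector, the background charge,
  prevents the current from being primary; it is the source of the central term with factor
  \<open>p - 1\<close>.\<close>

lemma vir_heis:
  assumes p: "p > 0"
  shows "heis p i (vir p n v) = vir p n (heis p i v) + fscale (of_int i) (heis p (i + n) v)
     + (if i + n = 0 then fscale (of_int (i * (i - 1)) * (of_nat p - 1)) v else 0)"
proof -
  have "Sum_any (\<lambda>j. fscale (ch i j) (nmode p (heis p (int j) (conformal p)) (n + 1 + i - int j) v)) =
    (\<Sum>j<3. fscale (ch i j) (nmode p (heis p (int j) (conformal p)) (n + 1 + i - int j) v))"
    by (rule Sum_any_lt) (simp add: heis_conformal[OF p] nmode_simps)
  also have "\<dots> = fscale (of_int i) (heis p (i + n) v) + (if i + n = 0 then fscale (of_int (i * (i - 1)) * (of_nat p - 1)) v else 0)"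
  proof -
    have c2: "ch i 2 = of_int (i * (i - 1)) / 2" by (simp add: gbinomial_prod_rev numeral_2_eq_2)
    have c3: "ch i 2 * (2 * of_nat p - 2) = of_int (i * (i - 1)) * (of_nat p - 1)"
      unfolding c2 by (simp add: field_simps)
    show ?thesis unfolding numeral_3_eq_3 lessThan_Suc lessThan_0
      using c3 by (auto simp: heis_conformal[OF p] nmode_simps nmode_osc0[OF p] nmode_one[OF p] add.commute numeral_2_eq_2)
  qed
  finally show ?thesis unfolding heis_nmode[OF p, of i "conformal p" "n + 1"] by (simp add: add_ac)
qed

lemma vir_expo_aux:
  assumes p: "p > 0"
  shows "vir p n (expo k) = fscale (1 / (4 * of_nat p)) ((\<Sum>i<nat (- n). heis p (- 1 - int i) (heis p (n + 1 + int i) (expo k))) + fscale (of_int k) (heis p n (expo k)))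
     - fscale ((of_nat p - 1) * of_int (n + 1) / (2 * of_nat p)) (heis p n (expo k))"
proof -
  have 1: "Sum_any (\<lambda>i. fscale (bn 0 i) (heis p (- 1 - int 0 - int i) (nmode p (osc 0) (n + 1 + int i) (expo k)))) =
    (\<Sum>i<nat (- n). heis p (- 1 - int i) (heis p (n + 1 + int i) (expo k)))"
    by (subst Sum_any_lt[of "nat (- n)"]) (auto simp: nmode_osc0[OF p] heis_expo bn_def)
  have 2: "Sum_any (\<lambda>i. fscale (bn 0 i) (nmode p (osc 0) (n + 1 - 1 - int 0 - int i) (heis p (int i) (expo k)))) = fscale (of_int k) (heis p n (expo k))"
    by (subst Sum_any_lt[of 1]) (auto simp: nmode_osc0[OF p] heis_expo[of p "int _"] bn_def heis_scale heis_expo[of p 0 k])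
  show ?thesis
    unfolding conformal_def power2_eq_square lin_add[OF vop_lin_left] lin_scale[OF vop_lin_left] nmode_osc 1 2 nmode_osc1[OF p]
    by (simp add: heis_scale times_divide_eq_left del: of_int_add)
qed

lemma vir_expo:
  assumes p: "p > 0"
  shows "n > 0 \<Longrightarrow> vir p n (expo k) = 0"
    and "vir p 0 (expo k) = fscale (of_int (k * (k - 2 * int p + 2)) / (4 * of_nat p)) (expo k)"
    and "vir p (- 1) (expo k) = fscale (of_int k / (2 * of_nat p)) (osc 0 * expo k)"
    and "vir p (- 2) (expo k) = fscale (1 / (4 * of_nat p)) (osc 0 * (osc 0 * expo k)) + fscale (of_int (k + int p - 1) / (2 * of_nat p)) (osc 1 * expo k)"
    and "vir p (- 3) (expo k) = fscale (1 / (2 * of_nat p)) (osc 0 * (osc 1 * expo k)) + fscale (of_int (k + 2 * int p - 2) / (2 * of_nat p)) (osc 2 * expo k)"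
proof -
  show "n > 0 \<Longrightarrow> vir p n (expo k) = 0" unfolding vir_expo_aux[OF p] by (simp add: heis_expo)
  have p': "of_nat p \<noteq> (0 :: complex)" using p by simp
  show "vir p 0 (expo k) = fscale (of_int (k * (k - 2 * int p + 2)) / (4 * of_nat p)) (expo k)"
    unfolding vir_expo_aux[OF p] using p' by (simp add: heis_expo field_simps flip: fock.scale_left_diff_distrib)
  show "vir p (- 1) (expo k) = fscale (of_int k / (2 * of_nat p)) (osc 0 * expo k)"
    unfolding vir_expo_aux[OF p] using p'
    by (simp add: heis_expo heis_neg field_simps fock.scale_right_distrib fscale_mult_right flip: fock.scale_left_distrib)
  have v: "fscale c (a + fscale d b + fscale d b) - fscale e b = fscale c a + fscale (2 * c * d - e) b" for c d e a b
    by (simp add: fock.scale_right_distrib fock.scale_left_diff_distrib fock.scale_left_distrib algebra_simps flip: fock.scale_left_distrib)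
  have v': "fscale c (a + a + fscale d b + fscale d b) - fscale e b = fscale (2 * c) a + fscale (2 * c * d - e) b" for c d e a b
    unfolding v by (simp only: fock.scale_right_distrib mult_2 fock.scale_left_distrib)
  have "vir p (- 2) (expo k) = fscale (1 / (4 * of_nat p)) (osc 0 * (osc 0 * expo k) + fscale (of_int k) (osc 1 * expo k) + fscale (of_int k) (osc 1 * expo k))
    - fscale ((of_nat p - 1) * of_int (- 2 + 1) / (2 * of_nat p)) (osc 1 * expo k)"
    unfolding vir_expo_aux[OF p] by (simp add: heis_expo heis_neg numeral_2_eq_2 lessThan_Suc fscale_mult_right)
  then show "vir p (- 2) (expo k) = fscale (1 / (4 * of_nat p)) (osc 0 * (osc 0 * expo k)) + fscale (of_int (k + int p - 1) / (2 * of_nat p)) (osc 1 * expo k)"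
    unfolding v using p' by (simp add: diff_divide_distrib add_divide_distrib)
  have "vir p (- 3) (expo k) = fscale (1 / (4 * of_nat p)) (osc 0 * (osc 1 * expo k) + osc 0 * (osc 1 * expo k) + fscale (of_int k) (osc 2 * expo k) + fscale (of_int k) (osc 2 * expo k))
    - fscale ((of_nat p - 1) * of_int (- 3 + 1) / (2 * of_nat p)) (osc 2 * expo k)"
    unfolding vir_expo_aux[OF p] by (simp add: heis_expo heis_neg numeral_3_eq_3 lessThan_Suc fscale_mult_right mult.left_commute[of "osc (Suc 0)"] numeral_2_eq_2)
  then show "vir p (- 3) (expo k) = fscale (1 / (2 * of_nat p)) (osc 0 * (osc 1 * expo k)) + fscale (of_int (k + 2 * int p - 2) / (2 * of_nat p)) (osc 2 * expo k)"
    unfolding v' using p' by (simp add: diff_divide_distrib add_divide_distrib)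
qed

section \<open>Conformal weights and graded pieces\<close>

definition dg :: "(nat \<Rightarrow>\<^sub>0 nat) \<Rightarrow> nat" where
  "dg \<mu> = sum_mset (image_mset Suc (mset (mono_list \<mu>)))"

text \<open>The conformal weight of e^(k\<alpha>/2p). It is symmetric under the reflection of
  \<open>k\<close> into 2p - 2 - k.\<close>

definition hh :: "nat \<Rightarrow> int \<Rightarrow> complex" where
  "hh p k = of_int (k * (k - 2 * int p + 2)) / (4 * of_nat p)"

definition wtk :: "nat \<Rightarrow> (nat \<Rightarrow>\<^sub>0 nat) \<times> int \<Rightarrow> complex" where
  "wtk p \<kappa> = of_nat (dg (fst \<kappa>)) + hh p (snd \<kappa>)"

definition gr :: "nat \<Rightarrow> int \<Rightarrow> complex \<Rightarrow> fock set" where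
  "gr p k c = {v. v \<in> chg {k} \<and> vir p 0 v = fscale c v}"

lemma dg_0: "dg 0 = 0" by (simp add: dg_def mono_list_def)

lemma dg_add: "dg (\<mu> + single n 1) = Suc n + dg \<mu>"
  unfolding dg_def mset_mono_list by simp

lemma dg_eq_0: "dg \<mu> = 0 \<longleftrightarrow> \<mu> = 0"
proof (induction \<mu> rule: mindex_induct)
  case (add \<mu> n)
  have "\<mu> + single n 1 \<noteq> 0"
  proof
    assume "\<mu> + single n 1 = 0"
    then have "lookup (\<mu> + single n 1) n = 0" by simp
    then show False by (simp add: lookup_add)
  qed
  then show ?case by (simp only: dg_add) simp
qed (simp add: dg_0)

text \<open>L(-1) and the translation operator have the same commutators with creation operators and
  agree on exponentials.\<close>

lemma vir_m1:
  assumes p: "p > 0"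
  shows "vir p (- 1) u = tran p u"
proof -
  have "u \<in> chg UNIV" "(UNIV :: int set) \<noteq> {}" by (auto intro: chg_UNIV)
  then show ?thesis
  proof (induction u rule: fock_induct)
    case (expo k)
    then show ?case by (simp only: vir_expo(3)[OF p] tran_expo[OF p])
  next
    case (osc n u)
    have "osc n * vir p (- 1) u = vir p (- 1) (osc n * u) + fscale (of_int (- 1 - int n)) (osc (n + 1) * u)"
      using vir_heis[OF p, of "- 1 - int n" "- 1" u] unfolding osc_heis[of n _ p] osc_heis[of "n + 1" _ p] by (simp add: algebra_simps diff_diff_eq2) (simp add: add.commute minus_diff_commute)
    then have "vir p (- 1) (osc n * u) = osc n * tran p u - fscale (of_int (- 1 - int n)) (osc (n + 1) * u)"
      unfolding osc(2) by (simp add: algebra_simps)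
    moreover have "of_int (- 1 - int n) = - (of_nat (n + 1) :: complex)" by simp
    ultimately show ?case unfolding tran_osc[OF p] by (simp only: fock.scale_minus_left diff_minus_eq_add)
  qed (auto simp: nmode_simps lin_simps[OF tran_lin])
qed

lemma vir_0_single:
  assumes p: "p > 0"
  shows "vir p 0 (single (\<mu>, k) 1) = fscale (wtk p (\<mu>, k)) (single (\<mu>, k) 1)"
proof (induction \<mu> rule: mindex_induct)
  case zero
  then show ?case using vir_expo(2)[OF p, of k] by (simp add: wtk_def dg_0 hh_def expo_def)
next
  case (add \<mu> n)
  have s: "single (\<mu> + single n 1, k) 1 = osc n * (single (\<mu>, k) 1 :: fock)"
    by (simp add: osc_single)
  have "osc n * vir p 0 v = vir p 0 (osc n * v) + fscale (of_int (- 1 - int n)) (osc n * v)" for v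
    using vir_heis[OF p, of "- 1 - int n" 0 v] unfolding osc_heis[of n _ p] by simp
  then have "vir p 0 (osc n * v) = osc n * vir p 0 v - fscale (of_int (- 1 - int n)) (osc n * v)" for v
    by (metis add_diff_cancel_right')
  then have *: "vir p 0 (osc n * v) = osc n * vir p 0 v + fscale (of_nat (Suc n)) (osc n * v)" for v
    by (simp add: fock.scale_left_diff_distrib fock.scale_left_distrib)
  show ?case unfolding s * add wtk_def fst_conv snd_conv dg_add fscale_mult_right
    by (simp only: fock.scale_left_distrib[symmetric] of_nat_add add.commute add.left_commute)
qed

lemma lookup_vir_0:
  assumes p: "p > 0"
  shows "lookup (vir p 0 v) \<kappa> = wtk p \<kappa> * lookup v \<kappa>"
proof (rule fock_basis_induct[OF chg_UNIV[of v]])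
  show "lookup (vir p 0 (single (\<mu>, l) 1)) \<kappa> = wtk p \<kappa> * lookup (single (\<mu>, l) 1) \<kappa>" for \<mu> l
    unfolding vir_0_single[OF p] by (simp add: lookup_fscale lookup_single when_def)
qed (auto simp: nmode_simps lookup_add lookup_fscale distrib_left)

lemma gr_iff: "p > 0 \<Longrightarrow> v \<in> gr p k c \<longleftrightarrow> (\<forall>\<kappa>\<in>keys v. snd \<kappa> = k \<and> wtk p \<kappa> = c)"
  unfolding gr_def chg_def poly_mapping_eq_iff fun_eq_iff mem_Collect_eq lookup_vir_0 lookup_fscale
  by (auto simp: in_keys_iff)

lemma gr_chg: "v \<in> gr p k c \<Longrightarrow> v \<in> chg {k}"
  by (simp add: gr_def)

lemma gr_vir_0: "v \<in> gr p k c \<Longrightarrow> vir p 0 v = fscale c v"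
  by (simp add: gr_def)

lemma gr_closed:
  "0 \<in> gr p k c" "u \<in> gr p k c \<Longrightarrow> v \<in> gr p k c \<Longrightarrow> u + v \<in> gr p k c" "v \<in> gr p k c \<Longrightarrow> fscale a v \<in> gr p k c"
  by (auto simp: gr_def chg_0 chg_add chg_scale nmode_simps fock.scale_right_distrib mult.commute)

lemma expo_gr: "p > 0 \<Longrightarrow> c = hh p k \<Longrightarrow> expo k \<in> gr p k c"
  by (simp only: gr_def expo_chg vir_expo(2) hh_def mem_Collect_eq singletonI simp_thms)

text \<open>A monomial exceeds the weight of its exponential by its degree, so in each charge there
  is nothing below that weight and a line at it. Most later vanishing statements and scalar
  identities come from this.\<close>

lemma gr_low:
  assumes p: "p > 0" and v: "v \<in> gr p k (hh p k + of_int d)"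
  shows "d < 0 \<Longrightarrow> v = 0" "d = 0 \<Longrightarrow> v = fscale (lookup v (0, k)) (expo k)"
proof -
  have *: "snd \<kappa> = k \<and> int (dg (fst \<kappa>)) = d" if "\<kappa> \<in> keys v" for \<kappa>
  proof -
    from v that have "snd \<kappa> = k" "of_nat (dg (fst \<kappa>)) = (of_int d :: complex)"
      unfolding gr_iff[OF p] wtk_def by auto
    then show ?thesis using of_int_eq_iff[of "int (dg (fst \<kappa>))" d, where ?'a = complex] by simp
  qed
  show "v = 0" if "d < 0"
  proof -
    have "\<kappa> \<notin> keys v" for \<kappa> using *[of \<kappa>] that by linarith
    then have "keys v = {}" by blast
    then show ?thesis by simp
  qed
  show "v = fscale (lookup v (0, k)) (expo k)" if "d = 0"
  proof (rule poly_mapping_eqI)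
    fix \<kappa>
    have "lookup v \<kappa> = 0" if "\<kappa> \<noteq> (0, k)"
      using *[of \<kappa>] that \<open>d = 0\<close> dg_eq_0[of "fst \<kappa>"] by (cases \<kappa>) (auto simp: in_keys_iff)
    then show "lookup v \<kappa> = lookup (fscale (lookup v (0, k)) (expo k)) \<kappa>"
      by (auto simp: lookup_fscale expo_def lookup_single when_def)
  qed
qed

lemma lookup_heis_0: "lookup (heis p 0 v) \<kappa> = of_int (snd \<kappa>) * lookup v \<kappa>"
proof (rule fock_basis_induct[OF chg_UNIV[of v]])
  show "lookup (heis p 0 (single (\<mu>, l) 1)) \<kappa> = of_int (snd \<kappa>) * lookup (single (\<mu>, l) 1) \<kappa>" for \<mu> l
    unfolding heis_zero_single by (auto simp: lookup_single when_def)
qed (auto simp: heis_add heis_scale lookup_add lookup_fscale distrib_left)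

lemma chg_iff: "v \<in> chg {k} \<longleftrightarrow> heis p 0 v = fscale (of_int k) v"
proof
  assume "v \<in> chg {k}"
  then show "heis p 0 v = fscale (of_int k) v" by (rule heis_zero_chg)
next
  assume h: "heis p 0 v = fscale (of_int k) v"
  have "of_int (snd \<kappa>) * lookup v \<kappa> = of_int k * lookup v \<kappa>" for \<kappa>
    using arg_cong[OF h, of "\<lambda>v. lookup v \<kappa>"] by (simp add: lookup_heis_0 lookup_fscale)
  then show "v \<in> chg {k}" unfolding chg_def in_keys_iff by (auto simp: in_keys_iff)
qed

lemma nmode_chg1:
  assumes p: "p > 0" and u: "u \<in> chg {a}" and v: "v \<in> chg {b}"
  shows "nmode p u n v \<in> chg {a + b}"
proof -
  have "heis p 0 (nmode p u n v) = nmode p u n (heis p 0 v) + nmode p (heis p 0 u) n v"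
    unfolding heis_nmode[OF p] using Sum_any_0[of "\<lambda>_. 1" "\<lambda>j. nmode p (heis p (int j) u) (n + 0 - int j) v"] by simp
  then show ?thesis using u v unfolding chg_iff[of _ _ p] by (simp add: nmode_simps fock.scale_left_distrib add.commute)
qed

lemma chg_lin:
  assumes "lin f" "v \<in> chg S" "\<And>k v. k \<in> S \<Longrightarrow> v \<in> chg {k} \<Longrightarrow> f v \<in> chg T"
  shows "f v \<in> chg T"
  by (rule lin_chg[OF assms(1,2)]) (auto intro!: assms(3) single_chg)

lemma nmode_chg:
  assumes p: "p > 0" and u: "u \<in> chg S" and v: "v \<in> chg T" and *: "\<And>a b. a \<in> S \<Longrightarrow> b \<in> T \<Longrightarrow> a + b \<in> R"
  shows "nmode p u n v \<in> chg R"
proof (rule chg_lin[OF vop_lin_left u])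
  fix a u assume a: "a \<in> S" "u \<in> chg {a}"
  show "nmode p u n v \<in> chg R"
    by (rule chg_lin[OF nmode_lin v]) (use a * in \<open>auto intro: chg_mono[OF nmode_chg1[OF p a(2)]]\<close>)
qed

lemma vir_m1_nmode:
  assumes p: "p > 0" and "u \<in> chg S" "v \<in> chg T" "\<And>a b. a \<in> S \<Longrightarrow> b \<in> T \<Longrightarrow> 2 * int p dvd a * b"
  shows "vir p (- 1) (nmode p u n v) = nmode p u n (vir p (- 1) v) - fscale (of_int n) (nmode p u (n - 1) v)"
proof -
  have b: "borch p (conformal p) u v" "borch p u 1 v"
    using assms by (auto intro!: borch_0[OF p conformal_chg, of _ S _ T] borch_1[of _ _ S _ T])
  have "vir p (- 1) (nmode p u n v) = nmode p u n (vir p (- 1) v) + nmode p (vir p (- 1) u) n v"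
    using borch_comm[OF b(1), of 0 n] Sum_any_0[of "\<lambda>_. 1" "\<lambda>j. nmode p (nmode p (conformal p) (int j) u) (n - int j) v"] by simp
  then show ?thesis by (simp add: vir_m1[OF p, of u, simplified] tran_nmode[OF p b(2)])
qed

lemma ch_1: "ch 1 j = (if j = 0 then 1 else if j = 1 then 1 else 0)"
  using binomial_gbinomial[of 1 j, where ?'a = complex] by (cases "j \<le> 1") (auto simp: binomial_eq_0 le_Suc_eq)

lemma nmode_vir_0:
  assumes p: "p > 0" and u: "u \<in> chg S" and v: "v \<in> chg T" and d: "\<And>a b. a \<in> S \<Longrightarrow> b \<in> T \<Longrightarrow> 2 * int p dvd a * b"
  shows "vir p 0 (nmode p u n v) = nmode p u n (vir p 0 v) + nmode p (vir p 0 u) n v - fscale (of_int (n + 1)) (nmode p u n v)"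
proof -
  have b: "borch p (conformal p) u v" "borch p u 1 v"
    using assms by (auto intro!: borch_0[OF p conformal_chg, of _ S _ T] borch_1[of _ _ S _ T])
  have "Sum_any (\<lambda>j. fscale (ch 1 j) (nmode p (nmode p (conformal p) (int j) u) (1 + n - int j) v)) =
     (\<Sum>j<2. fscale (ch 1 j) (nmode p (nmode p (conformal p) (int j) u) (1 + n - int j) v))"
    by (rule Sum_any_lt) (simp only: ch_1, simp)
  also have "\<dots> = nmode p (vir p (- 1) u) (n + 1) v + nmode p (vir p 0 u) n v"
    unfolding numeral_2_eq_2 lessThan_Suc lessThan_0 ch_1 by (simp add: add_ac)
  finally show ?thesis
    using borch_comm[OF b(1), of 1 n] by (simp add: vir_m1[OF p, of u, simplified] tran_nmode[OF p b(2)] algebra_simps)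
qed

lemma nmode_gr:
  assumes p: "p > 0" and u: "u \<in> gr p a c" and v: "v \<in> gr p b d" and "2 * int p dvd a * b"
    and e: "e = c + d - of_int n - 1" "ab = a + b"
  shows "nmode p u n v \<in> gr p ab e"
proof -
  have "vir p 0 (nmode p u n v) = fscale e (nmode p u n v)"
    using nmode_vir_0[OF p gr_chg[OF u] gr_chg[OF v], of n] assms(4) gr_vir_0[OF u] gr_vir_0[OF v] unfolding e
    by (simp add: nmode_simps algebra_simps fock.scale_left_diff_distrib fock.scale_left_distrib)
  then show ?thesis using nmode_chg1[OF p gr_chg[OF u] gr_chg[OF v]] unfolding gr_def e(2) by simp
qed

lemma hh_0: "hh p 0 = 0" by (simp add: hh_def)

lemma one_gr: "p > 0 \<Longrightarrow> 1 \<in> gr p 0 0"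
  using expo_gr[of p 0 0] by (simp add: expo_0 hh_0)

lemma vir_m2_one: "p > 0 \<Longrightarrow> vir p (- 2) 1 = conformal p"
  by (simp add: nmode_creation)

lemma conformal_gr: "p > 0 \<Longrightarrow> conformal p \<in> gr p 0 2"
proof -
  assume p: "p > 0"
  have *: "single (\<mu>, 0) 1 \<in> gr p 0 2" if "dg \<mu> = 2" for \<mu>
    using that by (simp add: gr_iff[OF p] wtk_def hh_0)
  have "osc 0 * osc 0 = single (0 + single 0 1 + single 0 1, 0) 1"
    by (simp add: osc_def mult_single)
  then have "osc 0 * osc 0 \<in> gr p 0 2" using *[of "0 + single 0 1 + single 0 1"] by (simp only: dg_add dg_0)
  moreover have "osc 1 = single (0 + single 1 1, 0) 1" by (simp add: osc_def)
  then have "osc 1 \<in> gr p 0 2" using *[of "0 + single 1 1"] by (simp only: dg_add dg_0)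
  ultimately show ?thesis unfolding conformal_def power2_eq_square by (intro gr_closed(2,3))
qed

lemma vir_gr: "p > 0 \<Longrightarrow> v \<in> gr p k c \<Longrightarrow> d = c - of_int n \<Longrightarrow> vir p n v \<in> gr p k d"
  by (rule nmode_gr[OF _ conformal_gr]) simp_all

definition restr :: "((nat \<Rightarrow>\<^sub>0 nat) \<times> int \<Rightarrow> bool) \<Rightarrow> fock \<Rightarrow> fock" where
  "restr P v = (\<Sum>\<kappa>\<in>keys v. single \<kappa> (if P \<kappa> then lookup v \<kappa> else 0))"

lemma lookup_restr: "lookup (restr P v) \<kappa> = (if P \<kappa> then lookup v \<kappa> else 0)"
  by (auto simp: restr_def lookup_sum lookup_single when_def in_keys_iff)

lemma restr_lin: "lin (restr P)"
  by (rule linI; rule poly_mapping_eqI) (auto simp: lookup_restr lookup_add lookup_fscale)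

lemma restr_all: "(\<And>\<kappa>. \<kappa> \<in> keys v \<Longrightarrow> P \<kappa>) \<Longrightarrow> restr P v = v"
  by (rule poly_mapping_eqI) (auto simp: lookup_restr in_keys_iff)

lemma restr_none: "(\<And>\<kappa>. \<kappa> \<in> keys v \<Longrightarrow> \<not> P \<kappa>) \<Longrightarrow> restr P v = 0"
  by (rule poly_mapping_eqI) (auto simp: lookup_restr in_keys_iff)

text \<open>An operator that keeps weights and shifts charges by \<open>a\<close> carries the part
  selected by \<open>P\<close> to the part selected by \<open>R\<close>. Applied to the second
  screening, it shows that W(p) contains the homogeneous components of its elements.\<close>

lemma restr_operator:
  assumes f: "lin f" and v: "v \<in> chg S"
    and t: "\<And>k c w. k \<in> S \<Longrightarrow> w \<in> gr p k c \<Longrightarrow> f w \<in> gr p (k + a) c"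
    and PR: "\<And>\<kappa> \<kappa>'. wtk p \<kappa> = wtk p \<kappa>' \<Longrightarrow> snd \<kappa>' = snd \<kappa> + a \<Longrightarrow> P \<kappa> = R \<kappa>'" and p: "p > 0"
  shows "f (restr P v) = restr R (f v)"
proof (rule lin_eq_basis[OF lin_comp[OF f restr_lin] lin_comp[OF restr_lin f] v])
  fix \<mu> k assume k: "k \<in> S"
  let ?v = "single (\<mu>, k) 1 :: fock"
  have "?v \<in> gr p k (wtk p (\<mu>, k))" by (simp add: gr_iff[OF p])
  then have "f ?v \<in> gr p (k + a) (wtk p (\<mu>, k))" by (rule t[OF k])
  then have *: "P (\<mu>, k) = R \<kappa>" if "\<kappa> \<in> keys (f ?v)" for \<kappa>
    using that unfolding gr_iff[OF p] by (intro PR) auto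
  show "f (restr P ?v) = restr R (f ?v)"
  proof (cases "P (\<mu>, k)")
    case True
    then have "restr P ?v = ?v" "restr R (f ?v) = f ?v" using * by (auto intro!: restr_all)
    then show ?thesis by simp
  next
    case False
    then have "restr P ?v = 0" "restr R (f ?v) = 0" using * by (auto intro!: restr_none)
    then show ?thesis by (simp add: lin_0[OF f])
  qed
qed

section \<open>The triplet algebra\<close>

locale triplet_setting =
  fixes p :: nat
  assumes p2: "p \<ge> 2"
begin

abbreviation "md \<equiv> nmode p"
abbreviation "L n \<equiv> vir p n"
abbreviation "Q \<equiv> screening p"
abbreviation "Qt \<equiv> dual_screening p"
abbreviation "W \<equiv> triplet_space p"
abbreviation "XF \<equiv> triplet_F p"
abbreviation "XH \<equiv> triplet_H p"
abbreviation "XE \<equiv> triplet_E p"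
abbreviation "VS \<equiv> {k. 2 * int p dvd k}"
abbreviation "VL \<equiv> chg VS"

lemma p0: "p > 0" using p2 by simp

lemma p0': "of_nat p \<noteq> (0::complex)" using p0 by simp

lemma lattice_space_eq: "lattice_space p = VL"
  by (auto simp: lattice_space_def chg_def)

lemma VL_0: "0 \<in> VL" and VL_1: "1 \<in> VL" and VL_conformal: "conformal p \<in> VL"
  using chg_mono[OF conformal_chg, of VS] by (auto simp: chg_0 one_chg)

lemma VL_borch: "u \<in> VL \<Longrightarrow> v \<in> VL \<Longrightarrow> borch p u v w"
  by (rule Borcherds[OF p0 _ _ chg_UNIV]) (auto elim!: dvdE)

lemma VL_md: "u \<in> VL \<Longrightarrow> v \<in> VL \<Longrightarrow> md u n v \<in> VL"
  by (rule nmode_chg[OF p0]) auto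

lemma hh_screening: "hh p (2 * int p) = 1" "hh p (- 2) = 1"
  using p0' by (simp_all add: hh_def field_simps)

text \<open>The zero mode of a primary field of weight one commutes with the Virasoro operators,
  because the commutator of L(n) with the field is a total derivative.\<close>

lemma screening_vir:
  assumes b: "hh p b = 1" and w: "w \<in> chg T" and d: "\<And>t. t \<in> T \<Longrightarrow> 2 * int p dvd b * t"
  shows "L n (md (expo b) 0 w) = md (expo b) 0 (L n w)"
proof -
  have e: "borch p (conformal p) (expo b) w" "borch p (expo b) 1 w"
    using d by (auto intro!: borch_0[OF p0 conformal_chg expo_chg[OF singletonI] w] borch_1[OF p0 expo_chg[OF singletonI] w])
  have z: "md (conformal p) (int j) (expo b) = 0" if "j \<ge> 2" for j
    using vir_expo(1)[OF p0, of "int j - 1" b] that by simp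
  have o: "md (conformal p) 1 (expo b) = expo b" using vir_expo(2)[OF p0, of b] b by (simp add: hh_def)
  have "Sum_any (\<lambda>j. fscale (ch (n + 1) j) (md (md (conformal p) (int j) (expo b)) (n + 1 + 0 - int j) w)) =
     (\<Sum>j<2. fscale (ch (n + 1) j) (md (md (conformal p) (int j) (expo b)) (n + 1 + 0 - int j) w))"
    by (rule Sum_any_lt) (simp add: z nmode_simps)
  also have "\<dots> = md (L (- 1) (expo b)) (n + 1) w + fscale (of_int (n + 1)) (md (expo b) n w)"
    unfolding numeral_2_eq_2 lessThan_Suc lessThan_0 by (simp add: o add_ac)
  also have "\<dots> = 0" using tran_nmode[OF p0 e(2), of "n + 1"] unfolding vir_m1[OF p0] by (simp flip: fock.scale_left_distrib)
  finally show ?thesis using borch_comm[OF e(1), of "n + 1" 0] by simp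
qed

lemma Q_def: "Q = md (expo (2 * int p)) 0" and Qt_def: "Qt = md (expo (- 2)) 0"
  by (simp_all add: screening_def dual_screening_def)

lemma Q_lin: "lin Q" and Qt_lin: "lin Qt"
  unfolding Q_def Qt_def by (rule nmode_lin)+

lemma Q_vir: "L n (Q w) = Q (L n w)"
  unfolding Q_def by (rule screening_vir[OF hh_screening(1) chg_UNIV]) simp

lemma Qt_vir: "w \<in> VL \<Longrightarrow> L n (Qt w) = Qt (L n w)"
  unfolding Qt_def by (rule screening_vir[OF hh_screening(2)]) auto

lemma zero_mode_derivation:
  assumes "borch p a u v"
  shows "md a 0 (md u n v) = md (md a 0 u) n v + md u n (md a 0 v)"
  using borch_comm[OF assms, of 0 n] Sum_any_0[of "\<lambda>_. 1" "\<lambda>j. md (md a (int j) u) (0 + n - int j) v"]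
  by (simp add: add.commute)

lemma expo_VL: "expo (2 * int p * k) \<in> VL"
  by (rule expo_chg) simp

lemma Q_md: "u \<in> VL \<Longrightarrow> Q (md u n v) = md (Q u) n v + md u n (Q v)"
  unfolding Q_def using zero_mode_derivation[OF VL_borch[OF expo_VL[of 1]]] by simp

text \<open>The charge -\<alpha>/p is outside the lattice but pairs with it in even
  integers.\<close>

lemma Qt_borch: "u \<in> VL \<Longrightarrow> v \<in> VL \<Longrightarrow> borch p (expo (- 2)) u v"
  by (rule Borcherds[OF p0 expo_chg[OF singletonI]]) (auto elim!: dvdE)

lemma Qt_md: "u \<in> VL \<Longrightarrow> v \<in> VL \<Longrightarrow> Qt (md u n v) = md (Qt u) n v + md u n (Qt v)"
  unfolding Qt_def by (rule zero_mode_derivation[OF Qt_borch])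

lemma Q_VL: "v \<in> VL \<Longrightarrow> Q v \<in> VL"
  unfolding Q_def using VL_md[OF expo_VL[of 1]] by simp

lemma Q_gr: "v \<in> gr p k c \<Longrightarrow> l = k + 2 * int p \<Longrightarrow> Q v \<in> gr p l c"
  unfolding Q_def by (rule nmode_gr[OF p0 expo_gr[OF p0 hh_screening(1)[symmetric]]]) auto

lemma Qt_gr: "v \<in> gr p k c \<Longrightarrow> k \<in> VS \<Longrightarrow> Qt v \<in> gr p (k + - 2) c"
  unfolding Qt_def by (rule nmode_gr[OF p0 expo_gr[OF p0 hh_screening(2)[symmetric]]]) auto

lemma Q_vac: "Q 1 = 0" and Qt_vac: "Qt 1 = 0"
  unfolding Q_def Qt_def by (simp_all add: nmode_creation(1)[OF p0])

lemma Qt_conformal: "Qt (conformal p) = 0"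
  using Qt_vir[OF VL_1, of "- 2"] by (simp add: Qt_vac vir_m2_one[OF p0, simplified] nmode_simps)

text \<open>The residue of \<open>e ^ (-\<alpha>/p)\<close> against \<open>e ^ \<alpha>\<close> is a total derivative.\<close>

lemma Qt_Q:
  assumes v: "v \<in> VL"
  shows "Qt (Q v) = Q (Qt v)"
proof -
  let ?y = "expo (2 * int p - 2)"
  have "md (expo (- 2)) 0 (expo (2 * int p)) = exp_creation p (- 2) 1 ?y"
  proof -
    have "- 2 * (2 * int p) div (2 * int p) = - 2" by (rule nonzero_mult_div_cancel_right) (use p0 in simp)
    then show ?thesis using nmode_expo[OF p0 expo_chg[OF singletonI], of "- 2" 0 "2 * int p"]
      unfolding ex_expo[OF p0] by simp
  qed
  also have "\<dots> = fscale (- 1 / of_nat p) (osc 0 * ?y)"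
    using exp_creation_Euler[of 1 p "- 2" ?y] by (simp add: heis_expo)
  also have "\<dots> = fscale (- 1 / (of_nat p - 1)) (tran p ?y)"
  proof -
    have "of_nat p - 1 \<noteq> (0::complex)" using p2 by (metis diff_eq_diff_eq diff_self less_irrefl numeral_le_one_iff of_nat_1 of_nat_eq_iff right_minus_eq semiring_norm(69))
    then show ?thesis unfolding tran_expo[OF p0] using p0' by (simp add: field_simps)
  qed
  finally have "md (md (expo (- 2)) 0 (expo (2 * int p))) 0 v = 0"
    using tran_nmode[OF p0 borch_1[OF p0 expo_chg[OF singletonI] v], of "2 * int p - 2" 0] by (auto simp: nmode_simps)
  then show ?thesis unfolding Q_def Qt_def
    using zero_mode_derivation[OF Qt_borch[OF expo_VL[of 1] v], of 0] by simp
qed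

lemma W_iff: "v \<in> W \<longleftrightarrow> v \<in> VL \<and> Qt v = 0"
  by (simp add: triplet_space_def lattice_space_eq)

lemma W_VL: "v \<in> W \<Longrightarrow> v \<in> VL" by (simp add: W_iff)

lemma W_closed: "0 \<in> W" "u \<in> W \<Longrightarrow> v \<in> W \<Longrightarrow> u + v \<in> W" "v \<in> W \<Longrightarrow> fscale c v \<in> W"
  by (auto simp: W_iff lin_simps[OF Qt_lin] chg_0 intro: chg_add chg_scale)

lemma W_md: "u \<in> W \<Longrightarrow> v \<in> W \<Longrightarrow> md u n v \<in> W"
  by (simp add: W_iff VL_md Qt_md nmode_simps)

lemma W_Q: "v \<in> W \<Longrightarrow> Q v \<in> W"
  by (simp add: W_iff Q_VL Qt_Q lin_0[OF Q_lin])

lemma W_1: "1 \<in> W" by (simp add: W_iff VL_1 Qt_vac)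

lemma W_conformal: "conformal p \<in> W" by (simp add: W_iff VL_conformal Qt_conformal)

lemma XH_Q: "XH = Q XF" and XE_Q: "XE = Q XH"
  by (simp_all add: triplet_F_def triplet_H_def triplet_E_def)

lemma W_F: "XF \<in> W"
proof -
  have "Qt (expo (- 2 * int p)) = 0"
    unfolding Qt_def using nmode_expo[OF p0 expo_chg[OF singletonI], of "- 2" 0 "- 2 * int p"] p0
    by (simp add: ex_expo[OF p0])
  then show ?thesis using expo_VL[of "- 1"] by (simp add: W_iff triplet_F_def)
qed

lemma W_X: "X \<in> {XF, XH, XE} \<Longrightarrow> X \<in> W"
  using W_F W_Q by (auto simp: XH_Q XE_Q)

lemma X_gr:
  "XF \<in> gr p (- 2 * int p) (2 * of_nat p - 1)" "XH \<in> gr p 0 (2 * of_nat p - 1)" "XE \<in> gr p (2 * int p) (2 * of_nat p - 1)"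
proof -
  show F: "XF \<in> gr p (- 2 * int p) (2 * of_nat p - 1)"
    unfolding triplet_F_def by (rule expo_gr[OF p0]) (use p0' in \<open>simp add: hh_def field_simps\<close>)
  show H: "XH \<in> gr p 0 (2 * of_nat p - 1)" unfolding XH_Q by (rule Q_gr[OF F]) simp
  show "XE \<in> gr p (2 * int p) (2 * of_nat p - 1)" unfolding XE_Q by (rule Q_gr[OF H]) simp
qed

lemma X_weight: "X \<in> {XF, XH, XE} \<Longrightarrow> L 0 X = fscale (2 * of_nat p - 1) X"
  using X_gr gr_vir_0 by blast

lemma X_primary: "n > 0 \<Longrightarrow> X \<in> {XF, XH, XE} \<Longrightarrow> L n X = 0"
  using vir_expo(1)[OF p0, of n "- 2 * int p"] by (auto simp: XH_Q XE_Q triplet_F_def Q_vir lin_0[OF Q_lin])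

text \<open>\<open>Q XE\<close> has charge 2\<alpha>, where the weights start at 2p + 2, three above
  2p - 1.\<close>

lemma Q_XE: "Q XE = 0"
proof (rule gr_low(1)[OF p0])
  have "2 * of_nat p - 1 = hh p (4 * int p) + of_int (- 3)" using p0' by (simp add: hh_def field_simps)
  then show "Q XE \<in> gr p (4 * int p) (hh p (4 * int p) + of_int (- 3))" using Q_gr[OF X_gr(3), of "4 * int p"] by (simp only:) simp
qed simp

lemma restr_W:
  assumes "v \<in> W"
  shows "restr (\<lambda>\<kappa>. wtk p \<kappa> = c) v \<in> W" "restr (\<lambda>\<kappa>. wtk p \<kappa> = c \<and> snd \<kappa> = k) v \<in> W"
proof -
  have v: "v \<in> VL" "Qt v = 0" using assms by (auto simp: W_iff)
  have c: "restr P v \<in> VL" for P using v by (auto simp: chg_def in_keys_iff lookup_restr split: if_splits)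
  have t: "k \<in> VS \<Longrightarrow> w \<in> gr p k c \<Longrightarrow> Qt w \<in> gr p (k + - 2) c" for k c w by (rule Qt_gr)
  have "Qt (restr (\<lambda>\<kappa>. wtk p \<kappa> = c) v) = restr (\<lambda>\<kappa>. wtk p \<kappa> = c) (Qt v)"
    by (rule restr_operator[OF Qt_lin v(1) t]) (auto simp: p0)
  then show "restr (\<lambda>\<kappa>. wtk p \<kappa> = c) v \<in> W" using c v by (simp add: W_iff lin_0[OF restr_lin])
  have "Qt (restr (\<lambda>\<kappa>. wtk p \<kappa> = c \<and> snd \<kappa> = k) v) = restr (\<lambda>\<kappa>. wtk p \<kappa> = c \<and> snd \<kappa> = k - 2) (Qt v)"
    by (rule restr_operator[OF Qt_lin v(1) t]) (auto simp: p0)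
  then show "restr (\<lambda>\<kappa>. wtk p \<kappa> = c \<and> snd \<kappa> = k) v \<in> W" using c v by (simp add: W_iff lin_0[OF restr_lin])
qed

end

text \<open>The polynomial records that the zero mode of \<open>u\<close> acts on highest weight vectors of weight
  \<open>h\<close> as \<open>\<pi>(h)\<close> times the zero mode of \<open>Z\<close>.\<close>

inductive Rep :: "nat \<Rightarrow> fock \<Rightarrow> int \<Rightarrow> int \<Rightarrow> fock \<Rightarrow> complex poly \<Rightarrow> bool" for p Z z where
  base: "Rep p Z z z Z 1"
| vir: "Rep p Z z w u \<pi> \<Longrightarrow> n > 0 \<Longrightarrow> Rep p Z z (w + int n) (vir p (- int n) u) (Polynomial.smult ((- 1) ^ n) ([:of_int w, of_nat n - 1:] * \<pi>))"
| zero: "Rep p Z z w 0 0"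
| add: "Rep p Z z w u \<pi> \<Longrightarrow> Rep p Z z w v \<rho> \<Longrightarrow> Rep p Z z w (u + v) (\<pi> + \<rho>)"
| scale: "Rep p Z z w u \<pi> \<Longrightarrow> Rep p Z z w (fscale c u) (Polynomial.smult c \<pi>)"

text \<open>A factor that really depends on the weight costs weight at least two: for
  \<open>n = 1\<close> the linear polynomial is a constant.\<close>

lemma Rep_degree: "Rep p Z z w u \<pi> \<Longrightarrow> \<pi> = 0 \<or> 2 * int (degree \<pi>) \<le> w - z"
proof (induction rule: Rep.induct)
  case (vir w u \<pi> n)
  show ?case
  proof (cases "[:of_int w, of_nat n - 1:] * \<pi> = 0")
    case False
    then have "degree ([:of_int w, of_nat n - 1:] * \<pi>) = degree [:of_int w, of_nat n - 1 :: complex:] + degree \<pi>"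
      by (intro degree_mult_eq) auto
    moreover have "2 * int (degree [:of_int w, of_nat n - 1 :: complex:]) \<le> int n" using vir(2)
      by (cases "n = 1") auto
    ultimately show ?thesis using vir False by auto
  qed simp
next
  case (add w u \<pi> v \<rho>)
  have "degree (\<pi> + \<rho>) \<le> max (degree \<pi>) (degree \<rho>)" by (rule degree_add_le_max)
  then show ?case using add by (auto simp: max_def split: if_splits)
next
  case (scale w u \<pi> c)
  then show ?case by (cases "c = 0") auto
qed auto

lemma subspace_Sum_any: "fock.subspace S \<Longrightarrow> (\<And>i. f i \<in> S) \<Longrightarrow> Sum_any f \<in> S"
  unfolding Sum_any.expand_set by (rule fock.subspace_sum)

definition Vsp :: "nat \<Rightarrow> fock \<Rightarrow> int \<Rightarrow> int \<Rightarrow> fock set" where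
  "Vsp p Z z w = {u. \<exists>\<pi>. Rep p Z z w u \<pi>}"

lemma Vsp_subspace: "fock.subspace (Vsp p Z z w)"
  unfolding fock.subspace_def Vsp_def by (auto intro: Rep.zero Rep.add Rep.scale)

lemmas Vsp_closed = fock.subspace_0[OF Vsp_subspace] fock.subspace_add[OF Vsp_subspace]
  fock.subspace_diff[OF Vsp_subspace] fock.subspace_scale[OF Vsp_subspace] fock.subspace_neg[OF Vsp_subspace]

lemma Vsp_base: "Z \<in> Vsp p Z z z" by (auto simp: Vsp_def intro: Rep.base)

lemma Vsp_vir: "u \<in> Vsp p Z z (w - int n) \<Longrightarrow> n > 0 \<Longrightarrow> vir p (- int n) u \<in> Vsp p Z z w"
  using Rep.vir[of p Z z "w - int n" u _ n] by (auto simp: Vsp_def)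

lemma Vsp_vir1: "u \<in> Vsp p Z z (w - 1) \<Longrightarrow> vir p (- 1) u \<in> Vsp p Z z w"
  using Vsp_vir[of u p Z z w 1] by simp

lemma fock_comb:
  assumes "a + x * a' + y * a'' = 0" "b + x * b' + y * b'' = 0" "c + x * c' + y * c'' = 0"
  shows "(fscale a A + fscale b B + fscale c C) + fscale x (fscale a' A + fscale b' B + fscale c' C)
    + fscale y (fscale a'' A + fscale b'' B + fscale c'' C) = 0"
proof -
  have "(fscale a A + fscale b B + fscale c C) + fscale x (fscale a' A + fscale b' B + fscale c' C)
    + fscale y (fscale a'' A + fscale b'' B + fscale c'' C) =
    fscale (a + x * a' + y * a'') A + fscale (b + x * b' + y * b'') B + fscale (c + x * c' + y * c'') C"
    by (simp add: fock.scale_left_distrib fock.scale_right_distrib)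
  then show ?thesis unfolding assms by simp
qed

section \<open>The null vector equation and its recursion\<close>

context triplet_setting begin

text \<open>The associator formula for L(-n), which is the mode 1 - n of \<omega>. In the second sum
  the terms with L(-1) w and L(0) w are split off: on a weight vector they contribute multiples of
  one mode of \<open>u\<close>, while the remaining L(j+1) w vanish for highest weight
  vectors.\<close>

lemma mode_vir:
  assumes u: "u \<in> chg S" and w: "w \<in> chg T" and d: "\<And>a b. a \<in> S \<Longrightarrow> b \<in> T \<Longrightarrow> 2 * int p dvd a * b"
  shows "md (L (- n) u) k w = Sum_any (\<lambda>j. fscale ((- 1) ^ j * ch (1 - n) j) (L (- n - int j) (md u (k + int j) w)))
    - fscale (sg (1 - n)) (L (- 1) (md u (k + 1 - n) w) + fscale (of_int (k + 1 - n)) (md u (k - n) w) + fscale (of_int (n - 1)) (md u (k - n) (L 0 w))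
      + Sum_any (\<lambda>j. fscale ((- 1) ^ j * ch (1 - n) (j + 2)) (md u (k - n - 1 - int j) (L (int j + 1) w))))"
proof -
  have b: "borch p (conformal p) u w"
    using d by (auto intro!: borch_0[OF p0 conformal_chg u w])
  let ?f = "\<lambda>j. fscale ((- 1) ^ j * ch (1 - n) j) (md u (1 - n + k - int j) (md (conformal p) (int j) w))"
  have f: "fs ?f" by (rule nmode_fsI[of p "conformal p" 0 w]) (simp add: nmode_simps)
  have "fs (\<lambda>j. ?f (Suc j))" using f unfolding fs_def by (meson le_Suc_eq)
  then have "Sum_any ?f = ?f 0 + (?f 1 + Sum_any (\<lambda>j. ?f (Suc (Suc j))))"
    unfolding Sum_any_Suc[OF f] by (simp only: Sum_any_Suc One_nat_def)
  also have "?f 0 = L (- 1) (md u (k + 1 - n) w) + fscale (of_int (k + 1 - n)) (md u (k - n) w)"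
    using vir_m1_nmode[OF p0 u w d, of "k + 1 - n"] by (simp add: algebra_simps)
  also have "?f 1 = fscale (of_int (n - 1)) (md u (k - n) (L 0 w))" by (simp add: algebra_simps)
  also have "(\<lambda>j. ?f (Suc (Suc j))) = (\<lambda>j. fscale ((- 1) ^ j * ch (1 - n) (j + 2)) (md u (k - n - 1 - int j) (L (int j + 1) w)))"
    by (rule ext) (simp add: algebra_simps)
  finally have 1: "Sum_any ?f = L (- 1) (md u (k + 1 - n) w) + fscale (of_int (k + 1 - n)) (md u (k - n) w) + fscale (of_int (n - 1)) (md u (k - n) (L 0 w))
      + Sum_any (\<lambda>j. fscale ((- 1) ^ j * ch (1 - n) (j + 2)) (md u (k - n - 1 - int j) (L (int j + 1) w)))" by (simp add: add.assoc)
  have e: "- n + 1 = 1 - n" "- n - int j + 1 = 1 - n - int j" for j by simp_all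
  show ?thesis unfolding e(1) borch_assoc[OF b, of "1 - n" k] 1 e(2) ..
qed

lemma mode_vir_primary:
  assumes w: "w \<in> chg T" and pr: "\<And>n. n > 0 \<Longrightarrow> L n w = 0" "L 0 w = fscale h w"
    and d: "\<And>a b. a \<in> S \<Longrightarrow> b \<in> T \<Longrightarrow> 2 * int p dvd a * b" and u: "u \<in> chg S"
  shows "md (L (- n) u) k w = Sum_any (\<lambda>j. fscale ((- 1) ^ j * ch (1 - n) j) (L (- n - int j) (md u (k + int j) w)))
    - fscale (sg (1 - n)) (L (- 1) (md u (k + 1 - n) w) + fscale (of_int (k + 1 - n) + of_int (n - 1) * h) (md u (k - n) w))"
proof -
  have e: "L (int j + 1) w = 0" for j by (rule pr) simp
  have z: "Sum_any (\<lambda>j. fscale (c j) (md u (f j) (0::fock))) = 0" for c and f :: "nat \<Rightarrow> int" by (simp add: nmode_simps)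
  have "fscale (of_int (n - 1)) (md u (k - n) (L 0 w)) = fscale (of_int (n - 1) * h) (md u (k - n) w)" unfolding pr(2) nmode_simps by simp
  then show ?thesis using mode_vir[OF u w d, of n k] unfolding e z by (simp only: fock.scale_left_distrib add.assoc add_0_right)
qed

text \<open>The singular vector of level three in the Virasoro Verma module of central charge 1 -
  6(p-1)^2/p and highest weight 2p - 1, normalised by the coefficient 1 of L(-1)^3.\<close>

definition NV :: "fock \<Rightarrow> fock" where
  "NV u = L (- 1) (L (- 1) (L (- 1) u)) + fscale (- 4 * of_nat p) (L (- 2) (L (- 1) u)) + fscale (2 * of_nat p * (2 * of_nat p - 1)) (L (- 3) u)"

text \<open>Above the exponential there are three monomials of degree three, \<open>?A\<close>,
  \<open>?B\<close> and \<open>?C\<close>; the equation is the cancellation of their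
  coefficients.\<close>

lemma NV_XF: "NV XF = 0"
proof -
  let ?e = "expo (- 2 * int p)"
  let ?A = "osc 0 * (osc 0 * (osc 0 * ?e))" and ?B = "osc 0 * (osc 1 * ?e)" and ?C = "osc 2 * ?e"
  have T: "tran p (osc n * u) = osc n * tran p u + fscale (of_nat (n + 1)) (osc (n + 1) * u)" for n u
    by (rule tran_osc[OF p0])
  have te: "tran p ?e = fscale (- 1) (osc 0 * ?e)" unfolding tran_expo[OF p0] using p0' by (simp add: field_simps)
  have a0: "vir p (- 2) (osc 0 * u) = osc 0 * vir p (- 2) u + osc 2 * u" for u
    using vir_heis[OF p0, of "- 1" "- 2" u] unfolding heis_neg[of "- 1", simplified] heis_neg[of "- 3", simplified]
    by (simp add: heis_neg numeral_2_eq_2)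
  have m2: "L (- 2) (L (- 1) ?e) = fscale (- 1 / (4 * of_nat p)) ?A + fscale ((of_nat p + 1) / (2 * of_nat p)) ?B + fscale (- 1) ?C"
    unfolding vir_m1[OF p0] te nmode_simps a0 vir_expo(4)[OF p0]
    by (simp add: fock.scale_right_distrib distrib_left fscale_mult_right field_simps)
  have m3: "L (- 3) ?e = fscale 0 ?A + fscale (1 / (2 * of_nat p)) ?B + fscale (- 1 / of_nat p) ?C"
    unfolding vir_expo(5)[OF p0] using p0' by (simp add: field_simps)
  have f3: "fscale 3 v = 2 * v + v" for v
    using fock.scale_left_distrib[of 1 1 v] fock.scale_left_distrib[of 2 1 v] by simp
  have m1: "L (- 1) (L (- 1) (L (- 1) ?e)) = fscale (- 1) ?A + fscale 3 ?B + fscale (- 2) ?C"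
    unfolding vir_m1[OF p0] te T lin_simps[OF tran_lin]
    by (simp add: T te lin_simps[OF tran_lin] fock.scale_right_distrib distrib_left fscale_mult_right right_diff_distrib f3 mult.left_commute[of "osc (Suc 0)"] numeral_2_eq_2)
  show ?thesis unfolding NV_def triplet_F_def m1 m2 m3
    by (rule fock_comb) (use p0' in \<open>simp_all add: field_simps\<close>)
qed

lemma NV_XH: "NV XH = 0"
  using lin_0[OF Q_lin] NV_XF unfolding XH_Q NV_def by (metis Q_vir lin_add[OF Q_lin] lin_scale[OF Q_lin])

lemma VL_hh: "k \<in> VS \<Longrightarrow> \<exists>d\<ge>0. hh p k = of_int d"
proof -
  assume "k \<in> VS"
  then obtain m where m: "k = 2 * int p * m" by blast
  have "hh p k = of_int (int p * m * m - (int p - 1) * m)" unfolding m hh_def using p0' by (simp add: field_simps)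
  moreover have "int p * m * m - (int p - 1) * m = (int p - 1) * (m * (m - 1)) + m * m" by (simp add: algebra_simps)
  moreover have "m * (m - 1) \<ge> 0" by (cases "m \<ge> 1") (auto simp: mult_nonpos_nonpos)
  ultimately show ?thesis using p2 by (intro exI[of _ "int p * m * m - (int p - 1) * m"]) simp
qed

lemma VL_neg: "v \<in> gr p k (of_int w) \<Longrightarrow> k \<in> VS \<Longrightarrow> w < 0 \<Longrightarrow> v = 0"
proof -
  assume v: "v \<in> gr p k (of_int w)" and k: "k \<in> VS" "w < 0"
  obtain d where "d \<ge> 0" "hh p k = of_int d" using VL_hh[OF k(1)] by blast
  then show "v = 0" using v k(2) by (intro gr_low(1)[OF p0, of v k "w - d"]) simp_all
qed

text \<open>A mode of \<open>NV X = 0\<close> applied to \<open>Y\<close> expresses w (w - (2p-1))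
  (w - (6p-2)) times the product of weight \<open>w\<close> through descendants of products of
  smaller weight. The roots are the weights at which a new highest weight vector may appear; there
  the assumptions \<open>0\<close> and \<open>1\<close> and the bound on \<open>w\<close> replace
  the recursion.\<close>

theorem BPZ:
  assumes X: "X \<in> gr p a (2 * of_nat p - 1)" "NV X = 0" and Y: "Y \<in> gr p b (2 * of_nat p - 1)" "\<And>n. n > 0 \<Longrightarrow> L n Y = 0"
    and ab: "a \<in> VS" "b \<in> VS"
    and 0: "md X (4 * int p - 3) Y \<in> Vsp p Z z 0"
    and 1: "(\<And>w. w < 2 * int p - 1 \<Longrightarrow> md X (4 * int p - 3 - w) Y \<in> Vsp p Z z w) \<Longrightarrow> md X (2 * int p - 2) Y \<in> Vsp p Z z (2 * int p - 1)"
  shows "w < 6 * int p - 2 \<Longrightarrow> md X (4 * int p - 3 - w) Y \<in> Vsp p Z z w"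
proof (induction "nat w" arbitrary: w rule: less_induct)
  case less
  have neg: "md X (4 * int p - 3 - w') Y \<in> Vsp p Z z w'" if "w' < 0" for w'
  proof -
    have "md X (4 * int p - 3 - w') Y \<in> gr p (a + b) (of_int w')"
      by (rule nmode_gr[OF p0 X(1) Y(1)]) (use ab in auto)
    then have "md X (4 * int p - 3 - w') Y = 0" by (rule VL_neg) (use ab that in auto)
    then show ?thesis by (simp add: Vsp_closed)
  qed
  have IH: "md X k Y \<in> Vsp p Z z w'" if "w' < w" "k = 4 * int p - 3 - w'" for w' k
    using neg[of w'] less.hyps[of w'] less.prems that by (cases "w' < 0") auto
  consider "w < 0" | "w = 0" | "w = 2 * int p - 1" | "w > 0" "w \<noteq> 2 * int p - 1" by linarith
  then show ?case
  proof cases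
    case 4
    \<comment> \<open>With this mode of the null vector equation, the unknown is the mode
      \<open>s - 3 = 4p - 3 - w\<close>.\<close>
    define s where "s = 4 * int p - w"
    have x: "X \<in> chg {a}" "Y \<in> chg {b}" and d: "\<And>a' b'. a' \<in> {a} \<Longrightarrow> b' \<in> {b} \<Longrightarrow> 2 * int p dvd a' * b'"
      using X Y ab by (auto simp: gr_chg)
    have T: "md (L (- 1) u) k Y = fscale (- of_int k) (md u (k - 1) Y)" if "u \<in> chg {a}" for u k
      unfolding vir_m1[OF p0] by (rule tran_nmode[OF p0 borch_1[OF p0 that x(2) d]])
    have Tc: "u \<in> chg {a} \<Longrightarrow> L (- 1) u \<in> chg {a}" for u
      using nmode_chg1[OF p0 conformal_chg[of p], of u a 0] by simp
    let ?D = "2 * of_nat p - 1 :: complex"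
    let ?S1 = "Sum_any (\<lambda>j. fscale ((- 1) ^ j * ch (1 - 2) j) (L (- 2 - int j) (md (L (- 1) X) (s + int j) Y)))"
    let ?S2 = "Sum_any (\<lambda>j. fscale ((- 1) ^ j * ch (1 - 3) j) (L (- 3 - int j) (md X (s + int j) Y)))"
    have VD: "L (- int n) (md X k Y) \<in> Vsp p Z z w" if "n > 0" "k = 4 * int p - 3 - (w - int n)" for n k
      by (rule Vsp_vir[OF IH]) (use that in auto)
    have S1: "?S1 \<in> Vsp p Z z w"
    proof (intro subspace_Sum_any[OF Vsp_subspace] Vsp_closed)
      fix j
      have "L (- int (j + 2)) (md X (s + int j - 1) Y) \<in> Vsp p Z z w" by (rule VD) (simp_all add: s_def)
      then show "L (- 2 - int j) (md (L (- 1) X) (s + int j) Y) \<in> Vsp p Z z w"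
        unfolding T[OF x(1)] nmode_simps by (intro Vsp_closed) (simp add: algebra_simps)
    qed
    have S2: "?S2 \<in> Vsp p Z z w"
    proof (intro subspace_Sum_any[OF Vsp_subspace] Vsp_closed)
      fix j
      have "L (- int (j + 3)) (md X (s + int j) Y) \<in> Vsp p Z z w" by (rule VD) (simp_all add: s_def)
      moreover have "- int (j + 3) = - 3 - int j" by simp
      ultimately show "L (- 3 - int j) (md X (s + int j) Y) \<in> Vsp p Z z w" by (simp only:)
    qed
    have S3: "L (- 1) (md X (s - 2) Y) \<in> Vsp p Z z w" using VD[of 1 "s - 2"] by (simp add: s_def)
    let ?y = "md X (s - 3) Y" and ?t = "L (- 1) (md X (s - 2) Y)"
    have e1: "md (L (- 1) (L (- 1) (L (- 1) X))) s Y = fscale (- of_int (s * (s - 1) * (s - 2))) ?y"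
      unfolding T[OF Tc[OF Tc[OF x(1)]]] T[OF Tc[OF x(1)]] T[OF x(1)] by (simp add: algebra_simps) (simp flip: fock.scale_left_distrib distrib_left)
    have e2: "md (L (- 2) (L (- 1) X)) s Y = ?S1 + fscale (- of_int (s - 1)) ?t + fscale (- of_int (s - 2) * (of_int (s - 1) + ?D)) ?y"
    proof -
      have t: "L (- 1) (md (L (- 1) X) (s + 1 - 2) Y) = fscale (- of_int (s - 1)) ?t" "md (L (- 1) X) (s - 2) Y = fscale (- of_int (s - 2)) ?y"
        unfolding T[OF x(1)] nmode_simps by simp_all
      have "md (L (- 2) (L (- 1) X)) s Y = ?S1 - fscale (sg (1 - 2)) (L (- 1) (md (L (- 1) X) (s + 1 - 2) Y)
          + fscale (of_int (s + 1 - 2) + of_int (2 - 1) * ?D) (md (L (- 1) X) (s - 2) Y))"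
        by (rule mode_vir_primary[OF x(2) Y(2) gr_vir_0[OF Y(1)] d Tc[OF x(1)]])
      also have "of_int (s + 1 - 2) + of_int (2 - 1) * ?D = of_int (s - 1) + ?D" by simp
      finally show ?thesis unfolding t by (simp only: sg_def fock.scale_scale mult.commute[of "of_int (s - 1) + ?D"]) simp
    qed
    have e3: "md (L (- 3) X) s Y = ?S2 - ?t - fscale (of_int (s - 2) + 2 * ?D) ?y"
      using mode_vir_primary[OF x(2) Y(2) gr_vir_0[OF Y(1)] d x(1), of 3 s]
      by (simp add: sg_def algebra_simps)
    have comb: "fscale c y + fscale x (S1 + fscale t1 t + fscale b y) + fscale z (S2 - t - fscale d y) =
      fscale (c + x * b - z * d) y + (fscale x S1 + fscale z S2 + fscale (x * t1 - z) t)" for c x b z d t1 y t S1 S2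
      by (simp add: fock.scale_left_distrib fock.scale_left_diff_distrib fock.scale_right_distrib fock.scale_right_diff_distrib)
    \<comment> \<open>The indicial polynomial of the equation, rewritten from \<open>s\<close> to
      \<open>w\<close>, splits into three linear factors.\<close>
    have coef: "- of_int (s * (s - 1) * (s - 2)) + - 4 * of_nat p * (- of_int (s - 2) * (of_int (s - 1) + ?D))
      - 2 * of_nat p * (2 * of_nat p - 1) * (of_int (s - 2) + 2 * ?D) = of_int (w * (w - (2 * int p - 1)) * (w - (6 * int p - 2)))"
      unfolding s_def by (simp add: algebra_simps)
    have "0 = md (NV X) s Y" using X by (simp add: nmode_simps)
    also have "\<dots> = fscale (of_int (w * (w - (2 * int p - 1)) * (w - (6 * int p - 2)))) ?y
      + (fscale (- 4 * of_nat p) ?S1 + fscale (2 * of_nat p * (2 * of_nat p - 1)) ?S2 + fscale (4 * of_nat p * of_int (s - 1) - 2 * of_nat p * (2 * of_nat p - 1)) ?t)"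
      unfolding NV_def nmode_simps e1 e2 e3 comb coef by (simp add: right_diff_distrib)
    finally have "fscale (of_int (w * (w - (2 * int p - 1)) * (w - (6 * int p - 2)))) ?y =
      - (fscale (- 4 * of_nat p) ?S1 + fscale (2 * of_nat p * (2 * of_nat p - 1)) ?S2 + fscale (4 * of_nat p * of_int (s - 1) - 2 * of_nat p * (2 * of_nat p - 1)) ?t)"
      by (simp only: eq_neg_iff_add_eq_0)
    also have "\<dots> \<in> Vsp p Z z w" by (intro Vsp_closed S1 S2 S3)
    finally have "fscale (1 / of_int (w * (w - (2 * int p - 1)) * (w - (6 * int p - 2)))) (fscale (of_int (w * (w - (2 * int p - 1)) * (w - (6 * int p - 2)))) ?y) \<in> Vsp p Z z w"
      by (rule Vsp_closed)
    moreover have "w * (w - (2 * int p - 1)) * (w - (6 * int p - 2)) \<noteq> 0" using 4 less.prems by simp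
    ultimately have "?y \<in> Vsp p Z z w" by (simp del: of_int_mult)
    then show ?thesis by (simp add: s_def algebra_simps)
  next
    case 3
    have "md X (2 * int p - 2) Y \<in> Vsp p Z z (2 * int p - 1)" by (rule 1) (use IH 3 in auto)
    moreover have "4 * int p - 3 - w = 2 * int p - 2" using 3 by simp
    ultimately show ?thesis using 3 by simp
  qed (use neg 0 in auto)
qed

lemma Rep_Q: "Rep p Z z w u \<pi> \<Longrightarrow> Rep p (Q Z) z w (Q u) \<pi>"
proof (induction rule: Rep.induct)
  case (vir w u \<pi> n)
  show ?case unfolding Q_vir[symmetric] by (rule Rep.vir[OF vir(3,2)])
qed (auto simp: lin_simps[OF Q_lin] intro: Rep.intros)

lemma Vsp_Q: "u \<in> Vsp p Z z w \<Longrightarrow> Q u \<in> Vsp p (Q Z) z w"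
  by (auto simp: Vsp_def intro: Rep_Q)

lemma Rep_gr: "Rep p Z z w u \<pi> \<Longrightarrow> Z \<in> gr p k (of_int z) \<Longrightarrow> u \<in> gr p k (of_int w)"
proof (induction rule: Rep.induct)
  case (vir w u \<pi> n)
  then show ?case by (intro vir_gr[OF p0 vir(3)]) auto
qed (auto intro: gr_closed)

lemma Rep_0: "Rep p 0 z w u \<pi> \<Longrightarrow> u = 0"
  by (induction rule: Rep.induct) (auto simp: nmode_simps)

section \<open>Products of the generators\<close>

abbreviation "D \<equiv> 2 * int p - 1"

lemma X_D: "XF \<in> gr p (- 2 * int p) (of_int D)" "XH \<in> gr p 0 (of_int D)" "XE \<in> gr p (2 * int p) (of_int D)"
  using X_gr by simp_all

lemma X_VL: "X \<in> {XF, XH, XE} \<Longrightarrow> X \<in> VL"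
  by (rule W_VL[OF W_X])

lemma X_prod_gr:
  assumes "X \<in> gr p a (of_int D)" "Y \<in> gr p b (of_int D)" "a \<in> VS" "c = a + b"
  shows "md X (4 * int p - 3 - w) Y \<in> gr p c (of_int w)"
  by (rule nmode_gr[OF p0 assms(1,2)]) (use assms(3,4) in auto)

text \<open>The products have charge -\<alpha>, where the weights start at \<open>D\<close> with the
  line of \<open>XF\<close>. So the product of weight 0 is zero and the one of weight
  \<open>D\<close> is a multiple of \<open>XF\<close>.\<close>

lemma FH_Vsp: "w < 6 * int p - 2 \<Longrightarrow> md XF (4 * int p - 3 - w) XH \<in> Vsp p XF D w"
proof (rule BPZ[OF X_gr(1) NV_XF X_gr(2) X_primary])
  have h: "hh p (- 2 * int p) = of_int D" using p0' by (simp add: hh_def field_simps)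
  have g: "md XF (4 * int p - 3 - w) XH \<in> gr p (- 2 * int p) (of_int w)" for w
    by (rule X_prod_gr[OF X_D(1,2)]) auto
  have h0: "hh p (- 2 * int p) + of_int (- D) = of_int 0" unfolding h by simp
  have "md XF (4 * int p - 3 - 0) XH = 0"
    by (rule gr_low(1)[OF p0, of _ "- 2 * int p" "- D"], unfold h0, rule g) (use p2 in simp)
  then show "md XF (4 * int p - 3) XH \<in> Vsp p XF D 0" by (simp add: Vsp_closed)
  have "md XF (4 * int p - 3 - D) XH = fscale (lookup (md XF (4 * int p - 3 - D) XH) (0, - 2 * int p)) (expo (- 2 * int p))"
    by (rule gr_low(2)[OF p0, of _ _ 0]) (use g[of D] in \<open>simp_all only: h of_int_0 add_0_right\<close>)
  also have "\<dots> \<in> Vsp p XF D D" unfolding triplet_F_def by (intro Vsp_closed Vsp_base)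
  finally show "md XF (2 * int p - 2) XH \<in> Vsp p XF D D" by (simp add: algebra_simps)
qed auto

text \<open>The mode -1 - j of \<open>x\<close> applied to the vacuum is L(-1)^j x / j!, a Virasoro
  descendant of \<open>x\<close>.\<close>

lemma tran_power_Vsp: "x \<in> Vsp p Z z w \<Longrightarrow> w + int j = w' \<Longrightarrow> md x (- 1 - int j) 1 \<in> Vsp p Z z w'"
proof (induction j arbitrary: x w)
  case 0
  then show ?case by (simp add: nmode_creation(2)[OF p0])
next
  case (Suc j)
  have "borch p x 1 1" by (rule borch_1[OF p0 chg_UNIV one_chg[OF singletonI]]) simp
  from tran_nmode[OF p0 this, of "- 1 - int j"]
  have "md (L (- 1) x) (- 1 - int j) 1 = fscale (of_int (1 + int j)) (md x (- 1 - int (Suc j)) 1)"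
    unfolding vir_m1[OF p0] by (simp add: algebra_simps)
  then have "md x (- 1 - int (Suc j)) 1 = fscale (1 / of_int (1 + int j)) (md (L (- 1) x) (- 1 - int j) 1)"
    by (simp del: of_nat_Suc of_int_add add: of_int_eq_0_iff)
  moreover have "md (L (- 1) x) (- 1 - int j) 1 \<in> Vsp p Z z w'"
    by (rule Suc.IH[of _ "w + 1"]) (use Suc.prems Vsp_vir1[of x p Z z "w + 1"] in auto)
  ultimately show ?case by (simp only: Vsp_closed)
qed

text \<open>At weight \<open>D\<close> the recursion leaves the product undetermined. Skew symmetry
  settles it: the mode 2p - 2 is even, so this product equals minus itself up to derivatives of
  products of lower weight.\<close>

lemma HH_Vsp: "w < 6 * int p - 2 \<Longrightarrow> md XH (4 * int p - 3 - w) XH \<in> Vsp p 1 0 w"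
proof (rule BPZ[OF X_gr(2) NV_XH X_gr(2) X_primary])
  have "md XH (4 * int p - 3 - 0) XH = fscale (lookup (md XH (4 * int p - 3 - 0) XH) (0, 0)) (expo 0)"
    by (rule gr_low(2)[OF p0, of _ _ 0]) (use X_prod_gr[OF X_D(2,2), of 0 0] in \<open>simp_all add: hh_0\<close>)
  then show "md XH (4 * int p - 3) XH \<in> Vsp p 1 0 0" using Vsp_base[of 1 p 0] by (metis Vsp_closed(4) diff_zero expo_0)
  assume IH: "\<And>w. w < D \<Longrightarrow> md XH (4 * int p - 3 - w) XH \<in> Vsp p 1 0 w"
  \<comment> \<open>Skew symmetry is obtained from the Borcherds identity on the vacuum with
    \<open>m = -1\<close>, \<open>l = 2p - 2\<close>, \<open>k = 0\<close>.\<close>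
  let ?l = "2 * int p - 2"
  let ?f = "\<lambda>j. fscale (ch (- 1) j) (md (md XH (?l + int j) XH) (- 1 + 0 - int j) 1)"
  have H: "XH \<in> VL" by (rule X_VL) simp
  have sl: "sg ?l = 1" by (simp add: sg_def)
  have f: "fs ?f" by (rule nmode_fsI[of p XH ?l XH]) (simp add: nmode_simps)
  have z: "(\<lambda>j. fscale ((- 1) ^ j * ch ?l j) (md XH (- 1 + ?l - int j) (md XH (0 + int j) 1))) = (\<lambda>j. 0)"
    by (rule ext) (simp add: nmode_creation(1)[OF p0] nmode_simps)
  have "Sum_any (\<lambda>j. fscale ((- 1) ^ j * ch ?l j) (md XH (?l + 0 - int j) (md XH (- 1 + int j) 1))) =
     (\<Sum>j<1. fscale ((- 1) ^ j * ch ?l j) (md XH (?l + 0 - int j) (md XH (- 1 + int j) 1)))"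
    by (rule Sum_any_lt) (simp add: nmode_creation(1)[OF p0] nmode_simps)
  then have "Sum_any ?f = - md XH ?l XH"
    unfolding borch_sum[OF VL_borch[OF H H], of "- 1" ?l 0] z sl by (simp add: nmode_creation(2)[OF p0])
  then have "- md XH ?l XH = md XH ?l XH + Sum_any (\<lambda>j. ?f (Suc j))"
    unfolding Sum_any_Suc[OF f] by (simp add: nmode_creation(2)[OF p0])
  then have "fscale 2 (md XH ?l XH) = - Sum_any (\<lambda>j. ?f (Suc j))"
    using fock.scale_left_distrib[of 1 1 "md XH ?l XH"] by (simp add: algebra_simps eq_neg_iff_add_eq_0)
  also have "\<dots> \<in> Vsp p 1 0 D"
  proof (intro Vsp_closed subspace_Sum_any[OF Vsp_subspace])
    fix j
    have "md XH (4 * int p - 3 - (D - int (Suc j))) XH \<in> Vsp p 1 0 (D - int (Suc j))" by (rule IH) simp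
    then have "md XH (?l + int (Suc j)) XH \<in> Vsp p 1 0 (D - int (Suc j))" by (simp add: algebra_simps)
    then have "md (md XH (?l + int (Suc j)) XH) (- 1 - int (Suc j)) 1 \<in> Vsp p 1 0 D"
      by (rule tran_power_Vsp) simp
    then show "md (md XH (?l + int (Suc j)) XH) (- 1 + 0 - int (Suc j)) 1 \<in> Vsp p 1 0 D" by simp
  qed
  finally have "fscale (1/2) (fscale 2 (md XH ?l XH)) \<in> Vsp p 1 0 D" by (rule Vsp_closed)
  then show "md XH ?l XH \<in> Vsp p 1 0 D" by simp
qed auto

definition Vall :: "int \<Rightarrow> fock set" where
  "Vall w = fock.span (Vsp p 1 0 w \<union> (\<Union>X\<in>{XF, XH, XE}. Vsp p X D w))"

lemma Vall_subspace: "fock.subspace (Vall w)"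
  unfolding Vall_def by (rule fock.subspace_span)

lemmas Vall_closed = fock.subspace_0[OF Vall_subspace] fock.subspace_add[OF Vall_subspace]
  fock.subspace_diff[OF Vall_subspace] fock.subspace_scale[OF Vall_subspace] fock.subspace_neg[OF Vall_subspace]

lemma VallI: "u \<in> Vsp p 1 0 w \<Longrightarrow> u \<in> Vall w" "u \<in> Vsp p X D w \<Longrightarrow> X \<in> {XF, XH, XE} \<Longrightarrow> u \<in> Vall w"
  unfolding Vall_def by (auto intro: fock.span_base)

lemma Vsp_0: "u \<in> Vsp p 0 z w \<Longrightarrow> u = 0"
  by (auto simp: Vsp_def dest: Rep_0)

lemma Vall_Q: "u \<in> Vall w \<Longrightarrow> Q u \<in> Vall w"
  unfolding Vall_def
proof (induction rule: fock.span_induct_alt)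
  case base
  then show ?case by (simp add: lin_0[OF Q_lin] fock.span_zero)
next
  case (step c x y)
  have "Q x \<in> Vsp p (Q 1) 0 w \<or> Q x \<in> Vsp p (Q XF) D w \<or> Q x \<in> Vsp p (Q XH) D w \<or> Q x \<in> Vsp p (Q XE) D w"
    using step(1) by (blast dest: Vsp_Q)
  then have "Q x \<in> Vall w" unfolding Q_vac Q_XE XH_Q[symmetric] XE_Q[symmetric]
    by (auto dest!: Vsp_0 intro: VallI Vall_closed)
  with step(2) show ?case
    by (simp add: lin_simps[OF Q_lin] Vall_def fock.span_add fock.span_scale)
qed

text \<open>Q is a derivation that sends F to H, H to E and E to 0. Applied to the products of F
  with F, of F with H and of H with H, it yields all others.\<close>

theorem X_products:
  assumes X: "X \<in> {XF, XH, XE}" and Y: "Y \<in> {XF, XH, XE}" and w: "w < 6 * int p - 2"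
  shows "md X (4 * int p - 3 - w) Y \<in> Vall w"
proof -
  let ?k = "4 * int p - 3 - w"
  have Qm: "Q (md X ?k Y) = md (Q X) ?k Y + md X ?k (Q Y)" if "X \<in> {XF, XH, XE}" for X Y
    by (rule Q_md[OF X_VL[OF that]])
  have FH: "md XF ?k XH \<in> Vall w" using FH_Vsp[OF w] by (auto intro: VallI)
  have HH: "md XH ?k XH \<in> Vall w" using HH_Vsp[OF w] by (auto intro: VallI)
  \<comment> \<open>In charge -2\<alpha> the weights start at 6p - 2, so the products of F with
    itself vanish in the range considered.\<close>
  have h: "hh p (- 4 * int p) = of_int (6 * int p - 2)" using p0' by (simp add: hh_def field_simps)
  have h0: "hh p (- 4 * int p) + of_int (w - (6 * int p - 2)) = of_int w" unfolding h by simp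
  have FF0: "md XF ?k XF = 0"
    by (rule gr_low(1)[OF p0, of _ "- 4 * int p" "w - (6 * int p - 2)"], unfold h0, rule X_prod_gr[OF X_D(1,1)]) (use w in auto)
  have HF: "md XH ?k XF \<in> Vall w"
    using Qm[of XF XF] FH Vall_closed(5)[OF FH] by (simp add: FF0 lin_0[OF Q_lin] flip: XH_Q) (metis add_eq_0_iff2)
  have FE: "md XF ?k XE \<in> Vall w"
    using Qm[of XF XH] Vall_closed(3)[OF Vall_Q[OF FH] HH] by (simp flip: XH_Q XE_Q)
  have EF: "md XE ?k XF \<in> Vall w"
    using Qm[of XH XF] Vall_closed(3)[OF Vall_Q[OF HF] HH] by (simp flip: XH_Q XE_Q)
  have HE: "md XH ?k XE \<in> Vall w"
    using Qm[of XF XE] Vall_Q[OF FE] by (simp add: Q_XE nmode_simps flip: XH_Q)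
  have EH: "md XE ?k XH \<in> Vall w"
    using Qm[of XH XH] Vall_closed(3)[OF Vall_Q[OF HH] HE] by (simp flip: XE_Q)
  have EE: "md XE ?k XE \<in> Vall w"
    using Qm[of XH XE] Vall_Q[OF HE] by (simp add: Q_XE nmode_simps flip: XE_Q)
  show ?thesis using X Y FF0 FH FE HF HH HE EF EH EE by (auto simp: Vall_closed)
qed

text \<open>Vectors built from the vacuum by Virasoro operators and at most \<open>k\<close>
  generator modes, all of negative index; \<open>w\<close> records the weight. The count
  \<open>k\<close> is the induction parameter in the proof that the set is closed under all
  modes.\<close>

inductive Gw :: "nat \<Rightarrow> int \<Rightarrow> fock \<Rightarrow> bool" where
  one: "Gw k 0 1"
| vir: "Gw k w u \<Longrightarrow> n > 0 \<Longrightarrow> Gw k (w + int n) (L (- int n) u)"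
| gen: "Gw k w u \<Longrightarrow> X \<in> {XF, XH, XE} \<Longrightarrow> n > 0 \<Longrightarrow> Gw (Suc k) (w + D - 1 + int n) (md X (- int n) u)"
| up: "Gw k w u \<Longrightarrow> Gw (Suc k) w u"
| zero: "Gw k w 0"
| add: "Gw k w u \<Longrightarrow> Gw k w v \<Longrightarrow> Gw k w (u + v)"
| scale: "Gw k w u \<Longrightarrow> Gw k w (fscale c u)"

lemma Gw_subspace: "fock.subspace {u. Gw k w u}"
  by (auto simp: fock.subspace_def intro: Gw.zero Gw.add Gw.scale)

lemma Gw_diff: "Gw k w u \<Longrightarrow> Gw k w v \<Longrightarrow> Gw k w (u - v)"
  using fock.subspace_diff[OF Gw_subspace] by auto

lemma Gw_Sum_any: "(\<And>i. Gw k w (f i)) \<Longrightarrow> Gw k w (Sum_any f)"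
  using subspace_Sum_any[OF Gw_subspace] by auto

lemma Gw_W: "Gw k w u \<Longrightarrow> u \<in> W"
  by (induction rule: Gw.induct) (auto intro: W_1 W_closed W_md W_conformal W_X)

lemma Gw_vir_neg: "Gw k w u \<Longrightarrow> n < 0 \<Longrightarrow> w' = w - n \<Longrightarrow> Gw k w' (L n u)"
  using Gw.vir[of k w u "nat (- n)"] by simp

lemma Gw_gen_neg: "Gw k w u \<Longrightarrow> X \<in> {XF, XH, XE} \<Longrightarrow> n < 0 \<Longrightarrow> w' = w + D - 1 - n \<Longrightarrow> Gw (Suc k) w' (md X n u)"
  using Gw.gen[of k w u X "nat (- n)"] by simp

section \<open>The generated subspace is closed under all modes\<close>

lemma vir_primary:
  assumes u: "u \<in> chg S" and pr: "\<And>n. n > 0 \<Longrightarrow> L n u = 0" "L 0 u = fscale h u"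
    and w: "w \<in> chg T" and d: "\<And>a b. a \<in> S \<Longrightarrow> b \<in> T \<Longrightarrow> 2 * int p dvd a * b"
  shows "L n (md u k w) = md u k (L n w) + fscale (of_int (n + 1) * h - of_int (n + 1 + k)) (md u (n + k) w)"
proof -
  have e: "borch p (conformal p) u w" "borch p u 1 w"
    using d by (auto intro!: borch_0[OF p0 conformal_chg u w] borch_1[OF p0 u w])
  have z: "md (conformal p) (int j) u = 0" if "j \<ge> 2" for j
    using pr(1)[of "int j - 1"] that by simp
  have o: "md (conformal p) 1 u = fscale h u" using pr(2) by simp
  have "Sum_any (\<lambda>j. fscale (ch (n + 1) j) (md (md (conformal p) (int j) u) (n + 1 + k - int j) w)) =
     (\<Sum>j<2. fscale (ch (n + 1) j) (md (md (conformal p) (int j) u) (n + 1 + k - int j) w))"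
    by (rule Sum_any_lt) (simp add: z nmode_simps)
  also have "\<dots> = md (L (- 1) u) (n + 1 + k) w + fscale (of_int (n + 1) * h) (md u (n + k) w)"
    unfolding numeral_2_eq_2 lessThan_Suc lessThan_0 by (simp add: o add_ac nmode_simps)
  also have "\<dots> = fscale (of_int (n + 1) * h - of_int (n + 1 + k)) (md u (n + k) w)"
    using tran_nmode[OF p0 e(2), of "n + 1 + k"] unfolding vir_m1[OF p0]
    by (simp add: fock.scale_left_distrib fock.scale_left_diff_distrib)
  finally show ?thesis unfolding borch_comm[OF e(1), of "n + 1" k] by (simp only:)
qed

lemma vir_X:
  assumes "X \<in> {XF, XH, XE}" "w \<in> VL"
  shows "\<exists>c. L n (md X k w) = md X k (L n w) + fscale c (md X (n + k) w)"
proof -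
  have "X \<in> chg VS" using X_VL[OF assms(1)] .
  from vir_primary[OF this X_primary[OF _ assms(1)] X_weight[OF assms(1)] assms(2)] show ?thesis by auto
qed

lemma vir_1_conformal: "L 1 (conformal p) = 0"
proof -
  have a: "vir p 1 (osc 0 * u) = osc 0 * vir p 1 u + heis p 0 u - fscale (2 * (of_nat p - 1)) u" for u
    using vir_heis[OF p0, of "- 1" 1 u] by (simp add: heis_neg algebra_simps fock.scale_left_diff_distrib)
  have b: "vir p 1 (osc 1 * u) = osc 1 * vir p 1 u + fscale 2 (osc 0 * u)" for u
    using vir_heis[OF p0, of "- 2" 1 u] by (simp add: heis_neg algebra_simps)
  have 1: "vir p 1 1 = 0" using nmode_creation(1)[OF p0, of 2] by simp
  have h: "heis p 0 (osc 0) = 0" using heis_zero_chg[OF osc_chg0[of 0], of p] by simp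
  have 2: "vir p 1 (osc 0) = - fscale (2 * (of_nat p - 1)) 1" using a[of 1] unfolding 1 by (simp add: heis_one)
  have 3: "vir p 1 (osc 1) = fscale 2 (osc 0)" using b[of 1] unfolding 1 by simp
  have c: "a * (- 4 * b) + b / (2 * of_nat p) * 2 = 0" if "a = 1 / (4 * of_nat p)" for a b :: complex
    using that p0' by (simp add: field_simps)
  have "vir p 1 (osc 0 * osc 0) = fscale (- 4 * (of_nat p - 1)) (osc 0)"
    unfolding a 2 h by (simp add: fscale_mult_right flip: fock.scale_left_distrib fock.scale_left_diff_distrib fock.scale_minus_left)
  then have "L 1 (fscale (1 / (4 * of_nat p)) (osc 0 * osc 0) + fscale ((of_nat p - 1) / (2 * of_nat p)) (osc 1)) =
    fscale (1 / (4 * of_nat p) * (- 4 * (of_nat p - 1)) + (of_nat p - 1) / (2 * of_nat p) * 2) (osc 0)"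
    unfolding nmode_simps 3 by (simp only: fock.scale_left_distrib fock.scale_scale)
  then show ?thesis unfolding c[OF refl] using arg_cong[OF conformal_def[of p, unfolded power2_eq_square], of "L 1"] by simp
qed

text \<open>The shape of the Virasoro relations with existential constants; \<open>d\<close> is the
  central term.\<close>

lemma vir_vir:
  "\<exists>c d. L n (L m w) = L m (L n w) + fscale c (L (n + m) w) + fscale d w \<and> (n + m \<noteq> 0 \<longrightarrow> d = 0)"
proof -
  let ?o = "conformal p"
  have e: "borch p ?o ?o w" "borch p ?o 1 w"
    by (auto intro!: borch_0[OF p0 conformal_chg conformal_chg chg_UNIV] borch_1[OF p0 conformal_chg chg_UNIV])
  have g: "md ?o (int j) ?o \<in> gr p 0 (hh p 0 + of_int (3 - int j))" for j
    by (rule nmode_gr[OF p0 conformal_gr[OF p0] conformal_gr[OF p0]]) (simp_all add: hh_0)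
  have z: "md ?o (int j) ?o = 0" if "j \<ge> 4" for j by (rule gr_low(1)[OF p0 g]) (use that in simp)
  obtain b where b: "md ?o 3 ?o = fscale b 1" using gr_low(2)[OF p0 g[of 3]] by (auto simp: expo_0)
  have 2: "md ?o 2 ?o = 0" using vir_1_conformal by simp
  have 1: "md ?o 1 ?o = fscale 2 ?o" using gr_vir_0[OF conformal_gr[OF p0]] by simp
  have "Sum_any (\<lambda>j. fscale (ch (n + 1) j) (md (md ?o (int j) ?o) (n + 1 + (m + 1) - int j) w)) =
     (\<Sum>j<4. fscale (ch (n + 1) j) (md (md ?o (int j) ?o) (n + 1 + (m + 1) - int j) w))"
    by (rule Sum_any_lt) (simp add: z nmode_simps)
  also have "\<dots> = md (L (- 1) ?o) (n + m + 2) w + fscale (of_int (n + 1) * 2) (L (n + m) w) + fscale (ch (n + 1) 3 * b) (if n + m = 0 then w else 0)"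
  proof -
    have "{..<4} = {0, 1, 2, 3 :: nat}" by auto
    then show ?thesis by (simp add: 1 2 b nmode_simps nmode_one[OF p0] add_ac)
  qed
  also have "md (L (- 1) ?o) (n + m + 2) w = fscale (- of_int (n + m + 2)) (L (n + m) w)"
    unfolding vir_m1[OF p0] tran_nmode[OF p0 e(2)] by (simp add: algebra_simps)
  finally have "L n (L m w) = L m (L n w) + fscale (- of_int (n + m + 2) + of_int (n + 1) * 2) (L (n + m) w) + fscale (if n + m = 0 then ch (n + 1) 3 * b else 0) w"
    unfolding borch_comm[OF e(1), of "n + 1" "m + 1"] by (cases "n + m = 0") (simp_all only: fock.scale_left_distrib if_True if_False fock.scale_zero_left fock.scale_zero_right add.assoc simp_thms)
  then show ?thesis by (cases "n + m = 0") (auto intro!: exI)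
qed

lemma mode_vir_VL:
  assumes "u \<in> VL" "w \<in> VL"
  shows "md (L (- n) u) k w = Sum_any (\<lambda>j. fscale ((- 1) ^ j * ch (1 - n) j) (L (- n - int j) (md u (k + int j) w)))
    - fscale (sg (1 - n)) (L (- 1) (md u (k + 1 - n) w) + fscale (of_int (k + 1 - n)) (md u (k - n) w) + fscale (of_int (n - 1)) (md u (k - n) (L 0 w))
      + Sum_any (\<lambda>j. fscale ((- 1) ^ j * ch (1 - n) (j + 2)) (md u (k - n - 1 - int j) (L (int j + 1) w))))"
  by (rule mode_vir[OF assms]) simp

definition Gcl :: "nat \<Rightarrow> bool" where
  "Gcl k \<longleftrightarrow> (\<forall>w u. Gw k w u \<longrightarrow> (\<forall>n. Gw k (w - n) (L n u)) \<and> (\<forall>X\<in>{XF, XH, XE}. \<forall>s. Gw (Suc k) (w + D - 1 - s) (md X s u)))"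

text \<open>A mode of a Virasoro descendant of \<open>Z\<close> is a combination of Virasoro
  operators and modes of \<open>Z\<close>, so it raises the generator count by at most one, like a
  mode of \<open>Z\<close> itself.\<close>

lemma Gcl_mode_Rep:
  assumes k: "Gcl k"
  shows "Rep p Z z w0 u \<pi> \<Longrightarrow> Z = 1 \<and> z = 0 \<or> Z \<in> {XF, XH, XE} \<and> z = D \<Longrightarrow>
    u \<in> VL \<and> (\<forall>s w x. Gw k w x \<longrightarrow> Gw (Suc k) (w + w0 - 1 - s) (md u s x))"
proof (induction rule: Rep.induct)
  case base
  then show ?case using k by (auto simp: Gcl_def nmode_one[OF p0] VL_1 X_VL intro: Gw.up Gw.zero)
next
  case (vir w0 u \<pi> n)
  then have u: "u \<in> VL" and IH: "\<And>s w x w'. Gw k w x \<Longrightarrow> w' = w + w0 - 1 - s \<Longrightarrow> Gw (Suc k) w' (md u s x)" by auto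
  have "Gw (Suc k) (w + (w0 + int n) - 1 - s) (md (L (- int n) u) s x)" if x: "Gw k w x" for s w x
  proof -
    have xV: "x \<in> VL" using W_VL[OF Gw_W[OF x]] .
    have Lx: "Gw k (w - m) (L m x)" for m using k x by (auto simp: Gcl_def)
    show ?thesis
      unfolding mode_vir_VL[OF u xV]
      using vir(2) by (intro Gw_diff Gw.scale Gw.add Gw_Sum_any Gw_vir_neg[OF IH[OF x refl]] IH[OF x] IH[OF Lx]) auto
  qed
  then show ?case using VL_md[OF VL_conformal u] by auto
qed (auto simp: nmode_simps VL_0 intro: Gw.zero Gw.add Gw.scale chg_add chg_scale)

lemma Gcl_mode:
  assumes k: "Gcl k" and u: "u \<in> Vall w0" and x: "Gw k w x" and w': "w' = w + w0 - 1 - s"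
  shows "Gw (Suc k) w' (md u s x)"
  using u unfolding Vall_def w'
proof (induction rule: fock.span_induct_alt)
  case (step c v y)
  then show ?case using Gcl_mode_Rep[OF k] x
    by (auto simp: Vsp_def nmode_simps intro!: Gw.add Gw.scale)
qed (simp add: nmode_simps Gw.zero)

text \<open>Moving a mode of \<open>X\<close> past a mode of \<open>Y\<close> produces modes of
  products of \<open>X\<close> and \<open>Y\<close>. By \<open>X_products\<close> these are
  descendants of a single generator or of the vacuum, so closure at a smaller count applies to
  them.\<close>

lemma Gcl_all: "Gcl k"
proof (induction k rule: less_induct)
  case (less k)
  have "Gw k w u \<Longrightarrow> (\<forall>k'<k. Gcl k') \<Longrightarrow> (\<forall>n. Gw k (w - n) (L n u)) \<and> (\<forall>X\<in>{XF, XH, XE}. \<forall>s. Gw (Suc k) (w + D - 1 - s) (md X s u))" for k w u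
  proof (induction rule: Gw.induct)
    case (one k)
    have "Gw k (0 - n) (L n 1)" for n
      by (cases "n < 0") (auto intro: Gw_vir_neg[OF Gw.one] simp: nmode_creation(1)[OF p0] Gw.zero)
    moreover have "Gw (Suc k) (0 + D - 1 - s) (md X s 1)" if "X \<in> {XF, XH, XE}" for X s
      by (cases "s < 0") (use that in \<open>auto intro: Gw_gen_neg[OF Gw.one] simp: nmode_creation(1)[OF p0] Gw.zero\<close>)
    ultimately show ?case by blast
  next
    case (vir k w u n)
    have A: "Gw k w' (L m u)" if "w' = w - m" for m w' using vir that by auto
    have B: "Gw (Suc k) w' (md X s u)" if "w' = w + D - 1 - s" "X \<in> {XF, XH, XE}" for s X w' using vir that by auto
    have "Gw k (w + int n - m) (L m (L (- int n) u))" for m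
    proof (cases "m < 0")
      case True
      then show ?thesis by (intro Gw_vir_neg[OF A[OF refl]]) auto
    next
      case False
      obtain c d where cd: "L m (L (- int n) u) = L (- int n) (L m u) + fscale c (L (m + - int n) u) + fscale d u" "m + - int n \<noteq> 0 \<longrightarrow> d = 0"
        using vir_vir by blast
      have d: "Gw k (w + int n - m) (fscale d u)"
        using cd(2) vir(1) by (cases "m = int n") (auto intro: Gw.scale Gw.zero)
      then show ?thesis unfolding cd(1) using vir(2) by (intro Gw.add d Gw.scale[of k _ "L _ u"] Gw_vir_neg[OF A[OF refl]] A) auto
    qed
    moreover have "Gw (Suc k) (w + int n + D - 1 - s) (md X s (L (- int n) u))" if X: "X \<in> {XF, XH, XE}" for X s
    proof -
      obtain c where "L (- int n) (md X s u) = md X s (L (- int n) u) + fscale c (md X (- int n + s) u)"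
        using vir_X[OF X W_VL[OF Gw_W[OF vir(1)]]] by blast
      then have e: "md X s (L (- int n) u) = L (- int n) (md X s u) - fscale c (md X (- int n + s) u)" by (simp add: algebra_simps)
      show ?thesis unfolding e using vir(2) X by (intro Gw_diff Gw.scale Gw_vir_neg[OF B[OF refl X]] B) auto
    qed
    ultimately show ?case by blast
  next
    case (gen k w u Y n)
    have k: "Gcl k" using gen by auto
    have A: "Gw k w' (L m u)" if "w' = w - m" for m w' using k gen(1) that by (auto simp: Gcl_def)
    have B: "Gw (Suc k) w' (md X s u)" if "w' = w + D - 1 - s" "X \<in> {XF, XH, XE}" for s X w' using k gen(1) that by (auto simp: Gcl_def)
    have u: "u \<in> VL" using W_VL[OF Gw_W[OF gen(1)]] .
    have "Gw (Suc k) (w + D - 1 + int n - m) (L m (md Y (- int n) u))" for m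
    proof -
      obtain c where c: "L m (md Y (- int n) u) = md Y (- int n) (L m u) + fscale c (md Y (m + - int n) u)"
        using vir_X[OF gen(2) u] by blast
      show ?thesis unfolding c using gen(2,3) by (intro Gw.add Gw.scale Gw_gen_neg[OF A[OF refl]] B) auto
    qed
    moreover have "Gw (Suc (Suc k)) (w + D - 1 + int n + D - 1 - s) (md X s (md Y (- int n) u))" if X: "X \<in> {XF, XH, XE}" for X s
    proof -
      \<comment> \<open>The commutator involves only nonnegative modes, hence products of weight at
        most 4p - 3, which is below 6p - 2.\<close>
      have V: "md X (int j) Y \<in> Vall (4 * int p - 3 - int j)" for j
        using X_products[OF X gen(2), of "4 * int p - 3 - int j"] p2 by simp
      show ?thesis unfolding borch_comm[OF VL_borch[OF X_VL[OF X] X_VL[OF gen(2)]], of s "- int n"]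
        using gen(2,3) X by (intro Gw.add Gw_Sum_any Gw.scale Gw_gen_neg[OF B[OF refl X]] Gw.up[OF Gcl_mode[OF k V gen(1)]]) auto
    qed
    ultimately show ?case by blast
  next
    case (up k w u)
    then show ?case by (auto intro: Gw.up)
  qed (auto simp: nmode_simps intro: Gw.intros)
  then show ?case using less by (simp only: Gcl_def) blast
qed

lemma Gw_vir: "Gw k w u \<Longrightarrow> w' = w - n \<Longrightarrow> Gw k w' (L n u)"
  using Gcl_all by (auto simp: Gcl_def)

lemma Gw_gen: "Gw k w u \<Longrightarrow> X \<in> {XF, XH, XE} \<Longrightarrow> w' = w + D - 1 - s \<Longrightarrow> Gw (Suc k) w' (md X s u)"
  using Gcl_all by (auto simp: Gcl_def)

lemma Gw_Q: "Gw k w u \<Longrightarrow> Gw k w (Q u)"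
proof (induction rule: Gw.induct)
  case (gen k w u X n)
  have "Gw (Suc k) (w + D - 1 + int n) (md (Q X) (- int n) u)"
  proof (cases "X = XE")
    case True
    then show ?thesis by (simp add: Q_XE nmode_simps Gw.zero)
  next
    case False
    then have "Q X \<in> {XF, XH, XE}" using gen(2) by (auto simp flip: XH_Q XE_Q)
    then show ?thesis using gen by (intro Gw.gen)
  qed
  then show ?case unfolding Q_md[OF X_VL[OF gen(2)]] by (rule Gw.add[OF _ Gw.gen[OF gen.IH gen(2,3)]])
next
  case (vir k w u n)
  then show ?case unfolding Q_vir[symmetric] by (intro Gw.vir)
qed (auto simp: Q_vac lin_simps[OF Q_lin] intro: Gw.intros)

lemma Gw_mono: "k \<le> k' \<Longrightarrow> Gw k w u \<Longrightarrow> Gw k' w u"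
  by (induction k' rule: dec_induct) (auto intro: Gw.up)

definition Wd :: "int \<Rightarrow> fock set" where
  "Wd w = {u. \<exists>k. Gw k w u}"

lemma Wd_subspace: "fock.subspace (Wd w)"
proof -
  have "u + v \<in> Wd w" if "u \<in> Wd w" "v \<in> Wd w" for u v
  proof -
    from that obtain k l where "Gw k w u" "Gw l w v" by (auto simp: Wd_def)
    then have "Gw (max k l) w (u + v)" by (intro Gw.add) (auto intro: Gw_mono[of k "max k l"] Gw_mono[of l "max k l"])
    then show ?thesis by (auto simp: Wd_def)
  qed
  then show ?thesis by (auto simp: fock.subspace_def Wd_def intro: Gw.zero Gw.scale)
qed

lemma Wd_vir: "u \<in> Wd w \<Longrightarrow> w' = w - n \<Longrightarrow> L n u \<in> Wd w'"
  unfolding Wd_def using Gw_vir by blast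

lemma Wd_gen: "u \<in> Wd w \<Longrightarrow> X \<in> {XF, XH, XE} \<Longrightarrow> w' = w + D - 1 - s \<Longrightarrow> md X s u \<in> Wd w'"
  unfolding Wd_def using Gw_gen by blast

lemma Wd_Q: "u \<in> Wd w \<Longrightarrow> Q u \<in> Wd w"
  unfolding Wd_def using Gw_Q by blast

end

section \<open>Zero modes on Fock modules\<close>

text \<open>Summation by parts, for the alternating sum in \<open>g_nonroot\<close>.\<close>

lemma sum_weighted_partial: "(\<Sum>j<n. of_nat (n - j) * x j) = (\<Sum>m<n. \<Sum>j\<le>m. (x j :: complex))"
proof (induction n)
  case (Suc n)
  have "(\<Sum>j<Suc n. of_nat (Suc n - j) * x j) = (\<Sum>j<n. of_nat (n - j) * x j + x j) + x n"
    by (simp add: Suc_diff_le algebra_simps less_imp_le)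
  also have "\<dots> = (\<Sum>m<n. \<Sum>j\<le>m. x j) + (\<Sum>j\<le>n. x j)"
    unfolding sum.distrib Suc.IH by (simp add: lessThan_Suc_atMost[symmetric])
  finally show ?case by simp
qed simp

context triplet_setting begin

text \<open>The zero mode of a descendant is a polynomial in the weight times the zero mode of
  \<open>Z\<close>, up to terms in which the weight is first lowered. The subspace \<open>S\<close>
  absorbs these: it is 0 on highest weight vectors in \<open>P_eval\<close>, the kernel of Q in
  \<open>g_eval\<close>, and the generated subspace in \<open>W_Wd\<close>.\<close>

lemma mode_eval:
  assumes R: "Rep p Z z w u \<pi>" and S: "fock.subspace S" and Z: "Z \<in> chg A" and v: "v \<in> chg B" "L 0 v = fscale h v"
    and d: "\<And>a b. a \<in> A \<Longrightarrow> b \<in> B \<Longrightarrow> 2 * int p dvd a * b"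
    and 1: "\<And>w u n. u \<in> Vsp p Z z w \<Longrightarrow> n > 0 \<Longrightarrow> L (- n) (md u (w - 1 + n) v) \<in> S"
    and 2: "\<And>w u j. u \<in> Vsp p Z z w \<Longrightarrow> md u (w - 2 - int j) (L (int j + 1) v) \<in> S"
  shows "md u (w - 1) v - fscale (poly \<pi> h) (md Z (z - 1) v) \<in> S"
  using R
proof (induction rule: Rep.induct)
  case base
  then show ?case using fock.subspace_0[OF S] by simp
next
  case (vir w u \<pi> n)
  have u: "u \<in> Vsp p Z z w" using vir by (auto simp: Vsp_def)
  have c: "u \<in> chg A" using vir(1) Z
    by (induction rule: Rep.induct) (auto intro: chg_add chg_scale chg_0 nmode_chg[OF p0 conformal_chg])
  let ?m = "md u (w - 1) v" and ?k = "w + int n - 1"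
  let ?s1 = "Sum_any (\<lambda>j. fscale ((- 1) ^ j * ch (1 - int n) j) (L (- int n - int j) (md u (?k + int j) v)))"
  let ?s2 = "L (- 1) (md u (?k + 1 - int n) v)"
  let ?s3 = "Sum_any (\<lambda>j. fscale ((- 1) ^ j * ch (1 - int n) (j + 2)) (md u (?k - int n - 1 - int j) (L (int j + 1) v)))"
  have s1: "?s1 \<in> S"
  proof (intro subspace_Sum_any[OF S] fock.subspace_scale[OF S])
    fix j
    have "L (- (int n + int j)) (md u (w - 1 + (int n + int j)) v) \<in> S" by (rule 1[OF u]) (use vir(2) in simp)
    then show "L (- int n - int j) (md u (?k + int j) v) \<in> S" by (simp add: algebra_simps)
  qed
  have s2: "?s2 \<in> S" using 1[OF u, of 1] by simp
  have s3: "?s3 \<in> S"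
  proof (intro subspace_Sum_any[OF S] fock.subspace_scale[OF S])
    fix j show "md u (?k - int n - 1 - int j) (L (int j + 1) v) \<in> S" using 2[OF u, of j] by (simp add: algebra_simps)
  qed
  have sg: "sg (1 - int n) = - ((- 1) ^ n)" using sg_nat[of n] by (simp add: sg_def)
  have mv: "md (L (- int n) u) ?k v = ?s1 - fscale (sg (1 - int n)) (?s2 + fscale (of_int (?k + 1 - int n)) (md u (?k - int n) v)
      + fscale (of_int (int n - 1)) (md u (?k - int n) (L 0 v)) + ?s3)"
    by (rule mode_vir[OF c v(1)]) (rule d)
  have e: "?k - int n = w - 1" "of_int (?k + 1 - int n) = (of_int w :: complex)" "of_int (int n - 1) = (of_nat n - 1 :: complex)" by simp_all
  have comb: "s1 - fscale (- e) (s2 + fscale a m + fscale b (fscale h m) + s3) = fscale (e * (a + h * b)) m + (s1 + fscale e (s2 + s3))" for s1 s2 s3 m a b e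
    by (simp add: fock.scale_right_distrib fock.scale_left_distrib algebra_simps)
  \<comment> \<open>The factor that the rule \<open>vir\<close> of \<open>Rep\<close> puts before
    the polynomial, evaluated at \<open>h\<close>.\<close>
  let ?q = "(- 1) ^ n * (of_int w + h * (of_nat n - 1)) :: complex"
  have "md (L (- int n) u) ?k v = fscale ?q ?m + (?s1 + fscale ((- 1) ^ n) (?s2 + ?s3))"
    unfolding mv sg v(2) lin_scale[OF nmode_lin] e(2,3) comb unfolding e(1) ..
  then have "md (L (- int n) u) ?k v - fscale (?q * poly \<pi> h) (md Z (z - 1) v) =
    fscale ?q (?m - fscale (poly \<pi> h) (md Z (z - 1) v)) + (?s1 + fscale ((- 1) ^ n) (?s2 + ?s3))"
    by (simp add: fock.scale_right_diff_distrib algebra_simps)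
  also have "\<dots> \<in> S"
    by (intro fock.subspace_add[OF S] fock.subspace_scale[OF S] s1 s2 s3 vir)
  finally show ?case by (simp add: algebra_simps)
next
  case (zero w)
  then show ?case using fock.subspace_0[OF S] by (simp add: nmode_simps)
next
  case (add w u \<pi> u' \<pi>')
  then show ?case using fock.subspace_add[OF S add.IH]
    by (simp add: nmode_simps fock.scale_left_distrib algebra_simps)
next
  case (scale w u \<pi> c)
  then show ?case using fock.subspace_scale[OF S scale.IH, of c]
    by (simp add: nmode_simps fock.scale_right_diff_distrib)
qed

text \<open>\<open>\<pi>\<close> is the polynomial of the residue of (1 + x)^D x^l Y(a, x) H. For
  \<open>a\<close> of weight \<open>D\<close>, the case \<open>l = -1\<close> is the product of
  \<open>a\<close> and H in Zhu's algebra and \<open>l = -2\<close> is the element a \<circ> H of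
  O(V).\<close>

definition Pol :: "fock \<Rightarrow> int \<Rightarrow> int \<Rightarrow> fock \<Rightarrow> complex poly \<Rightarrow> bool" where
  "Pol Z z l a \<pi> \<longleftrightarrow> (\<exists>\<rho>. (\<forall>j. Rep p Z z (2 * D - l - 1 - int j) (md a (l + int j) XH) (\<rho> j)) \<and>
     \<pi> = (\<Sum>j\<le>nat D. Polynomial.smult (of_nat (nat D choose j)) (\<rho> j)))"

text \<open>The largest weight occurs at \<open>j = 0\<close> and is \<open>2 * D - l - 1\<close>;
  half its excess over \<open>z\<close> bounds the degree. This gives 2p - 1 for H and H with
  \<open>l = -1\<close>, and p for F and H with \<open>l = -2\<close>.\<close>

lemma Pol_degree:
  assumes "Pol Z z l a \<pi>" "2 * D - l - 1 - z \<le> 2 * int n + 1"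
  shows "degree \<pi> \<le> n"
proof -
  obtain \<rho> where \<rho>: "\<And>j. Rep p Z z (2 * D - l - 1 - int j) (md a (l + int j) XH) (\<rho> j)"
    and \<pi>: "\<pi> = (\<Sum>j\<le>nat D. Polynomial.smult (of_nat (nat D choose j)) (\<rho> j))"
    using assms(1) by (auto simp: Pol_def)
  have "degree (\<rho> j) \<le> n" for j
    using Rep_degree[OF \<rho>[of j]] assms(2) by auto
  then show ?thesis unfolding \<pi> by (intro degree_sum_le) (auto intro: order.trans[OF degree_smult_le])
qed

lemma Pol_P: "\<exists>P. Pol 1 0 (- 1) XH P"
proof -
  have "\<exists>\<rho>. Rep p 1 0 (2 * D - int j) (md XH (- 1 + int j) XH) \<rho>" for j
    using HH_Vsp[of "2 * D - int j"] p2 by (simp add: Vsp_def algebra_simps)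
  then obtain \<rho> where "\<And>j. Rep p 1 0 (2 * D - int j) (md XH (- 1 + int j) XH) (\<rho> j)" by metis
  then show ?thesis unfolding Pol_def by (intro exI conjI allI) (auto)
qed

lemma Pol_g: "\<exists>g. Pol XF D (- 2) XF g"
proof -
  have "\<exists>\<rho>. Rep p XF D (2 * D + 1 - int j) (md XF (- 2 + int j) XH) \<rho>" for j
    using FH_Vsp[of "2 * D + 1 - int j"] p2 by (simp add: Vsp_def algebra_simps)
  then obtain \<rho> where "\<And>j. Rep p XF D (2 * D + 1 - int j) (md XF (- 2 + int j) XH) (\<rho> j)" by metis
  then show ?thesis unfolding Pol_def by (intro exI conjI allI) (auto)
qed

text \<open>The sum on the left is the zero mode of the \<open>l\<close>-th twisted product of \<open>a\<close> and \<open>H\<close>.\<close>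

lemma Pol_eval:
  assumes P: "Pol Z z l a \<pi>" and a: "a \<in> VL" and S: "fock.subspace S" and Z: "Z \<in> chg A" and v: "v \<in> chg B" "L 0 v = fscale h v"
    and d: "\<And>a b. a \<in> A \<Longrightarrow> b \<in> B \<Longrightarrow> 2 * int p dvd a * b"
    and 1: "\<And>w u n. u \<in> Vsp p Z z w \<Longrightarrow> n > 0 \<Longrightarrow> L (- n) (md u (w - 1 + n) v) \<in> S"
    and 2: "\<And>w u j. u \<in> Vsp p Z z w \<Longrightarrow> md u (w - 2 - int j) (L (int j + 1) v) \<in> S"
  shows "Sum_any (\<lambda>j. fscale ((- 1) ^ j * ch l j) (md a (D + l - int j) (md XH (D - l - 2 + int j) v)))
    - fscale (sg l) (Sum_any (\<lambda>j. fscale ((- 1) ^ j * ch l j) (md XH (D - 2 - int j) (md a (D + int j) v))))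
    - fscale (poly \<pi> h) (md Z (z - 1) v) \<in> S"
proof -
  obtain \<rho> where \<rho>: "\<And>j. Rep p Z z (2 * D - l - 1 - int j) (md a (l + int j) XH) (\<rho> j)"
    and \<pi>: "\<pi> = (\<Sum>j\<le>nat D. Polynomial.smult (of_nat (nat D choose j)) (\<rho> j))"
    using P by (auto simp: Pol_def)
  have c: "ch D j = of_nat (nat D choose j)" for j using binomial_gbinomial[of "nat D" j, where ?'a = complex] p2 by simp
  have H: "XH \<in> VL" by (rule X_VL) simp
  let ?x = "\<lambda>j. md (md a (l + int j) XH) (2 * D - l - 1 - int j - 1) v"
  have e: "D + (D - l - 2) - int j = 2 * D - l - 1 - int j - 1" "l + (D - l - 2) = D - 2" for j by simp_all
  let ?T = "Sum_any (\<lambda>j. fscale ((- 1) ^ j * ch l j) (md a (D + l - int j) (md XH (D - l - 2 + int j) v)))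
    - fscale (sg l) (Sum_any (\<lambda>j. fscale ((- 1) ^ j * ch l j) (md XH (D - 2 - int j) (md a (D + int j) v))))"
  have "?T = Sum_any (\<lambda>j. fscale (ch D j) (?x j))"
    using borch_sum[OF VL_borch[OF a H], of D l "D - l - 2" v] unfolding e by (rule sym)
  also have "\<dots> = (\<Sum>j\<le>nat D. fscale (ch D j) (?x j))"
    by (rule Sum_any_le) (unfold c, simp add: binomial_eq_0)
  finally have "?T - fscale (poly \<pi> h) (md Z (z - 1) v) = (\<Sum>j\<le>nat D. fscale (ch D j) (?x j)) - fscale (poly \<pi> h) (md Z (z - 1) v)"
    by (simp only:)
  also have "\<dots> = (\<Sum>j\<le>nat D. fscale (ch D j) (?x j - fscale (poly (\<rho> j) h) (md Z (z - 1) v)))"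
    unfolding \<pi> poly_sum poly_smult c fock.scale_sum_left fock.scale_right_diff_distrib sum_subtractf fock.scale_scale ..
  also have "\<dots> \<in> S"
    by (intro fock.subspace_sum[OF S] fock.subspace_scale[OF S] mode_eval[OF \<rho> S Z v d 1 2])
  finally show ?thesis .
qed

section \<open>Evaluation on exponentials of arbitrary charge\<close>

lemma expo_mode:
  "md (expo (2 * int p * s)) m (expo k) =
    (if m + 1 + s * k \<le> 0 then exp_creation p (2 * int p * s) (nat (- m - 1 - s * k)) (expo (2 * int p * s + k)) else 0)"
proof -
  have "2 * int p * s * k div (2 * int p) = s * k" using p0 by (simp add: mult.assoc)
  then show ?thesis using nmode_expo[OF p0 expo_chg[OF singletonI], of "2 * int p * s" m k] by (simp add: ex_expo[OF p0])
qed

lemma lookup_mode_creation: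
  "lookup (md (expo (2 * int p * r)) m (exp_creation p (2 * int p * s) N (expo l))) (0, K) =
    (if m + 1 + r * l = int N \<and> K = 2 * int p * r + l then (- 1) ^ N * (of_int (2 * int p * r * s) gchoose N) else 0)"
proof -
  have "2 * int p * r * l div (2 * int p) = r * l" using p0 by (simp add: mult.assoc)
  moreover have "of_int (2 * int p * r * (2 * int p * s)) / (2 * of_nat p) = (of_int (2 * int p * r * s) :: complex)"
    using p0' by (simp add: field_simps)
  ultimately show ?thesis unfolding lookup_expo_creation[OF p0] by simp
qed

lemma XF_expo: "XF = expo (2 * int p * (- 1))"
  by (simp add: triplet_F_def)

lemma Q_expo: "Q v = md (expo (2 * int p * 1)) 0 v"
  by (simp add: Q_def)

lemma gr_pos_zero: "v \<in> gr p k (hh p k - of_int n) \<Longrightarrow> n > 0 \<Longrightarrow> v = 0"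
  by (rule gr_low(1)[OF p0, of _ _ "- n"]) simp_all

lemma expo_gr': "expo k \<in> gr p k (hh p k)"
  by (rule expo_gr[OF p0 refl])

lemma mode_expo_zero: "u \<in> gr p 0 (of_int w) \<Longrightarrow> n > 0 \<Longrightarrow> md u (w - 1 + n) (expo t) = 0"
  by (rule gr_pos_zero[of _ t n], rule nmode_gr[OF p0 _ expo_gr']) auto

text \<open>In the charge reached by Q the minimal weight exceeds that of \<open>expo t\<close> by t
  + 1.\<close>

lemma Q_expo_zero: "t \<ge> 0 \<Longrightarrow> Q (expo t) = 0"
proof (rule gr_pos_zero)
  have "hh p t = hh p (t + 2 * int p) - of_int (t + 1)" using p0' by (simp add: hh_def field_simps)
  then show "Q (expo t) \<in> gr p (t + 2 * int p) (hh p (t + 2 * int p) - of_int (t + 1))"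
    using Q_gr[OF expo_gr'[of t] refl] by simp
qed simp

lemma expo_highest:
  "n > 0 \<Longrightarrow> L n (expo t) = 0" "L 0 (expo t) = fscale (hh p t) (expo t)"
  using vir_expo(1,2)[OF p0] by (simp_all only: hh_def)

text \<open>By weight and charge the result is a multiple of the exponential. The contraction of
  e^\<alpha> with e^(-\<alpha>) is (1 - z)^(-2p), whose coefficient at N = t - (2p - 1) is
  \<open>t choose (2 * p - 1)\<close>.\<close>

lemma QF_expo: "Q (md XF (D - 1) (expo (int t))) = fscale (of_nat (t choose (2 * p - 1))) (expo (int t))"
proof -
  have F: "md XF (D - 1) (expo (int t)) \<in> gr p (int t - 2 * int p) (hh p (int t))"
    by (rule nmode_gr[OF p0 X_D(1) expo_gr']) auto
  have "Q (md XF (D - 1) (expo (int t))) \<in> gr p (int t) (hh p (int t) + of_int 0)"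
    using Q_gr[OF F, of "int t"] by simp
  from gr_low(2)[OF p0 this refl]
  have *: "Q (md XF (D - 1) (expo (int t))) = fscale (lookup (Q (md XF (D - 1) (expo (int t)))) (0, int t)) (expo (int t))" .
  have "lookup (Q (md XF (D - 1) (expo (int t)))) (0, int t) = of_nat (t choose (2 * p - 1))"
  proof (cases "t \<ge> 2 * p - 1")
    case True
    define N where "N = t - (2 * p - 1)"
    have N: "nat (- (D - 1) - 1 - (- 1) * int t) = N" "D - 1 + 1 + (- 1) * int t \<le> 0" "0 + 1 + 1 * (2 * int p * - 1 + int t) = int N"
      using True p2 by (simp_all add: N_def)
    have "lookup (Q (md XF (D - 1) (expo (int t)))) (0, int t) = (- 1) ^ N * (of_int (2 * int p * 1 * (- 1)) gchoose N)"
      unfolding XF_expo expo_mode Q_expo using N by (simp only: if_True lookup_mode_creation) simp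
    also have "\<dots> = (- 1) ^ N * ((- 1) ^ N * (of_nat t gchoose N))"
    proof -
      have "of_nat N - of_int (2 * int p * 1 * (- 1)) - 1 = (of_nat t :: complex)"
      proof -
        have "t + 1 = N + 2 * p" using True p2 by (simp add: N_def)
        then have "of_nat t + 1 = of_nat N + 2 * (of_nat p :: complex)" by (metis of_nat_1 of_nat_add of_nat_mult of_nat_numeral)
        then show ?thesis by (simp add: algebra_simps)
      qed
      then show ?thesis using gbinomial_negated_upper[of "of_int (2 * int p * 1 * (- 1)) :: complex" N] by (simp only:)
    qed
    also have "\<dots> = of_nat (t choose (2 * p - 1))"
      using binomial_symmetric[of "2 * p - 1" t] True by (simp add: N_def binomial_gbinomial flip: power_add mult.assoc)
    finally show ?thesis .
  next
    case False
    then have "\<not> (D - 1) + 1 + (- 1) * int t \<le> 0" by simp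
    then have "md XF (D - 1) (expo (int t)) = 0" unfolding XF_expo expo_mode by (simp only: if_False)
    then show ?thesis using False by (simp add: lin_0[OF Q_lin] binomial_eq_0)
  qed
  then show ?thesis using * by simp
qed

text \<open>The zero mode of H is the commutator of Q with that of F, and Q annihilates the
  exponential.\<close>

lemma H_expo: "md XH (D - 1) (expo (int t)) = fscale (of_nat (t choose (2 * p - 1))) (expo (int t))"
proof -
  have "Q (md XF (D - 1) (expo (int t))) = md XH (D - 1) (expo (int t)) + md XF (D - 1) (Q (expo (int t)))"
    unfolding XH_Q by (rule Q_md[OF X_VL]) simp
  then show ?thesis unfolding QF_expo by (simp add: Q_expo_zero nmode_simps)
qed

lemma subspace_zero: "fock.subspace {0}"
  by (simp add: fock.subspace_def)

lemma H_pos_expo: "md XH (D - 1 + int (Suc j)) (expo t) = 0"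
  by (rule mode_expo_zero[OF X_D(2)]) simp

text \<open>Positive modes of H annihilate the exponential, so of the zero mode of the product of H
  with H only the square of the zero mode of H remains.\<close>

lemma P_eval:
  assumes P: "Pol 1 0 (- 1) XH P"
  shows "poly P (hh p (int t)) = (of_nat (t choose (2 * p - 1)))\<^sup>2"
proof -
  let ?v = "expo (int t)"
  have V: "u \<in> gr p 0 (of_int w)" if "u \<in> Vsp p 1 0 w" for u w
    using that Rep_gr[of 1 0 w u _ 0] one_gr[OF p0] by (auto simp: Vsp_def)
  have H1: "md XH (D - 1 + int j) ?v = (if j = 0 then md XH (D - 1) ?v else 0)" for j
    using H_pos_expo[of "j - 1" "int t"] by (cases j) auto
  have H2: "md XH (D + int j) ?v = 0" for j
    using H_pos_expo[of j "int t"] by (simp add: algebra_simps)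
  have b1: "(- 1) ^ j * ch (- 1) j = 1" for j using bn_eq[of 0 j] by (simp add: bn_def)
  have s: "Sum_any (\<lambda>j. fscale ((- 1) ^ j * ch (- 1) j) (md XH (D + - 1 - int j) (md XH (D - - 1 - 2 + int j) ?v))) = md XH (D - 1) (md XH (D - 1) ?v)"
    using H1 by (subst Sum_any_single[of 0]) (simp_all add: nmode_simps)
  have "Sum_any (\<lambda>j. fscale ((- 1) ^ j * ch (- 1) j) (md XH (D + - 1 - int j) (md XH (D - - 1 - 2 + int j) ?v)))
    - fscale (sg (- 1)) (Sum_any (\<lambda>j. fscale ((- 1) ^ j * ch (- 1) j) (md XH (D - 2 - int j) (md XH (D + int j) ?v))))
    - fscale (poly P (hh p (int t))) (md 1 (0 - 1) ?v) \<in> {0}"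
  proof (rule Pol_eval[OF P X_VL subspace_zero one_chg[OF singletonI] expo_chg[OF singletonI] expo_highest(2)])
    show "L (- n) (md u (w - 1 + n) ?v) \<in> {0}" if "u \<in> Vsp p 1 0 w" "n > 0" for w u n
      using mode_expo_zero[OF V[OF that(1)] that(2)] by (simp add: nmode_simps)
    show "md u (w - 2 - int j) (L (int j + 1) ?v) \<in> {0}" for w u j
      using expo_highest(1)[of "int j + 1"] by (simp add: nmode_simps)
  qed simp_all
  then have "md XH (D - 1) (md XH (D - 1) ?v) = fscale (poly P (hh p (int t))) ?v"
    unfolding s H2 by (simp add: nmode_simps nmode_one[OF p0])
  then have "fscale ((of_nat (t choose (2 * p - 1)))\<^sup>2) ?v = fscale (poly P (hh p (int t))) ?v"
    unfolding H_expo nmode_simps by (simp add: power2_eq_square)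
  from arg_cong[OF this, of "\<lambda>x. lookup x (0, int t)"] show ?thesis
    unfolding lookup_fscale lookup_expo by (simp only: simp_thms if_True mult_1_right)
qed

text \<open>The zero mode of F leads to another charge; applying Q returns to a multiple of the
  exponential, and the kernel of Q absorbs the remaining descendants. Positive modes of H annihilate
  the exponential, and the H in the other sum is replaced by the commutator of Q with F.\<close>

lemma g_eval:
  assumes g: "Pol XF D (- 2) XF g"
  shows "fscale (poly g (hh p (int t)) * of_nat (t choose (2 * p - 1))) (expo (int t)) =
    - Sum_any (\<lambda>j. fscale (of_nat (j + 1)) (Q (Q (md XF (D - 2 - int j) (md XF (D + int j) (expo (int t)))))))"
proof -
  let ?v = "expo (int t)"
  let ?S = "{x. Q x = 0}"
  have S: "fock.subspace ?S" by (auto simp: fock.subspace_def lin_simps[OF Q_lin])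
  have F: "XF \<in> chg {- 2 * int p}" "XF \<in> VL" "XH \<in> VL" using gr_chg[OF X_D(1)] X_VL by auto
  have V: "u \<in> gr p (- 2 * int p) (of_int w)" if "u \<in> Vsp p XF D w" for u w
    using that Rep_gr[of XF D w u _ "- 2 * int p"] X_D(1) by (auto simp: Vsp_def)
  have z: "Q (md u (w - 1 + n) ?v) = 0" if u: "u \<in> gr p (- 2 * int p) (of_int w)" and n: "n > 0" for u w n
  proof (rule gr_pos_zero[OF _ n])
    have "md u (w - 1 + n) ?v \<in> gr p (int t - 2 * int p) (hh p (int t) - of_int n)"
      by (rule nmode_gr[OF p0 u expo_gr']) auto
    then show "Q (md u (w - 1 + n) ?v) \<in> gr p (int t) (hh p (int t) - of_int n)" by (rule Q_gr) simp
  qed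
  have H2: "md XH (D - - 2 - 2 + int j) ?v = 0" for j
    using H_pos_expo[of j "int t"] by (simp add: algebra_simps)
  let ?f = "\<lambda>j. fscale ((- 1) ^ j * ch (- 2) j) (md XH (D - 2 - int j) (md XF (D + int j) ?v))"
  have f: "fs ?f" by (rule nmode_fsI[of p XF D ?v]) (simp add: nmode_simps)
  have Qf: "Q (?f j) = fscale (of_nat (j + 1)) (Q (Q (md XF (D - 2 - int j) (md XF (D + int j) ?v))))" for j
  proof -
    let ?y = "md XF (D + int j) ?v"
    have y: "Q ?y = 0" using z[OF X_D(1), of "int j + 1"] by (simp add: algebra_simps)
    have "Q (md XF (D - 2 - int j) ?y) = md XH (D - 2 - int j) ?y"
      unfolding Q_md[OF F(2), of "D - 2 - int j" ?y] XH_Q y by (simp add: nmode_simps)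
    then show ?thesis by (simp only: lin_scale[OF Q_lin] ch_m2)
  qed
  have "Sum_any (\<lambda>j. fscale ((- 1) ^ j * ch (- 2) j) (md XF (D + - 2 - int j) (md XH (D - - 2 - 2 + int j) ?v)))
    - fscale (sg (- 2)) (Sum_any ?f) - fscale (poly g (hh p (int t))) (md XF (D - 1) ?v) \<in> ?S"
  proof (rule Pol_eval[OF g F(2) S F(1) expo_chg[OF singletonI] expo_highest(2)])
    show "L (- n) (md u (w - 1 + n) ?v) \<in> ?S" if "u \<in> Vsp p XF D w" "n > 0" for w u n
      using z[OF V[OF that(1)] that(2)] unfolding mem_Collect_eq Q_vir[symmetric] by (simp add: nmode_simps)
    show "md u (w - 2 - int j) (L (int j + 1) ?v) \<in> ?S" for w u j
      using expo_highest(1)[of "int j + 1"] by (simp add: nmode_simps lin_0[OF Q_lin])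
  qed auto
  then have "- Q (Sum_any ?f) = fscale (poly g (hh p (int t)) * of_nat (t choose (2 * p - 1))) ?v"
    unfolding H2 using QF_expo[of t] by (simp add: nmode_simps sg_def lin_simps[OF Q_lin] eq_neg_iff_add_eq_0 neg_eq_iff_add_eq_0)
  then show ?thesis unfolding Sum_any_lin[OF Q_lin f] Qf by simp
qed

lemma FF_gr: "md XF (D - 2 - int j) (md XF (D + int j) (expo t)) \<in> gr p (t - 4 * int p) (hh p t)"
proof (rule nmode_gr[OF p0 X_D(1)])
  show "md XF (D + int j) (expo t) \<in> gr p (t - 2 * int p) (hh p t - of_nat j - 1)"
    by (rule nmode_gr[OF p0 X_D(1) expo_gr']) auto
qed auto

lemma hh_FF: "hh p t = hh p (t - 4 * int p) + of_int (2 * t + 2 - 6 * int p)"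
  using p0' by (simp add: hh_def field_simps)

text \<open>By \<open>hh_FF\<close> the two modes of F lead to a weight that exceeds the minimum of
  its charge by 2t + 2 - 6p, which is negative up to t = 3p - 2; from t = 2p - 1 on the binomial
  factor in \<open>g_eval\<close> is nonzero. These are p roots.\<close>

lemma g_roots:
  assumes g: "Pol XF D (- 2) XF g" and t: "2 * p - 1 \<le> t" "t \<le> 3 * p - 2"
  shows "poly g (hh p (int t)) = 0"
proof -
  have "md XF (D - 2 - int j) (md XF (D + int j) (expo (int t))) = 0" for j
    by (rule gr_low(1)[OF p0, of _ "int t - 4 * int p" "2 * int t + 2 - 6 * int p"], fold hh_FF, rule FF_gr) (use t p2 in auto)
  then have "fscale (poly g (hh p (int t)) * of_nat (t choose (2 * p - 1))) (expo (int t)) = 0"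
    unfolding g_eval[OF g] by (simp add: lin_0[OF Q_lin])
  from arg_cong[OF this, of "\<lambda>x. lookup x (0, int t)"]
  have "poly g (hh p (int t)) * of_nat (t choose (2 * p - 1)) = 0"
    unfolding lookup_fscale lookup_expo lookup_zero by (simp only: simp_thms if_True mult_1_right)
  then show ?thesis using t by (simp add: binomial_eq_0_iff)
qed

text \<open>At the first t beyond the roots of \<open>g_roots\<close>, the two modes of F lead
  exactly to the minimal weight of their charge, so every vector in \<open>g_eval\<close> is an
  explicit multiple of an exponential.\<close>

lemma g_nonroot:
  assumes g: "Pol XF D (- 2) XF g"
  shows "poly g (hh p (int (3 * p - 1))) \<noteq> 0"
proof
  assume g0: "poly g (hh p (int (3 * p - 1))) = 0"
  define t where "t = 3 * int p - 1"
  have t: "int (3 * p - 1) = t" using p2 by (simp add: t_def)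
  let ?c = "\<lambda>j. if j < p then (- 1) ^ (p - Suc j) * (of_nat (2 * p) gchoose (p - Suc j)) else (0::complex)"
  have FF: "md XF (D - 2 - int j) (md XF (D + int j) (expo t)) = fscale (?c j) (expo (- int p - 1))" for j
  proof -
    let ?x = "md XF (D - 2 - int j) (md XF (D + int j) (expo t))"
    have "?x \<in> gr p (- int p - 1) (hh p (- int p - 1) + of_int 0)"
      using FF_gr[of j t] hh_FF[of t] by (simp add: t_def)
    from gr_low(2)[OF p0 this refl] have "?x = fscale (lookup ?x (0, - int p - 1)) (expo (- int p - 1))" .
    moreover have "lookup ?x (0, - int p - 1) = ?c j"
    proof (cases "j < p")
      case True
      then have N: "nat (- (D + int j) - 1 - (- 1) * t) = p - Suc j" "(D + int j) + 1 + (- 1) * t \<le> 0"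
        "(D - 2 - int j) + 1 + (- 1) * (2 * int p * - 1 + t) = int (p - Suc j)" "- int p - 1 = 2 * int p * (- 1) + (2 * int p * - 1 + t)"
        by (auto simp: t_def)
      have "lookup ?x (0, - int p - 1) = (- 1) ^ (p - Suc j) * (of_int (2 * int p * - 1 * - 1) gchoose (p - Suc j))"
        unfolding XF_expo expo_mode[of "- 1" _ t] using N(2) unfolding N(1) by (simp only: if_True lookup_mode_creation N(3) N(4)) simp
      then show ?thesis using True by simp
    next
      case False
      then have "\<not> (D + int j) + 1 + (- 1) * t \<le> 0" by (simp add: t_def)
      then have "md XF (D + int j) (expo t) = 0" unfolding XF_expo expo_mode by (simp only: if_False)
      then show ?thesis using False by (simp add: nmode_simps)
    qed
    ultimately show ?thesis by simp
  qed
  let ?x = "Q (Q (expo (- int p - 1)))"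
  have "?x \<in> gr p t (hh p t + of_int 0)"
  proof -
    have "hh p t = hh p (- int p - 1)" using hh_FF[of t] by (simp add: t_def)
    then show ?thesis using Q_gr[OF Q_gr[OF expo_gr'[of "- int p - 1"] refl], of t] by (simp add: t_def)
  qed
  from gr_low(2)[OF p0 this refl] have "?x = fscale (lookup ?x (0, t)) (expo t)" .
  moreover have "lookup ?x (0, t) = (- 1) ^ p * (of_nat (2 * p) gchoose p)"
  proof -
    have N: "nat (- 0 - 1 - 1 * (- int p - 1)) = p" "0 + 1 + 1 * (- int p - 1) \<le> 0"
        "0 + 1 + 1 * (2 * int p * 1 + (- int p - 1)) = int p" "t = 2 * int p * 1 + (2 * int p * 1 + (- int p - 1))"
      by (auto simp: t_def)
    have "lookup ?x (0, t) = (- 1) ^ p * (of_int (2 * int p * 1 * 1) gchoose p)"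
      unfolding Q_expo expo_mode[of 1 _ "- int p - 1"] using N(2) unfolding N(1) by (simp only: if_True lookup_mode_creation N(3) N(4)) simp
    then show ?thesis by simp
  qed
  ultimately have QQ: "?x = fscale ((- 1) ^ p * (of_nat (2 * p) gchoose p)) (expo t)" by simp
  \<comment> \<open>The contraction of F with F gives the coefficients of (1 - z)^(2p), weighted by
    j + 1. Reversed and written as iterated partial sums, where each summation lowers the upper
    index 2p by one, the sum is up to sign the nonzero number (2p - 2) choose (p - 1).\<close>
  let ?s = "\<Sum>j<p. of_nat (j + 1) * ?c j"
  have "Sum_any (\<lambda>j. fscale (of_nat (j + 1)) (Q (Q (md XF (D - 2 - int j) (md XF (D + int j) (expo t)))))) =
    (\<Sum>j<p. fscale (of_nat (j + 1)) (fscale (?c j) ?x))"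
    unfolding FF lin_scale[OF Q_lin] by (rule Sum_any_lt) simp
  also have "\<dots> = fscale ?s ?x" by (simp only: fock.scale_scale fock.scale_sum_left)
  finally have "fscale ?s ?x = 0"
    using g_eval[OF g, of "3 * p - 1"] g0 unfolding t by simp
  from arg_cong[OF this, of "\<lambda>x. lookup x (0, t)"]
  have "?s * ((- 1) ^ p * (of_nat (2 * p) gchoose p)) = 0"
    unfolding QQ fock.scale_scale lookup_fscale lookup_expo lookup_zero by (simp only: simp_thms if_True mult_1_right)
  moreover have "of_nat (2 * p) gchoose p \<noteq> (0::complex)"
    unfolding binomial_gbinomial[symmetric] by simp
  ultimately have "?s = 0" by simp
  have "?s = (\<Sum>j<p. of_nat (p - (p - Suc j)) * ((of_nat (2 * p) gchoose (p - Suc j)) * (- 1) ^ (p - Suc j)))"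
    by (rule sum.cong) auto
  also have "\<dots> = (\<Sum>j<p. of_nat (p - j) * ((of_nat (2 * p) gchoose j) * (- 1) ^ j))"
    by (rule sum.nat_diff_reindex)
  also have "\<dots> = (\<Sum>m<p. \<Sum>j\<le>m. (of_nat (2 * p) gchoose j) * (- 1) ^ j)"
    by (rule sum_weighted_partial)
  also have "\<dots> = (\<Sum>m<p. (- 1) ^ m * (of_nat (2 * p) - 1 gchoose m))"
    by (simp only: gbinomial_sum_lower_neg)
  also have "\<dots> = (\<Sum>m\<le>p - 1. (of_nat (2 * p) - 1 gchoose m) * (- 1) ^ m)"
    by (rule sum.cong) (use p2 in auto)
  also have "\<dots> = (- 1) ^ (p - 1) * (of_nat (2 * p - 2) gchoose (p - 1))"
    unfolding gbinomial_sum_lower_neg using p2 by (simp add: of_nat_diff)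
  finally have "of_nat (2 * p - 2) gchoose (p - 1) = (0::complex)" using \<open>?s = 0\<close> by simp
  moreover have "p - 1 \<le> 2 * p - 2" by simp
  ultimately show False unfolding binomial_gbinomial[symmetric] by (simp add: binomial_eq_0_iff)
qed

text \<open>As polynomials in t, P(h_t) and (t choose 2p-1)^2 agree, since they do so at all natural
  numbers. The weight N equals h_r for the larger solution r = p - 1 + sqrt((p-1)^2 + 4pN), and r >
  2p - 2 avoids the zeros 0, ..., 2p - 2 of the binomial coefficient.\<close>

lemma P_nonroot:
  assumes P: "Pol 1 0 (- 1) XH P" and N: "N \<ge> 1"
  shows "poly P (of_int N) \<noteq> 0"
proof
  assume z: "poly P (of_int N) = 0"
  let ?n = "2 * p - 1"
  let ?h = "Polynomial.smult (1 / (4 * of_nat p)) [:0, 2 - 2 * of_nat p, 1:] :: complex poly"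
  let ?b = "Polynomial.smult (1 / fact ?n) (\<Prod>i<?n. [:- of_nat i, 1:]) :: complex poly"
  have h: "poly ?h (of_int t) = hh p t" for t
    using p0' by (simp add: hh_def field_simps)
  have b: "poly ?b x = x gchoose ?n" for x
    by (simp add: poly_prod gbinomial_prod_rev atLeast0LessThan algebra_simps)
  have eq: "poly (pcompose P ?h - ?b ^ 2) (of_nat t) = 0" for t
    using P_eval[OF P, of t] h[of "int t"] b[of "of_nat t"] by (simp add: poly_pcompose binomial_gbinomial)
  have "pcompose P ?h - ?b ^ 2 = 0"
  proof (rule ccontr)
    assume "pcompose P ?h - ?b ^ 2 \<noteq> 0"
    then have "finite {x. poly (pcompose P ?h - ?b ^ 2) x = 0}" by (rule poly_roots_finite)
    moreover have "range (of_nat :: nat \<Rightarrow> complex) \<subseteq> {x. poly (pcompose P ?h - ?b ^ 2) x = 0}" using eq by blast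
    ultimately have "finite (range (of_nat :: nat \<Rightarrow> complex))" by (rule finite_subset[rotated])
    then show False by (simp add: finite_image_iff inj_of_nat)
  qed
  then have e: "pcompose P ?h = ?b ^ 2" by (simp only: right_minus_eq)
  have 1: "poly P (poly ?h x) = (x gchoose ?n)\<^sup>2" for x
    using arg_cong[OF e, of "\<lambda>q. poly q x"] unfolding poly_pcompose poly_power b .
  define r where "r = real p - 1 + sqrt ((real p - 1)\<^sup>2 + 4 * real p * real_of_int N)"
  have q: "(r - (real p - 1))\<^sup>2 = (real p - 1)\<^sup>2 + 4 * real p * real_of_int N"
    unfolding r_def using N by simp
  have "poly ?h (of_real r) = of_real (r * (r - 2 * real p + 2) / (4 * real p))"
    by (simp add: algebra_simps add_divide_distrib diff_divide_distrib)
  also have "r * (r - 2 * real p + 2) = 4 * real p * real_of_int N"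
    using q by (simp add: power2_eq_square algebra_simps)
  finally have "poly ?h (of_real r) = of_int N" using p0 by simp
  then have "(complex_of_real r gchoose ?n) = 0" using 1[of "of_real r"] z by simp
  then obtain i where i: "i < ?n" "complex_of_real r = of_nat i"
    by (auto simp: gbinomial_prod_rev)
  then have "r = real i" by (metis of_real_eq_iff of_real_of_nat_eq)
  moreover have "r > real p - 1 + (real p - 1)"
  proof -
    have "real p - 1 < sqrt ((real p - 1)\<^sup>2 + 4 * real p * real_of_int N)"
      using N p2 by (intro real_less_rsqrt) simp
    then show ?thesis by (simp add: r_def)
  qed
  ultimately show False using i(1) p2 by linarith
qed

lemma g_nonzero: "Pol XF D (- 2) XF g \<Longrightarrow> g \<noteq> 0"
  using g_nonroot poly_0 by blast

text \<open>The p distinct weights of \<open>g_roots\<close> are at most (3p - 2)/4, hence smaller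
  than 2p - 1. A further root \<open>N\<close> would be one too many for degree p.\<close>

lemma g_nonroot_int:
  assumes g: "Pol XF D (- 2) XF g" and N: "N \<ge> 2 * int p - 1"
  shows "poly g (of_int N) \<noteq> 0"
proof
  assume z: "poly g (of_int N) = 0"
  have inj: "inj_on (\<lambda>t. hh p (int t)) {2 * p - 1..3 * p - 2}"
  proof (rule inj_onI)
    fix s t assume s: "s \<in> {2 * p - 1..3 * p - 2}" and t: "t \<in> {2 * p - 1..3 * p - 2}" and e: "hh p (int s) = hh p (int t)"
    then have "of_int (int s * (int s - 2 * int p + 2)) = (of_int (int t * (int t - 2 * int p + 2)) :: complex)"
      using p0' unfolding hh_def by (simp only: divide_cancel_right) simp
    then have "int s * (int s - 2 * int p + 2) = int t * (int t - 2 * int p + 2)" by (simp only: of_int_eq_iff)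
    then have "(int s - int t) * (int s + int t - 2 * int p + 2) = 0" by (simp add: algebra_simps)
    moreover have "int s + int t - 2 * int p + 2 > 0" using s t p2 by (simp add: of_nat_diff) linarith
    ultimately show "s = t" by simp
  qed
  let ?R = "(\<lambda>t. hh p (int t)) ` {2 * p - 1..3 * p - 2}"
  have "of_int N \<notin> ?R"
  proof
    assume "of_int N \<in> ?R"
    then obtain t where t: "2 * p - 1 \<le> t" "t \<le> 3 * p - 2" "of_int N = hh p (int t)" by auto
    then have "of_int (4 * int p * N) = (of_int (int t * (int t - 2 * int p + 2)) :: complex)"
      using p0' unfolding hh_def by (simp add: field_simps)
    then have "4 * int p * N = int t * (int t - 2 * int p + 2)" by (simp only: of_int_eq_iff)
    also have "\<dots> \<le> (3 * int p - 2) * int p" using t p2 by (intro mult_mono) auto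
    finally have "4 * N * int p \<le> (3 * int p - 2) * int p" by (simp add: algebra_simps)
    then have "4 * N \<le> 3 * int p - 2" using p0 by simp
    then show False using N p2 by simp
  qed
  then have "card (insert (of_int N) ?R) = p + 1" using inj p2 by (simp add: card_image)
  moreover have "insert (of_int N) ?R \<subseteq> {x. poly g x = 0}" using z g_roots[OF g] by auto
  moreover have "card {x. poly g x = 0} \<le> degree g" "finite {x. poly g x = 0}"
    using card_poly_roots_bound[OF g_nonzero[OF g]] poly_roots_finite[OF g_nonzero[OF g]] by auto
  moreover have "degree g \<le> p" by (rule Pol_degree[OF g]) simp
  ultimately show False using card_mono[of "{x. poly g x = 0}" "insert (of_int N) ?R"] by linarith
qed

section \<open>The weights of W(p) in charge \<alpha>\<close>

lemma heis_gr: "v \<in> gr p k c \<Longrightarrow> heis p i v \<in> gr p k (c - of_int i)"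
  using vir_heis[OF p0, of i 0 v]
  by (auto simp: gr_def heis_scale heis_chg algebra_simps fock.scale_left_diff_distrib simp flip: fock.scale_left_distrib)

text \<open>If all modes of e^(\<alpha>/2p) annihilate \<open>v\<close>, they annihilate every image
  of \<open>v\<close> under the \<open>\<alpha>(i)\<close>. An image with a nonzero coefficient at
  e^\<alpha> would be a multiple of e^\<alpha>, on which the mode -2 does not vanish.\<close>

lemma expo_1_separating:
  assumes v: "v \<in> gr p (2 * int p) c" and z: "\<And>m. md (expo 1) m v = 0"
  shows "v = 0"
proof (rule heis_separating[OF p0])
  fix "is" :: "int list" and K :: int
  have c: "heis p (int j) (expo 1) = (if j = 0 then expo 1 else 0)" for j by (simp add: heis_expo)
  have "(\<forall>m. md (expo 1) m (foldr (heis p) is v) = 0) \<and> (\<exists>c. foldr (heis p) is v \<in> gr p (2 * int p) c)"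
  proof (induction "is")
    case Nil
    then show ?case using z v by auto
  next
    case (Cons i "is")
    let ?y = "foldr (heis p) is v"
    have "md (expo 1) m (heis p i ?y) = 0" for m
    proof -
      have "Sum_any (\<lambda>j. fscale (ch i j) (md (heis p (int j) (expo 1)) (m + i - int j) ?y)) = 0"
        using Cons by (intro Sum_any_zero) (simp add: c nmode_simps)
      then show ?thesis using heis_nmode[OF p0, of i "expo 1" m ?y] Cons by simp
    qed
    then show ?case using Cons heis_gr[of ?y "2 * int p" _ i] by auto
  qed
  then obtain c where y: "\<And>m. md (expo 1) m (foldr (heis p) is v) = 0" "foldr (heis p) is v \<in> gr p (2 * int p) c" by blast
  let ?y = "foldr (heis p) is v"
  show "lookup ?y (0, K) = 0"
  proof (rule ccontr)
    assume nz: "lookup ?y (0, K) \<noteq> 0"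
    then have K: "K = 2 * int p" "c = hh p (2 * int p) + of_int 0"
      using y(2) unfolding gr_iff[OF p0] by (auto simp: in_keys_iff wtk_def dg_0 dest!: bspec[of _ _ "(0, K)"])
    have "?y = fscale (lookup ?y (0, 2 * int p)) (expo (2 * int p))"
      by (rule gr_low(2)[OF p0 _ refl]) (use y(2) K in simp)
    then have "lookup (md (expo 1) (- 2) ?y) (0, 1 + 2 * int p) =
      lookup ?y (0, 2 * int p) * lookup (md (expo 1) (- 2) (expo (2 * int p))) (0, 1 + 2 * int p)"
      by (metis lookup_fscale lin_scale[OF nmode_lin])
    then show False using y(1) nz K p0 by (simp add: lookup_nmode_expo)
  qed
qed

lemma top_mode:
  assumes "md u m0 v \<noteq> 0"
  shows "\<exists>r. md u r v \<noteq> 0 \<and> (\<forall>m>r. md u m v = 0)"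
proof -
  obtain N where N: "\<forall>m\<ge>N. md u m v = 0" using nmode_trunc by blast
  let ?A = "{m \<in> {m0..N}. md u m v \<noteq> 0}"
  have "m0 \<le> N" using assms N by (metis linear)
  then have A: "finite ?A" "m0 \<in> ?A" using assms by (auto intro: finite_subset[of _ "{m0..N}"])
  have "md u m v = 0" if "m > Max ?A" for m
    using Max_ge[OF A(1), of m] Max_ge[OF A] that N by (cases "m \<ge> N") auto
  moreover have "Max ?A \<in> ?A" using A by (intro Max_in) auto
  ultimately show ?thesis by blast
qed

text \<open>The vector \<open>e ^ (\<alpha>/2p)\<close> has a singular descendant of degree two, which restricts the weights of
  the highest weight vectors on which its field acts.\<close>

lemma expo_1_null: "fscale (of_nat p) (L (- 1) (L (- 1) (expo 1))) = L (- 2) (expo 1)"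
proof -
  have "tran p (expo 1) = fscale (1 / (2 * of_nat p)) (osc 0 * expo 1)" using tran_expo[OF p0, of 1] by simp
  then have "fscale (of_nat p) (L (- 1) (L (- 1) (expo 1))) = fscale (of_nat p) (fscale (1 / (2 * of_nat p)) (osc 0 * fscale (1 / (2 * of_nat p)) (osc 0 * expo 1) + osc 1 * expo 1))"
    unfolding vir_m1[OF p0] by (simp add: lin_simps[OF tran_lin] tran_osc[OF p0])
  also have "\<dots> = fscale (1 / (4 * of_nat p)) (osc 0 * (osc 0 * expo 1)) + fscale (1 / 2) (osc 1 * expo 1)"
    using p0' by (simp add: fock.scale_right_distrib fscale_mult_right field_simps)
  finally show ?thesis using p0' by (simp only: vir_expo(4)[OF p0]) simp
qed

lemma singular_weight:
  assumes v: "v \<in> gr p (2 * int p) (of_int N)" "v \<noteq> 0" and pr: "\<And>n. n > 0 \<Longrightarrow> L n v = 0"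
  shows "\<exists>m. N = m * (int p * m + int p - 1)"
proof -
  \<comment> \<open>The highest mode that does not annihilate \<open>v\<close>. In the mode
    \<open>r + 2\<close> of the null vector equation only terms with this vector survive, and
    comparing them determines \<open>N\<close>.\<close>
  obtain r where r: "md (expo 1) r v \<noteq> 0" "\<And>m. m > r \<Longrightarrow> md (expo 1) m v = 0"
    using top_mode expo_1_separating[OF v(1)] v(2) by metis
  let ?e = "expo 1" and ?T = "{1 :: int}"
  have e: "?e \<in> chg {1}" "L (- 1) ?e \<in> chg {1}"
    using nmode_chg1[OF p0 conformal_chg[of p] expo_chg[OF singletonI[of 1]], of 0] by (auto intro: expo_chg)
  have T: "md (L (- 1) u) k v = fscale (- of_int k) (md u (k - 1) v)" if "u \<in> chg {1}" for u k
    unfolding vir_m1[OF p0] by (rule tran_nmode[OF p0 borch_1[OF p0 that gr_chg[OF v(1)]]]) simp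
  have z: "md ?e (r + 2 + int j) v = 0" "md ?e (r + 2 - 1) v = 0" for j using r(2) by simp_all
  have "md (L (- 2) ?e) (r + 2) v = Sum_any (\<lambda>j. fscale ((- 1) ^ j * ch (1 - 2) j) (L (- 2 - int j) (md ?e (r + 2 + int j) v)))
    - fscale (sg (1 - 2)) (L (- 1) (md ?e (r + 2 + 1 - 2) v) + fscale (of_int (r + 2 + 1 - 2) + of_int (2 - 1) * of_int N) (md ?e (r + 2 - 2) v))"
    by (rule mode_vir_primary[OF gr_chg[OF v(1)] pr gr_vir_0[OF v(1)] _ e(1)]) simp_all
  then have 1: "md (L (- 2) ?e) (r + 2) v = fscale (of_int (r + 1 + N)) (md ?e r v)"
    unfolding z(1) using z(2) by (simp add: nmode_simps sg_def algebra_simps)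
  have "md (fscale (of_nat p) (L (- 1) (L (- 1) ?e))) (r + 2) v = fscale (of_int (int p * (r + 2) * (r + 1))) (md ?e r v)"
    unfolding lin_scale[OF vop_lin_left] T[OF e(2)] T[OF e(1)] fock.scale_scale by (simp add: algebra_simps)
  from this[unfolded expo_1_null 1] have "fscale (of_int (int p * (r + 2) * (r + 1))) (md ?e r v) = fscale (of_int (r + 1 + N)) (md ?e r v)"
    by (rule sym)
  then have "of_int (int p * (r + 2) * (r + 1)) = (of_int (r + 1 + N) :: complex)" using r(1) by simp
  then have "int p * (r + 2) * (r + 1) = r + 1 + N" by (simp only: of_int_eq_iff)
  then have "N = (r + 1) * (int p * (r + 1) + int p - 1)" by (simp add: algebra_simps)
  then show ?thesis by blast
qed

text \<open>By induction all L(n) v with n > 0 vanish, so the weight is m (p m + p - 1) by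
  \<open>singular_weight\<close>. Positive and below 2p - 1 this is only for m = -1, that is weight
  1, where \<open>v\<close> is a multiple of e^\<alpha>; the second screening does not annihilate
  e^\<alpha>.\<close>

lemma W_charge_1:
  assumes "v \<in> W" "v \<in> gr p (2 * int p) (of_int N)" "N < 2 * int p - 1"
  shows "v = 0"
  using assms
proof (induction "nat N" arbitrary: N v rule: less_induct)
  case less
  have z: "v = 0" if "N < 1"
    using gr_low(1)[OF p0, of v "2 * int p" "N - 1"] less.prems(2) that by (simp add: hh_screening)
  show ?case
  proof (rule ccontr)
    assume nz: "v \<noteq> 0"
    then have N: "N \<ge> 1" using z by fastforce
    have pr: "L n v = 0" if n: "n > 0" for n
    proof (cases "N - n < 1")
      case True
      have "L n v \<in> gr p (2 * int p) (hh p (2 * int p) + of_int (N - n - 1))"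
        by (rule vir_gr[OF p0 less.prems(2)]) (simp add: hh_screening)
      then show ?thesis by (rule gr_low(1)[OF p0]) (use True in simp)
    next
      case False
      show ?thesis
        by (rule less.hyps[of "N - n"])
           (use n False less.prems in \<open>auto intro: W_md W_conformal vir_gr[OF p0 less.prems(2)]\<close>)
    qed
    obtain m where m: "N = m * (int p * m + int p - 1)" using singular_weight[OF less.prems(2) nz pr] by blast
    have "m = - 1"
    proof (rule ccontr)
      assume "m \<noteq> - 1"
      then consider "m = 0" | "m \<ge> 1" | "m \<le> - 2" by linarith
      then show False
      proof cases
        case 2
        then have a: "int p * 1 \<le> int p * m" by (intro mult_left_mono) auto
        then have "1 * (int p * m + int p - 1) \<le> m * (int p * m + int p - 1)" using p2 2 by (intro mult_right_mono) linarith+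
        with a show False using m less.prems(3) by simp
      next
        case 3
        then have a: "int p * 1 \<le> int p * (- m - 1)" by (intro mult_left_mono) auto
        then have "2 * (int p * 1 + 1) \<le> (- m) * (int p * (- m - 1) + 1)" using 3 by (intro mult_mono) linarith+
        also have "\<dots> = N" unfolding m by (simp add: algebra_simps)
        finally show False using less.prems(3) by simp
      qed (use m N in simp)
    qed
    then have "N = 1" using m by simp
    then have v: "v = fscale (lookup v (0, 2 * int p)) (expo (2 * int p))"
      using less.prems(2) by (intro gr_low(2)[OF p0 _ refl]) (simp add: hh_screening)
    let ?c = "lookup v (0, 2 * int p)"
    have "fscale ?c (Qt (expo (2 * int p))) = 0"
      using less.prems(1) v by (metis W_iff lin_scale[OF Qt_lin])
    \<comment> \<open>\<open>\<alpha>(1)\<close> turns this vector into -2 times the mode 1 of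
      e^(-\<alpha>/p) on e^\<alpha>, which is a nonzero exponential.\<close>
    moreover have "Qt (expo (2 * int p)) \<noteq> 0"
    proof
      assume "Qt (expo (2 * int p)) = 0"
      then have h: "heis p 1 (md (expo (- 2)) 0 (expo (2 * int p))) = 0" by (simp add: Qt_def)
      have "Sum_any (\<lambda>j. fscale (ch 1 j) (md (heis p (int j) (expo (- 2))) (0 + 1 - int j) (expo (2 * int p)))) =
         fscale (- 2) (md (expo (- 2)) 1 (expo (2 * int p)))"
        by (subst Sum_any_single[of 0]) (auto simp: heis_expo nmode_simps)
      then have "fscale (- 2) (md (expo (- 2)) 1 (expo (2 * int p))) = 0"
        using heis_nmode[OF p0, of 1 "expo (- 2)" 0 "expo (2 * int p)"] h by (simp add: heis_expo nmode_simps)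
      then have "md (expo (- 2)) 1 (expo (2 * int p)) = 0" by simp
      moreover have "lookup (md (expo (- 2)) 1 (expo (2 * int p))) (0, - 2 + 2 * int p) = 1"
      proof -
        have "- 2 * (2 * int p) div (2 * int p) = - 2" by (rule nonzero_mult_div_cancel_right) (use p0 in simp)
        then show ?thesis by (simp add: lookup_nmode_expo[OF p0])
      qed
      ultimately show False by simp
    qed
    ultimately have "?c = 0" by simp
    then show False using v nz by (metis fock.scale_zero_left)
  qed
qed

section \<open>Generation of W(p)\<close>

lemmas Wd_closed = fock.subspace_0[OF Wd_subspace] fock.subspace_add[OF Wd_subspace]
  fock.subspace_diff[OF Wd_subspace] fock.subspace_scale[OF Wd_subspace] fock.subspace_neg[OF Wd_subspace]

lemma Wd_mode:
  assumes u: "u \<in> Vsp p Z z w0" and Z: "Z = 1 \<and> z = 0 \<or> Z \<in> {XF, XH, XE} \<and> z = D" and x: "x \<in> Wd w" and w': "w' = w + w0 - 1 - s"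
  shows "md u s x \<in> Wd w'"
proof -
  obtain k \<pi> where "Gw k w x" "Rep p Z z w0 u \<pi>" using u x by (auto simp: Wd_def Vsp_def)
  then have "Gw (Suc k) w' (md u s x)" using Gcl_mode_Rep[OF Gcl_all _ Z] w' by blast
  then show ?thesis by (auto simp: Wd_def)
qed

lemma W_vir: "v \<in> W \<Longrightarrow> L n v \<in> W"
  by (rule W_md[OF W_conformal])

lemma Vsp_W: "u \<in> Vsp p Z z w \<Longrightarrow> Z \<in> W \<Longrightarrow> u \<in> W"
  unfolding Vsp_def mem_Collect_eq
proof (erule exE)
  fix \<pi> assume "Rep p Z z w u \<pi>" "Z \<in> W"
  then show "u \<in> W" by (induction rule: Rep.induct) (auto intro: W_closed W_md W_conformal)
qed

theorem W_Wd: "v \<in> W \<Longrightarrow> v \<in> gr p k (of_int N) \<Longrightarrow> v \<in> Wd N"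
proof (induction "nat N" arbitrary: N k v rule: less_induct)
  case less
  have VS: "v = 0" if "v \<in> W" "v \<in> gr p k c" "k \<notin> VS" for v k c
  proof -
    have "v \<in> chg {}" using W_VL[OF that(1)] gr_chg[OF that(2)] that(3) by (auto simp: chg_def)
    then show ?thesis by (rule chg_empty)
  qed
  have neg: "v \<in> Wd N" if "v \<in> W" "v \<in> gr p k (of_int N)" "N < 0" for v k N
    using VL_neg[OF that(2) _ that(3)] VS[OF that(1,2)] Wd_closed(1) by metis
  have IH: "v \<in> Wd N'" if "v \<in> W" "v \<in> gr p k (of_int N')" "N' < N" for v k N'
    using less.hyps[of N' v k] neg[OF that(1,2)] that by (cases "N' < 0") auto
  show ?case
  proof (cases "v = 0 \<or> N \<le> 0")
    case True
    then consider "v = 0" | "v \<noteq> 0" "N < 0" | "v \<noteq> 0" "N = 0" by linarith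
    then show ?thesis
    proof cases
      case 3
      then have "k \<in> VS" using VS less.prems by blast
      then obtain m where m: "k = 2 * int p * m" by blast
      have h: "hh p k = of_int (int p * m * m - (int p - 1) * m)" unfolding m hh_def using p0' by (simp add: field_simps)
      \<comment> \<open>In charge m\<alpha> the minimal weight is m (p m - (p - 1)); a nonzero
        vector of weight 0 forces it to be 0, which leaves only the vacuum.\<close>
      have "m * (int p * m - (int p - 1)) = 0"
      proof (rule ccontr)
        assume nz: "m * (int p * m - (int p - 1)) \<noteq> 0"
        obtain d where d: "d \<ge> 0" "hh p k = of_int d" using VL_hh[OF \<open>k \<in> VS\<close>] by blast
        have "d = m * (int p * m - (int p - 1))"
          using d(2) unfolding h of_int_eq_iff by (simp add: algebra_simps)
        then have "d > 0" using nz d(1) by linarith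
        then have "v = 0" using less.prems(2) d(2) 3 by (intro gr_low(1)[OF p0, of v k "- d"]) auto
        then show False using 3 by simp
      qed
      moreover have "int p * m \<noteq> int p - 1"
      proof
        assume "int p * m = int p - 1"
        then have "int p dvd 1" by (metis diff_diff_cancel dvd_diff dvd_refl dvd_triv_left diff_diff_eq2 add_diff_cancel_left')
        then show False using p2 by simp
      qed
      ultimately have "k = 0" using m by auto
      then have "v = fscale (lookup v (0, 0)) 1"
        using gr_low(2)[OF p0, of v 0 0] less.prems(2) 3 by (simp add: hh_0 expo_0)
      moreover have "1 \<in> Wd 0" by (auto simp: Wd_def intro: Gw.one)
      ultimately show ?thesis using 3 by (metis Wd_closed(4))
    qed (use neg less.prems Wd_closed(1) in auto)
  next
    case False
    then have nz: "v \<noteq> 0" and N: "N \<ge> 1" by auto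
    obtain P g where P: "Pol 1 0 (- 1) XH P" and g: "Pol XF D (- 2) XF g" using Pol_P Pol_g by blast
    \<comment> \<open>Operators that first lower the weight reach vectors to which the induction
      hypothesis applies; \<open>X\<close>, \<open>cond\<close> and \<open>cond2\<close> are the
      forms in which such terms occur in \<open>Pol_eval\<close>.\<close>
    have X: "md X (D - 1 + n) x \<in> Wd (N - n)" if "X \<in> W" "X \<in> gr p a (of_int D)" "x \<in> W" "x \<in> gr p k (of_int N)" "n > 0" "a \<in> VS" for X a x k n
      by (rule IH[of _ "a + k"]) (use that in \<open>auto intro: W_md nmode_gr[OF p0 that(2,4)]\<close>)
    have cond: "L (- n) (md u (w - 1 + n) x) \<in> Wd N"
      if u: "u \<in> Vsp p Z z w" and n: "n > 0" and x: "x \<in> W" "x \<in> gr p k (of_int N)" and Z: "Z \<in> W" "Z \<in> gr p a (of_int z)" "a \<in> VS" for u w n x k Z z a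
    proof -
      have u': "u \<in> W" "u \<in> gr p a (of_int w)" using Vsp_W[OF u Z(1)] u Rep_gr[of Z z w u _ a] Z(2) by (auto simp: Vsp_def)
      have "md u (w - 1 + n) x \<in> Wd (N - n)"
        by (rule IH[of _ "a + k"]) (use n Z(3) in \<open>auto intro: W_md[OF u'(1) x(1)] nmode_gr[OF p0 u'(2) x(2)]\<close>)
      then show ?thesis by (rule Wd_vir) simp
    qed
    have cond2: "md u (w - 2 - int j) (L (int j + 1) x) \<in> Wd N"
      if u: "u \<in> Vsp p Z z w" and x: "x \<in> W" "x \<in> gr p k (of_int N)" and Z: "Z = 1 \<and> z = 0 \<or> Z \<in> {XF, XH, XE} \<and> z = D" for u w j x k Z z
    proof -
      have "L (int j + 1) x \<in> Wd (N - (int j + 1))"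
        by (rule IH[OF W_vir[OF x(1)] vir_gr[OF p0 x(2)]]) auto
      then show ?thesis by (rule Wd_mode[OF u Z]) simp
    qed
    have XX: "XF \<in> W" "XH \<in> W" by (auto intro: W_X)
    have oH: "md XH (D - 1) (md XH (D - 1) x) - fscale (poly P (of_int N)) x \<in> Wd N" if x: "x \<in> W" "x \<in> gr p k (of_int N)" for x k
    proof -
      let ?f = "\<lambda>j. fscale ((- 1) ^ j * ch (- 1) j) (md XH (D + - 1 - int j) (md XH (D - - 1 - 2 + int j) x))"
      let ?g = "\<lambda>j. fscale ((- 1) ^ j * ch (- 1) j) (md XH (D - 2 - int j) (md XH (D + int j) x))"
      have 1: "Sum_any ?f - fscale (sg (- 1)) (Sum_any ?g) - fscale (poly P (of_int N)) (md 1 (0 - 1) x) \<in> Wd N"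
      proof (rule Pol_eval[OF P X_VL Wd_subspace one_chg[OF singletonI] gr_chg[OF x(2)] gr_vir_0[OF x(2)]])
        show "L (- n) (md u (w - 1 + n) x) \<in> Wd N" if "u \<in> Vsp p 1 0 w" "n > 0" for u w n
          by (rule cond[OF that x W_1, of 0]) (simp_all add: one_gr[OF p0])
        show "md u (w - 2 - int j) (L (int j + 1) x) \<in> Wd N" if "u \<in> Vsp p 1 0 w" for u w j
          by (rule cond2[OF that x]) simp
      qed auto
      have 2: "Sum_any ?g \<in> Wd N"
      proof (intro subspace_Sum_any[OF Wd_subspace] Wd_closed)
        fix j
        have xw: "md XH (D - 1 + (int j + 1)) x \<in> Wd (N - (int j + 1))" by (rule X[OF XX(2) X_D(2) x]) auto
        show "md XH (D - 2 - int j) (md XH (D + int j) x) \<in> Wd N"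
          using Wd_gen[OF xw, of XH N "D - 2 - int j"] by (simp add: algebra_simps)
      qed
      have 3: "Sum_any (\<lambda>j. ?f (Suc j)) \<in> Wd N"
      proof (intro subspace_Sum_any[OF Wd_subspace] Wd_closed)
        fix j
        have xw: "md XH (D - 1 + int (Suc j)) x \<in> Wd (N - int (Suc j))" by (rule X[OF XX(2) X_D(2) x]) auto
        show "md XH (D + - 1 - int (Suc j)) (md XH (D - - 1 - 2 + int (Suc j)) x) \<in> Wd N"
          using Wd_gen[OF xw, of XH N "D + - 1 - int (Suc j)"] by (simp add: algebra_simps)
      qed
      have "fs ?f" by (rule nmode_fsI[of p XH "D - - 1 - 2" x]) (simp add: nmode_simps)
      then have e: "Sum_any ?f = ?f 0 + Sum_any (\<lambda>j. ?f (Suc j))" by (rule Sum_any_Suc)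
      have "Sum_any ?f - fscale (sg (- 1)) (Sum_any ?g) - fscale (poly P (of_int N)) (md 1 (0 - 1) x)
         + fscale (sg (- 1)) (Sum_any ?g) - Sum_any (\<lambda>j. ?f (Suc j)) \<in> Wd N"
        by (rule Wd_closed(3)[OF Wd_closed(2)[OF 1 Wd_closed(4)[OF 2]] 3])
      then show ?thesis unfolding e by (simp add: nmode_one[OF p0])
    qed
    have oF: "fscale (poly g (of_int N)) (md XF (D - 1) x) \<in> Wd N" if x: "x \<in> W" "x \<in> gr p k (of_int N)" for x k
    proof -
      let ?f = "\<lambda>j. fscale ((- 1) ^ j * ch (- 2) j) (md XF (D + - 2 - int j) (md XH (D - - 2 - 2 + int j) x))"
      let ?g = "\<lambda>j. fscale ((- 1) ^ j * ch (- 2) j) (md XH (D - 2 - int j) (md XF (D + int j) x))"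
      have 1: "Sum_any ?f - fscale (sg (- 2)) (Sum_any ?g) - fscale (poly g (of_int N)) (md XF (D - 1) x) \<in> Wd N"
      proof (rule Pol_eval[OF g X_VL Wd_subspace gr_chg[OF X_D(1)] gr_chg[OF x(2)] gr_vir_0[OF x(2)]])
        show "L (- n) (md u (w - 1 + n) x) \<in> Wd N" if "u \<in> Vsp p XF D w" "n > 0" for u w n
          by (rule cond[OF that x XX(1) X_D(1)]) simp
        show "md u (w - 2 - int j) (L (int j + 1) x) \<in> Wd N" if "u \<in> Vsp p XF D w" for u w j
          by (rule cond2[OF that x]) simp
        show "2 * int p dvd a * b" if "a \<in> {- 2 * int p}" for a b :: int using that by simp
      qed simp
      have 2: "Sum_any ?g \<in> Wd N"
      proof (intro subspace_Sum_any[OF Wd_subspace] Wd_closed)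
        fix j
        have xw: "md XF (D - 1 + (int j + 1)) x \<in> Wd (N - (int j + 1))" by (rule X[OF XX(1) X_D(1) x]) auto
        show "md XH (D - 2 - int j) (md XF (D + int j) x) \<in> Wd N"
          using Wd_gen[OF xw, of XH N "D - 2 - int j"] by (simp add: algebra_simps)
      qed
      have 3: "Sum_any ?f \<in> Wd N"
      proof (intro subspace_Sum_any[OF Wd_subspace] Wd_closed)
        fix j
        have xw: "md XH (D - 1 + (int j + 1)) x \<in> Wd (N - (int j + 1))" by (rule X[OF XX(2) X_D(2) x]) auto
        show "md XF (D + - 2 - int j) (md XH (D - - 2 - 2 + int j) x) \<in> Wd N"
          using Wd_gen[OF xw, of XF N "D + - 2 - int j"] by (simp add: algebra_simps)
      qed
      have "- ((Sum_any ?f - fscale (sg (- 2)) (Sum_any ?g) - fscale (poly g (of_int N)) (md XF (D - 1) x)) + fscale (sg (- 2)) (Sum_any ?g) - Sum_any ?f) \<in> Wd N"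
        by (rule Wd_closed(5)[OF Wd_closed(3)[OF Wd_closed(2)[OF 1 Wd_closed(4)[OF 2]] 3]])
      then show ?thesis by simp
    qed
    have Qv: "Q v \<in> W" "Q v \<in> gr p (k + 2 * int p) (of_int N)" using W_Q Q_gr less.prems by auto
    have QF: "md XH (D - 1) v = Q (md XF (D - 1) v) - md XF (D - 1) (Q v)"
      unfolding XH_Q using Q_md[OF W_VL[OF XX(1)], of "D - 1" v] by simp
    \<comment> \<open>From weight 2p - 1 on \<open>g\<close> can be inverted at \<open>N\<close>.
      Below it V_L has only the charges 0 and \<alpha>, and there \<open>W_charge_1\<close> makes
      both terms of \<open>QF\<close> or \<open>v\<close> itself vanish.\<close>
    have "md XH (D - 1) v \<in> Wd N"
    proof (cases "N \<ge> 2 * int p - 1")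
      case True
      have F: "md XF (D - 1) x \<in> Wd N" if x: "x \<in> W" "x \<in> gr p k (of_int N)" for x k
      proof -
        have "fscale (1 / poly g (of_int N)) (fscale (poly g (of_int N)) (md XF (D - 1) x)) \<in> Wd N" by (intro Wd_closed oF[OF x])
        then show ?thesis using g_nonroot_int[OF g True] by simp
      qed
      show ?thesis unfolding QF by (intro Wd_closed Wd_Q F[OF less.prems] F[OF Qv])
    next
      case False
      have "k \<in> VS" using VS less.prems nz by blast
      then obtain m where m: "k = 2 * int p * m" by blast
      define d where "d = int p * m * m - (int p - 1) * m"
      have h: "hh p k = of_int d" unfolding m hh_def d_def using p0' by (simp add: field_simps)
      have "N \<ge> d"
      proof (rule ccontr)
        assume "\<not> N \<ge> d"
        then have "v = 0" using less.prems(2) h by (intro gr_low(1)[OF p0, of v k "N - d"]) auto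
        then show False using nz by simp
      qed
      moreover have "d \<ge> 2 * int p - 1" if "m \<noteq> 0" "m \<noteq> 1"
      proof (cases "m \<ge> 2")
        case True
        have "int p * 1 \<le> int p * (m - 1)" using True by (intro mult_left_mono) auto
        then have "2 * (int p * 1 + 1) \<le> m * (int p * (m - 1) + 1)" using True by (intro mult_mono) linarith+
        then show ?thesis by (simp add: d_def algebra_simps)
      next
        case False
        then have m': "- m \<ge> 1" using that by linarith
        then have "int p * 1 \<le> int p * (- m)" by (intro mult_left_mono) auto
        moreover from this have "1 * (int p * (- m) + int p - 1) \<le> (- m) * (int p * (- m) + int p - 1)" using p2 m' by (intro mult_right_mono) linarith+
        ultimately show ?thesis by (simp add: d_def algebra_simps)
      qed
      ultimately consider "m = 0" | "m = 1" using False by linarith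
      then show ?thesis
      proof cases
        case 1
        then have k: "k = 0" using m by simp
        have "Q v = 0" by (rule W_charge_1[OF Qv(1), of N]) (use Qv(2) k False in auto)
        moreover have "md XF (D - 1) v = 0"
        proof (rule gr_low(1)[OF p0, of _ "- 2 * int p" "N - D"])
          have "hh p (- 2 * int p) = of_int D" using p0' by (simp add: hh_def field_simps)
          then show "md XF (D - 1) v \<in> gr p (- 2 * int p) (hh p (- 2 * int p) + of_int (N - D))"
            using less.prems(2) k by (intro nmode_gr[OF p0 X_D(1) less.prems(2)]) auto
        qed (use False in simp)
        ultimately show ?thesis unfolding QF by (simp add: nmode_simps lin_0[OF Q_lin] Wd_closed)
      next
        case 2
        then have "v = 0" using less.prems m False by (intro W_charge_1[of v N]) auto
        then show ?thesis using nz by simp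
      qed
    qed
    then have "md XH (D - 1) (md XH (D - 1) v) \<in> Wd N" by (rule Wd_gen) auto
    from Wd_closed(3)[OF this oH[OF less.prems]] have "fscale (poly P (of_int N)) v \<in> Wd N" by simp
    then have "fscale (1 / poly P (of_int N)) (fscale (poly P (of_int N)) v) \<in> Wd N" by (rule Wd_closed)
    then show ?thesis using P_nonroot[OF P N] by simp
  qed
qed

end

section \<open>Zhu products\<close>

text \<open>The residue of x^k (1 + x)^M against a series with modes \<open>f\<close>.\<close>

definition bsum :: "nat \<Rightarrow> (int \<Rightarrow> fock) \<Rightarrow> int \<Rightarrow> fock" where
  "bsum M f k = (\<Sum>i\<le>M. fscale (of_nat (M choose i)) (f (k + int i)))"

lemma bsum_0: "bsum 0 f k = f k"
  by (simp add: bsum_def)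

lemma bsum_Suc: "bsum (Suc M) f k = bsum M f k + bsum M f (k + 1)"
proof -
  let ?g = "\<lambda>c i. fscale (of_nat c) (f (k + int i))"
  have "bsum (Suc M) f k = ?g (Suc M choose 0) 0 + (\<Sum>i\<le>M. ?g (Suc M choose Suc i) (Suc i))"
    unfolding bsum_def by (rule sum.atMost_Suc_shift)
  also have "(\<Sum>i\<le>M. ?g (Suc M choose Suc i) (Suc i)) = (\<Sum>i\<le>M. ?g (M choose i) (Suc i)) + (\<Sum>i\<le>M. ?g (M choose Suc i) (Suc i))"
    by (simp add: fock.scale_left_distrib sum.distrib)
  also have "(\<Sum>i\<le>M. ?g (M choose i) (Suc i)) = bsum M f (k + 1)"
    by (simp add: bsum_def add.assoc)
  also have "?g (Suc M choose 0) 0 + (bsum M f (k + 1) + (\<Sum>i\<le>M. ?g (M choose Suc i) (Suc i)))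
    = bsum M f (k + 1) + (\<Sum>i\<le>Suc M. ?g (M choose i) i)"
    unfolding sum.atMost_Suc_shift[of _ M] by simp
  also have "(\<Sum>i\<le>Suc M. ?g (M choose i) i) = bsum M f k"
    by (simp add: bsum_def binomial_eq_0)
  finally show ?thesis by (simp add: add.commute)
qed

lemma bsum_bsum: "bsum M (bsum N f) k = bsum (M + N) f k"
  by (induction M arbitrary: k) (simp_all add: bsum_0 bsum_Suc)

lemma bsum_lin: "lin g \<Longrightarrow> g (bsum M f k) = bsum M (\<lambda>i. g (f i)) k"
  by (simp add: bsum_def lin_sum lin_scale)

lemma bsum_add: "bsum M (\<lambda>i. f i + g i) k = bsum M f k + bsum M g k"
  by (simp add: bsum_def fock.scale_right_distrib sum.distrib)

lemma bsum_scale: "bsum M (\<lambda>i. fscale c (f i)) k = fscale c (bsum M f k)"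
  by (simp add: bsum_def fock.scale_sum_right mult.commute)

lemma bsum_swap: "bsum M (\<lambda>i. bsum N (f i) l) k = bsum N (\<lambda>j. bsum M (\<lambda>i. f i j) k) l"
  unfolding bsum_def fock.scale_sum_right by (subst sum.swap) (simp add: mult.commute)

lemma bsum_sum: "bsum M (\<lambda>i. \<Sum>l\<in>A. f l i) k = (\<Sum>l\<in>A. bsum M (f l) k)"
  unfolding bsum_def fock.scale_sum_right by (rule sum.swap)

lemma bsum_subspace: "fock.subspace S \<Longrightarrow> (\<And>i. f i \<in> S) \<Longrightarrow> bsum M f k \<in> S"
  unfolding bsum_def by (intro fock.subspace_sum fock.subspace_scale)

lemma Sum_any_bsum:
  assumes "\<And>i. fs (\<lambda>j. f j i)"
  shows "bsum M (\<lambda>i. Sum_any (\<lambda>j. f j i)) k = Sum_any (\<lambda>j. bsum M (f j) k)" "fs (\<lambda>j. bsum M (f j) k)"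
proof -
  have *: "(\<Sum>i\<in>A. fscale (c i) (Sum_any (\<lambda>j. f j (g i)))) = Sum_any (\<lambda>j. \<Sum>i\<in>A. fscale (c i) (f j (g i))) \<and> fs (\<lambda>j. \<Sum>i\<in>A. fscale (c i) (f j (g i)))"
    if "finite A" for A :: "nat set" and c g
    using that
  proof (induction A rule: finite_induct)
    case (insert i A)
    have "fs (\<lambda>j. fscale (c i) (f j (g i)))" by (rule fs_fscale[OF assms])
    then show ?case using insert Sum_any_add[of "\<lambda>j. fscale (c i) (f j (g i))" "\<lambda>j. \<Sum>i\<in>A. fscale (c i) (f j (g i))"]
      by (simp add: Sum_any_fscale[OF assms] fs_add)
  qed (simp add: fs_zero)
  show "bsum M (\<lambda>i. Sum_any (\<lambda>j. f j i)) k = Sum_any (\<lambda>j. bsum M (f j) k)" "fs (\<lambda>j. bsum M (f j) k)"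
    using *[of "{..M}"] unfolding bsum_def by auto
qed

text \<open>The substitution x = y + z in (1 + x)^M: the coefficient of z^l is (M choose l) (1 +
  y)^(M-l).\<close>

lemma bsum_choose:
  "bsum M (\<lambda>m. \<Sum>l\<le>M. fscale (of_nat (nat m choose l)) (x l (m - int l))) 0 = (\<Sum>l\<le>M. fscale (of_nat (M choose l)) (bsum (M - l) (x l) 0))"
proof -
  have "bsum M (\<lambda>m. \<Sum>l\<le>M. fscale (of_nat (nat m choose l)) (x l (m - int l))) 0 =
    (\<Sum>l\<le>M. \<Sum>i\<le>M. fscale (of_nat ((M choose i) * (i choose l))) (x l (int i - int l)))"
    unfolding bsum_sum by (simp add: bsum_def)
  also have "\<dots> = (\<Sum>l\<le>M. fscale (of_nat (M choose l)) (bsum (M - l) (x l) 0))"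
  proof (rule sum.cong[OF refl])
    fix l assume "l \<in> {..M}"
    then have l: "l \<le> M" by simp
    have "(\<Sum>i\<le>M. fscale (of_nat ((M choose i) * (i choose l))) (x l (int i - int l))) =
      (\<Sum>i\<in>{l..M}. fscale (of_nat ((M choose i) * (i choose l))) (x l (int i - int l)))"
      by (rule sum.mono_neutral_right) (auto simp: binomial_eq_0)
    also have "\<dots> = (\<Sum>i\<in>{0..M - l}. fscale (of_nat ((M choose (i + l)) * ((i + l) choose l))) (x l (int (i + l) - int l)))"
      using l sum.shift_bounds_cl_nat_ivl[of "\<lambda>i. fscale (of_nat ((M choose i) * (i choose l))) (x l (int i - int l))" 0 l "M - l"] by simp
    also have "\<dots> = (\<Sum>i\<le>M - l. fscale (of_nat (M choose l)) (fscale (of_nat (M - l choose i)) (x l (0 + int i))))"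
    proof (rule sum.cong)
      fix i assume "i \<in> {..M - l}"
      then have "(M choose (i + l)) * ((i + l) choose l) = (M choose l) * (M - l choose i)"
        using choose_mult[of l "i + l" M] l by simp
      then show "fscale (of_nat ((M choose (i + l)) * ((i + l) choose l))) (x l (int (i + l) - int l)) =
        fscale (of_nat (M choose l)) (fscale (of_nat (M - l choose i)) (x l (0 + int i)))"
        by (simp del: of_nat_mult add: of_nat_mult[symmetric])
    qed auto
    finally show "(\<Sum>i\<le>M. fscale (of_nat ((M choose i) * (i choose l))) (x l (int i - int l))) = fscale (of_nat (M choose l)) (bsum (M - l) (x l) 0)"
      unfolding bsum_def fock.scale_sum_right .
  qed
  finally show ?thesis .
qed

context triplet_setting begin

definition tm :: "nat \<Rightarrow> fock \<Rightarrow> int \<Rightarrow> fock \<Rightarrow> fock" where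
  "tm M a r y = bsum M (\<lambda>m. md a m y) r"

lemma tm_lin: "lin (tm M a r)"
  unfolding tm_def[abs_def] bsum_def by (intro lin_sum_fun lin_smult nmode_lin)

lemma tm_lin_left: "lin (\<lambda>a. tm M a r y)"
  unfolding tm_def bsum_def by (intro lin_sum_fun lin_smult vop_lin_left)

lemma tm_Suc: "tm (Suc M) a r y = tm M a r y + tm M a (r + 1) y"
  unfolding tm_def by (rule bsum_Suc)

lemma tm_W: "a \<in> W \<Longrightarrow> y \<in> W \<Longrightarrow> tm M a r y \<in> W"
  unfolding tm_def by (rule bsum_subspace) (auto simp: fock.subspace_def intro: W_closed W_md)

text \<open>The Borcherds identity with (1 + x)^M (1 + y)^N inserted under the residues; in the
  iterate x = y + z, which is where \<open>bsum_choose\<close> enters. With the weights of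
  \<open>a\<close> and \<open>b\<close> as exponents, the choices \<open>n = -1\<close> and
  \<open>n = -2\<close> give the properties of Zhu's product.\<close>

theorem twisted_Borcherds:
  assumes a: "a \<in> VL" and b: "b \<in> VL"
  shows "Sum_any (\<lambda>j. fscale ((- 1) ^ j * ch n j) (tm M a (n - int j) (tm N b (k + int j) c)))
    - fscale (sg n) (Sum_any (\<lambda>j. fscale ((- 1) ^ j * ch n j) (tm N b (n + k - int j) (tm M a (int j) c))))
    = (\<Sum>l\<le>M. fscale (of_nat (M choose l)) (tm (M - l + N) (md a (n + int l) b) k c))"
proof -
  let ?x = "\<lambda>l r. md (md a (n + int l) b) r c"
  let ?f = "\<lambda>m q j. fscale ((- 1) ^ j * ch n j) (md a (m + n - int j) (md b (q + int j) c))"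
  let ?g = "\<lambda>m q j. fscale ((- 1) ^ j * ch n j) (md b (n + q - int j) (md a (m + int j) c))"
  have B: "Sum_any (?f m q) - fscale (sg n) (Sum_any (?g m q)) = Sum_any (\<lambda>l. fscale (ch m l) (?x l (m + q - int l)))" for m q
    by (rule borch_sum[OF VL_borch[OF a b], symmetric])
  have f: "fs (?f m q)" for m q by (rule nmode_fsI[of p b q c]) (simp add: nmode_simps)
  have g: "fs (?g m q)" for m q by (rule nmode_fsI[of p a m c]) (simp add: nmode_simps)
  have ff: "bsum M (\<lambda>m. bsum N (\<lambda>q. Sum_any (?f m q)) k) 0 = Sum_any (\<lambda>j. bsum M (\<lambda>m. bsum N (\<lambda>q. ?f m q j) k) 0)"
    unfolding Sum_any_bsum(1)[OF f] by (rule Sum_any_bsum(1)[OF Sum_any_bsum(2)[OF f]])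
  have gg: "bsum M (\<lambda>m. bsum N (\<lambda>q. Sum_any (?g m q)) k) 0 = Sum_any (\<lambda>j. bsum M (\<lambda>m. bsum N (\<lambda>q. ?g m q j) k) 0)"
    unfolding Sum_any_bsum(1)[OF g] by (rule Sum_any_bsum(1)[OF Sum_any_bsum(2)[OF g]])
  have sh: "bsum M f (r + s) = bsum M (\<lambda>i. f (i + s)) r" for f M r and s :: int by (simp add: bsum_def algebra_simps)
  have tf: "bsum M (\<lambda>m. bsum N (\<lambda>q. ?f m q j) k) 0 = fscale ((- 1) ^ j * ch n j) (tm M a (n - int j) (tm N b (k + int j) c))" for j
    unfolding tm_def bsum_scale bsum_lin[OF nmode_lin] sh[of _ _ k] using sh[of M _ 0 "n - int j"] by (simp add: algebra_simps)
  have tg: "bsum M (\<lambda>m. bsum N (\<lambda>q. ?g m q j) k) 0 = fscale ((- 1) ^ j * ch n j) (tm N b (n + k - int j) (tm M a (int j) c))" for j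
    unfolding tm_def bsum_scale bsum_lin[OF nmode_lin] using sh[of M _ 0 "int j"] sh[of N _ k "n - int j"]
    by (subst bsum_swap) (simp add: algebra_simps)
  have "bsum M (\<lambda>m. bsum N (\<lambda>q. Sum_any (?f m q)) k) 0 - fscale (sg n) (bsum M (\<lambda>m. bsum N (\<lambda>q. Sum_any (?g m q)) k) 0)
    = bsum M (\<lambda>m. bsum N (\<lambda>q. Sum_any (?f m q) + fscale (- sg n) (Sum_any (?g m q))) k) 0"
    unfolding bsum_add bsum_scale by simp
  also have "\<dots> = bsum M (\<lambda>m. bsum N (\<lambda>q. Sum_any (\<lambda>l. fscale (ch m l) (?x l (m + q - int l)))) k) 0"
    by (simp add: B[symmetric])
  also have "\<dots> = bsum M (\<lambda>m. \<Sum>l\<le>M. fscale (of_nat (nat m choose l)) (bsum N (?x l) (k + (m - int l)))) 0"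
    unfolding bsum_def[of M]
  proof (intro sum.cong refl arg_cong[where f = "fscale _"])
    fix i assume "i \<in> {..M}"
    then have i: "i \<le> M" by simp
    have c: "ch (int i) l = of_nat (i choose l)" for l by (simp add: binomial_gbinomial)
    have "Sum_any (\<lambda>l. fscale (ch (0 + int i) l) (?x l (0 + int i + q - int l))) = (\<Sum>l\<le>M. fscale (of_nat (i choose l)) (?x l (0 + int i + q - int l)))" for q
      unfolding add_0 c by (rule Sum_any_le) (use i in \<open>simp add: binomial_eq_0\<close>)
    then show "bsum N (\<lambda>q. Sum_any (\<lambda>l. fscale (ch (0 + int i) l) (?x l (0 + int i + q - int l)))) k =
      (\<Sum>l\<le>M. fscale (of_nat (nat (0 + int i) choose l)) (bsum N (?x l) (k + (0 + int i - int l))))"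
      unfolding sh[of N _ k] by (simp add: bsum_sum bsum_scale algebra_simps)
  qed
  also have "\<dots> = (\<Sum>l\<le>M. fscale (of_nat (M choose l)) (bsum (M - l) (\<lambda>r. bsum N (?x l) (k + r)) 0))"
    using bsum_choose[of M "\<lambda>l r. bsum N (?x l) (k + r)"] .
  also have "\<dots> = (\<Sum>l\<le>M. fscale (of_nat (M choose l)) (tm (M - l + N) (md a (n + int l) b) k c))"
    unfolding tm_def bsum_bsum[symmetric] using sh[of _ _ 0 k] by (simp add: add.commute)
  finally show ?thesis unfolding ff gg tf tg .
qed

abbreviation "TV \<equiv> triplet p"

definition wsp :: "nat \<Rightarrow> fock set" where
  "wsp N = {a \<in> W. L 0 a = fscale (of_nat N) a}"

definition wc :: "nat \<Rightarrow> fock \<Rightarrow> fock" where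
  "wc N a = restr (\<lambda>\<kappa>. wtk p \<kappa> = of_nat N) a"

definition OV :: "fock set" where "OV = zhu_O TV"

lemma wt_space_eq: "wt_space TV N = wsp N"
  by (auto simp: wt_space_def wsp_def triplet_def nmode_def)

lemma wsp_keys: "a \<in> wsp N \<longleftrightarrow> a \<in> W \<and> (\<forall>\<kappa>\<in>keys a. wtk p \<kappa> = of_nat N)"
  unfolding wsp_def poly_mapping_eq_iff fun_eq_iff mem_Collect_eq lookup_vir_0[OF p0] lookup_fscale
  by (auto simp: in_keys_iff)

lemma wsp_W: "a \<in> wsp N \<Longrightarrow> a \<in> W" by (simp add: wsp_def)

lemma wsp_closed: "0 \<in> wsp N" "a \<in> wsp N \<Longrightarrow> b \<in> wsp N \<Longrightarrow> a + b \<in> wsp N" "a \<in> wsp N \<Longrightarrow> fscale c a \<in> wsp N"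
  by (auto simp: wsp_def W_closed nmode_simps fock.scale_right_distrib mult.commute)

lemma wc_wsp: "a \<in> W \<Longrightarrow> wc N a \<in> wsp N"
  unfolding wsp_keys wc_def using restr_W(1) by (auto simp: in_keys_iff lookup_restr split: if_splits)

lemma wc_lin: "lin (wc N)"
  unfolding wc_def[abs_def] by (rule restr_lin)

lemma wc_same: "a \<in> wsp N \<Longrightarrow> wc M a = (if M = N then a else 0)"
  unfolding wc_def by (auto simp: wsp_keys intro: restr_all restr_none)

lemma VL_weight: "\<kappa> \<in> keys a \<Longrightarrow> a \<in> VL \<Longrightarrow> \<exists>N. wtk p \<kappa> = of_nat N"
proof -
  assume "\<kappa> \<in> keys a" "a \<in> VL"
  then obtain d where "d \<ge> 0" "hh p (snd \<kappa>) = of_int d" using VL_hh[of "snd \<kappa>"] by (auto simp: chg_def)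
  then have "wtk p \<kappa> = of_nat (dg (fst \<kappa>) + nat d)" by (simp add: wtk_def)
  then show ?thesis by blast
qed

lemma wc_finite: "finite {N. wc N a \<noteq> 0}"
proof -
  have "N \<in> (\<lambda>\<kappa>. SOME n. wtk p \<kappa> = of_nat n) ` keys a" if "wc N a \<noteq> 0" for N
  proof -
    have "\<exists>\<kappa>\<in>keys a. wtk p \<kappa> = of_nat N"
    proof (rule ccontr)
      assume "\<not> ?thesis"
      then have "wc N a = 0" unfolding wc_def by (intro restr_none) blast
      then show False using that by simp
    qed
    then obtain \<kappa> where "\<kappa> \<in> keys a" "wtk p \<kappa> = of_nat N" by blast
    then show ?thesis by (intro image_eqI[of _ _ \<kappa>]) auto
  qed
  then have "{N. wc N a \<noteq> 0} \<subseteq> (\<lambda>\<kappa>. SOME n. wtk p \<kappa> = of_nat n) ` keys a" by blast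
  then show ?thesis by (rule finite_subset) simp
qed

lemma wc_sum:
  assumes a: "a \<in> W" and S: "finite S" "{N. wc N a \<noteq> 0} \<subseteq> S"
  shows "(\<Sum>N\<in>S. wc N a) = a"
proof (rule poly_mapping_eqI)
  fix \<kappa>
  show "lookup (\<Sum>N\<in>S. wc N a) \<kappa> = lookup a \<kappa>"
  proof (cases "\<kappa> \<in> keys a")
    case True
    then obtain N where N: "wtk p \<kappa> = of_nat N" using VL_weight W_VL[OF a] by blast
    have "lookup (wc N a) \<kappa> \<noteq> 0" using True N by (simp add: wc_def lookup_restr in_keys_iff)
    then have "N \<in> S" using S(2) by (auto simp del: lookup_not_eq_zero_eq_in_keys)
    moreover have "lookup (wc M a) \<kappa> = (if M = N then lookup a \<kappa> else 0)" for M
      using N by (simp add: wc_def lookup_restr)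
    ultimately show ?thesis using S(1) by (simp add: lookup_sum)
  next
    case False
    then show ?thesis by (simp add: lookup_sum wc_def lookup_restr in_keys_iff cong: if_cong)
  qed
qed

text \<open>Weights in V_L are natural numbers, so the components \<open>wc N a\<close> exist and
  are the only decomposition; this gives the description by \<open>THE\<close> its value.\<close>

lemma wt_decomp_lookup:
  assumes a: "a \<in> W"
  shows "lookup (wt_decomp TV a) N = wc N a"
proof -
  define f where "f = Abs_poly_mapping (\<lambda>N. wc N a)"
  have f: "lookup f = (\<lambda>N. wc N a)"
    unfolding f_def by (rule lookup_Abs_poly_mapping) (rule wc_finite)
  have "wt_decomp TV a = f"
    unfolding wt_decomp_def
  proof (rule the_equality)
    show "(\<forall>n. lookup f n \<in> wt_space TV n) \<and> a = (\<Sum>n\<in>keys f. lookup f n)"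
      unfolding wt_space_eq f using wc_wsp[OF a] wc_sum[OF a finite_keys, of f] by (auto simp: in_keys_iff f subset_iff)
    fix g assume g: "(\<forall>n. lookup g n \<in> wt_space TV n) \<and> a = (\<Sum>n\<in>keys g. lookup g n)"
    then have "wc M (lookup g n) = (if M = n then lookup g n else 0)" for M n
      unfolding wt_space_eq by (intro wc_same) blast
    then have "wc M a = (\<Sum>n\<in>keys g. if M = n then lookup g n else 0)" for M
      using g by (simp add: lin_sum[OF wc_lin])
    then have "wc M a = lookup g M" for M by (auto simp: in_keys_iff)
    then show "g = f" by (intro poly_mapping_eqI) (simp add: f)
  qed
  then show ?thesis by (simp add: f)
qed

lemma fls_bsum:
  "fls_nth (f * (1 + fls_X) ^ N * fls_X_intpow k) (- 1) = bsum N (\<lambda>m. fls_nth f (- m - 1)) k"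
proof (induction N arbitrary: k)
  case 0
  have "- 1 - k = - k - 1" by simp
  then have "fls_nth f (- 1 - k) = fls_nth f (- k - 1)" by (rule arg_cong)
  then show ?case by (simp add: bsum_0 fls_X_intpow_times_conv_shift)
next
  case (Suc N)
  have "f * (1 + fls_X) ^ Suc N * fls_X_intpow k = f * (1 + fls_X) ^ N * fls_X_intpow k + f * (1 + fls_X) ^ N * (fls_X_intpow 1 * fls_X_intpow k)"
    by (simp add: algebra_simps fls_X_conv_shift_1)
  also have "fls_X_intpow 1 * fls_X_intpow k = (fls_X_intpow (k + 1) :: fock fls)"
    unfolding fls_X_intpow_times_fls_X_intpow by (simp add: add.commute)
  finally show ?case unfolding bsum_Suc Suc.IH[symmetric] by simp
qed

lemma fls_twisted: "fls_nth (vop p u b * (1 + fls_X) ^ N * fls_X_intpow (- int r)) (- 1) = tm N u (- int r) b"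
  unfolding fls_bsum tm_def nmode_def ..

text \<open>The index set may exceed the support of the weights, so that products for two different
  left factors can be added over a common set.\<close>

lemma zhu_prod_eq:
  assumes a: "a \<in> W" and S: "finite S" "{N. wc N a \<noteq> 0} \<subseteq> S"
  shows "zhu_prod TV r a b = (\<Sum>N\<in>S. tm N (wc N a) (- int r) b)"
proof -
  have k: "keys (wt_decomp TV a) = {N. wc N a \<noteq> 0}"
    by (auto simp: in_keys_iff wt_decomp_lookup[OF a])
  have "zhu_prod TV r a b = (\<Sum>N\<in>{N. wc N a \<noteq> 0}. tm N (wc N a) (- int r) b)"
    unfolding zhu_prod_def k wt_decomp_lookup[OF a] fls_twisted[symmetric] by (simp add: triplet_def)
  also have "\<dots> = (\<Sum>N\<in>S. tm N (wc N a) (- int r) b)"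
    by (rule sum.mono_neutral_left[OF S]) (auto simp: lin_0[OF tm_lin_left])
  finally show ?thesis .
qed

lemma zhu_prod_wsp: "a \<in> wsp N \<Longrightarrow> zhu_prod TV r a b = tm N a (- int r) b"
  by (subst zhu_prod_eq[of a "{N}"]) (auto simp: wsp_W wc_same split: if_splits)

lemma zhu_prod_lin: "a \<in> W \<Longrightarrow> lin (zhu_prod TV r a)"
  using zhu_prod_eq[OF _ wc_finite subset_refl, of a r]
  by (auto simp: lin_def lin_simps[OF tm_lin] sum.distrib fock.scale_sum_right)

lemma zhu_prod_left:
  assumes "a \<in> W" "b \<in> W"
  shows "zhu_prod TV r (a + b) c = zhu_prod TV r a c + zhu_prod TV r b c"
    and "zhu_prod TV r (fscale x a) c = fscale x (zhu_prod TV r a c)"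
proof -
  let ?S = "{N. wc N a \<noteq> 0} \<union> {N. wc N b \<noteq> 0}"
  have S: "finite ?S" using wc_finite by blast
  have "{N. wc N (a + b) \<noteq> 0} \<subseteq> ?S" "{N. wc N (fscale x a) \<noteq> 0} \<subseteq> ?S" "{N. wc N a \<noteq> 0} \<subseteq> ?S" "{N. wc N b \<noteq> 0} \<subseteq> ?S"
    by (auto simp: lin_simps[OF wc_lin])
  then show "zhu_prod TV r (a + b) c = zhu_prod TV r a c + zhu_prod TV r b c"
    "zhu_prod TV r (fscale x a) c = fscale x (zhu_prod TV r a c)"
    using assms by (simp_all add: zhu_prod_eq[OF _ S] W_closed lin_simps[OF wc_lin] lin_simps[OF tm_lin_left] sum.distrib fock.scale_sum_right)
qed

lemma zhu_prod_W: "a \<in> W \<Longrightarrow> b \<in> W \<Longrightarrow> zhu_prod TV r a b \<in> W"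
  unfolding zhu_prod_eq[OF _ wc_finite subset_refl]
  by (rule fock.subspace_sum) (auto simp: fock.subspace_def W_closed intro!: tm_W wsp_W[OF wc_wsp])

lemma OV_subspace: "fock.subspace OV"
  unfolding OV_def zhu_O_def by (rule fock.subspace_span)

lemmas OV_closed = fock.subspace_0[OF OV_subspace] fock.subspace_add[OF OV_subspace]
  fock.subspace_diff[OF OV_subspace] fock.subspace_scale[OF OV_subspace] fock.subspace_neg[OF OV_subspace]

lemma OV_circ: "a \<in> wsp N \<Longrightarrow> b \<in> W \<Longrightarrow> tm N a (- 2) b \<in> OV"
proof -
  assume a: "a \<in> wsp N" and b: "b \<in> W"
  have "zhu_circ TV a b \<in> OV" unfolding OV_def zhu_O_def
    by (rule fock.span_base) (use wsp_W[OF a] b in \<open>auto simp: triplet_def\<close>)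
  then show ?thesis using zhu_prod_wsp[OF a, of 2 b] by (simp add: zhu_circ_def)
qed

text \<open>Elements of O(V) are sums of a \<circ> b with homogeneous \<open>a\<close>: scalars and
  weight components are absorbed into the left factor.\<close>

lemma OV_induct [consumes 1, case_names zero circ add]:
  assumes "x \<in> OV" "P 0" "\<And>N a b. a \<in> wsp N \<Longrightarrow> b \<in> W \<Longrightarrow> P (tm N a (- 2) b)"
    "\<And>x y. x \<in> OV \<Longrightarrow> y \<in> OV \<Longrightarrow> P x \<Longrightarrow> P y \<Longrightarrow> P (x + y)"
  shows "P x"
proof -
  have sum: "P (\<Sum>N\<in>S. tm N (wc N a) (- int 2) b) \<and> (\<Sum>N\<in>S. tm N (wc N a) (- int 2) b) \<in> OV" if "finite S" "a \<in> W" "b \<in> W" for S a b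
    using that(1)
  proof (induction S rule: finite_induct)
    case (insert N S)
    then show ?case using assms(3)[OF wc_wsp[OF that(2)] that(3)] OV_circ[OF wc_wsp[OF that(2)] that(3)] assms(4)
      by (simp add: OV_closed)
  qed (simp add: assms(2) OV_closed)
  have c: "P (zhu_circ TV a b) \<and> zhu_circ TV a b \<in> OV" if "a \<in> W" "b \<in> W" for a b
    using sum[OF wc_finite that, of a] unfolding zhu_circ_def zhu_prod_eq[OF that(1) wc_finite subset_refl] .
  have "x \<in> fock.span {zhu_circ TV a b | a b. a \<in> voa_space TV \<and> b \<in> voa_space TV}"
    using assms(1) by (simp add: OV_def zhu_O_def)
  then have "P x \<and> x \<in> OV"
  proof (induction rule: fock.span_induct_alt)
    case (step k x y)
    then obtain a b where ab: "x = zhu_circ TV a b" "a \<in> W" "b \<in> W" by (auto simp: triplet_def)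
    have "fscale k x = zhu_circ TV (fscale k a) b"
      unfolding ab zhu_circ_def using zhu_prod_left(2)[OF ab(2,2)] by simp
    then have "P (fscale k x) \<and> fscale k x \<in> OV" using c[OF W_closed(3)[OF ab(2)] ab(3)] by simp
    then show ?case using step(2) assms(4) OV_closed(2) by blast
  qed (use assms(2) OV_closed in auto)
  then show ?thesis by blast
qed

lemma OV_W: "x \<in> OV \<Longrightarrow> x \<in> W"
  by (induction rule: OV_induct) (auto intro: W_closed tm_W wsp_W)

end

lemma bsum_vanish: "(\<And>i. i \<ge> k \<Longrightarrow> f i = 0) \<Longrightarrow> bsum N f k = 0"
  by (simp add: bsum_def)

lemma bsum_vanish1: "(\<And>i. i \<ge> k \<Longrightarrow> f i = 0) \<Longrightarrow> bsum N f (k - 1) = f (k - 1)"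
  by (induction N) (simp_all add: bsum_0 bsum_Suc bsum_vanish)

lemma bsum_vanish2: "(\<And>i. i \<ge> k \<Longrightarrow> f i = 0) \<Longrightarrow> bsum N f (k - 2) = f (k - 2) + fscale (of_nat N) (f (k - 1))"
proof (induction N)
  case (Suc N)
  have "k - 2 + 1 = k - 1" by simp
  then show ?case using Suc bsum_vanish1[of k f N] by (simp only: bsum_Suc) (simp add: fock.scale_left_distrib)
qed (simp add: bsum_0)

lemma bsum_vanish3: "(\<And>i. i \<ge> k \<Longrightarrow> f i = 0) \<Longrightarrow>
  bsum N f (k - 3) = f (k - 3) + fscale (of_nat N) (f (k - 2)) + fscale (of_nat N * (of_nat N - 1) / 2) (f (k - 1))"
proof (induction N)
  case (Suc N)
  have "k - 3 + 1 = k - 2" by simp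
  moreover have "complex_of_nat (Suc N) * (of_nat (Suc N) - 1) / 2 = of_nat N * (of_nat N - 1) / 2 + of_nat N"
    by (simp add: field_simps)
  ultimately show ?case using Suc bsum_vanish2[of k f N] by (simp only: bsum_Suc) (simp add: fock.scale_left_distrib)
qed (simp add: bsum_0)

lemma fscale_2: "fscale 2 y = 2 * y"
  using fock.scale_left_distrib[of 1 1 y] by (simp only: fock.scale_one one_add_one mult_2)

text \<open>Integration by parts: the residue of the derivative of x^k (1 + x)^(N+1) times the
  series is zero.\<close>

lemma bsum_derivative:
  "bsum (Suc N) (\<lambda>m. fscale (- of_int m) (f (m - 1))) k = fscale (- of_int k) (bsum N f (k - 1)) - fscale (of_int k + of_nat N + 1) (bsum N f k)"
proof (induction N arbitrary: k)
  case 0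
  then show ?case by (simp add: bsum_0 bsum_Suc fock.scale_left_diff_distrib fock.scale_left_distrib)
next
  case (Suc N)
  have e: "k - 1 + 1 = k" by simp
  have comb: "fscale (- c) x - fscale (c + n + 1) y + (fscale (- (c + 1)) y - fscale (c + 1 + n + 1) z) =
    fscale (- c) (x + y) - fscale (c + (1 + n) + 1) (y + z)" for c n x y z
    by (simp add: fock.scale_right_distrib fock.scale_left_distrib fock.scale_left_diff_distrib fscale_2)
  show ?case unfolding bsum_Suc[of "Suc N"] Suc.IH bsum_Suc[of N f] e
    using comb[of "of_int k" "bsum N f (k - 1)" "of_nat N" "bsum N f k" "bsum N f (k + 1)"] by simp
qed

section \<open>O(V) is a two-sided ideal and the product is associative modulo O(V)\<close>

context triplet_setting begin

abbreviation "st \<equiv> zhu_prod TV (Suc 0)"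

lemma md_weight:
  assumes a: "a \<in> VL" "L 0 a = fscale x a" and b: "b \<in> VL" "L 0 b = fscale y b"
  shows "L 0 (md a n b) = fscale (y + x - of_int (n + 1)) (md a n b)"
proof -
  have "L 0 (md a n b) = md a n (L 0 b) + md (L 0 a) n b - fscale (of_int (n + 1)) (md a n b)"
    by (rule nmode_vir_0[OF p0 a(1) b(1)]) simp
  then show ?thesis unfolding a(2) b(2) by (simp only: lin_scale[OF nmode_lin] lin_scale[OF vop_lin_left] fock.scale_left_diff_distrib fock.scale_left_distrib)
qed

lemma md_wsp:
  assumes a: "a \<in> wsp M" and b: "b \<in> wsp N" and K: "int K = int M + int N - n - 1"
  shows "md a n b \<in> wsp K"
proof -
  have "int N + int M - (n + 1) = int K" using K by simp
  then have "of_int (int N + int M - (n + 1)) = (of_int (int K) :: complex)" by (simp only:)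
  then have "of_nat N + of_nat M - of_int (n + 1) = (of_nat K :: complex)" by simp
  then have "L 0 (md a n b) = fscale (of_nat K) (md a n b)"
    using md_weight[of a "of_nat M" b "of_nat N" n] a b by (simp only: W_VL wsp_def mem_Collect_eq)
  then show ?thesis using W_md[OF wsp_W[OF a] wsp_W[OF b]] unfolding wsp_def by blast
qed

lemma conformal_wsp: "conformal p \<in> wsp 2"
  using gr_vir_0[OF conformal_gr[OF p0]] W_conformal by (simp add: wsp_def)

lemma vir_wsp: "b \<in> wsp N \<Longrightarrow> int K = int N - n \<Longrightarrow> L n b \<in> wsp K"
  by (rule md_wsp[OF conformal_wsp]) auto

lemma one_wsp: "1 \<in> wsp 0"
  using gr_vir_0[OF one_gr[OF p0]] W_1 by (simp add: wsp_def)

lemma X_wsp: "X \<in> {XF, XH, XE} \<Longrightarrow> X \<in> wsp (2 * p - 1)"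
  using X_weight W_X p2 by (auto simp: wsp_def of_nat_diff)

lemma W_induct [consumes 1, case_names wsp add]:
  assumes "a \<in> W" "\<And>N a. a \<in> wsp N \<Longrightarrow> P a" "\<And>a b. a \<in> W \<Longrightarrow> b \<in> W \<Longrightarrow> P a \<Longrightarrow> P b \<Longrightarrow> P (a + b)"
  shows "P a"
proof -
  have "P (\<Sum>N\<in>S. wc N a) \<and> (\<Sum>N\<in>S. wc N a) \<in> W" if "finite S" for S
    using that
  proof (induction S rule: finite_induct)
    case (insert N S)
    then show ?case using wc_wsp[OF assms(1), of N] assms(2,3) wsp_W W_closed(2) by auto
  qed (use assms(2)[OF wsp_closed(1)] W_closed in auto)
  from this[OF wc_finite, of a] show ?thesis using wc_sum[OF assms(1) wc_finite subset_refl] by simp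
qed

lemma zhu_prod_scale: "a \<in> W \<Longrightarrow> zhu_prod TV r (fscale x a) c = fscale x (zhu_prod TV r a c)"
  using zhu_prod_left(2)[of a a] .

lemma zhu_prod_sum:
  "(\<And>i. i \<in> A \<Longrightarrow> f i \<in> W) \<Longrightarrow> zhu_prod TV r (\<Sum>i\<in>A. fscale (c i) (f i)) b = (\<Sum>i\<in>A. fscale (c i) (zhu_prod TV r (f i) b))
    \<and> (\<Sum>i\<in>A. fscale (c i) (f i)) \<in> W"
proof (induction A rule: infinite_finite_induct)
  case (insert i A)
  then show ?case by (simp add: zhu_prod_left(1) zhu_prod_scale W_closed)
qed (use zhu_prod_scale[OF W_1, of r 0] in \<open>auto simp: W_closed\<close>)

text \<open>The element is a \<circ> 1: the residue starts with the mode -2, and of the modes from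
  there on only -2 and -1 are nonzero on the vacuum.\<close>

lemma vir_m1_OV: "a \<in> wsp N \<Longrightarrow> L (- 1) a + fscale (of_nat N) a \<in> OV"
proof -
  assume a: "a \<in> wsp N"
  have "tm N a (- 2) 1 = md a (- 2) 1 + fscale (of_nat N) (md a (- 1) 1)"
    using bsum_vanish2[of 0 "\<lambda>m. md a m 1" N] by (simp add: tm_def nmode_creation(1)[OF p0])
  then show ?thesis using OV_circ[OF a W_1] unfolding vir_m1[OF p0] tran_def by (simp add: nmode_creation(2)[OF p0])
qed

text \<open>By \<open>bsum_derivative\<close>, the residue with x^(-r) for L(-1) a is r times the
  one with x^(-r-1) for \<open>a\<close>, up to a multiple of the one with x^(-r).\<close>

lemma tm_OV: "r \<ge> 2 \<Longrightarrow> a \<in> wsp N \<Longrightarrow> b \<in> W \<Longrightarrow> tm N a (- int r) b \<in> OV"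
proof (induction r arbitrary: a N rule: dec_induct)
  case base
  then show ?case using OV_circ by simp
next
  case (step r)
  have a: "a \<in> VL" using W_VL[OF wsp_W[OF step.prems(1)]] .
  have "tm (Suc N) (L (- 1) a) (- int r) b = bsum (Suc N) (\<lambda>m. fscale (- of_int m) (md a (m - 1) b)) (- int r)"
    unfolding tm_def vir_m1[OF p0] tran_nmode[OF p0 VL_borch[OF a VL_1]] ..
  also have "\<dots> = fscale (of_nat r) (tm N a (- int (Suc r)) b) - fscale (- of_nat r + of_nat N + 1) (tm N a (- int r) b)"
  proof -
    have "- int r - 1 = - int (Suc r)" by simp
    then show ?thesis unfolding bsum_derivative[of N "\<lambda>m. md a m b"] tm_def by (simp only: of_int_minus of_int_of_nat_eq minus_minus)
  qed
  finally have "fscale (of_nat r) (tm N a (- int (Suc r)) b) = tm (Suc N) (L (- 1) a) (- int r) b + fscale (- of_nat r + of_nat N + 1) (tm N a (- int r) b)"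
    by (simp only: eq_diff_eq diff_eq_eq)
  also have "\<dots> \<in> OV"
    by (intro OV_closed step.IH step.prems vir_wsp[OF step.prems(1)]) simp
  finally have "fscale (1 / of_nat r) (fscale (of_nat r) (tm N a (- int (Suc r)) b)) \<in> OV" by (rule OV_closed)
  then show ?case using step.hyps by simp
qed

lemma tm_OV': "r \<le> - 2 \<Longrightarrow> a \<in> wsp N \<Longrightarrow> b \<in> W \<Longrightarrow> tm N a r b \<in> OV"
  using tm_OV[of "nat (- r)" a N b] by simp

lemma ch_m1: "(- 1) ^ j * ch (- 1) j = 1"
  using bn_eq[of 0 j] by (simp add: bn_def)

text \<open>For \<open>n = -1\<close> every term except that of \<open>j = 0\<close> begins with a
  residue of order at least two and lies in O(V). The choice \<open>k = -1\<close> gives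
  associativity, and \<open>k = -2\<close> shows that multiplication from the left preserves
  O(V).\<close>

lemma twisted_m1:
  assumes a: "a \<in> wsp M" and b: "b \<in> wsp N" and c: "c \<in> W" and k: "k < 0"
  shows "(\<Sum>l\<le>M. fscale (of_nat (M choose l)) (tm (M - l + N) (md a (- 1 + int l) b) k c)) - tm M a (- 1) (tm N b k c) \<in> OV"
proof -
  have aV: "a \<in> VL" "b \<in> VL" using W_VL wsp_W a b by auto
  let ?f = "\<lambda>j. tm M a (- 1 - int j) (tm N b (k + int j) c)" and ?g = "\<lambda>j. tm N b (- 1 + k - int j) (tm M a (int j) c)"
  have f: "fs ?f"
  proof -
    obtain K where "\<forall>m\<ge>K. md b m c = 0" using nmode_trunc by blast
    then have "tm N b (k + int j) c = 0" if "j \<ge> nat (K - k)" for j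
      using that unfolding tm_def by (intro bsum_vanish) auto
    then show ?thesis by (intro fsI[of "nat (K - k)"]) (simp add: lin_0[OF tm_lin])
  qed
  have X: "?f 0 + Sum_any (\<lambda>j. ?f (Suc j)) + Sum_any ?g = (\<Sum>l\<le>M. fscale (of_nat (M choose l)) (tm (M - l + N) (md a (- 1 + int l) b) k c))"
    using twisted_Borcherds[OF aV, of "- 1" M N k c] unfolding ch_m1 Sum_any_Suc[OF f, symmetric] by (simp add: sg_def)
  have "Sum_any (\<lambda>j. ?f (Suc j)) \<in> OV" "Sum_any ?g \<in> OV"
    using k by (auto intro!: subspace_Sum_any[OF OV_subspace] tm_OV' a b tm_W wsp_W[OF a] wsp_W[OF b] c)
  then have "?f 0 + Sum_any (\<lambda>j. ?f (Suc j)) + Sum_any ?g - ?f 0 \<in> OV" using OV_closed(2) by (simp only: add.assoc add_diff_cancel_left')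
  then show ?thesis unfolding X by simp
qed

lemma star_assoc_wsp:
  assumes a: "a \<in> wsp M" and b: "b \<in> wsp N" and c: "c \<in> W"
  shows "st (st a b) c - st a (st b c) \<in> OV"
proof -
  have x: "md a (- 1 + int l) b \<in> wsp (M - l + N)" if "l \<le> M" for l
    by (rule md_wsp[OF a b]) (use that in auto)
  have "st (\<Sum>l\<le>M. fscale (of_nat (M choose l)) (md a (- 1 + int l) b)) c = (\<Sum>l\<le>M. fscale (of_nat (M choose l)) (tm (M - l + N) (md a (- 1 + int l) b) (- 1) c))"
    using zhu_prod_sum[of "{..M}" "\<lambda>l. md a (- 1 + int l) b" "Suc 0" "\<lambda>l. of_nat (M choose l)" c] zhu_prod_wsp[OF x, of _ "Suc 0" c] wsp_W[OF x]
    by (auto intro!: sum.cong)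
  moreover have "(\<Sum>l\<le>M. fscale (of_nat (M choose l)) (md a (- 1 + int l) b)) = st a b"
    using zhu_prod_wsp[OF a, of "Suc 0" b] by (simp add: tm_def bsum_def)
  ultimately show ?thesis using twisted_m1[OF a b c, of "- 1"] zhu_prod_wsp[OF a, of "Suc 0"] zhu_prod_wsp[OF b, of "Suc 0"] by simp
qed

lemma star_circ_wsp:
  assumes a: "a \<in> wsp M" and b: "b \<in> wsp N" and c: "c \<in> W"
  shows "st a (tm N b (- 2) c) \<in> OV"
proof -
  have "(\<Sum>l\<le>M. fscale (of_nat (M choose l)) (tm (M - l + N) (md a (- 1 + int l) b) (- 2) c)) \<in> OV"
    by (intro fock.subspace_sum[OF OV_subspace] OV_closed tm_OV' md_wsp[OF a b] c) auto
  from OV_closed(3)[OF this twisted_m1[OF a b c, of "- 2"]] show ?thesis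
    using zhu_prod_wsp[OF a, of "Suc 0"] by simp
qed

text \<open>The components of a \<circ> b have weight one more than the exponent M - l + N of
  \<open>twisted_Borcherds\<close>. The additional factor 1 + x splits the product into the residues
  with \<open>k = -1\<close> and \<open>k = 0\<close>; for \<open>n = -2\<close> both lie in
  O(V).\<close>

lemma circ_star_wsp:
  assumes a: "a \<in> wsp M" and b: "b \<in> wsp N" and c: "c \<in> W"
  shows "st (tm M a (- 2) b) c \<in> OV"
proof -
  have aV: "a \<in> VL" "b \<in> VL" using W_VL wsp_W a b by auto
  let ?R = "\<lambda>k. \<Sum>l\<le>M. fscale (of_nat (M choose l)) (tm (M - l + N) (md a (- 2 + int l) b) k c)"
  have R: "?R k \<in> OV" if "k \<le> 0" for k
    unfolding twisted_Borcherds[OF aV, symmetric] using that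
    by (intro OV_closed subspace_Sum_any[OF OV_subspace] tm_OV' a b tm_W wsp_W[OF a] wsp_W[OF b] c) auto
  have x: "md a (- 2 + int l) b \<in> wsp (Suc (M - l + N))" if "l \<le> M" for l
    by (rule md_wsp[OF a b]) (use that in auto)
  have "st (\<Sum>l\<le>M. fscale (of_nat (M choose l)) (md a (- 2 + int l) b)) c = (\<Sum>l\<le>M. fscale (of_nat (M choose l)) (tm (Suc (M - l + N)) (md a (- 2 + int l) b) (- 1) c))"
    using zhu_prod_sum[of "{..M}" "\<lambda>l. md a (- 2 + int l) b" "Suc 0" "\<lambda>l. of_nat (M choose l)" c] zhu_prod_wsp[OF x, of _ "Suc 0" c] wsp_W[OF x]
    by (auto intro!: sum.cong)
  also have "\<dots> = ?R (- 1) + ?R 0"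
    unfolding tm_Suc fock.scale_right_distrib sum.distrib by simp
  finally show ?thesis using OV_closed(2)[OF R[of "- 1"] R[of 0]] by (simp add: tm_def bsum_def)
qed

lemma star_W: "a \<in> W \<Longrightarrow> b \<in> W \<Longrightarrow> st a b \<in> W"
  by (rule zhu_prod_W)

lemma star_left: "a \<in> W \<Longrightarrow> b \<in> W \<Longrightarrow> st (a + b) c = st a c + st b c" "a \<in> W \<Longrightarrow> st (fscale x a) c = fscale x (st a c)"
  using zhu_prod_left(1) zhu_prod_scale by auto

lemma star_right: "a \<in> W \<Longrightarrow> st a (b + c) = st a b + st a c" "a \<in> W \<Longrightarrow> st a (fscale x b) = fscale x (st a b)"
  "a \<in> W \<Longrightarrow> st a (b - c) = st a b - st a c" "a \<in> W \<Longrightarrow> st a 0 = 0"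
  using lin_simps[OF zhu_prod_lin] by auto

lemma star_assoc:
  assumes a: "a \<in> W" and b: "b \<in> W" and c: "c \<in> W"
  shows "st (st a b) c - st a (st b c) \<in> OV"
  using a
proof (induction rule: W_induct)
  case (wsp M a)
  then have aW: "a \<in> W" by (rule wsp_W)
  from b show ?case
  proof (induction rule: W_induct)
    case (wsp N b)
    then show ?case by (rule star_assoc_wsp[OF \<open>a \<in> wsp M\<close> _ c])
  next
    case (add b b')
    then show ?case using OV_closed(2)[OF add(3,4)] aW by (simp add: star_left star_right star_W algebra_simps)
  qed
next
  case (add a a')
  then show ?case using OV_closed(2)[OF add(3,4)] b by (simp add: star_left star_W algebra_simps)
qed

lemma OV_star_right: "x \<in> OV \<Longrightarrow> a \<in> W \<Longrightarrow> st a x \<in> OV"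
proof (induction rule: OV_induct)
  case (circ N b c)
  from circ(3) show ?case
  proof (induction rule: W_induct)
    case (wsp M a)
    then show ?case using star_circ_wsp circ by blast
  qed (simp add: star_left OV_closed)
qed (simp_all add: star_right OV_closed)

lemma OV_star_left: "x \<in> OV \<Longrightarrow> c \<in> W \<Longrightarrow> st x c \<in> OV"
proof (induction rule: OV_induct)
  case zero
  then show ?case using star_left(2)[of 1 0 c] W_1 by (simp add: OV_closed)
next
  case (circ M a b)
  from circ(2) show ?case
  proof (induction rule: W_induct)
    case (wsp N b)
    then show ?case using circ_star_wsp circ by blast
  next
    case (add b b')
    then show ?case using circ(1) circ(3)
      by (simp add: lin_add[OF tm_lin] star_left tm_W wsp_W OV_closed)
  qed
qed (simp_all add: star_left OV_closed OV_W)

abbreviation "om \<equiv> st (conformal p)"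

lemma om_eq: "om u = L (- 2) u + fscale 2 (L (- 1) u) + L 0 u"
  using zhu_prod_wsp[OF conformal_wsp, of "Suc 0" u] unfolding tm_def by (simp add: bsum_def numeral_2_eq_2 add_ac)

lemma om_lin: "lin om" by (rule zhu_prod_lin[OF W_conformal])

lemma om_W: "u \<in> W \<Longrightarrow> om u \<in> W" by (rule star_W[OF W_conformal])

text \<open>Residues of \<omega> of order at least two put L(-n-3) u + 2 L(-n-2) u + L(-n-1) u into
  O(V). This recursion has the double characteristic root -1; its initial values come from
  \<open>vir_m1_OV\<close> and from the definition of the product with \<omega>.\<close>

lemma vir_neg_OV:
  assumes u: "u \<in> wsp N"
  shows "L (- int (Suc n)) u - fscale ((- 1) ^ Suc n) (fscale (of_nat n) (om u) + fscale (of_nat N) u) \<in> OV"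
proof -
  let ?A = "\<lambda>n. L (- int (Suc n)) u - fscale ((- 1) ^ Suc n) (fscale (of_nat n) (om u) + fscale (of_nat N) u)"
  have "?A n \<in> OV \<and> ?A (Suc n) \<in> OV"
  proof (induction n)
    case 0
    have "?A 0 = L (- 1) u + fscale (of_nat N) u" by simp
    moreover have "?A (Suc 0) = - fscale 2 (L (- 1) u + fscale (of_nat N) u)"
      unfolding om_eq using u by (simp add: wsp_def fock.scale_right_distrib fock.scale_left_distrib[of 1 1 "fscale _ _", simplified])
    ultimately show ?case using vir_m1_OV[OF u] OV_closed(4)[of "L (- 1) u + fscale (of_nat N) u" 2] OV_closed(5)[of "fscale 2 (L (- 1) u + fscale (of_nat N) u)"] by simp
  next
    case (Suc n)
    have t1: "tm 2 (conformal p) (- int (n + 2)) u \<in> OV" by (rule tm_OV[OF _ conformal_wsp wsp_W[OF u]]) simp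
    have t2: "tm 2 (conformal p) (- int (n + 2)) u = L (- int (Suc (Suc (Suc n)))) u + fscale 2 (L (- int (Suc (Suc n))) u) + L (- int (Suc n)) u"
      by (simp add: tm_def bsum_def numeral_2_eq_2 algebra_simps)
    have t3: "?A (Suc (Suc n)) = (L (- int (Suc (Suc (Suc n)))) u + fscale 2 (L (- int (Suc (Suc n))) u) + L (- int (Suc n)) u) - fscale 2 (?A (Suc n)) - ?A n"
    proof -
      have "l3 - fscale (- s) (fscale (c + 2) y + w) = (l3 + fscale 2 l2 + l1) - fscale 2 (l2 - fscale s (fscale (c + 1) y + w)) - (l1 - fscale (- s) (fscale c y + w))"
        for l1 l2 l3 y w s c
      proof -
        have 1: "fscale (- s) (fscale (c + 1 + 1) y + w) = - (fscale (s * c) y + fscale s y + fscale s y + fscale s w)"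
          "fscale s (fscale (c + 1) y + w) = fscale (s * c) y + fscale s y + fscale s w" "fscale (- s) (fscale c y + w) = - (fscale (s * c) y + fscale s w)"
          by (simp_all only: fock.scale_right_distrib fock.scale_left_distrib fock.scale_scale fock.scale_one fock.scale_minus_left minus_add_distrib distrib_left mult_1_right mult_minus_left)
        have 2: "c + 2 = c + 1 + 1" "fscale 2 v = v + v" for v using trans[OF fscale_2[of v] mult_2[of v]] by simp_all
        have 3: "l3 - - (a + b + b + d) = (l3 + (l2 + l2) + l1) - ((l2 - (a + b + d)) + (l2 - (a + b + d))) - (l1 - - (a + d))" for a b d :: fock
          by (simp only: minus_minus minus_add_distrib diff_conv_add_uminus) (simp add: add_ac)
        show ?thesis unfolding 2 1 by (rule 3)
      qed
      from this[of "L (- int (Suc (Suc (Suc n)))) u" "(- 1) ^ n" "of_nat n" "om u" "fscale (of_nat N) u" "L (- int (Suc (Suc n))) u" "L (- int (Suc n)) u"]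
      moreover have "complex_of_nat (Suc (Suc n)) = of_nat n + 2" "complex_of_nat (Suc n) = of_nat n + 1"
        "(- 1 :: complex) ^ Suc (Suc (Suc n)) = - ((- 1) ^ n)" "(- 1 :: complex) ^ Suc (Suc n) = (- 1) ^ n" "(- 1 :: complex) ^ Suc n = - ((- 1) ^ n)" by simp_all
      ultimately show ?thesis by (simp only:)
    qed
    have "?A (Suc (Suc n)) \<in> OV"
      unfolding t3 by (rule OV_closed(3)[OF OV_closed(3)[OF t1[unfolded t2] OV_closed(4)[OF conjunct2[OF Suc]]] conjunct1[OF Suc]])
    then show ?case using Suc by blast
  qed
  then show ?thesis by blast
qed

text \<open>The class of \<omega> commutes with those of the generators. As \<open>X\<close> is
  primary, the commutator can be computed outright: it is a combination of L(-1) y + L(0) y for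
  \<open>y = X\<close> and \<open>y = L(-1) X\<close>, which \<open>vir_m1_OV\<close> puts into
  O(V).\<close>

lemma star_X_conformal:
  assumes X: "X \<in> {XF, XH, XE}"
  shows "st X (conformal p) - om X \<in> OV"
proof -
  let ?d = "of_nat (2 * p - 1) :: complex" and ?T = "L (- 1) X"
  have d: "?d = 2 * of_nat p - 1" using p2 by (simp add: of_nat_diff)
  have XW: "X \<in> VL" using W_VL[OF W_X[OF X]] .
  have Xm: "md X m (conformal p) = L (- 2) (md X m 1) + fscale (?d + of_int m - 1) (md X (m - 2) 1)" for m
    using vir_primary[OF XW X_primary[OF _ X] X_weight[OF X] VL_1, of "- 2" m] unfolding vir_m2_one[OF p0] d
    by (simp add: fock.scale_left_diff_distrib fock.scale_left_distrib algebra_simps)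
  have m3: "md X (- 3) 1 = fscale (1 / 2) (L (- 1) ?T)"
  proof -
    have "tran p ?T = fscale 2 (md X (- 3) 1)"
      using tran_nmode[OF p0 VL_borch[OF XW VL_1], of "- 2" 1] unfolding vir_m1[OF p0] tran_def[of p "tran p X"] by simp
    then show ?thesis unfolding vir_m1[OF p0, of "tran p X"] vir_m1[OF p0, of ?T] by simp
  qed
  have v: "md X m (conformal p) = 0" if "m \<ge> 2" for m
    unfolding Xm using that by (simp add: nmode_creation(1)[OF p0] nmode_simps)
  have "st X (conformal p) = md X (- 1) (conformal p) + fscale ?d (md X 0 (conformal p)) + fscale (?d * (?d - 1) / 2) (md X 1 (conformal p))"
    using zhu_prod_wsp[OF X_wsp[OF X], of "Suc 0" "conformal p"] bsum_vanish3[of 2 "\<lambda>m. md X m (conformal p)" "2 * p - 1", OF v] by (simp add: tm_def)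
  also have "md X (- 1) (conformal p) = L (- 2) X + fscale ((?d - 2) / 2) (L (- 1) ?T)"
    unfolding Xm using m3 by (simp add: nmode_creation(2)[OF p0])
  also have "md X 0 (conformal p) = fscale (?d - 1) ?T"
    unfolding Xm vir_m1[OF p0] tran_def by (simp add: nmode_creation(1)[OF p0] nmode_simps)
  also have "md X 1 (conformal p) = fscale ?d X"
    unfolding Xm by (simp add: nmode_creation[OF p0] nmode_simps)
  finally have e1: "st X (conformal p) = L (- 2) X + fscale ((?d - 2) / 2) (L (- 1) ?T) + fscale ?d (fscale (?d - 1) ?T) + fscale (?d * (?d - 1) / 2) (fscale ?d X)" .
  have e2: "om X = L (- 2) X + fscale 2 ?T + fscale ?d X"
    unfolding om_eq X_weight[OF X] d ..
  have "st X (conformal p) - om X = fscale ((?d - 2) / 2) (L (- 1) ?T + fscale (of_nat (Suc (2 * p - 1))) ?T) + fscale ((?d - 2) * (?d + 1) / 2) (?T + fscale ?d X)"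
  proof -
    have "(l + fscale ((d - 2) / 2) t2 + fscale d (fscale (d - 1) t) + fscale (d * (d - 1) / 2) (fscale d x)) - (l + fscale 2 t + fscale d x) =
      fscale ((d - 2) / 2) (t2 + fscale (1 + d) t) + fscale ((d - 2) * (d + 1) / 2) (t + fscale d x)" for l t2 t x d
    proof -
      have c: "(d - 2) / 2 * (1 + d) + (d - 2) * (d + 1) / 2 = d * (d - 1) - 2" "(d - 2) * (d + 1) / 2 * d = d * (d - 1) / 2 * d - d"
        by (simp_all add: field_simps)
      have r: "fscale h (t2 + fscale u t) + fscale k (t + fscale d x) = fscale h t2 + fscale (h * u + k) t + fscale (k * d) x" for h k u
        by (simp add: fock.scale_right_distrib fock.scale_left_distrib)
      have "(l + a + fscale d (fscale (d - 1) t) + fscale e (fscale d x)) - (l + fscale 2 t + fscale d x) = a + fscale (d * (d - 1) - 2) t + fscale (e * d - d) x" for a e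
        unfolding fock.scale_scale unfolding fock.scale_left_diff_distrib by simp
      then show ?thesis unfolding r c .
    qed
    from this[of "L (- 2) X" ?d "L (- 1) ?T" ?T X] show ?thesis unfolding e1 e2 of_nat_Suc .
  qed
  also have "\<dots> \<in> OV"
    by (intro OV_closed vir_m1_OV X_wsp[OF X] vir_wsp[OF X_wsp[OF X]]) simp
  finally show ?thesis .
qed

section \<open>Polynomials in \<omega> acting modulo O(V)\<close>

definition pact :: "complex poly \<Rightarrow> fock \<Rightarrow> fock" where
  "pact q Z = foldr (\<lambda>a v. fscale a Z + om v) (coeffs q) 0"

lemma pact_0 [simp]: "pact 0 Z = 0"
  by (simp add: pact_def)

lemma pact_pCons [simp]: "pact (pCons a q) Z = fscale a Z + om (pact q Z)"
  by (auto simp: pact_def cCons_def lin_0[OF om_lin])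

lemma pact_1 [simp]: "pact 1 Z = Z"
  using pact_pCons[of 1 0 Z] by (simp add: lin_0[OF om_lin] flip: one_pCons)

lemma pact_add: "pact (q + r) Z = pact q Z + pact r Z"
  by (induction q r rule: poly_induct2) (simp_all add: lin_add[OF om_lin] fock.scale_left_distrib)

lemma pact_smult: "pact (Polynomial.smult c q) Z = fscale c (pact q Z)"
  by (induction q) (simp_all add: lin_scale[OF om_lin] fock.scale_right_distrib)

lemma pact_mult: "pact (q * r) Z = pact q (pact r Z)"
  by (induction q) (simp_all add: pact_add pact_smult)

lemma pact_sum: "pact (sum f A) Z = (\<Sum>i\<in>A. pact (f i) Z)"
  by (induction A rule: infinite_finite_induct) (simp_all add: pact_add)

lemma pact_lin: "lin (pact q)"
proof (induction q)
  case 0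
  then show ?case by (simp add: lin_zero)
next
  case (pCons a q)
  show ?case unfolding pact_pCons[abs_def] by (intro lin_plus lin_fscale lin_comp[OF om_lin pCons(2)])
qed

lemma pact_W: "Z \<in> W \<Longrightarrow> pact q Z \<in> W"
  by (induction q) (auto intro: W_closed om_W)

lemma pact_OV: "Z \<in> OV \<Longrightarrow> pact q Z \<in> OV"
  by (induction q) (auto intro: OV_closed OV_star_right W_conformal)

lemma Q_om: "Q (om u) = om (Q u)"
  unfolding om_eq lin_add[OF Q_lin] lin_scale[OF Q_lin] Q_vir ..

lemma pact_Q: "Q (pact q Z) = pact q (Q Z)"
  by (induction q) (simp_all add: lin_simps[OF Q_lin] Q_om)

lemma pact_monom: "pact (Polynomial.monom c i) Z = fscale c ((om ^^ i) Z)"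
  by (induction i) (simp_all add: monom_0 monom_Suc lin_0[OF om_lin] lin_scale[OF om_lin])

lemma gr_wsp: "u \<in> W \<Longrightarrow> u \<in> gr p k (of_int w) \<Longrightarrow> w \<ge> 0 \<Longrightarrow> u \<in> wsp (nat w)"
  using gr_vir_0[of u p k "of_int w"] by (simp add: wsp_def)

lemma vir_neg_gr:
  assumes u: "u \<in> W" "u \<in> gr p k (of_int w)" and n: "n > 0"
  shows "L (- int n) u - fscale ((- 1) ^ n) (fscale (of_nat n - 1) (om u) + fscale (of_int w) u) \<in> OV"
proof (cases "w \<ge> 0")
  case True
  then show ?thesis using vir_neg_OV[OF gr_wsp[OF u True], of "n - 1"] n by (simp add: of_nat_diff)
next
  case False
  have "u = 0"
  proof (cases "k \<in> VS")
    case True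
    then show ?thesis using VL_neg[OF u(2)] False by simp
  next
    case False
    then have "u \<in> chg {}" using W_VL[OF u(1)] gr_chg[OF u(2)] by (auto simp: chg_def)
    then show ?thesis by (rule chg_empty)
  qed
  then show ?thesis by (simp add: nmode_simps lin_0[OF om_lin] OV_closed)
qed

text \<open>The recursion of \<open>Rep\<close> is that of \<open>vir_neg_OV\<close>, with the
  weight replaced by multiplication by \<omega>. So the polynomial that governs zero modes on
  modules also describes the class of \<open>u\<close>.\<close>

lemma Rep_pact:
  assumes "Rep p Z z w u \<pi>" and Z: "Z \<in> W" "Z \<in> gr p k (of_int z)"
  shows "u - pact \<pi> Z \<in> OV"
  using assms(1)
proof (induction rule: Rep.induct)
  case (vir w u \<pi> n)
  have u: "u \<in> W" "u \<in> gr p k (of_int w)"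
    using Vsp_W[of u Z z w] Rep_gr[OF vir(1) Z(2)] vir(1) Z(1) by (auto simp: Vsp_def)
  let ?x = "u - pact \<pi> Z" and ?s = "(- 1) ^ n :: complex"
  have "L (- int n) u - pact (Polynomial.smult ?s ([:of_int w, of_nat n - 1:] * \<pi>)) Z =
    (L (- int n) u - fscale ?s (fscale (of_nat n - 1) (om u) + fscale (of_int w) u)) + fscale ?s (fscale (of_nat n - 1) (om ?x) + fscale (of_int w) ?x)"
    unfolding pact_smult pact_mult
    by (simp add: lin_simps[OF om_lin] fock.scale_right_distrib fock.scale_right_diff_distrib)
  also have "\<dots> \<in> OV"
    by (intro OV_closed OV_star_right vir_neg_gr[OF u] vir W_conformal)
  finally show ?case .
next
  case (add w u \<pi> v \<rho>)
  then show ?case using OV_closed(2)[OF add.IH] by (simp add: pact_add algebra_simps)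
next
  case (scale w u \<pi> c)
  then show ?case using OV_closed(4)[OF scale.IH, of c] by (simp add: pact_smult fock.scale_right_diff_distrib)
qed (simp_all add: OV_closed)

text \<open>The preimage of the span of the claimed classes, for arbitrary powers of \<omega>.
  Including O(V) turns congruences into memberships.\<close>

definition Msp :: "fock set" where
  "Msp = fock.span (OV \<union> (\<Union>Z\<in>{1, XF, XH, XE}. range (\<lambda>q. pact q Z)))"

lemma Msp_subspace: "fock.subspace Msp"
  unfolding Msp_def by (rule fock.subspace_span)

lemmas Msp_closed = fock.subspace_0[OF Msp_subspace] fock.subspace_add[OF Msp_subspace]
  fock.subspace_diff[OF Msp_subspace] fock.subspace_scale[OF Msp_subspace]

lemma Msp_OV: "x \<in> OV \<Longrightarrow> x \<in> Msp"
  unfolding Msp_def by (rule fock.span_base) simp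

lemma Msp_pact: "Z \<in> {1, XF, XH, XE} \<Longrightarrow> pact q Z \<in> Msp"
  unfolding Msp_def by (rule fock.span_base) blast

lemma Msp_cong: "x - y \<in> OV \<Longrightarrow> y \<in> Msp \<Longrightarrow> x \<in> Msp"
  using Msp_closed(2)[OF Msp_OV, of "x - y" y] by simp

lemma gen_W: "Z \<in> {1, XF, XH, XE} \<Longrightarrow> Z \<in> W"
  using W_X W_1 by auto

lemma Msp_lin:
  assumes "lin f" "\<And>x. x \<in> OV \<Longrightarrow> f x \<in> OV" "\<And>q Z. Z \<in> {1, XF, XH, XE} \<Longrightarrow> f (pact q Z) \<in> Msp" and u: "u \<in> Msp"
  shows "f u \<in> Msp"
proof -
  from u have "u \<in> fock.span (OV \<union> (\<Union>Z\<in>{1, XF, XH, XE}. range (\<lambda>q. pact q Z)))" by (simp only: Msp_def)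
  then show ?thesis
  proof (induction rule: fock.span_induct_alt)
    case (step c x y)
    have "f x \<in> Msp" using step(1) assms(2,3) Msp_OV by blast
    with step(2) show ?case using Msp_closed(2,4) by (simp add: lin_simps[OF assms(1)])
  qed (simp add: lin_0[OF assms(1)] Msp_closed)
qed

lemma Msp_om: "u \<in> Msp \<Longrightarrow> om u \<in> Msp"
proof (rule Msp_lin[OF om_lin])
  show "om (pact q Z) \<in> Msp" if "Z \<in> {1, XF, XH, XE}" for q Z
    using Msp_pact[OF that, of "pCons 0 q"] by simp
qed (auto intro: OV_star_right W_conformal)

lemma Vall_Msp: "u \<in> Vall w \<Longrightarrow> u \<in> Msp"
  unfolding Vall_def
proof (induction rule: fock.span_induct_alt)
  case (step c x y)
  have V: "x \<in> Msp" if h: "x \<in> Vsp p Z z w" "Z \<in> {1, XF, XH, XE}" "Z \<in> gr p k (of_int z)" for Z z k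
  proof -
    obtain \<pi> where "Rep p Z z w x \<pi>" using h(1) unfolding Vsp_def by blast
    from Rep_pact[OF this gen_W[OF h(2)] h(3)] show ?thesis by (rule Msp_cong[OF _ Msp_pact[OF h(2)]])
  qed
  have "x \<in> Msp" using step(1) V[of 1 0 0] V[OF _ _ X_D(1)] V[OF _ _ X_D(2)] V[OF _ _ X_D(3)] one_gr[OF p0] by auto
  then show ?case using step(2) Msp_closed by blast
qed (simp add: Msp_closed)

text \<open>Modulo O(V), X * (\<omega> * y) = (X * \<omega>) * y = (\<omega> * X) * y = \<omega> *
  (X * y).\<close>

lemma star_X_om:
  assumes X: "X \<in> {XF, XH, XE}" and y: "y \<in> W" "st X y \<in> Msp"
  shows "st X (om y) \<in> Msp"
proof -
  have XW: "X \<in> W" by (rule W_X[OF X])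
  have 1: "st (st X (conformal p)) y - st X (om y) \<in> OV" by (rule star_assoc[OF XW W_conformal y(1)])
  have "st (st X (conformal p) - om X) y \<in> OV" by (rule OV_star_left[OF star_X_conformal[OF X] y(1)])
  then have 2: "st (st X (conformal p)) y - st (om X) y \<in> OV"
    using star_left(1)[of "st X (conformal p) - om X" "om X" y] XW W_conformal
    by (simp add: star_W om_W OV_W star_X_conformal[OF X])
  have 3: "st (om X) y - om (st X y) \<in> OV" by (rule star_assoc[OF W_conformal XW y(1)])
  have "- (st (st X (conformal p)) y - st X (om y)) + (st (st X (conformal p)) y - st (om X) y) + (st (om X) y - om (st X y)) \<in> OV"
    by (rule OV_closed(2)[OF OV_closed(2)[OF OV_closed(5)[OF 1] 2] 3])
  then have "st X (om y) - om (st X y) \<in> OV" by simp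
  then show ?thesis using Msp_cong Msp_om[OF y(2)] by blast
qed

text \<open>Powers of \<omega> are moved to the left by \<open>star_X_om\<close>; what remains is a
  product of two generators, or of a generator with the vacuum, and the former is a combination of
  modes covered by \<open>X_products\<close>.\<close>

lemma star_X_Msp:
  assumes X: "X \<in> {XF, XH, XE}"
  shows "u \<in> Msp \<Longrightarrow> st X u \<in> Msp"
proof (rule Msp_lin[OF zhu_prod_lin[OF W_X[OF X]]])
  show "st X x \<in> OV" if "x \<in> OV" for x using OV_star_right[OF that W_X[OF X]] .
  fix q Z assume Z: "Z \<in> {1, XF, XH, XE}"
  have t: "st X Z = tm (2 * p - 1) X (- 1) Z" using zhu_prod_wsp[OF X_wsp[OF X], of "Suc 0" Z] by simp
  have "st X Z \<in> Msp"
  proof (cases "Z = 1")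
    case True
    have "st X 1 = X" using t bsum_vanish1[of 0 "\<lambda>m. md X m 1" "2 * p - 1"] unfolding True tm_def
      by (simp add: nmode_creation[OF p0])
    then show ?thesis using Msp_pact[of X 1] X True by auto
  next
    case False
    then have Z: "Z \<in> {XF, XH, XE}" using Z by blast
    have "md X (- 1 + int i) Z \<in> Msp" for i
      using Vall_Msp[OF X_products[OF X Z, of "4 * int p - 2 - int i"]] p2 by (simp add: algebra_simps)
    then show ?thesis unfolding t tm_def bsum_def by (intro fock.subspace_sum[OF Msp_subspace] Msp_closed)
  qed
  then show "st X (pact q Z) \<in> Msp"
  proof (induction q)
    case (pCons a q)
    show ?case unfolding pact_pCons star_right(1,2)[OF W_X[OF X]]
      by (intro Msp_closed pCons(3) star_X_om[OF X pact_W[OF gen_W[OF Z]] pCons(2)[OF pCons(3)]])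
  qed (use star_right(4)[OF W_X[OF X]] in \<open>simp add: Msp_closed\<close>)
qed

lemma Gw_weight: "Gw k w u \<Longrightarrow> L 0 u = fscale (of_int w) u"
proof (induction rule: Gw.induct)
  case (one k)
  then show ?case using gr_vir_0[OF one_gr[OF p0]] by simp
next
  case (vir k w u n)
  then show ?case using md_weight[OF VL_conformal gr_vir_0[OF conformal_gr[OF p0]] W_VL[OF Gw_W[OF vir(1)]] vir(3), of "- int n + 1"]
    by (simp add: algebra_simps)
next
  case (gen k w u X n)
  then show ?case using md_weight[OF X_VL[OF gen(2)] X_weight[OF gen(2)] W_VL[OF Gw_W[OF gen(1)]] gen(4), of "- int n"]
    by (simp add: algebra_simps)
qed (auto simp: nmode_simps fock.scale_right_distrib)

lemma Wd_wsp:
  assumes "u \<in> Wd w"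
  shows "w \<ge> 0 \<Longrightarrow> u \<in> wsp (nat w)" "w < 0 \<Longrightarrow> u = 0"
proof -
  obtain k where k: "Gw k w u" using assms by (auto simp: Wd_def)
  show "w \<ge> 0 \<Longrightarrow> u \<in> wsp (nat w)" using Gw_weight[OF k] Gw_W[OF k] by (simp add: wsp_def)
  assume w: "w < 0"
  have "\<kappa> \<notin> keys u" for \<kappa>
  proof
    assume \<kappa>: "\<kappa> \<in> keys u"
    then obtain N where N: "wtk p \<kappa> = of_nat N" using VL_weight W_VL[OF Gw_W[OF k]] by blast
    have "wtk p \<kappa> * lookup u \<kappa> = of_int w * lookup u \<kappa>"
      using arg_cong[OF Gw_weight[OF k], of "\<lambda>v. lookup v \<kappa>"] by (simp only: lookup_vir_0[OF p0] lookup_fscale)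
    then have "of_int (int N) = (of_int w :: complex)" using \<kappa> N by (simp add: in_keys_iff)
    then show False using w by (simp only: of_int_eq_iff)
  qed
  then have "keys u = {}" by blast
  then show "u = 0" by simp
qed

lemma bsum_first: "fock.subspace S \<Longrightarrow> (\<And>i. i > k \<Longrightarrow> f i \<in> S) \<Longrightarrow> bsum N f k - f k \<in> S"
proof (induction N)
  case (Suc N)
  have "bsum N f (k + 1) \<in> S"
    unfolding bsum_def by (intro fock.subspace_sum fock.subspace_scale Suc.prems) simp
  from fock.subspace_add[OF Suc.prems(1) Suc.IH[OF Suc.prems] this] show ?case
    unfolding bsum_Suc by (simp only: add_diff_eq diff_add_eq)
qed (simp add: bsum_0 fock.subspace_0)

text \<open>The mode -n of \<open>X\<close> on \<open>u\<close> is the leading term of the residue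
  of order n, whose other terms have smaller weight. The residue itself is the product of
  \<open>X\<close> with \<open>u\<close> for n = 1 and an element of O(V) for larger n.\<close>

lemma Wd_Msp: "v \<in> Wd N \<Longrightarrow> v \<in> Msp"
proof (induction "nat N" arbitrary: N v rule: less_induct)
  case less
  have IH: "u \<in> Msp" if "u \<in> Wd w" "w < N" for u w
    using less.hyps[of w u] that Wd_wsp(2)[OF that(1)] by (cases "w < 0") (auto simp: Msp_closed)
  have "Gw k w v \<Longrightarrow> w = N \<longrightarrow> v \<in> Msp" for k w v
  proof (induction rule: Gw.induct)
    case (one k)
    then show ?case using Msp_pact[of 1 1] by simp
  next
    case (vir k w u n)
    show ?case
    proof
      assume N: "w + int n = N"
      have u: "u \<in> Wd w" using vir(1) by (auto simp: Wd_def)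
      then have M: "u \<in> Msp" using IH N vir(2) by auto
      show "L (- int n) u \<in> Msp"
      proof (cases "w < 0")
        case True
        then show ?thesis using Wd_wsp(2)[OF u] by (simp add: nmode_simps Msp_closed)
      next
        case False
        then have "u \<in> wsp (nat w)" using Wd_wsp(1)[OF u] by simp
        from vir_neg_OV[OF this, of "n - 1"] vir(2) show ?thesis
          using M by (intro Msp_cong[of "L (- int n) u" "fscale ((- 1) ^ Suc (n - 1)) (fscale (of_nat (n - 1)) (om u) + fscale (of_nat (nat w)) u)"])
            (auto intro!: Msp_closed Msp_om)
      qed
    qed
  next
    case (gen k w u X n)
    show ?case
    proof
      assume N: "w + D - 1 + int n = N"
      have u: "u \<in> Wd w" using gen(1) by (auto simp: Wd_def)
      then have M: "u \<in> Msp" using IH N p2 by auto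
      have "tm (2 * p - 1) X (- int n) u \<in> Msp"
      proof (cases "n = 1")
        case True
        then show ?thesis using star_X_Msp[OF gen(2) M] zhu_prod_wsp[OF X_wsp[OF gen(2)], of "Suc 0" u] by simp
      next
        case False
        then show ?thesis using gen(3) tm_OV[OF _ X_wsp[OF gen(2)] Gw_W[OF gen(1)], of n] Msp_OV by auto
      qed
      moreover have "tm (2 * p - 1) X (- int n) u - md X (- int n) u \<in> Msp"
        unfolding tm_def
      proof (rule bsum_first[OF Msp_subspace])
        fix i assume "i > - int n"
        then show "md X i u \<in> Msp" using N by (intro IH[OF Wd_gen[OF u gen(2) refl]]) simp
      qed
      ultimately have "tm (2 * p - 1) X (- int n) u - (tm (2 * p - 1) X (- int n) u - md X (- int n) u) \<in> Msp" by (rule Msp_closed(3))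
      then show "md X (- int n) u \<in> Msp" by simp
    qed
  qed (auto intro: Msp_closed)
  then show ?case using less.prems by (auto simp: Wd_def)
qed

theorem W_Msp:
  assumes v: "v \<in> W"
  shows "v \<in> Msp"
proof -
  have "wc N v \<in> Msp" for N
  proof -
    let ?a = "wc N v"
    have a: "?a \<in> wsp N" by (rule wc_wsp[OF v])
    let ?r = "\<lambda>k. restr (\<lambda>\<kappa>. wtk p \<kappa> = of_nat N \<and> snd \<kappa> = k) ?a"
    have "?r k \<in> Msp" for k
    proof (rule Wd_Msp[OF W_Wd])
      show "?r k \<in> W" by (rule restr_W(2)[OF wsp_W[OF a]])
      show "?r k \<in> gr p k (of_int (int N))"
        unfolding gr_iff[OF p0] by (auto simp: in_keys_iff lookup_restr split: if_splits)
    qed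
    then have "(\<Sum>k\<in>snd ` keys ?a. ?r k) \<in> Msp" by (intro fock.subspace_sum[OF Msp_subspace])
    also have "(\<Sum>k\<in>snd ` keys ?a. ?r k) = ?a"
    proof (rule poly_mapping_eqI)
      fix \<kappa>
      show "lookup (\<Sum>k\<in>snd ` keys ?a. ?r k) \<kappa> = lookup ?a \<kappa>"
        using a unfolding wsp_keys lookup_sum lookup_restr
        by (cases "\<kappa> \<in> keys ?a") (auto simp: in_keys_iff cong: if_cong)
    qed
    finally show ?thesis .
  qed
  then have "(\<Sum>N\<in>{N. wc N v \<noteq> 0}. wc N v) \<in> Msp" by (intro fock.subspace_sum[OF Msp_subspace])
  then show ?thesis unfolding wc_sum[OF v wc_finite subset_refl] .
qed

text \<open>Q is a derivation and preserves weights. This carries a relation for F over to H and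
  E.\<close>

lemma Q_OV: "x \<in> OV \<Longrightarrow> Q x \<in> OV"
proof (induction rule: OV_induct)
  case (circ N a b)
  have "Q a \<in> wsp N" using circ(1) W_Q Q_vir[of 0 a] by (simp add: wsp_def lin_scale[OF Q_lin])
  then have "tm N (Q a) (- 2) b + tm N a (- 2) (Q b) \<in> OV" by (intro OV_closed OV_circ circ W_Q)
  also have "tm N (Q a) (- 2) b + tm N a (- 2) (Q b) = Q (tm N a (- 2) b)"
    unfolding tm_def bsum_lin[OF Q_lin] Q_md[OF W_VL[OF wsp_W[OF circ(1)]]] by (rule bsum_add[symmetric])
  finally show ?case .
qed (simp_all add: lin_simps[OF Q_lin] OV_closed)

lemma Pol_pact:
  assumes P: "Pol Z z l a \<pi>" and a: "a \<in> {XF, XH, XE}" and Z: "Z \<in> W" "Z \<in> gr p k (of_int z)"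
  shows "tm (2 * p - 1) a l XH - pact \<pi> Z \<in> OV"
proof -
  obtain \<rho> where \<rho>: "\<And>j. Rep p Z z (2 * D - l - 1 - int j) (md a (l + int j) XH) (\<rho> j)"
    and \<pi>: "\<pi> = (\<Sum>j\<le>nat D. Polynomial.smult (of_nat (nat D choose j)) (\<rho> j))"
    using P by (auto simp: Pol_def)
  have D: "nat D = 2 * p - 1" using p2 by simp
  have "tm (2 * p - 1) a l XH - pact \<pi> Z = (\<Sum>j\<le>2 * p - 1. fscale (of_nat (2 * p - 1 choose j)) (md a (l + int j) XH - pact (\<rho> j) Z))"
    unfolding \<pi> D pact_sum pact_smult tm_def bsum_def fock.scale_right_diff_distrib sum_subtractf ..
  also have "\<dots> \<in> OV" by (intro fock.subspace_sum[OF OV_subspace] OV_closed Rep_pact[OF \<rho> Z])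
  finally show ?thesis .
qed

lemma star_pact:
  assumes "u \<in> W" "v \<in> W"
  shows "st (pact q u) v - pact q (st u v) \<in> OV"
proof (induction q)
  case 0
  then show ?case using zhu_prod_scale[OF W_1, of "Suc 0" 0 v] by (simp add: OV_closed)
next
  case (pCons a q)
  let ?y = "pact q u"
  have y: "?y \<in> W" by (rule pact_W[OF assms(1)])
  have "st (om ?y) v - om (st ?y v) + om (st ?y v - pact q (st u v)) \<in> OV"
    by (intro OV_closed star_assoc OV_star_right W_conformal y assms pCons)
  then show ?case using assms y
    by (simp add: star_left zhu_prod_scale W_closed om_W lin_diff[OF om_lin])
qed

lemma relations:
  obtains g f where "g \<noteq> 0" "degree g \<le> p" "\<And>X. X \<in> {XF, XH, XE} \<Longrightarrow> pact g X \<in> OV"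
    "f \<noteq> 0" "degree f \<le> 3 * p - 1" "pact f 1 \<in> OV"
proof -
  obtain P g where P: "Pol 1 0 (- 1) XH P" and g: "Pol XF D (- 2) XF g" using Pol_P Pol_g by blast
  have X: "XF \<in> W" "XH \<in> W" by (auto intro: W_X)
  \<comment> \<open>\<open>tm (2 * p - 1) XF (- 2) XH\<close> is F \<circ> H, an element of O(V) by
    definition.\<close>
  have "- (tm (2 * p - 1) XF (- 2) XH - pact g XF) + tm (2 * p - 1) XF (- 2) XH \<in> OV"
    by (intro OV_closed(2)[OF OV_closed(5)[OF Pol_pact[OF g _ X(1) X_D(1)]]] OV_circ[OF X_wsp X(2)]) auto
  then have gF: "pact g XF \<in> OV" by simp
  have gH: "pact g XH \<in> OV" using Q_OV[OF gF] by (simp add: pact_Q XH_Q)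
  have gE: "pact g XE \<in> OV" using Q_OV[OF gH] by (simp add: pact_Q XE_Q)
  have "st XH XH - pact P 1 \<in> OV"
    using Pol_pact[OF P _ W_1, of 0] zhu_prod_wsp[OF X_wsp, of XH "Suc 0" XH] by (simp add: one_gr[OF p0])
  then have "pact g (st XH XH - pact P 1) \<in> OV" by (rule pact_OV)
  then have "st (pact g XH) XH - (st (pact g XH) XH - pact g (st XH XH)) - pact g (st XH XH - pact P 1) \<in> OV"
    by (intro OV_closed(3)[OF OV_closed(3)[OF OV_star_left[OF gH X(2)] star_pact[OF X(2) X(2)]]])
  then have f: "pact (g * P) 1 \<in> OV" by (simp add: pact_mult lin_diff[OF pact_lin])
  have "P \<noteq> 0" "g \<noteq> 0" using P_nonroot[OF P, of 1] g_nonzero[OF g] by auto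
  moreover have "degree P \<le> 2 * p - 1" "degree g \<le> p"
    by (rule Pol_degree[OF P], use p2 in simp) (rule Pol_degree[OF g], simp)
  ultimately show ?thesis using gF gH gE f p2 degree_mult_le[of g P]
    by (intro that[of g "g * P"]) auto
qed

text \<open>Division with remainder by \<open>q\<close>: the multiple of \<open>q\<close> acts into
  O(V), and the remainder has degree below \<open>n\<close>.\<close>

lemma pact_reduce:
  assumes q: "q \<noteq> 0" "degree q \<le> n" "pact q Z \<in> OV"
  shows "pact r Z \<in> fock.span (OV \<union> (\<lambda>i. (om ^^ i) Z) ` {..<n})"
proof -
  let ?S = "fock.span (OV \<union> (\<lambda>i. (om ^^ i) Z) ` {..<n})"
  have "pact (r div q) (pact q Z) \<in> ?S" by (rule fock.span_base) (simp add: pact_OV q)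
  moreover have "pact (r mod q) Z \<in> ?S"
  proof (cases "r mod q = 0")
    case False
    let ?m = "r mod q"
    have "degree ?m < n" using degree_mod_less[OF q(1), of r] False q(2) by auto
    moreover have "pact ?m Z = (\<Sum>i\<le>degree ?m. fscale (Polynomial.coeff ?m i) ((om ^^ i) Z))"
      by (subst poly_as_sum_of_monoms[symmetric]) (simp add: pact_sum pact_monom)
    ultimately show ?thesis by (simp only:) (intro fock.span_sum fock.span_scale, rule fock.span_base, auto)
  qed (simp add: fock.span_zero)
  moreover have "pact r Z = pact (r div q) (pact q Z) + pact (r mod q) Z"
    unfolding pact_mult[symmetric] pact_add[symmetric] by simp
  ultimately show ?thesis by (simp add: fock.span_add)
qed

theorem W_spanned:
  assumes "v \<in> W"
  shows "v \<in> fock.span (OV \<union> (\<lambda>i. (om ^^ i) 1) ` {..<3 * p - 1} \<union> (\<Union>X\<in>{XF, XH, XE}. (\<lambda>i. (om ^^ i) X) ` {..<p}))"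
    (is "_ \<in> fock.span ?B")
proof -
  obtain g f where gf: "g \<noteq> 0" "degree g \<le> p" "\<And>X. X \<in> {XF, XH, XE} \<Longrightarrow> pact g X \<in> OV"
    "f \<noteq> 0" "degree f \<le> 3 * p - 1" "pact f 1 \<in> OV" using relations by blast
  have 1: "pact q 1 \<in> fock.span ?B" for q
    by (rule subsetD[OF fock.span_mono pact_reduce[OF gf(4-6)]]) blast
  have X: "pact q X \<in> fock.span ?B" if "X \<in> {XF, XH, XE}" for q X
    by (rule subsetD[OF fock.span_mono pact_reduce[OF gf(1,2) gf(3)[OF that]]]) (use that in blast)
  have "OV \<union> (\<Union>Z\<in>{1, XF, XH, XE}. range (\<lambda>q. pact q Z)) \<subseteq> fock.span ?B"
    using 1 X fock.span_superset[of ?B] by blast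
  then have "Msp \<subseteq> fock.span ?B" unfolding Msp_def by (rule fock.span_minimal) (rule fock.subspace_span)
  then show ?thesis using W_Msp[OF assms] by blast
qed

section \<open>The quotient ring, its spans and its dimension\<close>

abbreviation "A \<equiv> zhu_alg TV"

definition cls :: "fock \<Rightarrow> fock set" where "cls v = (\<lambda>x. x + v) ` OV"

lemma zhu_class_cls: "zhu_class TV v = cls v"
  by (auto simp: zhu_class_def cls_def a_r_coset_def r_coset_def zhu_pre_def OV_def)

lemma cls_self: "v \<in> cls v"
  unfolding cls_def by (rule image_eqI[of _ _ 0]) (simp_all add: OV_closed)

lemma mem_cls: "u \<in> cls v \<longleftrightarrow> u - v \<in> OV"
  by (auto simp: cls_def intro: image_eqI[of _ _ "u - v"])

lemma cls_eq: "cls u = cls v \<longleftrightarrow> u - v \<in> OV"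
proof
  show "cls u = cls v \<Longrightarrow> u - v \<in> OV" using cls_self[of u] by (simp add: mem_cls)
  assume uv: "u - v \<in> OV"
  show "cls u = cls v"
  proof (rule Set.set_eqI)
    fix x
    have "x - v = (x - u) + (u - v)" "x - u = (x - v) - (u - v)" by simp_all
    then show "x \<in> cls u \<longleftrightarrow> x \<in> cls v" unfolding mem_cls using uv OV_closed(2,3) by metis
  qed
qed

lemma carrier_A: "carrier A = cls ` W"
  by (auto simp: zhu_alg_def FactRing_def A_RCOSETS_def RCOSETS_def zhu_pre_def r_coset_def cls_def OV_def triplet_def)

lemma one_A: "\<one>\<^bsub>A\<^esub> = cls 1"
  using zhu_class_cls[of 1] by (simp add: zhu_alg_def FactRing_def zhu_class_def zhu_pre_def triplet_def)

lemma zero_A: "\<zero>\<^bsub>A\<^esub> = cls 0"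
  by (simp add: zhu_alg_def FactRing_def cls_def OV_def)

lemma add_A: "cls u \<oplus>\<^bsub>A\<^esub> cls v = cls (u + v)"
proof -
  have "cls u \<oplus>\<^bsub>A\<^esub> cls v = (\<Union>x\<in>cls u. \<Union>y\<in>cls v. {x + y})"
    by (simp add: zhu_alg_def FactRing_def set_add_def set_mult_def zhu_pre_def)
  also have "\<dots> = cls (u + v)"
  proof (intro Set.set_eqI iffI)
    fix z assume "z \<in> (\<Union>x\<in>cls u. \<Union>y\<in>cls v. {x + y})"
    then obtain x y where "z = x + y" "x - u \<in> OV" "y - v \<in> OV" by (auto simp: mem_cls)
    moreover from this have "(x - u) + (y - v) \<in> OV" by (intro OV_closed(2))
    ultimately show "z \<in> cls (u + v)" by (simp add: mem_cls algebra_simps)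
  next
    fix z assume "z \<in> cls (u + v)"
    then have "z - v \<in> cls u" by (simp add: mem_cls algebra_simps)
    then show "z \<in> (\<Union>x\<in>cls u. \<Union>y\<in>cls v. {x + y})" using cls_self[of v] by force
  qed
  finally show ?thesis .
qed

text \<open>The quotient multiplies cosets by a union over all representatives; the union collapses
  to a single class because O(V) is a two-sided ideal.\<close>

lemma mult_A:
  assumes u: "u \<in> W" and v: "v \<in> W"
  shows "cls u \<otimes>\<^bsub>A\<^esub> cls v = cls (st u v)"
proof -
  have "cls (st x y) = cls (st u v)" if x: "x \<in> cls u" and y: "y \<in> cls v" for x y
  proof -
    have o: "x - u \<in> OV" "y - v \<in> OV" using x y by (simp_all add: mem_cls)
    then have W: "x \<in> W" using W_closed(2)[OF OV_W[OF o(1)] u] by simp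
    have "st x y - st u v = st x (y - v) + st (x - u) v"
      using star_left(1)[OF OV_W[OF o(1)] u, of v] by (simp add: star_right(3)[OF W])
    moreover have "st x (y - v) + st (x - u) v \<in> OV" by (intro OV_closed OV_star_right OV_star_left o W v)
    ultimately show ?thesis by (simp add: cls_eq)
  qed
  moreover have "cls u \<otimes>\<^bsub>A\<^esub> cls v = (\<Union>x\<in>cls u. \<Union>y\<in>cls v. cls (st x y))"
    unfolding zhu_class_cls[symmetric] by (simp add: zhu_alg_def FactRing_def rcoset_mult_def zhu_class_def zhu_pre_def zhu_star_def)
  ultimately show ?thesis using cls_self[of u] cls_self[of v] by blast
qed

lemma star_1: "st 1 u = u" "u \<in> W \<Longrightarrow> st u 1 = u"
proof -
  show 1: "st 1 u = u" using zhu_prod_wsp[OF one_wsp, of "Suc 0" u] by (simp add: tm_def bsum_0 nmode_one[OF p0])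
  show "u \<in> W \<Longrightarrow> st u 1 = u"
  proof (induction rule: W_induct)
    case (wsp N a)
    then show ?case using zhu_prod_wsp[OF wsp, of "Suc 0" 1] bsum_vanish1[of 0 "\<lambda>m. md a m 1" N]
      by (simp add: tm_def nmode_creation[OF p0])
  qed (simp add: star_left)
qed

text \<open>\<open>zhu_pre\<close> is not a ring, so general facts about quotients by ideals do not
  apply; the axioms are checked on classes, with associativity from
  \<open>star_assoc\<close>.\<close>

lemma ring_A: "ring A"
proof -
  have assoc: "cls (st (st x y) z) = cls (st x (st y z))" if "x \<in> W" "y \<in> W" "z \<in> W" for x y z
    using star_assoc[OF that] by (simp add: cls_eq)
  show ?thesis
proof (intro ringI abelian_groupI monoidI)
  fix x assume "x \<in> carrier A"
  then obtain u where u: "x = cls u" "u \<in> W" by (auto simp: carrier_A)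
  have "cls (- u) \<oplus>\<^bsub>A\<^esub> x = \<zero>\<^bsub>A\<^esub>" using u by (simp add: add_A zero_A)
  moreover have "cls (- u) \<in> carrier A" using W_closed(3)[OF u(2), of "- 1"] by (simp add: carrier_A)
  ultimately show "\<exists>y\<in>carrier A. y \<oplus>\<^bsub>A\<^esub> x = \<zero>\<^bsub>A\<^esub>" by blast
qed (auto simp: carrier_A add_A mult_A zero_A one_A W_closed W_1 star_W star_1 star_left star_right assoc algebra_simps)
qed

lemma scalars_A: "zhu_scalars TV = range (\<lambda>c. cls (fscale c 1))"
  unfolding zhu_scalars_def zhu_class_cls by (simp add: triplet_def)

abbreviation "K \<equiv> zhu_scalars TV"

lemma line_extension_A:
  assumes u: "u \<in> W" and S: "S \<subseteq> W"
  shows "ring.line_extension A K (cls u) (cls ` S) = {cls (fscale c u + s) | c s. s \<in> S}"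
proof -
  have m: "cls (fscale c 1) \<otimes>\<^bsub>A\<^esub> cls u = cls (fscale c u)" for c
    using mult_A[OF W_closed(3)[OF W_1] u] by (simp add: star_left(2)[OF W_1] star_1)
  have "ring.line_extension A K (cls u) (cls ` S) = (\<Union>c. \<Union>s\<in>S. {cls (fscale c u) \<oplus>\<^bsub>A\<^esub> cls s})"
    unfolding ring.line_extension_def[OF ring_A] scalars_A set_add_def set_mult_def r_coset_def by (auto simp: m)
  then show ?thesis by (auto simp: add_A)
qed

text \<open>Span and dimension are followed in one induction: a class outside the span so far raises
  the dimension by one, and a class inside leaves the span unchanged. So the length of the list
  bounds the dimension even for dependent classes.\<close>

lemma Span_A:
  "set us \<subseteq> W \<Longrightarrow> ring.Span A K (map cls us) = cls ` fock.span (set us) \<and> (\<exists>d \<le> length us. ring.dimension A d K (ring.Span A K (map cls us)))"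
proof (induction us)
  case Nil
  have "ring.dimension A 0 K {\<zero>\<^bsub>A\<^esub>}" by (rule ring.zero_dim[OF ring_A])
  then show ?case by (simp add: ring.Span.simps[OF ring_A] zero_A)
next
  case (Cons u us)
  let ?S = "fock.span (set us)" and ?E = "ring.Span A K (map cls us)"
  have u: "u \<in> W" and S: "?S \<subseteq> W"
    using Cons.prems fock.span_minimal[of "set us" W] by (auto simp: fock.subspace_def W_closed)
  have E: "?E = cls ` ?S" and d: "\<exists>d \<le> length us. ring.dimension A d K ?E" using Cons by auto
  have sp: "ring.Span A K (map cls (u # us)) = ring.line_extension A K (cls u) ?E"
    by (simp add: ring.Span.simps[OF ring_A])
  have l: "ring.line_extension A K (cls u) ?E = {cls (fscale c u + s) | c s. s \<in> ?S}"
    unfolding E by (rule line_extension_A[OF u S])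
  also have "\<dots> = cls ` fock.span (set (u # us))"
  proof -
    have "fock.span (set (u # us)) = {fscale c u + s | c s. s \<in> ?S}"
    proof (intro Set.set_eqI iffI)
      fix x assume "x \<in> fock.span (set (u # us))"
      then obtain c where "x - fscale c u \<in> ?S" by (auto simp: fock.span_insert)
      moreover have "x = fscale c u + (x - fscale c u)" by simp
      ultimately show "x \<in> {fscale c u + s | c s. s \<in> ?S}" by blast
    next
      fix x assume "x \<in> {fscale c u + s | c s. s \<in> ?S}"
      then obtain c s where "x = fscale c u + s" "s \<in> ?S" by blast
      then show "x \<in> fock.span (set (u # us))" by (auto simp: fock.span_insert intro: exI[of _ c])
    qed
    then show ?thesis by auto
  qed
  finally have l': "ring.line_extension A K (cls u) ?E = cls ` fock.span (set (u # us))" .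
  have "\<exists>d \<le> length (u # us). ring.dimension A d K (ring.line_extension A K (cls u) ?E)"
  proof (cases "cls u \<in> ?E")
    case True
    then obtain s where s: "s \<in> ?S" "u - s \<in> OV" unfolding E by (auto simp: cls_eq)
    have "cls (fscale c u + t) \<in> ?E" if "t \<in> ?S" for c t
    proof -
      have "fscale c u + t - (fscale c s + t) = fscale c (u - s)" by (simp add: fock.scale_right_diff_distrib)
      then have "cls (fscale c u + t) = cls (fscale c s + t)" unfolding cls_eq using OV_closed(4)[OF s(2)] by simp
      then show ?thesis unfolding E using s(1) that by (auto intro!: imageI fock.span_add fock.span_scale)
    qed
    moreover have "cls t \<in> {cls (fscale c u + s) | c s. s \<in> ?S}" if "t \<in> ?S" for t
      using that by (auto intro!: exI[of _ 0] exI[of _ t])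
    ultimately have "ring.line_extension A K (cls u) ?E = ?E" unfolding l by (auto simp: E)
    then show ?thesis using d by (auto intro: le_SucI)
  next
    case False
    obtain d where "d \<le> length us" "ring.dimension A d K ?E" using d by blast
    then have "ring.dimension A (Suc d) K (ring.line_extension A K (cls u) ?E)"
      using False u by (intro ring.Suc_dim[OF ring_A]) (auto simp: carrier_A)
    then show ?thesis using \<open>d \<le> length us\<close> by auto
  qed
  then show ?case unfolding sp l' by simp
qed

lemma om_pow_W: "Z \<in> W \<Longrightarrow> (om ^^ i) Z \<in> W"
  by (induction i) (auto intro: om_W)

text \<open>Powers in a monoid add factors on the right, iterates of \<open>om\<close> on the left;
  associativity in the quotient reconciles the two.\<close>

lemma pow_A: "cls (conformal p) [^]\<^bsub>A\<^esub> (i::nat) = cls ((om ^^ i) 1)"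
proof (induction i)
  case 0
  then show ?case by (simp add: one_A nat_pow_def)
next
  case (Suc i)
  have "cls (conformal p) [^]\<^bsub>A\<^esub> Suc i = cls (conformal p) \<otimes>\<^bsub>A\<^esub> cls ((om ^^ i) 1)"
    unfolding Suc.IH[symmetric] by (rule monoid.nat_pow_Suc2[OF ring.is_monoid[OF ring_A]]) (simp add: carrier_A W_conformal)
  then show ?case by (simp add: mult_A W_conformal om_pow_W W_1)
qed

lemma pow_mult_A: "X \<in> W \<Longrightarrow> cls (conformal p) [^]\<^bsub>A\<^esub> (i::nat) \<otimes>\<^bsub>A\<^esub> cls X = cls ((om ^^ i) X)"
  using star_pact[OF W_1, of X "Polynomial.monom 1 i"]
  by (simp add: pow_A mult_A om_pow_W W_1 cls_eq pact_monom star_1)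

theorem Zhu_span:
  defines "us \<equiv> map (\<lambda>i. (om ^^ i) 1) [0..<3 * p - 1] @ concat (map (\<lambda>X. map (\<lambda>i. (om ^^ i) X) [0..<p]) [XE, XF, XH])"
  shows "ring.Span A K (map cls us) = carrier A \<and> (\<exists>d \<le> 6 * p - 1. ring.dimension A d K (carrier A))"
proof -
  have "XE \<in> W" "XF \<in> W" "XH \<in> W" by (auto intro: W_X)
  then have us: "set us \<subseteq> W" unfolding us_def by (auto intro!: om_pow_W W_1)
  have "OV \<union> (\<lambda>i. (om ^^ i) 1) ` {..<3 * p - 1} \<union> (\<Union>X\<in>{XF, XH, XE}. (\<lambda>i. (om ^^ i) X) ` {..<p}) = OV \<union> set us"
    unfolding us_def by auto
  then have span: "v \<in> fock.span (OV \<union> set us)" if "v \<in> W" for v using W_spanned[OF that] by simp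
  have "cls v \<in> cls ` fock.span (set us)" if v: "v \<in> W" for v
  proof -
    obtain x y where "v = x + y" "x \<in> OV" "y \<in> fock.span (set us)"
      using span[OF v] unfolding fock.span_Un fock.span_eq_iff[THEN iffD2, OF OV_subspace] by auto
    then have "cls v = cls y" by (simp add: cls_eq)
    then show ?thesis using \<open>y \<in> fock.span (set us)\<close> by blast
  qed
  moreover have "fock.span (set us) \<subseteq> W"
    by (rule fock.span_minimal[OF us]) (auto simp: fock.subspace_def W_closed)
  ultimately have "cls ` fock.span (set us) = carrier A" unfolding carrier_A by blast
  moreover have "length us = 6 * p - 1" using p2 by (simp add: us_def)
  ultimately show ?thesis using Span_A[OF us] by (simp only:) metis
qed

end

theorem corollary5p3:
  fixes p :: nat
  assumes "p \<ge> 2"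
  shows "let V = triplet p; A = zhu_alg V; K = zhu_scalars V; w = zhu_class V (conformal p) in
    ring.Span A K
      (map (\<lambda>i. w [^]\<^bsub>A\<^esub> i) [0..<3 * p - 1]
       @ concat (map (\<lambda>X. map (\<lambda>i. (w [^]\<^bsub>A\<^esub> i) \<otimes>\<^bsub>A\<^esub> zhu_class V X) [0..<p])
                     [triplet_E p, triplet_F p, triplet_H p]))
      = carrier A
    \<and> (\<exists>d \<le> 6 * p - 1. ring.dimension A d K (carrier A))"
proof -
  interpret triplet_setting p by standard (rule assms)
  have X: "X \<in> {XF, XH, XE} \<Longrightarrow> X \<in> W" for X by (rule W_X)
  show ?thesis
    using Zhu_span unfolding Let_def zhu_class_cls
    by (simp add: pow_mult_A X o_def) (simp add: pow_A[abs_def])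
qed

end
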